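(* Let $\lambda\in\{-1,+1\}$ and consider the equation $$(\partial_s+p\cdot\nabla_q)\gamma+\lambda s^{-1}E[\gamma]\cdot\nabla_p\gamma=0\qquad (\ast)$$ for $\gamma=\gamma(s,q,p)\in\mathbb{R}$, $s>0$, $(q,p)\in\mathbb{R}^3\times\mathbb{R}^3$. There exists $\varepsilon>0$ such that if $\gamma_1(q,p)$ satisfies $$\|\gamma_1\|_{L^2_{q,p}}+\|\langle p\rangle^2\gamma_1\|_{L^\infty_{q,p}}+\|\nabla_{p,q}\gamma_1\|_{L^\infty_{q,p}}\le\varepsilon_0\le\varepsilon,$$ then there exists a unique solution $\gamma$ of $(\ast)$ with data $\gamma(s=1)=\gamma_1$ for all times $0<s\le1$, and $\gamma\in L^\infty_s((0,1],L^\infty_{q,p}\cap L^2_{q,p})$ satisfies $$\|\langle p\rangle^2\gamma(s)\|_{L^\infty_{q,p}}\lesssim\varepsilon_0\langle\ln(s)\rangle^2,\qquad \|\nabla_{p,q}\gamma(s)\|_{L^\infty_{q,p}}\lesssim\varepsilon_0\langle\ln(s)\rangle^5.$$ If in addition $$\|\langle p\rangle\nabla_{p,q}\gamma_1\|_{L^\infty_{q,p}}\le\varepsilon_0,$$ then $\|\langle p\rangle\nabla_{p,q}\gamma(s)\|_{L^\infty_{q,p}}\lesssim\varepsilon_0\langle\ln(s)\rangle^6$ and there exist $\gamma_0\in L^\infty_{q,p}$ and $E_0=E[\gamma_0]\in L^\infty_q$ such that, uniformly in $(q,p)$, $$\gamma\big(s,\,q+ps+\lambda s\ln(s)E_0(q),\,p+\lambda\ln(s)E_0(q)\big)\to\gamma_0(q,p),\qquad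 s\to0.$$
   Context: Notation: $\langle y\rangle=(1+|y|^2)^{1/2}$. For $\gamma=\gamma(q,p)$ (possibly also depending on $s$, in which case the definition is applied at each fixed $s$), $$E[\gamma](q):=\nabla_q\Delta_q^{-1}\int\gamma^2(q,p)\,dp=\frac{1}{4\pi}\iint\frac{q-r}{|q-r|^3}\,\gamma^2(r,u)\,du\,dr.$$ $X\lesssim Y$ means $X\le CY$ with a constant $C$ independent of $s$, $\varepsilon_0$ and $\gamma$. *)

theory Defs
  imports "HOL-Analysis.Analysis" "HOL-Probability.Essential_Supremum"
begin

type_synonym R3 = "real^3"

text \<open>Phase space: pairs \<open>(q, p)\<close> of position and momentum. Its library norm is the Euclidean
  norm of \<open>\<real>\<^sup>6\<close>.\<close>
type_synonym phase = "R3 \<times> R3"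

definition japanese_bracket :: "'a::real_normed_vector \<Rightarrow> real" (\<open>\<langle>_\<rangle>\<close>)
  where "\<langle>y\<rangle> = sqrt (1 + (norm y)\<^sup>2)"

text \<open>Both norms take the value \<open>\<infinity>\<close> on functions outside the space, in particular on
  non-measurable ones.\<close>

definition Linf_norm :: "('a::euclidean_space \<Rightarrow> 'b::real_normed_vector) \<Rightarrow> ereal"
  where "Linf_norm f =
    (if f \<in> borel_measurable lborel then esssup lborel (\<lambda>x. ereal (norm (f x))) else \<infinity>)"

definition L2_norm :: "('a::euclidean_space \<Rightarrow> real) \<Rightarrow> ereal"
  where "L2_norm f =
    (if f \<in> borel_measurable lborel \<and> integrable lborel (\<lambda>x. (f x)\<^sup>2)
     then ereal (sqrt (LINT x|lborel. (f x)\<^sup>2)) else \<infinity>)"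

definition locally_integrable_on ::
    "'a::euclidean_space set \<Rightarrow> ('a \<Rightarrow> 'b::{banach, second_countable_topology}) \<Rightarrow> bool"
  where "locally_integrable_on U f \<longleftrightarrow>
    (\<forall>K. compact K \<and> K \<subseteq> U \<longrightarrow> set_integrable lborel K f)"

text \<open>The test functions are the \<open>C\<^sup>1\<close> functions with compact support in \<open>U\<close>; for first-order weak
  derivatives they give the same notion as smooth ones, by mollification.\<close>

definition weak_gradient_on ::
    "'a::euclidean_space set \<Rightarrow> ('a \<Rightarrow> real) \<Rightarrow> ('a \<Rightarrow> 'a) \<Rightarrow> bool"
  where "weak_gradient_on U f g \<longleftrightarrow>
    locally_integrable_on U f \<and> locally_integrable_on U g \<and>
    (\<forall>\<phi> D. (\<forall>x. GDERIV \<phi> x :> D x) \<and> continuous_on UNIV D \<and>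
       compact (closure (support_on UNIV \<phi>)) \<and> closure (support_on UNIV \<phi>) \<subseteq> U \<longrightarrow>
       (LINT x:U|lborel. f x *\<^sub>R D x) = - (LINT x:U|lborel. \<phi> x *\<^sub>R g x))"

definition field_integrand :: "(phase \<Rightarrow> real) \<Rightarrow> R3 \<Rightarrow> phase \<Rightarrow> R3"
  where "field_integrand f q = (\<lambda>(r, u). ((f (r, u))\<^sup>2 / norm (q - r) ^ 3) *\<^sub>R (q - r))"

definition E_field :: "(phase \<Rightarrow> real) \<Rightarrow> R3 \<Rightarrow> R3"
  where "E_field f q = (1 / (4 * pi)) *\<^sub>R (LINT z|lborel. field_integrand f q z)"

text \<open>Where the integral diverges, \<open>E_field\<close> is the junk value \<open>0\<close>; the following excludes this.\<close>

definition E_field_converges :: "(phase \<Rightarrow> real) \<Rightarrow> bool"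
  where "E_field_converges f \<longleftrightarrow> (\<forall>q. integrable lborel (field_integrand f q))"

text \<open>The equation
  \<open>(\<partial>\<^sub>s + p \<cdot> \<nabla>\<^sub>q) \<gamma> + \<lambda> s\<^sup>-\<^sup>1 E[\<gamma>] \<cdot> \<nabla>\<^sub>p \<gamma> = 0\<close>
  holds almost everywhere on \<open>(0,1) \<times> \<real>\<^sup>3 \<times> \<real>\<^sup>3\<close>, with \<open>\<partial>\<^sub>s \<gamma>\<close>, \<open>\<nabla>\<^sub>q \<gamma>\<close>, \<open>\<nabla>\<^sub>p \<gamma>\<close> the components of
  the weak space-time gradient \<open>G\<close>. Here \<open>l\<close> is the sign \<open>\<lambda>\<close>.\<close>

definition satisfies_equation :: "real \<Rightarrow> (real \<Rightarrow> phase \<Rightarrow> real) \<Rightarrow> bool"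
  where "satisfies_equation l \<gamma> \<longleftrightarrow>
    (\<exists>G :: real \<times> phase \<Rightarrow> real \<times> phase.
       weak_gradient_on ({0<..<1} \<times> UNIV) (\<lambda>(s, z). \<gamma> s z) G \<and>
       (AE (s, q, p) in lborel. 0 < s \<and> s < 1 \<longrightarrow>
          (case G (s, q, p) of (G_s, G_q, G_p) \<Rightarrow>
             G_s + p \<bullet> G_q + (l / s) * (E_field (\<gamma> s) q \<bullet> G_p) = 0)))"

text \<open>Solutions on \<open>(0,1]\<close> have, locally uniformly in \<open>s\<close>, the regularity required of the data. In
  particular \<open>\<integral>\<gamma>\<^sup>2 dp\<close> is bounded and integrable in \<open>q\<close>, so that \<open>E[\<gamma>]\<close> converges. Together with the
  equation these bounds make \<open>\<gamma>\<close> locally Lipschitz up to a null set; continuity selects that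
  representative, and gives a meaning to \<open>\<gamma> s\<close> for every single \<open>s\<close>, including the data at
  \<open>s = 1\<close>.\<close>

definition solution :: "real \<Rightarrow> (real \<Rightarrow> phase \<Rightarrow> real) \<Rightarrow> bool"
  where "solution l \<gamma> \<longleftrightarrow>
    continuous_on ({0<..1} \<times> UNIV) (\<lambda>(s, z). \<gamma> s z) \<and>
    (\<forall>a\<in>{0<..1}. \<exists>M::real. \<forall>s\<in>{a..1}.
       L2_norm (\<gamma> s) \<le> ereal M \<and>
       Linf_norm (\<lambda>(q, p). \<langle>p\<rangle>\<^sup>2 * \<gamma> s (q, p)) \<le> ereal M \<and>
       (\<exists>g. weak_gradient_on UNIV (\<gamma> s) g \<and> Linf_norm g \<le> ereal M)) \<and>
    satisfies_equation l \<gamma>"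

definition solution_with_data ::
    "real \<Rightarrow> (phase \<Rightarrow> real) \<Rightarrow> (real \<Rightarrow> phase \<Rightarrow> real) \<Rightarrow> bool"
  where "solution_with_data l \<gamma>\<^sub>1 \<gamma> \<longleftrightarrow>
    solution l \<gamma> \<and> (AE z in lborel. \<gamma> 1 z = \<gamma>\<^sub>1 z)"

end

(* In logarithmic time t = - ln s the characteristics solve q' = - exp (- t) p, p' = - l E, and a
 solution is its initial datum transported by this measure-preserving flow. As long as |E| and |DE|
 are at most 1, the Lipschitz constants of the flow grow only polynomially in t. A splitting into slow
 and fast particles then shows that E and DE change by at most a multiple of eps^2 exp (- t / 256) over
 a unit time interval; so, for small data, the map from a field to the field of the transported datum
 preserves these bounds. The field depends on the trajectories with a logarithmic modulus of
 continuity, and an argument of Osgood type makes the iteration of this map converge and its fixed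
 point unique. A weak solution has vanishing weak derivative along its own characteristics, hence is
 constant along them, so its field is a fixed point as well. Finally E(t) converges exponentially fast
 to some E0. The datum transported along the explicit trajectories of the field E0 is then an
 exponentially convergent family, and passing to the limit in its field gives E0 = E[gamma0]. *)
theory Submission
 imports Defs
begin

text \<open>In the time \<open>t = - ln s\<close> the factor \<open>1/s\<close> disappears from the
  force, but the time interval becomes infinite: positions are almost frozen, momenta drift linearly
  in \<open>t\<close>. The obstacle is circular. Decay of the increments of the field needs a
  Lipschitz bound for the transported datum, and this needs a bounded field gradient, although the
  gradient of the Coulomb kernel is not integrable. The loop closes because the Lipschitz constant
  costs only \<open>(1 + t)^2\<close>, hence \<open>(1 + t)^4\<close> in the quadratic field, while
  the increments gain an exponential; each such polynomial is paid for by halving a rate (1/128,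
  then 1/256, then 1/512). Momentum decay has a similar budget: the squared datum decays like
  \<open>1 + |p|^2\<close> to the power -2, integrability in three dimensions stops at -3/2, and the
  exponents -7/4 and -13/8 in between pay for Hoelder continuity, for the gain on fast particles and
  for the logarithmic drift of momenta in the limit. All fields are compared by changing variables
  to common particle labels, which is where preservation of measure enters.\<close>

abbreviation (input) nn_lborel :: "('a::euclidean_space => ennreal) => ennreal" (binder "NNI " 10)
 where "nn_lborel f == nn_integral lborel f"

abbreviation (input) lebesgue_lborel :: "('a::euclidean_space => 'b::{banach, second_countable_topology}) => 'b" (binder "LI " 10)
 where "lebesgue_lborel f == integral\<^sup>L lborel f"

abbreviation (input) bmeas :: "('a::topological_space => 'b::topological_space) set"
 where "bmeas == borel_measurable borel"

abbreviation (input) limseq :: "(nat => 'a::topological_space) => 'a => bool" (infixr "---->" 60)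
 where "limseq X a == X \<longlonglongrightarrow> a"

notation (input) scaleR (infixr "*R" 75)
notation (input) inner (infixl "<.>" 70)

section \<open>Differential equations with Lipschitz right-hand side\<close>

text \<open>The norm is not differentiable at 0. The regularisation
  \<open>sqrt (w <.> w + d^2)\<close> is smooth, and \<open>d\<close> tends to 0 at the end of the
  Gronwall argument.\<close>

lemma sqrt_reg_bounds:
 fixes w :: "'a::real_inner"
 assumes "d > 0"
 shows "norm w <= sqrt (w <.> w + d^2)" "sqrt (w <.> w + d^2) <= norm w + d" "0 < sqrt (w <.> w + d^2)"
proof -
 show "norm w <= sqrt (w <.> w + d^2)"
  unfolding norm_eq_sqrt_inner by (rule real_sqrt_le_mono) simp
 have "w <.> w + d^2 <= (norm w + d)^2"
  using assms by (simp add: power2_sum power2_norm_eq_inner[symmetric])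
 then show "sqrt (w <.> w + d^2) <= norm w + d"
  using assms by (metis norm_ge_zero add_nonneg_nonneg less_imp_le real_le_lsqrt inner_ge_zero zero_le_power2)
 have "0 < w <.> w + d^2" using assms by (simp add: add_nonneg_pos)
 then show "0 < sqrt (w <.> w + d^2)" by simp
qed

text \<open>The forcing enters through an antiderivative \<open>G\<close>, so that no integral
  occurs in the statement. The function \<open>u\<close> below is nonincreasing: the exponential
  factor absorbs \<open>L * v\<close>, and being at most 1 it may be dropped in front of
  \<open>g\<close>.\<close>

lemma gronwall_forward:
 fixes w w' :: "real => 'a::real_inner" and G g :: "real => real"
 assumes ab: "a <= b" and L: "L >= 0"
  and dw: "!!t. a <= t ==> t <= b ==> (w has_vector_derivative w' t) (at t)"
  and dG: "!!t. a <= t ==> t <= b ==> (G has_real_derivative g t) (at t)"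
  and g0: "!!t. a <= t ==> t <= b ==> 0 <= g t"
  and bd: "!!t. a <= t ==> t <= b ==> norm (w' t) <= L * norm (w t) + g t"
 shows "norm (w b) <= exp (L * (b - a)) * (norm (w a) + (G b - G a))"
proof -
 have main: "norm (w b) <= exp (L * (b - a)) * (norm (w a) + (G b - G a)) + exp (L * (b - a)) * d" if d: "d > 0" for d
 proof -
  define v where "v t = sqrt (w t <.> w t + d^2)" for t
  define u where "u t = exp (- (L * (t - a))) * v t - G t" for t
  have "\<exists>y. (u has_real_derivative y) (at t) & y <= 0" if t: "a <= t" "t <= b" for t
  proof -
   have vpos: "v t > 0" unfolding v_def using sqrt_reg_bounds(3)[OF d] .
   have sq: "w t <.> w t + d^2 > 0" using d by (simp add: add_nonneg_pos)
   have "((%t. w t <.> w t + d^2) has_derivative (%h. w t <.> (h *R w' t) + (h *R w' t) <.> w t)) (at t)"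
    using dw[OF t] unfolding has_vector_derivative_def by (auto intro!: derivative_eq_intros)
   then have 1: "((%t. w t <.> w t + d^2) has_real_derivative (2 * (w t <.> w' t))) (at t)"
    unfolding has_field_derivative_def by (rule back_subst[where P="%D. (_ has_derivative D) _"]) (auto simp: inner_commute fun_eq_iff)
   have 2: "(v has_real_derivative (w t <.> w' t) / v t) (at t)"
    unfolding v_def using DERIV_chain2[OF DERIV_real_sqrt[OF sq] 1] by (simp add: field_simps)
   have 3: "(u has_real_derivative (exp (- (L * (t - a))) * ((w t <.> w' t) / v t) - L * exp (- (L * (t - a))) * v t - g t)) (at t)"
    unfolding u_def using 2 dG[OF t] by (auto intro!: derivative_eq_intros simp: field_simps)
   have "w t <.> w' t <= norm (w t) * norm (w' t)" by (rule norm_cauchy_schwarz)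
   also have "... <= v t * norm (w' t)"
    unfolding v_def using sqrt_reg_bounds(1)[OF d] by (rule mult_right_mono) simp
   finally have "(w t <.> w' t) / v t <= norm (w' t)" using vpos by (simp add: field_simps)
   also have "... <= L * v t + g t"
    using bd[OF t] mult_left_mono[OF sqrt_reg_bounds(1)[OF d, of "w t"] L] unfolding v_def by linarith
   finally have "exp (- (L * (t - a))) * ((w t <.> w' t) / v t) <= exp (- (L * (t - a))) * (L * v t + g t)"
    by (rule mult_left_mono) simp
   also have "... <= L * exp (- (L * (t - a))) * v t + g t"
    using mult_right_mono[of "exp (- (L * (t - a)))" 1 "g t"] g0[OF t] L t by (simp add: algebra_simps mult_left_mono)
   finally show ?thesis using 3 by (intro exI[of _ "exp (- (L * (t - a))) * ((w t <.> w' t) / v t) - L * exp (- (L * (t - a))) * v t - g t"] conjI) simp_all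
  qed
  then have "u b <= u a" using DERIV_nonpos_imp_nonincreasing[of a b u] ab by auto
  then have "exp (- (L * (b - a))) * v b <= v a + (G b - G a)" unfolding u_def by simp
  then have "exp (L * (b - a)) * (exp (- (L * (b - a))) * v b) <= exp (L * (b - a)) * (v a + (G b - G a))"
   by (intro mult_left_mono) auto
  then have "v b <= exp (L * (b - a)) * (v a + (G b - G a))"
   by (simp add: mult.assoc[symmetric] mult_exp_exp)
  also have "... <= exp (L * (b - a)) * (norm (w a) + d + (G b - G a))"
   using sqrt_reg_bounds(2)[OF d, of "w a"] unfolding v_def by (intro mult_left_mono) auto
  finally show ?thesis using sqrt_reg_bounds(1)[OF d, of "w b"] unfolding v_def by (simp add: algebra_simps)
 qed
 show ?thesis
 proof (rule field_le_epsilon)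
  fix e :: real assume "e > 0"
  then show "norm (w b) <= exp (L * (b - a)) * (norm (w a) + (G b - G a)) + e"
   using main[of "e / exp (L * (b - a))"] by simp
 qed
qed

text \<open>Both directions of time are covered, since trajectories will be followed back to the
  initial time. For \<open>r < s\<close> time is reversed, and \<open>- G (- t)\<close> is then an
  antiderivative of \<open>g (- t)\<close>.\<close>

lemma gronwall:
 fixes w w' :: "real => 'a::real_inner" and G g :: "real => real"
 assumes L: "L >= 0"
  and dw: "!!t. t : closed_segment s r ==> (w has_vector_derivative w' t) (at t)"
  and dG: "!!t. t : closed_segment s r ==> (G has_real_derivative g t) (at t)"
  and g0: "!!t. t : closed_segment s r ==> 0 <= g t"
  and bd: "!!t. t : closed_segment s r ==> norm (w' t) <= L * norm (w t) + g t"
 shows "norm (w r) <= exp (L * \<bar>r - s\<bar>) * (norm (w s) + \<bar>G r - G s\<bar>)"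
proof (cases "s <= r")
 case True
 have "norm (w r) <= exp (L * (r - s)) * (norm (w s) + (G r - G s))"
  using True assms by (intro gronwall_forward[where w'=w' and g=g]) (auto simp: closed_segment_eq_real_ivl)
 also have "... <= exp (L * (r - s)) * (norm (w s) + \<bar>G r - G s\<bar>)"
  by (intro mult_left_mono) auto
 finally show ?thesis using True by simp
next
 case False
 have inI: "-t : closed_segment s r" if "-s <= t" "t <= -r" for t
  using that False by (auto simp: closed_segment_eq_real_ivl)
 have "norm ((%t. w (-t)) (-r)) <= exp (L * (-r - (-s))) * (norm ((%t. w (-t)) (-s)) + ((%t. - G (-t)) (-r) - (%t. - G (-t)) (-s)))"
 proof (rule gronwall_forward[where w'="%t. - w' (-t)" and g="%t. g (-t)"])
  fix t assume t: "-s <= t" "t <= -r"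
  have "((w \<circ> uminus) has_vector_derivative (-1) *R w' (-t)) (at t)"
   by (rule vector_diff_chain_at) (auto intro!: derivative_eq_intros dw inI t)
  then show "((%t. w (-t)) has_vector_derivative - w' (-t)) (at t)" by (simp add: o_def)
  have "(G has_real_derivative g (-t)) (at (- t))" using dG[OF inI[OF t]] .
  then have "((%t. G (-t)) has_real_derivative g (-t) * (-1)) (at t)"
   by (rule DERIV_chain2) (auto intro!: derivative_eq_intros)
  then show "((%t. - G (-t)) has_real_derivative g (-t)) (at t)"
   using DERIV_minus by fastforce
 qed (use False g0 bd inI L in auto)
 also have "... <= exp (L * (s - r)) * (norm (w s) + \<bar>G r - G s\<bar>)"
  by (simp add: mult_left_mono)
 finally show ?thesis using False by simp
qed

lemma gronwall_const:
 fixes w w' :: "real => 'a::real_inner"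
 assumes L: "L >= 0" and e: "e >= 0"
  and dw: "!!t. t : closed_segment s r ==> (w has_vector_derivative w' t) (at t)"
  and bd: "!!t. t : closed_segment s r ==> norm (w' t) <= L * norm (w t) + e"
 shows "norm (w r) <= exp (L * \<bar>r - s\<bar>) * (norm (w s) + e * \<bar>r - s\<bar>)"
proof -
 have "norm (w r) <= exp (L * \<bar>r - s\<bar>) * (norm (w s) + \<bar>e * r - e * s\<bar>)"
  by (rule gronwall[where G="%t. e * t" and g="%_. e", OF L dw])
    (auto intro!: derivative_eq_intros e bd)
 moreover have "\<bar>e * r - e * s\<bar> = e * \<bar>r - s\<bar>" using e by (simp add: abs_mult right_diff_distrib[symmetric])
 ultimately show ?thesis by simp
qed

section \<open>Global solutions by Picard iteration\<close>

definition lip_field :: "real => (real => 'a::euclidean_space => 'a) => bool"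
 where "lip_field L F \<longleftrightarrow> 0 <= L & continuous_on UNIV (%(t, x). F t x) &
  (\<forall>t x y. norm (F t x - F t y) <= L * norm (x - y))"

lemma lip_fieldD:
 assumes "lip_field L F"
 shows "0 <= L" "norm (F t x - F t y) <= L * norm (x - y)"
  "continuous_on S f ==> continuous_on S g ==> continuous_on S (%z. F (f z) (g z))"
proof -
 assume f: "continuous_on S f" "continuous_on S g"
 have "continuous_on UNIV (%(t, x). F t x)" using assms by (simp add: lip_field_def)
 from continuous_on_compose2[OF this, of S "%z. (f z, g z)"]
 show "continuous_on S (%z. F (f z) (g z))" using f by (auto intro!: continuous_intros)
qed (use assms in \<open>auto simp: lip_field_def\<close>)

lemma antiderivative_exists:
 fixes f :: "real => 'a::euclidean_space"
 assumes "continuous_on UNIV f"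
 shows "\<exists>g. g t0 = x0 & (\<forall>t. (g has_vector_derivative f t) (at t))"
proof -
 have "((%t. x0 + (LBINT y=t0..t. f y)) has_vector_derivative f t) (at t)" for t
 proof -
 let ?T = "\<bar>t\<bar> + \<bar>t0\<bar> + 1"
 have "((%u. LBINT y=t0..u. f y) has_vector_derivative f t) (at t within {-?T..?T})"
  by (intro interval_integral_FTC2) (auto intro: continuous_on_subset[OF assms])
 moreover have "at t within {-?T..?T} = at t"
  by (rule at_within_interior) (auto simp: interior_atLeastAtMost_real)
 ultimately have "((%u. LBINT y=t0..u. f y) has_vector_derivative f t) (at t)" by simp
 from has_vector_derivative_add[OF has_vector_derivative_const[of x0] this]
 show ?thesis by simp
 qed
 then show ?thesis by (intro exI[of _ "%t::real. x0 + (LBINT y=t0..t. f y)"]) simp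
qed

definition antider :: "real => 'a::euclidean_space => (real => 'a) => real => 'a"
 where "antider t0 x0 f = (SOME g. g t0 = x0 & (\<forall>t. (g has_vector_derivative f t) (at t)))"

lemma antider:
 assumes "continuous_on UNIV f"
 shows "antider t0 x0 f t0 = x0" "(antider t0 x0 f has_vector_derivative f t) (at t)"
 using someI_ex[OF antiderivative_exists[OF assms, of t0 x0]] unfolding antider_def by auto

lemma continuous_on_vector_derivative:
 "(!!t. (g has_vector_derivative f t) (at t)) ==> continuous_on S g"
 by (meson continuous_at_imp_continuous_on has_vector_derivative_continuous)

lemma geometric_Cauchy:
 fixes x :: "nat => 'a::banach"
 assumes r: "0 <= r" "r < 1" and x: "!!n. norm (x (Suc n) - x n) <= c * r ^ n"
 shows "convergent x" "norm (lim x - x n) <= c * r ^ n / (1 - r)"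
proof -
 have s: "summable (%n. c * r ^ n)" using r by (simp add: summable_geometric summable_mult)
 have "summable (%n. x (Suc n) - x n)"
  by (rule summable_comparison_test'[OF s]) (rule x)
 then obtain l where "(%n. x (Suc n) - x n) sums l" by (auto simp: summable_def)
 then have "(%n. \<Sum>i<n. x (Suc i) - x i) ----> l" by (simp add: sums_def)
 then have "(%n. (x n - x 0) + x 0) ----> l + x 0"
  by (intro tendsto_add) (auto simp: sum_lessThan_telescope)
 then have lim: "x ----> l + x 0" by simp
 then show "convergent x" by (auto simp: convergent_def)
 have part: "norm (x (n + k) - x n) <= c * r ^ n / (1 - r)" for k
 proof -
  have c0: "c >= 0" using x[of 0] norm_ge_zero order_trans by (metis mult.right_neutral power_0)
  have "x (n + k) - x n = (\<Sum>i<k. x (Suc (n + i)) - x (n + i))"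
   by (induction k) (auto simp: algebra_simps)
  also have "norm ... <= (\<Sum>i<k. c * r ^ (n + i))" by (rule sum_norm_le) (use x in auto)
  also have "... = c * r ^ n * (\<Sum>i<k. r ^ i)" by (simp add: sum_distrib_left power_add algebra_simps)
  also have "... <= c * r ^ n * (1 / (1 - r))"
   using c0 r by (intro mult_left_mono) (auto simp: sum_gp_strict intro!: divide_right_mono)
  finally show ?thesis by simp
 qed
 have "(%k. x (n + k)) ----> lim x" using lim limI LIMSEQ_ignore_initial_segment[OF lim, of n] by (metis (no_types, lifting) ext add.commute)
 then have "(%k. norm (x (n + k) - x n)) ----> norm (lim x - x n)" by (intro tendsto_intros)
 then show "norm (lim x - x n) <= c * r ^ n / (1 - r)"
  by (rule LIMSEQ_le_const2) (use part in auto)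
qed

text \<open>Picard iteration is measured in the weight \<open>exp (2 * L' * |t - t0|)\<close>:
  integrating \<open>L'\<close> times the weight gains the factor 1/2, so the iteration converges on
  every bounded interval at once and no local solutions have to be glued.\<close>

lemma ode_exists:
 fixes F :: "real => 'a::euclidean_space => 'a"
 assumes F: "lip_field L F"
 shows "\<exists>y. y t0 = x0 & (\<forall>t. (y has_vector_derivative F t (y t)) (at t))"
proof -
 define L' where "L' = L + 1"
 have L': "L' > 0" "norm (F t x - F t y) <= L' * norm (x - y)" for t x y
  using lip_fieldD(1)[OF F] lip_fieldD(2)[OF F, of t x y] unfolding L'_def by (auto simp: algebra_simps intro: order_trans[OF _ le_add_same_cancel2[THEN iffD2]])
 define Y where "Y n = ((%y. antider t0 x0 (%t. F t (y t))) ^^ n) (%_. x0)" for n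
 have Y0: "Y 0 = (%_. x0)" by (simp add: Y_def)
 have YS: "Y (Suc n) = antider t0 x0 (%t. F t (Y n t))" for n by (simp add: Y_def)
 have contY: "continuous_on UNIV (Y n)" for n
 proof (induction n)
  case 0 then show ?case by (simp add: Y0)
 next
  case (Suc n)
  show ?case unfolding YS
   by (rule continuous_on_vector_derivative, rule antider, rule lip_fieldD(3)[OF F]) (auto intro: Suc continuous_intros)
 qed
 have dY: "Y (Suc n) t0 = x0" "(Y (Suc n) has_vector_derivative F t (Y n t)) (at t)" for n t
  unfolding YS by (rule antider, rule lip_fieldD(3)[OF F], auto intro: contY continuous_intros)+
 have step: "\<exists>c. \<forall>n t. \<bar>t - t0\<bar> <= T --> norm (Y (Suc n) t - Y n t) <= c * (1/2) ^ n" if T: "T >= 0" for T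
 proof -
  have "compact ((%t. Y 1 t - Y 0 t) ` {t0 - T..t0 + T})"
   by (intro compact_continuous_image continuous_intros continuous_on_subset[OF contY]) auto
  then obtain c where c: "!!t. \<bar>t - t0\<bar> <= T ==> norm (Y 1 t - Y 0 t) <= c"
   unfolding compact_eq_bounded_closed bounded_iff by (fastforce simp: abs_le_iff)
  have c0: "c >= 0" using c[of t0] T norm_ge_zero order_trans by (metis abs_zero diff_self)
  have up: "norm (Y (Suc n) t - Y n t) <= c * (1/2) ^ n * exp (2 * L' * \<bar>t - t0\<bar>)" if "\<bar>t - t0\<bar> <= T" for n t
   using that
  proof (induction n arbitrary: t)
   case 0
   have "c * 1 <= c * exp (2 * L' * \<bar>t - t0\<bar>)" using c0 L'(1) by (intro mult_left_mono) auto
   then show ?case using c[OF 0] by simp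
  next
   case (Suc n)
   \<comment> \<open>The sign makes \<open>|t - t0|\<close> a differentiable function along the
     segment, on which \<open>t - t0\<close> does not change sign.\<close>
   define sg :: real where "sg = (if t0 <= t then 1 else -1)"
   have sg: "sg * (sig - t0) = \<bar>sig - t0\<bar>" if "sig : closed_segment t0 t" for sig
    using that by (auto simp: sg_def closed_segment_eq_real_ivl split: if_splits)
   let ?G = "%sig. sg * (c * (1/2) ^ Suc n * exp (2 * L' * (sg * (sig - t0))))"
   have sg2: "sg * sg = 1" "sg * (sg * z) = z" for z by (auto simp: sg_def)
   \<comment> \<open>With Lipschitz constant 0 the Gronwall lemma bounds an increment by the
     integral of the norm of the derivative.\<close>
   have "norm (Y (Suc (Suc n)) t - Y (Suc n) t) <= exp (0 * \<bar>t - t0\<bar>) * (norm (Y (Suc (Suc n)) t0 - Y (Suc n) t0) + \<bar>?G t - ?G t0\<bar>)"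
   proof (rule gronwall[where w="%t. Y (Suc (Suc n)) t - Y (Suc n) t" and w'="%t. F t (Y (Suc n) t) - F t (Y n t)" and G="?G" and g="%sig. L' * (c * (1/2)^n * exp (2 * L' * (sg * (sig - t0))))"])
    fix sig assume s: "sig : closed_segment t0 t"
    show "((%t. Y (Suc (Suc n)) t - Y (Suc n) t) has_vector_derivative F sig (Y (Suc n) sig) - F sig (Y n sig)) (at sig)"
     by (intro derivative_intros dY)
    show "(?G has_real_derivative L' * (c * (1/2)^n * exp (2 * L' * (sg * (sig - t0))))) (at sig)"
     by (auto intro!: derivative_eq_intros simp: field_simps sg2)
    show "0 <= L' * (c * (1/2)^n * exp (2 * L' * (sg * (sig - t0))))" using c0 L'(1) by simp
    have "\<bar>sig - t0\<bar> <= T" using s Suc.prems by (auto simp: closed_segment_eq_real_ivl split: if_splits)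
    from Suc.IH[OF this]
    have "L' * norm (Y (Suc n) sig - Y n sig) <= L' * (c * (1/2)^n * exp (2 * L' * (sg * (sig - t0))))"
     using L'(1) sg[OF s] by simp
    then show "norm (F sig (Y (Suc n) sig) - F sig (Y n sig)) <= 0 * norm (Y (Suc (Suc n)) sig - Y (Suc n) sig) + L' * (c * (1/2)^n * exp (2 * L' * (sg * (sig - t0))))"
     using L'(2)[of sig "Y (Suc n) sig" "Y n sig"] by simp
   qed simp
   also have "... = c * (1/2) ^ Suc n * \<bar>exp (2 * L' * \<bar>t - t0\<bar>) - 1\<bar>"
   proof -
    have "?G t - ?G t0 = sg * (c * (1/2) ^ Suc n) * (exp (2 * L' * \<bar>t - t0\<bar>) - 1)"
     using sg[of t] by (simp add: algebra_simps)
    then have "\<bar>?G t - ?G t0\<bar> = c * (1/2) ^ Suc n * \<bar>exp (2 * L' * \<bar>t - t0\<bar>) - 1\<bar>"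
     using c0 by (simp only: abs_mult) (simp add: sg_def)
    then show ?thesis by (simp only: dY) simp
   qed
   also have "... <= c * (1/2) ^ Suc n * exp (2 * L' * \<bar>t - t0\<bar>)"
    using c0 L'(1) by (intro mult_left_mono) auto
   finally show ?case .
  qed
  show ?thesis
  proof (intro exI[of _ "c * exp (2 * L' * T)"] allI impI)
   fix n t assume t: "\<bar>t - t0\<bar> <= T"
   have "c * (1/2) ^ n * exp (2 * L' * \<bar>t - t0\<bar>) <= c * (1/2) ^ n * exp (2 * L' * T)"
    using c0 L'(1) t by (intro mult_left_mono) auto
   then show "norm (Y (Suc n) t - Y n t) <= c * exp (2 * L' * T) * (1/2) ^ n"
    using up[OF t, of n] by (simp add: mult_ac)
  qed
 qed
 define y where "y t = lim (%n. Y n t)" for t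
 have conv: "\<exists>c\<ge>0. \<forall>n t. \<bar>t - t0\<bar> <= T --> (%n. Y n t) ----> y t & norm (y t - Y n t) <= c * (1/2) ^ n" if T: "T >= 0" for T
 proof -
  obtain c where c: "!!n t. \<bar>t - t0\<bar> <= T ==> norm (Y (Suc n) t - Y n t) <= c * (1/2) ^ n" using step[OF T] by blast
  have c0: "c >= 0" using c[of t0 0] T norm_ge_zero order_trans by (metis abs_zero diff_self mult.right_neutral power_0)
  show ?thesis
  proof (intro exI[of _ "c * 2"] conjI allI impI)
   fix n t assume t: "\<bar>t - t0\<bar> <= T"
   show "(%n. Y n t) ----> y t"
    unfolding y_def using geometric_Cauchy(1)[OF _ _ c[OF t]] by (simp add: convergent_LIMSEQ_iff)
   show "norm (y t - Y n t) <= c * 2 * (1/2) ^ n"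
    unfolding y_def using geometric_Cauchy(2)[OF _ _ c[OF t], of n] by (simp add: mult_ac)
  qed (use c0 in simp)
 qed
 have "y t0 = x0"
 proof -
  have "(%n. Y (Suc n) t0) ----> y t0" using conv[of 0] LIMSEQ_Suc by fastforce
  then show ?thesis by (simp add: dY LIMSEQ_const_iff)
 qed
 moreover have "(y has_vector_derivative F t (y t)) (at t)" for t
 proof -
  define T where "T = \<bar>t - t0\<bar> + 1"
  have T: "T >= 0" by (simp add: T_def)
  obtain c where c: "c >= 0" "!!n t. \<bar>t - t0\<bar> <= T ==> (%n. Y n t) ----> y t" "!!n t. \<bar>t - t0\<bar> <= T ==> norm (y t - Y n t) <= c * (1/2) ^ n"
   using conv[OF T] by blast
  let ?S = "{t0 - T<..<t0 + T}"
  have S: "\<bar>s - t0\<bar> <= T" if "s : ?S" for s using that by auto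
  have tS: "t : ?S" by (auto simp: T_def)
  \<comment> \<open>The derivatives converge uniformly on the interval, so the limit of the iterates
    may be differentiated termwise.\<close>
  have "\<exists>g. \<forall>x\<in>?S. (%n. Y (Suc n) x) ----> g x & (g has_derivative (%h. h *R F x (y x))) (at x within ?S)"
  proof (rule has_derivative_sequence[where f'="%n x h. h *R F x (Y n x)" and ?x0.0=t and l="y t"])
   show "convex ?S" by simp
   show "(Y (Suc n) has_derivative (%h. h *R F x (Y n x))) (at x within ?S)" for n x
    using dY(2)[of n x] unfolding has_vector_derivative_def by (rule has_derivative_at_withinI)
   show "(%n. Y (Suc n) t) ----> y t" using c(2)[OF S[OF tS]] by (rule LIMSEQ_Suc)
   fix e :: real assume e: "e > 0"
   have "(%n. L' * (c * (1/2) ^ n)) ----> L' * (c * 0)"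
    by (intro tendsto_intros LIMSEQ_realpow_zero) auto
   then have "\<forall>\<^sub>F n in sequentially. L' * (c * (1/2) ^ n) < e" using e by (auto dest: order_tendstoD(2))
   then show "\<forall>\<^sub>F n in sequentially. \<forall>x\<in>?S. \<forall>h. norm (h *R F x (Y n x) - h *R F x (y x)) <= e * norm h"
   proof eventually_elim
    case (elim n)
    show ?case
    proof (intro ballI allI)
     fix x h assume x: "x : ?S"
     have "norm (F x (Y n x) - F x (y x)) <= L' * norm (Y n x - y x)" by (rule L')
     also have "... <= L' * (c * (1/2) ^ n)" using c(3)[OF S[OF x], of n] L'(1) by (simp add: norm_minus_commute)
     finally have "norm (F x (Y n x) - F x (y x)) <= e" using elim by simp
     then show "norm (h *R F x (Y n x) - h *R F x (y x)) <= e * norm (h::real)"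
      unfolding scaleR_diff_right[symmetric] norm_scaleR real_norm_def mult.commute[of e] by (rule mult_left_mono) simp
    qed
   qed
  qed (rule tS)
  then obtain g where g: "!!x. x : ?S ==> (%n. Y (Suc n) x) ----> g x" "!!x. x : ?S ==> (g has_derivative (%h. h *R F x (y x))) (at x within ?S)"
   by blast
  have gy: "g x = y x" if "x : ?S" for x
   using g(1)[OF that] LIMSEQ_Suc[OF c(2)[OF S[OF that]]] LIMSEQ_unique by blast
  have "(g has_derivative (%h. h *R F t (y t))) (at t)"
   using g(2)[OF tS] at_within_open[OF tS] by simp
  then have "(y has_derivative (%h. h *R F t (y t))) (at t)"
   by (rule has_derivative_transform_within_open[OF _ _ tS]) (auto simp: gy)
  then show ?thesis by (simp add: has_vector_derivative_def)
 qed
 ultimately show ?thesis by blast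
qed

section \<open>The flow and its continuous dependence on data\<close>

definition flow :: "(real => 'a::euclidean_space => 'a) => real => real => 'a => 'a"
 where "flow F s t x = (SOME y. y s = x & (\<forall>t. (y has_vector_derivative F t (y t)) (at t))) t"

context
 fixes F :: "real => 'a::euclidean_space => 'a" and L
 assumes F: "lip_field L F"
begin

lemma flow_init [simp]: "flow F s s x = x"
 and flow_vderiv: "((%t. flow F s t x) has_vector_derivative F t (flow F s t x)) (at t)"
 using someI_ex[OF ode_exists[OF F, of s x]] unfolding flow_def by auto

text \<open>The curve \<open>y\<close> solves the equation up to a defect \<open>e\<close>. From
  this follow uniqueness (\<open>e = 0\<close>), the Lipschitz bound, continuity in parameters, and
  later the comparison of true with explicit asymptotic trajectories.\<close>

lemma flow_dist_solution:
 assumes y: "!!t. t : closed_segment s r ==> (y has_vector_derivative y' t) (at t)"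
  and e: "e >= 0" "!!t. t : closed_segment s r ==> norm (y' t - F t (y t)) <= e"
 shows "norm (flow F s r x - y r) <= exp (L * \<bar>r - s\<bar>) * (norm (x - y s) + e * \<bar>r - s\<bar>)"
proof -
 have "norm ((%t. flow F s t x - y t) r) <= exp (L * \<bar>r - s\<bar>) * (norm ((%t. flow F s t x - y t) s) + e * \<bar>r - s\<bar>)"
 proof (rule gronwall_const[where w'="%t. F t (flow F s t x) - y' t"])
  fix t assume t: "t : closed_segment s r"
  show "((%t. flow F s t x - y t) has_vector_derivative F t (flow F s t x) - y' t) (at t)"
   by (intro derivative_intros flow_vderiv y t)
  have "norm (F t (flow F s t x) - y' t) <= norm (F t (flow F s t x) - F t (y t)) + norm (F t (y t) - y' t)"
   by (rule norm_triangle_sub[of "F t (flow F s t x) - y' t" "F t (y t) - y' t", simplified, THEN order_trans]) simp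
  then show "norm (F t (flow F s t x) - y' t) <= L * norm (flow F s t x - y t) + e"
   using lip_fieldD(2)[OF F, of t "flow F s t x" "y t"] e(2)[OF t] by (simp add: norm_minus_commute)
 qed (use lip_fieldD(1)[OF F] e in auto)
 then show ?thesis by simp
qed

lemma flow_unique:
 assumes y: "!!t. t : closed_segment s r ==> (y has_vector_derivative F t (y t)) (at t)"
 shows "flow F s r (y s) = y r"
 using flow_dist_solution[OF y, of s r 0 "y s"] by simp

lemma flow_flow: "flow F s t (flow F r s x) = flow F r t x"
 using flow_unique[of s t "%t. flow F r t x"] flow_vderiv by blast

lemma flow_inverse [simp]: "flow F s t (flow F t s x) = x"
 by (simp add: flow_flow)

lemma flow_lipschitz: "norm (flow F s t x - flow F s t y) <= exp (L * \<bar>t - s\<bar>) * norm (x - y)"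
 using flow_dist_solution[of s t "%t. flow F s t y" "%t. F t (flow F s t y)" 0 x] flow_vderiv by simp

end

text \<open>The parameter \<open>k\<close> makes it possible to apply this to the linearised equation.\<close>

lemma flow_continuous_param:
 fixes F :: "'k::euclidean_space => real => 'a::euclidean_space => 'a"
 assumes F: "!!k. lip_field L (F k)" and cF: "continuous_on UNIV (%(k, t, x). F k t x)"
 shows "continuous_on UNIV (%(k, s, t, x). flow (F k) s t x)"
proof -
 have L: "L >= 0" using lip_fieldD(1)[OF F] .
 have "isCont (%(k, s, t, x). flow (F k) s t x) (k0, s0, t0, x0)" for k0 s0 t0 x0
  unfolding continuous_at_eps_delta
 proof (intro allI impI)
  fix e :: real assume e: "e > 0"
  define T where "T = \<bar>s0\<bar> + \<bar>t0\<bar> + 1"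
  define y where "y t = flow (F k0) s0 t x0" for t
  have dy: "(y has_vector_derivative F k0 t (y t)) (at t)" for t
   unfolding y_def by (rule flow_vderiv[OF F])
  have cy: "continuous_on S y" for S by (rule continuous_on_vector_derivative[OF dy])
  define c where "c = exp (L * (2 * T)) * (1 + 2 * T)"
  have c: "c > 0" unfolding c_def T_def by (intro mult_pos_pos) auto
  define e' where "e' = e / (4 * c)"
  have e': "e' > 0" using e c by (simp add: e'_def)
  have "continuous_on UNIV (%z. case (fst z, snd z, y (snd z)) of (k, t, x) => F k t x)"
   by (rule continuous_on_compose2[OF cF]) (auto intro!: continuous_intros continuous_on_compose2[OF cy])
  then have "continuous_on (UNIV \<times> {-T..T}) (%(k, t). F k t (y t))"
   by (auto simp: case_prod_beta intro: continuous_on_subset)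
  \<comment> \<open>Compactness of the time interval makes the variation of the field in
    \<open>k\<close> uniform along the reference trajectory \<open>y\<close>, which is thus a
    solution with small defect for every nearby \<open>k\<close>.\<close>
  from continuous_on_prod_compactE[OF this compact_Icc UNIV_I e', of k0]
  obtain X0 where X0: "k0 : X0" "open X0" "\<forall>k\<in>X0. \<forall>t\<in>{-T..T}. dist (F k t (y t)) (F k0 t (y t)) <= e'"
   by auto
  obtain d1 where d1: "d1 > 0" "ball k0 d1 <= X0" using X0 openE by blast
  have "isCont y s0" "isCont y t0" using cy[of UNIV] by (auto simp: continuous_on_eq_continuous_at)
  then obtain d2 d3 where d2: "d2 > 0" "!!s. dist s s0 < d2 ==> dist (y s) (y s0) < e'"
   and d3: "d3 > 0" "!!t. dist t t0 < d3 ==> dist (y t) (y t0) < e/4"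
   using e e' unfolding continuous_at_eps_delta by (metis divide_pos_pos zero_less_numeral)
  have ys0: "y s0 = x0" by (simp add: y_def flow_init[OF F])
  define d where "d = min (min d1 d2) (min (min d3 e') 1)"
  have dpos: "d > 0" using d1 d2 d3 e' by (simp add: d_def)
  show "\<exists>d>0. \<forall>z. dist z (k0, s0, t0, x0) < d --> dist (case z of (k, s, t, x) => flow (F k) s t x) (case (k0, s0, t0, x0) of (k, s, t, x) => flow (F k) s t x) < e"
  proof (intro exI[of _ d] conjI allI impI dpos)
   fix z assume z: "dist z (k0, s0, t0, x0) < d"
   obtain k s t x where zz: "z = (k, s, t, x)" by (cases z)
   have dk: "dist k k0 < d" and ds: "dist s s0 < d" and dt: "dist t t0 < d" and dx: "dist x x0 < d"
    using z dist_fst_le[of z "(k0, s0, t0, x0)"] dist_snd_le[of z "(k0, s0, t0, x0)"]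
     dist_fst_le[of "snd z" "(s0, t0, x0)"] dist_snd_le[of "snd z" "(s0, t0, x0)"]
     dist_fst_le[of "snd (snd z)" "(t0, x0)"] dist_snd_le[of "snd (snd z)" "(t0, x0)"]
    by (auto simp: zz)
   have seg: "r : {-T..T}" if "r : closed_segment s t" for r
    using that ds dt unfolding d_def T_def closed_segment_eq_real_ivl dist_real_def
    by (auto split: if_splits) linarith+
   have kX: "k : X0" using dk d1 by (auto simp: d_def dist_commute subset_iff)
   have "\<bar>s - s0\<bar> < 1" "\<bar>t - t0\<bar> < 1" using ds dt by (auto simp: d_def dist_real_def)
   then have "\<bar>s\<bar> <= T" "\<bar>t\<bar> <= T" unfolding T_def by linarith+
   then have ts: "\<bar>t - s\<bar> <= 2 * T" by linarith
   have "norm (flow (F k) s t x - y t) <= exp (L * \<bar>t - s\<bar>) * (norm (x - y s) + e' * \<bar>t - s\<bar>)"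
    by (rule flow_dist_solution[OF F dy]) (use e' X0(3) kX seg in \<open>auto simp: dist_norm norm_minus_commute\<close>)
   also have "... <= exp (L * (2 * T)) * (2 * e' + e' * (2 * T))"
   proof (intro mult_mono add_mono)
    have "dist x (y s) <= dist x x0 + dist (y s) (y s0)" using ys0 by (metis dist_triangle2)
    also have "... <= 2 * e'" using dx d2(2)[of s] ds by (auto simp: d_def)
    finally show "norm (x - y s) <= 2 * e'" by (simp add: dist_norm)
   qed (use ts e' L in \<open>auto intro: mult_left_mono add_nonneg_nonneg\<close>)
   also have "... <= 2 * (c * e')" using e' by (auto simp: c_def algebra_simps T_def)
   also have "... = e / 2" using c by (simp add: e'_def)
   finally have "dist (flow (F k) s t x) (y t) <= e/2" by (simp add: dist_norm)
   moreover have "dist (y t) (y t0) < e/4" using d3 dt by (auto simp: d_def)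
   ultimately show "dist (case z of (k, s, t, x) => flow (F k) s t x) (case (k0, s0, t0, x0) of (k, s, t, x) => flow (F k) s t x) < e"
    using e dist_triangle[of "flow (F k) s t x" "y t0" "y t"] by (simp add: zz y_def)
  qed
 qed
 then show ?thesis by (auto simp: continuous_on_eq_continuous_at)
qed

lemma continuous_on_curry2:
 assumes "continuous_on UNIV (%(a, b). f a b)" "continuous_on S g" "continuous_on S h"
 shows "continuous_on S (%z. f (g z) (h z))"
proof -
 have "continuous_on S (%z. (%(a, b). f a b) (g z, h z))"
  by (rule continuous_on_compose2[OF assms(1)]) (auto intro: continuous_on_Pair assms)
 then show ?thesis by simp
qed

lemma continuous_on_curry4:
 assumes "continuous_on UNIV (%(a, b, c, d). f a b c d)"
  "continuous_on S g" "continuous_on S h" "continuous_on S k" "continuous_on S m"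
 shows "continuous_on S (%z. f (g z) (h z) (k z) (m z))"
proof -
 have "continuous_on S (%z. (%(a, b, c, d). f a b c d) (g z, h z, k z, m z))"
  by (rule continuous_on_compose2[OF assms(1)]) (auto intro!: continuous_on_Pair assms)
 then show ?thesis by simp
qed

lemma flow_continuous_on:
 assumes F: "lip_field L F" "continuous_on S f" "continuous_on S g" "continuous_on S h"
 shows "continuous_on S (%z. flow F (f z) (g z) (h z))"
proof -
 have "continuous_on UNIV (%(k::real, s, t, x). flow F s t x)"
  by (rule flow_continuous_param[where F="%_. F" and L=L])
    (auto intro!: F lip_fieldD(3)[OF F(1)] continuous_intros simp: case_prod_beta)
 from continuous_on_curry4[OF this continuous_on_const assms(2-)] show ?thesis .
qed

text \<open>Start and end time both vary near \<open>t0\<close>, and the same vector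
  \<open>F t0 x0\<close> serves for all of them. The derivative in the starting time and the shear
  approximation in \<open>flow_mpres\<close> rest on this uniformity.\<close>

lemma flow_first_order:
 assumes F: "lip_field L F" and e: "e > 0"
 shows "\<exists>d>0. \<forall>s t y t'. \<bar>s - t0\<bar> < d --> \<bar>t - t0\<bar> < d --> \<bar>t' - t0\<bar> < d --> dist y x0 < d -->
  norm (flow F s t y - y - (t - s) *R F t0 x0) <= e * \<bar>t - s\<bar>"
proof -
 have "continuous_on UNIV (%z. F (fst (snd z)) (flow F (fst z) (fst (snd z)) (snd (snd z))))"
  by (intro lip_fieldD(3)[OF F] flow_continuous_on[OF F] continuous_intros)
 then have "isCont (%z. F (fst (snd z)) (flow F (fst z) (fst (snd z)) (snd (snd z)))) (t0, t0, x0)"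
  by (simp add: continuous_on_eq_continuous_at)
 then obtain d where d: "d > 0" "!!s t y. dist (s, t, y) (t0, t0, x0) < d ==> dist (F t (flow F s t y)) (F t0 x0) < e"
  unfolding continuous_at_eps_delta using e flow_init[OF F] by (metis fst_conv snd_conv)
 show ?thesis
 proof (intro exI[of _ "d / 3"] conjI allI impI)
  fix s t t' y assume *: "\<bar>s - t0\<bar> < d/3" "\<bar>t - t0\<bar> < d/3" "dist y x0 < d/3"
  let ?w = "%r. flow F s r y - y - (r - s) *R F t0 x0"
  have "norm (?w t) <= exp (0 * \<bar>t - s\<bar>) * (norm (?w s) + e * \<bar>t - s\<bar>)"
  proof (rule gronwall_const[where w'="%r. F r (flow F s r y) - F t0 x0"])
   fix r assume r: "r : closed_segment s t"
   show "(?w has_vector_derivative F r (flow F s r y) - F t0 x0) (at r)"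
    by (rule has_vector_derivative_eq_rhs, rule derivative_intros, rule derivative_intros,
      rule flow_vderiv[OF F], rule derivative_intros) (auto intro!: derivative_eq_intros)
   have "closed_segment s t <= ball t0 (d/3)"
    by (rule closed_segment_subset) (use * in \<open>auto simp: dist_real_def abs_minus_commute\<close>)
   then have "\<bar>r - t0\<bar> < d/3" using r by (auto simp: dist_real_def abs_minus_commute)
   then have "dist (s, r, y) (t0, t0, x0) < d"
    using * dist_triangle[of "(s, r, y)" "(t0, t0, x0)" "(t0, r, y)"] dist_triangle[of "(t0, r, y)" "(t0, t0, x0)" "(t0, t0, y)"]
    by (simp add: dist_Pair_Pair dist_real_def real_sqrt_abs)
   from d(2)[OF this] show "norm (F r (flow F s r y) - F t0 x0) <= 0 * norm (?w r) + e"
    by (simp add: dist_norm)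
  qed (use e in auto)
  then show "norm (?w t) <= e * \<bar>t - s\<bar>" by (simp add: flow_init[OF F])
 qed (use d in auto)
qed

section \<open>Differentiability of the flow in the initial value\<close>

definition linearised :: "(real => 'a::euclidean_space => 'a) => (real => 'a => 'a => 'a) => real \<times> 'a => real => 'a => 'a"
 where "linearised F DF = (%(s, x) t h. DF t (flow F s t x) h)"

definition Dflow :: "(real => 'a::euclidean_space => 'a) => (real => 'a => 'a => 'a) => real => real => 'a => 'a => 'a"
 where "Dflow F DF s t x h = flow (linearised F DF (s, x)) s t h"

lemma Lipschitz_derivative_bound:
 fixes f :: "'a::euclidean_space => 'b::real_normed_vector"
 assumes f: "(f has_derivative D) (at x)" and L: "!!x y. norm (f x - f y) <= L * norm (x - y)"
 shows "norm (D h) <= L * norm h"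
proof -
 interpret D: bounded_linear D using f by (rule has_derivative_bounded_linear)
 show ?thesis
 proof (cases "h = 0")
  case False
  have *: "norm (D h) <= (L + e) * norm h" if e: "e > 0" for e
  proof -
   obtain d where d: "d > 0" "!!y. norm (y - x) < d ==> norm (f y - f x - D (y - x)) <= e * norm (y - x)"
    using f e unfolding has_derivative_at_alt by blast
   define t where "t = d / (2 * norm h)"
   have t: "t > 0" "norm (t *R h) < d" using d False by (auto simp: t_def)
   have "norm (D (t *R h)) <= norm (f (x + t *R h) - f x) + norm (f (x + t *R h) - f x - D (t *R h))"
    by (metis norm_triangle_sub norm_minus_commute)
   also have "... <= L * norm (t *R h) + e * norm (t *R h)"
    using L[of "x + t *R h" x] d(2)[of "x + t *R h"] t by (intro add_mono) auto
   finally have "t * norm (D h) <= t * ((L + e) * norm h)" using t by (simp add: D.scaleR algebra_simps)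
   then show ?thesis using t(1) by simp
  qed
  show ?thesis
  proof (rule field_le_epsilon)
   fix e :: real assume "e > 0"
   then show "norm (D h) <= L * norm h + e"
    using *[of "e / norm h"] False by (simp add: algebra_simps)
  qed
 qed (simp add: D.zero)
qed

lemma linearised_lip_field:
 assumes F: "lip_field L F" and DF: "!!t x. (F t has_derivative DF t x) (at x)"
  and cDF: "!!h. continuous_on UNIV (%(t, x). DF t x h)"
 shows "lip_field L (linearised F DF k)" "continuous_on UNIV (%(k, t, h). linearised F DF k t h)"
  "norm (DF t x h) <= L * norm h"
proof -
 have bd: "norm (DF t x h) <= L * norm h" for t x h
  by (rule Lipschitz_derivative_bound[OF DF lip_fieldD(2)[OF F]])
 then show "norm (DF t x h) <= L * norm h" .
 have lin: "linear (DF t x)" for t x using DF has_derivative_linear by blast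
 have c1: "continuous_on UNIV (%z. DF (fst z) (fst (snd z)) (snd (snd z)))"
 proof -
  \<comment> \<open>Continuity is known for each fixed direction only; linearity and a basis
    expansion make it joint in the direction as well.\<close>
  have "(%z. DF (fst z) (fst (snd z)) (snd (snd z))) = (%z. \<Sum>b\<in>Basis. (snd (snd z) <.> b) *R DF (fst z) (fst (snd z)) b)"
  proof
   fix z :: "real \<times> 'a \<times> 'a"
   interpret linear "DF (fst z) (fst (snd z))" by (rule lin)
   have "DF (fst z) (fst (snd z)) (snd (snd z)) = DF (fst z) (fst (snd z)) (\<Sum>b\<in>Basis. (snd (snd z) <.> b) *R b)"
    by (simp add: euclidean_representation)
   then show "DF (fst z) (fst (snd z)) (snd (snd z)) = (\<Sum>b\<in>Basis. (snd (snd z) <.> b) *R DF (fst z) (fst (snd z)) b)"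
    by (simp add: sum scaleR)
  qed
  moreover have "continuous_on UNIV (%z::real \<times> 'a \<times> 'a. DF (fst z) (fst (snd z)) b)" for b
   by (intro continuous_on_curry2[OF cDF[of b]] continuous_intros)
  ultimately show ?thesis by (simp only:) (intro continuous_intros)
 qed
 have c2: "continuous_on S (%z. DF (f z) (g z) (h z))" if "continuous_on S f" "continuous_on S g" "continuous_on S h" for S :: "'z::topological_space set" and f g h
 proof -
  have "continuous_on S (%z. (%z. DF (fst z) (fst (snd z)) (snd (snd z))) (f z, g z, h z))"
   by (rule continuous_on_compose2[OF c1]) (auto intro!: continuous_on_Pair that)
  then show ?thesis by simp
 qed
 show "continuous_on UNIV (%(k, t, h). linearised F DF k t h)"
  unfolding linearised_def case_prod_beta by (intro c2 flow_continuous_on[OF F] continuous_intros)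
 show "lip_field L (linearised F DF k)"
  unfolding lip_field_def linearised_def case_prod_beta
 proof (intro conjI allI)
  show "continuous_on UNIV (%p. DF (fst p) (flow F (fst k) (fst p) (snd k)) (snd p))"
   by (intro c2 flow_continuous_on[OF F] continuous_intros)
  fix t x y
  show "norm (DF t (flow F (fst k) t (snd k)) x - DF t (flow F (fst k) t (snd k)) y) <= L * norm (x - y)"
   using bd[of t _ "x - y"] linear_diff[OF lin] by metis
 qed (use lip_fieldD(1)[OF F] in simp)
qed

lemma Dflow_continuous_on:
 assumes F: "lip_field L F" and DF: "!!t x. (F t has_derivative DF t x) (at x)"
  and cDF: "!!h. continuous_on UNIV (%(t, x). DF t x h)"
  and c: "continuous_on S f" "continuous_on S g" "continuous_on S h"
 shows "continuous_on S (%z. Dflow F DF (f z) (g z) (h z) v)"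
proof -
 note l = linearised_lip_field[OF F DF cDF]
 show ?thesis unfolding Dflow_def
  by (intro continuous_on_curry4[OF flow_continuous_param[OF l(1,2)]] continuous_on_Pair c continuous_on_const)
qed

text \<open>Linearity of \<open>Dflow\<close> follows from uniqueness for the linearised equation.
  Differentiability is Gronwall applied to the first-order remainder, whose forcing is the Taylor
  remainder of \<open>F\<close> along the trajectory.\<close>

lemma Dflow:
 assumes F: "lip_field L F" and DF: "!!t x. (F t has_derivative DF t x) (at x)"
  and cDF: "!!h. continuous_on UNIV (%(t, x). DF t x h)"
 shows "(flow F s t has_derivative Dflow F DF s t x) (at x)"
  and "norm (Dflow F DF s t x h) <= exp (L * \<bar>t - s\<bar>) * norm h"
  and "((%t. Dflow F DF s t x h) has_vector_derivative DF t (flow F s t x) (Dflow F DF s t x h)) (at t)"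
proof -
 note l = linearised_lip_field[OF F DF cDF]
 have L: "L >= 0" using F by (rule lip_fieldD)
 have lin: "linear (DF t x)" for t x using DF has_derivative_linear by blast
 have dD: "((%t. Dflow F DF s t x h) has_vector_derivative DF t (flow F s t x) (Dflow F DF s t x h)) (at t)" for t h
  unfolding Dflow_def using flow_vderiv[OF l(1), of "(s, x)" s h t] by (simp add: linearised_def)
 show "((%t. Dflow F DF s t x h) has_vector_derivative DF t (flow F s t x) (Dflow F DF s t x h)) (at t)" by (rule dD)
 have init: "Dflow F DF s s x h = h" for h unfolding Dflow_def by (rule flow_init[OF l(1)])
 have uniq: "Dflow F DF s t x (y s) = y t" if "!!t. (y has_vector_derivative DF t (flow F s t x) (y t)) (at t)" for y t
  unfolding Dflow_def using flow_unique[OF l(1), of s t y "(s, x)"] that by (simp add: linearised_def)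
 have linD: "linear (Dflow F DF s t x)"
 proof
  fix a b
  have "((%t. Dflow F DF s t x a + Dflow F DF s t x b) has_vector_derivative DF t (flow F s t x) (Dflow F DF s t x a + Dflow F DF s t x b)) (at t)" for t
   unfolding linear_add[OF lin] by (intro derivative_intros dD)
  from uniq[OF this, of t] show "Dflow F DF s t x (a + b) = Dflow F DF s t x a + Dflow F DF s t x b" by (simp add: init)
 next
  fix r :: real and a
  have "((%t. r *R Dflow F DF s t x a) has_vector_derivative DF t (flow F s t x) (r *R Dflow F DF s t x a)) (at t)" for t
   unfolding linear_scale[OF lin] using has_vector_derivative_scaleR[OF DERIV_const[of r] dD] by simp
  from uniq[OF this, of t] show "Dflow F DF s t x (r *R a) = r *R Dflow F DF s t x a" by (simp add: init)
 qed
 have bd: "norm (Dflow F DF s t x h) <= exp (L * \<bar>t - s\<bar>) * norm h" for h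
 proof -
  have "flow (linearised F DF (s, x)) s t 0 = 0"
   using linear_0[OF linD] unfolding Dflow_def .
  then show ?thesis using flow_lipschitz[OF l(1), of "(s, x)" s t h 0] unfolding Dflow_def by simp
 qed
 then show "norm (Dflow F DF s t x h) <= exp (L * \<bar>t - s\<bar>) * norm h" .
 have main: "\<exists>d>0. \<forall>y. norm (y - x) < d --> norm (flow F s t y - flow F s t x - Dflow F DF s t x (y - x)) <= e * norm (y - x)"
  if e: "e > 0" for e
 proof -
  define T where "T = \<bar>t - s\<bar> + 1"
  define E where "E = exp (L * T)"
  have E: "E > 0" "T > 0" by (auto simp: E_def T_def)
  have seg: "\<bar>r - s\<bar> <= T" if "r : closed_segment s t" for r
   using that by (auto simp: T_def closed_segment_eq_real_ivl split: if_splits)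
  have exle: "exp (L * \<bar>r - s\<bar>) <= E" if "\<bar>r - s\<bar> <= T" for r
   unfolding E_def using L that by (simp add: mult_left_mono)
  \<comment> \<open>One factor \<open>E\<close> bounds the distance of the two trajectories; the
    other one and \<open>T\<close> are the loss in Gronwall's inequality.\<close>
  define e' where "e' = e / (E * E * T)"
  have e': "e' > 0" using e E by (simp add: e'_def)
  \<comment> \<open>The oscillation of \<open>DF\<close> is controlled on basis vectors first, which
    costs the dimension.\<close>
  define e'' where "e'' = e' / (real DIM('a))"
  have e'': "e'' > 0" using e' by (simp add: e''_def)
  have "continuous_on UNIV (%z. DF (snd z) (flow F s (snd z) x + fst z) b)" for b
   by (intro continuous_on_curry2[OF cDF[of b]] continuous_intros flow_continuous_on[OF F])
  then have cc: "continuous_on (UNIV \<times> closed_segment s t) (%(v, r). DF r (flow F s r x + v) b)" for b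
   by (auto simp: case_prod_beta intro: continuous_on_subset)
  have "\<exists>d>0. \<forall>v. norm v < d --> (\<forall>r\<in>closed_segment s t. norm (DF r (flow F s r x + v) b - DF r (flow F s r x) b) <= e'')" for b
  proof -
   from continuous_on_prod_compactE[OF cc[of b] compact_segment UNIV_I[of 0] e'']
   obtain X0 where X0: "0 : X0" "open X0" "\<forall>v\<in>X0 \<inter> UNIV. \<forall>r\<in>closed_segment s t. dist ((%(v, r). DF r (flow F s r x + v) b) (v, r)) ((%(v, r). DF r (flow F s r x + v) b) (0, r)) <= e''"
    by blast
   then obtain d where "d > 0" "ball 0 d <= X0" using openE by blast
   then show ?thesis using X0(3) by (intro exI[of _ d]) (auto simp: dist_norm subset_iff)
  qed
  then obtain dd where dd: "!!b. dd b > 0" "!!b v r. norm v < dd b ==> r : closed_segment s t ==> norm (DF r (flow F s r x + v) b - DF r (flow F s r x) b) <= e''"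
   by metis
  define d where "d = Min (dd ` Basis)"
  have d: "d > 0" "!!b. b : Basis ==> d <= dd b" using dd(1) by (auto simp: d_def)
  have DFd: "norm (DF r (flow F s r x + v) h - DF r (flow F s r x) h) <= e' * norm h" if v: "norm v < d" and r: "r : closed_segment s t" for v r h
  proof -
   let ?A = "%h. DF r (flow F s r x + v) h - DF r (flow F s r x) h"
   have lA: "linear ?A" by (intro linear_compose_sub lin)
   have "?A h = ?A (\<Sum>b\<in>Basis. (h <.> b) *R b)" by (simp add: euclidean_representation)
   also have "... = (\<Sum>b\<in>Basis. (h <.> b) *R ?A b)" by (simp only: linear_sum[OF lA] linear_scale[OF lA])
   also have "norm ... <= (\<Sum>b\<in>(Basis::'a set). norm h * e'')"
   proof (rule sum_norm_le)
    fix b :: 'a assume b: "b : Basis"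
    have "\<bar>h <.> b\<bar> <= norm h" using b by (rule Basis_le_norm)
    moreover have "norm (?A b) <= e''" by (rule dd(2)) (use v r d(2)[OF b] in auto)
    ultimately show "norm ((h <.> b) *R ?A b) <= norm h * e''" by (auto intro: mult_mono)
   qed
   finally show ?thesis by (simp add: e''_def mult.commute)
  qed
  show ?thesis
  proof (intro exI[of _ "d / E"] conjI allI impI)
   fix y assume y: "norm (y - x) < d / E"
   let ?w = "%r. flow F s r y - flow F s r x - Dflow F DF s r x (y - x)"
   have "norm (?w t) <= exp (L * \<bar>t - s\<bar>) * (norm (?w s) + (e' * (E * norm (y - x))) * \<bar>t - s\<bar>)"
   proof (rule gronwall_const[where w'="%r. F r (flow F s r y) - F r (flow F s r x) - DF r (flow F s r x) (Dflow F DF s r x (y - x))"])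
    fix r assume r: "r : closed_segment s t"
    show "(?w has_vector_derivative F r (flow F s r y) - F r (flow F s r x) - DF r (flow F s r x) (Dflow F DF s r x (y - x))) (at r)"
     by (intro derivative_intros flow_vderiv[OF F] dD)
    let ?a = "flow F s r x" and ?b = "flow F s r y"
    have n1: "norm (?b - ?a) <= E * norm (y - x)"
     using flow_lipschitz[OF F, of s r y x] mult_right_mono[OF exle[OF seg[OF r]], of "norm (y - x)"] by simp
    also have "... < d" using y E by (simp add: field_simps)
    finally have n2: "norm (?b - ?a) < d" .
    have "norm (F r ?b - F r ?a - DF r ?a (?b - ?a)) <= norm (?b - ?a) * e'"
    proof (rule differentiable_bound_linearization[where f'="DF r" and S="ball ?a d"])
     show "?a + t *R (?b - ?a) : ball ?a d" if "t : {0..1}" for t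
     proof -
      have "norm (t *R (?b - ?a)) <= 1 * norm (?b - ?a)" unfolding norm_scaleR using that by (intro mult_right_mono) auto
      then show ?thesis using n2 by (simp add: dist_norm)
     qed
     show "(F r has_derivative DF r z) (at z within ball ?a d)" for z by (rule has_derivative_at_withinI[OF DF])
     show "onorm (DF r z - DF r ?a) <= e'" if "z : ball ?a d" for z
      using DFd[of "z - ?a" r] r that by (intro onorm_le) (auto simp: dist_norm norm_minus_commute)
    qed (use d in auto)
    also have "... <= e' * (E * norm (y - x))" using n1 e' by (simp add: mult.commute)
    finally have rem: "norm (F r ?b - F r ?a - DF r ?a (?b - ?a)) <= e' * (E * norm (y - x))" .
    have "F r ?b - F r ?a - DF r ?a (Dflow F DF s r x (y - x)) = DF r ?a (?w r) + (F r ?b - F r ?a - DF r ?a (?b - ?a))"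
     by (simp add: linear_diff[OF lin])
    then show "norm (F r ?b - F r ?a - DF r ?a (Dflow F DF s r x (y - x))) <= L * norm (?w r) + e' * (E * norm (y - x))"
     using norm_triangle_le[OF add_mono[OF l(3)[of r ?a "?w r"] rem]] by metis
   qed (use L e' E in auto)
   also have "... = exp (L * \<bar>t - s\<bar>) * ((e' * (E * norm (y - x))) * \<bar>t - s\<bar>)"
    by (simp add: init flow_init[OF F])
   also have "... <= E * ((e' * (E * norm (y - x))) * T)"
    using e' E by (intro mult_mono exle) (auto simp: T_def)
   also have "... = e * norm (y - x)" using E by (simp add: e'_def)
   finally show "norm (?w t) <= e * norm (y - x)" .
  qed (use d E in auto)
 qed
 show "(flow F s t has_derivative Dflow F DF s t x) (at x)"
  unfolding has_derivative_at_alt using main linD linear_conv_bounded_linear by blast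
qed

text \<open>Differentiability in time and initial value jointly follows from that in the initial value by the group property.\<close>

lemma flow_deriv_start:
 assumes F: "lip_field L F" and DF: "!!t x. (F t has_derivative DF t x) (at x)"
  and cDF: "!!h. continuous_on UNIV (%(t, x). DF t x h)"
 shows "((%(s, z). flow F s t z) has_derivative (%(h, k). Dflow F DF s t z (k - h *R F s z))) (at (s, z))"
  and "((%(s, z). flow F t s z) has_derivative (%(h, k). Dflow F DF t s z k + h *R F s (flow F t s z))) (at (s, z))"
proof -
 have near1: "((%p. flow F (fst p) s (snd p)) has_derivative (%p. snd p - fst p *R F s z)) (at (s, z))"
  unfolding has_derivative_at_alt
 proof (intro conjI allI impI)
  fix e :: real assume "e > 0"
  from flow_first_order[OF F this, of s z] obtain d where d: "d > 0" "!!r y. \<bar>r - s\<bar> < d ==> dist y z < d ==>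
    norm (flow F r s y - y - (s - r) *R F s z) <= e * \<bar>s - r\<bar>" by (metis abs_zero diff_self)
  show "\<exists>d>0. \<forall>y. norm (y - (s, z)) < d --> norm (flow F (fst y) s (snd y) - flow F (fst (s, z)) s (snd (s, z)) - (snd (y - (s, z)) - fst (y - (s, z)) *R F s z)) <= e * norm (y - (s, z))"
  proof (intro exI[of _ d] conjI allI impI d(1))
   fix p assume p: "norm (p - (s, z)) < d"
   obtain r y where ry: "p = (r, y)" by (cases p)
   have 1: "\<bar>r - s\<bar> <= norm (p - (s, z))" "dist y z <= norm (p - (s, z))"
    using norm_fst_le[of "r - s" "y - z"] norm_snd_le[of "y - z" "r - s"] by (auto simp: ry dist_norm)
   have "norm (flow F r s y - y - (s - r) *R F s z) <= e * \<bar>s - r\<bar>" by (rule d(2)) (use 1 p in auto)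
   also have "... <= e * norm (p - (s, z))" using 1 \<open>e > 0\<close> by (simp add: abs_minus_commute)
   finally show "norm (flow F (fst p) s (snd p) - flow F (fst (s, z)) s (snd (s, z)) - (snd (p - (s, z)) - fst (p - (s, z)) *R F s z)) <= e * norm (p - (s, z))"
    by (simp add: ry flow_init[OF F] algebra_simps)
  qed
 qed (intro bounded_linear_intros)
 have "((%p. flow F s t (flow F (fst p) s (snd p))) has_derivative (%p. Dflow F DF s t z (snd p - fst p *R F s z))) (at (s, z))"
  by (rule has_derivative_compose[OF near1]) (simp add: flow_init[OF F] Dflow(1)[OF F DF cDF])
 then show "((%(s, z). flow F s t z) has_derivative (%(h, k). Dflow F DF s t z (k - h *R F s z))) (at (s, z))"
  by (simp add: flow_flow[OF F] case_prod_unfold)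
 let ?z = "flow F t s z"
 have near2: "((%p. flow F s (fst p) (snd p)) has_derivative (%p. snd p + fst p *R F s ?z)) (at (s, ?z))"
  unfolding has_derivative_at_alt
 proof (intro conjI allI impI)
  fix e :: real assume "e > 0"
  from flow_first_order[OF F this, of s ?z] obtain d where d: "d > 0" "!!r y. \<bar>r - s\<bar> < d ==> dist y ?z < d ==>
    norm (flow F s r y - y - (r - s) *R F s ?z) <= e * \<bar>r - s\<bar>" by (metis abs_zero diff_self)
  show "\<exists>d>0. \<forall>y. norm (y - (s, ?z)) < d --> norm (flow F s (fst y) (snd y) - flow F s (fst (s, ?z)) (snd (s, ?z)) - (snd (y - (s, ?z)) + fst (y - (s, ?z)) *R F s ?z)) <= e * norm (y - (s, ?z))"
  proof (intro exI[of _ d] conjI allI impI d(1))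
   fix p assume p: "norm (p - (s, ?z)) < d"
   obtain r y where ry: "p = (r, y)" by (cases p)
   have 1: "\<bar>r - s\<bar> <= norm (p - (s, ?z))" "dist y ?z <= norm (p - (s, ?z))"
    using norm_fst_le[of "r - s" "y - ?z"] norm_snd_le[of "y - ?z" "r - s"] by (auto simp: ry dist_norm)
   have "norm (flow F s r y - y - (r - s) *R F s ?z) <= e * \<bar>r - s\<bar>" by (rule d(2)) (use 1 p in auto)
   also have "... <= e * norm (p - (s, ?z))" using 1 \<open>e > 0\<close> by simp
   finally show "norm (flow F s (fst p) (snd p) - flow F s (fst (s, ?z)) (snd (s, ?z)) - (snd (p - (s, ?z)) + fst (p - (s, ?z)) *R F s ?z)) <= e * norm (p - (s, ?z))"
    by (simp add: ry flow_init[OF F] algebra_simps)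
  qed
 qed (intro bounded_linear_intros)
 have "((%p. (fst p, flow F t s (snd p))) has_derivative (%p. (fst p, Dflow F DF t s z (snd p)))) (at (s, z))"
  by (intro derivative_intros has_derivative_compose[of snd snd "(s, z)" UNIV "flow F t s"])
    (auto intro!: derivative_eq_intros Dflow(1)[OF F DF cDF])
 from has_derivative_compose[OF this, of "%p. flow F s (fst p) (snd p)" "%p. snd p + fst p *R F s ?z"] near2
 have "((%p. flow F s (fst p) (flow F t s (snd p))) has_derivative (%p. Dflow F DF t s z (snd p) + fst p *R F s ?z)) (at (s, z))"
  by simp
 then show "((%(s, z). flow F t s z) has_derivative (%(h, k). Dflow F DF t s z k + h *R F s (flow F t s z))) (at (s, z))"
  by (simp add: flow_flow[OF F] case_prod_unfold)
qed

section \<open>Measure preservation\<close>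

definition mpres :: "('a::euclidean_space => 'a) => bool"
 where "mpres T \<longleftrightarrow> T : bmeas & distr lborel borel T = lborel"

lemma mpres_measurable [measurable_dest]: "mpres T ==> T : bmeas"
 by (simp add: mpres_def)

lemma mpres_nn_integral:
 assumes "mpres T" "f : bmeas"
 shows "(NNI x. f (T x)) = (NNI x. f x)"
 using nn_integral_distr[of T lborel borel f] assms by (simp add: mpres_def)

lemma mpres_integrable:
 fixes f :: "'a::euclidean_space => 'b::{banach, second_countable_topology}"
 assumes "mpres T" "f : bmeas"
 shows "integrable lborel (%x. f (T x)) \<longleftrightarrow> integrable lborel f"
 using integrable_distr_eq[of T lborel borel f] assms by (simp add: mpres_def)

lemma mpres_integral:
 fixes f :: "'a::euclidean_space => 'b::{banach, second_countable_topology}"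
 assumes "mpres T" "f : bmeas"
 shows "(LI x. f (T x)) = (LI x. f x)"
 using integral_distr[of T lborel borel f] assms by (simp add: mpres_def)

lemma mpres_AE:
 assumes "mpres T" "AE x in lborel. P x"
 shows "AE x in lborel. P (T x)"
proof -
 obtain N where N: "N : null_sets lborel" "{x. \<not> P x} <= N"
  using assms(2) by (auto simp: eventually_ae_filter)
 have [measurable]: "N : sets borel" using N by auto
 have "emeasure lborel (T -` N) = emeasure (distr lborel borel T) N"
  using assms(1) by (subst emeasure_distr) (auto simp: mpres_def)
 also have "... = 0" using assms(1) N by (auto simp: mpres_def)
 finally have "T -` N : null_sets lborel"
  using measurable_sets[of T borel borel N] mpres_measurable[OF assms(1)] by (auto simp: null_sets_def)
 moreover have "{x. \<not> P (T x)} <= T -` N" using N by auto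
 ultimately show ?thesis by (auto simp: eventually_ae_filter)
qed

lemma mpres_comp:
 assumes "mpres S" "mpres T"
 shows "mpres (%x. S (T x))"
proof -
 have "distr lborel borel (S \<circ> T) = distr (distr lborel borel T) borel S"
  using assms by (subst distr_distr) (auto simp: mpres_def)
 then show ?thesis using assms by (auto simp: mpres_def o_def)
qed

lemma mpresI_nn_integral:
 fixes T :: "'a::euclidean_space => 'a"
 assumes T: "T : bmeas"
  and I: "!!f. f : bmeas ==> (NNI x. f (T x)) = (NNI x. f x)"
 shows "mpres T"
 unfolding mpres_def
proof (intro conjI T measure_eqI)
 fix A assume "A : sets (distr lborel borel T)"
 then have A: "A : sets borel" by simp
 have "emeasure (distr lborel borel T) A = nn_integral (distr lborel borel T) (indicator A)" using A by simp
 also have "... = (NNI x. indicator A (T x))" by (rule nn_integral_distr) (use A T in auto)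
 also have "... = emeasure lborel A" using A by (subst I) auto
 finally show "emeasure (distr lborel borel T) A = emeasure lborel A" .
qed simp

lemma nn_integral_lborel_translate:
 fixes f :: "'a::euclidean_space => ennreal"
 assumes "f : bmeas"
 shows "(NNI x. f (c + x)) = (NNI x. f x)"
 using nn_integral_distr[of "(+) c" lborel borel f] assms by (simp add: lborel_distr_plus)

lemma nn_integral_lborel_pair:
 fixes f :: "'a::euclidean_space \<times> 'b::euclidean_space => ennreal"
 assumes [measurable]: "f : bmeas"
 shows "(NNI z. f z) = (NNI x. NNI y. f (x, y))"
  and "(NNI z. f z) = (NNI y. NNI x. f (x, y))"
proof -
 have f: "f : borel_measurable (lborel \<Otimes>\<^sub>M lborel)" by (simp add: lborel_prod)
 show "(NNI z. f z) = (NNI x. NNI y. f (x, y))"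
  using lborel.nn_integral_fst[OF f] by (simp add: lborel_prod)
 show "(NNI z. f z) = (NNI y. NNI x. f (x, y))"
  using lborel_pair.nn_integral_snd[OF f] by (simp add: lborel_prod)
qed

text \<open>On each fibre over the first component the map is a translation; Fubini does the
  rest.\<close>

lemma mpres_shear_snd:
 fixes b :: "'a::euclidean_space => 'b::euclidean_space"
 assumes b[measurable]: "b : bmeas"
 shows "mpres (%z. (fst z, snd z + b (fst z)))"
proof (rule mpresI_nn_integral)
 show m: "(%z. (fst z, snd z + b (fst z))) : bmeas"
  unfolding borel_prod[symmetric] by measurable
 fix f :: "'a \<times> 'b => ennreal" assume f[measurable]: "f : bmeas"
 have "(NNI z. f (fst z, snd z + b (fst z))) = (NNI x. NNI y. f (x, b x + y))"
  by (subst nn_integral_lborel_pair(1)) (use measurable_compose[OF m f] in \<open>auto simp: add.commute\<close>)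
 also have "... = (NNI x. NNI y. f (x, y))"
 proof (rule nn_integral_cong)
  fix x
  have "(%y. f (x, y)) : bmeas"
   by (rule measurable_compose[OF _ f]) (simp add: borel_prod[symmetric])
  from nn_integral_lborel_translate[OF this]
  show "(NNI y. f (x, b x + y)) = (NNI y. f (x, y))" .
 qed
 also have "... = (NNI z. f z)" by (rule nn_integral_lborel_pair(1)[symmetric]) (rule f)
 finally show "(NNI z. f (fst z, snd z + b (fst z))) = (NNI z. f z)" .
qed

lemma mpres_shear_fst:
 fixes b :: "'b::euclidean_space => 'a::euclidean_space"
 assumes b[measurable]: "b : bmeas"
 shows "mpres (%z. (fst z + b (snd z), snd z))"
proof (rule mpresI_nn_integral)
 show m: "(%z. (fst z + b (snd z), snd z)) : bmeas"
  unfolding borel_prod[symmetric] by measurable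
 fix f :: "'a \<times> 'b => ennreal" assume f[measurable]: "f : bmeas"
 have "(NNI z. f (fst z + b (snd z), snd z)) = (NNI y. NNI x. f (b y + x, y))"
  by (subst nn_integral_lborel_pair(2)) (use measurable_compose[OF m f] in \<open>auto simp: add.commute\<close>)
 also have "... = (NNI y. NNI x. f (x, y))"
 proof (rule nn_integral_cong)
  fix y
  have "(%x. f (x, y)) : bmeas"
   by (rule measurable_compose[OF _ f]) (simp add: borel_prod[symmetric])
  from nn_integral_lborel_translate[OF this]
  show "(NNI x. f (b y + x, y)) = (NNI x. f (x, y))" .
 qed
 also have "... = (NNI z. f z)" by (rule nn_integral_lborel_pair(2)[symmetric]) (rule f)
 finally show "(NNI z. f (fst z + b (snd z), snd z)) = (NNI z. f z)" .
qed

lemma integrable_continuous_compact_support: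
 fixes f :: "'a::euclidean_space => 'b::euclidean_space"
 assumes "continuous_on UNIV f" "compact K" "!!x. x ~: K ==> f x = 0"
 shows "integrable lborel f"
proof -
 have "integrable lborel (%x. indicator K x *R f x)"
  by (rule borel_integrable_compact) (use assms in \<open>auto intro: continuous_on_subset\<close>)
 moreover have "(%x. indicator K x *R f x) = f" using assms(3) by (auto simp: indicator_def)
 ultimately show ?thesis by simp
qed

text \<open>Boxes determine Lebesgue measure, and the indicator of an open box is a limit of the
  Lipschitz functions \<open>phi n\<close>. It therefore suffices to test with Lipschitz functions
  of compact support, for which the integral along a flow can be differentiated. Compactness of
  preimages supplies the integrable majorant.\<close>

lemma emeasure_lborel_box_eq_of_Lipschitz:
 fixes T :: "'a::euclidean_space => 'a"
 assumes cT: "continuous_on UNIV T" and K: "!!K. compact K ==> compact (T -` K)"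
  and eq: "!!phi Lam K. (!!x y. \<bar>phi x - phi y\<bar> <= Lam * dist x y) ==> compact K ==> (!!x. x ~: K ==> phi x = (0::real)) ==>
   (LI x. phi (T x)) = (LI x. phi x)"
 shows "mpres T"
proof -
 have [measurable]: "T : bmeas" using cT by (rule borel_measurable_continuous_onI)
 have "lborel = distr lborel borel T"
 proof (rule lborel_eqI)
  fix l u :: 'a assume lu: "!!b. b : Basis ==> l <.> b <= u <.> b"
  let ?B = "box l u"
  define phi where "phi n x = min 1 (real n * infdist x (- ?B))" for n x
  have ne: "- ?B ~= {}" using bounded_box[of l u] not_bounded_UNIV by (metis Compl_empty_eq double_compl)
  have lip: "\<bar>phi n x - phi n y\<bar> <= real n * dist x y" for n x y
  proof -
   have "\<bar>phi n x - phi n y\<bar> <= \<bar>real n * infdist x (- ?B) - real n * infdist y (- ?B)\<bar>"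
    unfolding phi_def by linarith
   also have "... = real n * \<bar>infdist x (- ?B) - infdist y (- ?B)\<bar>"
    by (simp add: abs_mult right_diff_distrib[symmetric])
   finally show ?thesis using infdist_triangle_abs[of x "- ?B" y] by (meson mult_left_mono of_nat_0_le_iff order_trans)
  qed
  have cphi: "continuous_on UNIV (phi n)" for n unfolding phi_def by (intro continuous_intros)
  have [measurable]: "phi n : bmeas" for n using cphi by (rule borel_measurable_continuous_onI)
  have supp: "phi n x = 0" if "x ~: ?B" for n x using that by (simp add: phi_def)
  have bnd: "0 <= phi n x" "phi n x <= indicator ?B x" for n x
   using supp[of x n] by (auto simp: phi_def infdist_nonneg indicator_def)
  have lim: "(%n. phi n x) ----> indicator ?B x" for x
  proof (cases "x : ?B")
   case True
   then have "infdist x (- ?B) > 0"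
    using in_closed_iff_infdist_zero[of "- ?B" x] ne infdist_nonneg[of x "- ?B"] open_box[of l u] by (auto simp: less_le)
   then obtain N where N: "real N * infdist x (- ?B) >= 1"
    by (metis less_imp_le reals_Archimedean3)
   have "phi n x = 1" if "n >= N" for n
   proof -
    have "real N * infdist x (- ?B) <= real n * infdist x (- ?B)" using that infdist_nonneg by (intro mult_right_mono) auto
    then show ?thesis using N by (simp add: phi_def)
   qed
   then have "\<forall>\<^sub>F n in sequentially. phi n x = 1" unfolding eventually_sequentially by blast
   then show ?thesis using True tendsto_eventually by fastforce
  qed (simp add: supp)
  have fin: "emeasure lborel (T -` cbox l u) < \<infinity>" by (intro emeasure_compact_finite K compact_cbox)
  have m1: "T -` S : sets borel" if "S : sets borel" for S
   using measurable_sets[of T borel borel S] that by simp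
  have l1: "(%n. LI x. phi n x) ----> (LI x. indicator ?B x)"
   by (rule integral_dominated_convergence[where w="indicator ?B"])
     (use bnd lim in \<open>auto simp: integrable_indicator_iff emeasure_lborel_box_finite[simplified]\<close>)
  have "(%n. LI x. phi n (T x)) ----> (LI x. indicator (T -` ?B) x)"
  proof (rule integral_dominated_convergence[where w="indicator (T -` cbox l u)"])
   show "AE x in lborel. (%n. phi n (T x)) ----> indicator (T -` ?B) x"
    using lim by (auto simp: indicator_def)
   show "AE x in lborel. norm (phi n (T x)) <= indicator (T -` cbox l u) x" for n
   proof (rule AE_I2)
    fix x
    have "norm (phi n (T x)) <= indicator ?B (T x)" using bnd[of n "T x"] by simp
    also have "... <= indicator (T -` cbox l u) x" using box_subset_cbox[of l u] by (auto simp: indicator_def)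
    finally show "norm (phi n (T x)) <= indicator (T -` cbox l u) x" .
   qed
   show "integrable lborel (indicator (T -` cbox l u) :: 'a => real)"
    using fin m1 by (intro integrable_real_indicator) auto
  qed (use m1[of ?B] in auto)
  moreover have "(LI x. phi n (T x)) = (LI x. phi n x)" for n
   by (rule eq[OF lip, of "cbox l u"]) (use supp box_subset_cbox[of l u] in auto)
  ultimately have "(LI x. indicator (T -` ?B) x :: real) = (LI x. indicator ?B x)"
   using l1 LIMSEQ_unique by simp
  then have "measure lborel (T -` ?B) = measure lborel ?B" using m1[of ?B] by simp
  moreover have "emeasure lborel (T -` ?B) ~= \<infinity>"
   using fin emeasure_mono[of "T -` ?B" "T -` cbox l u" lborel] m1[of "cbox l u"] box_subset_cbox[of l u] by (auto simp: less_top top_unique vimage_mono)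
  ultimately have "emeasure lborel (T -` ?B) = emeasure lborel ?B"
   using emeasure_lborel_box_finite[of l u] by (simp only: emeasure_eq_ennreal_measure infinity_ennreal_def less_irrefl) (metis emeasure_eq_ennreal_measure less_irrefl)
  then show "emeasure (distr lborel borel T) ?B = (\<Prod>b\<in>Basis. (u - l) <.> b)"
   using lu by (simp add: emeasure_distr emeasure_lborel_box)
 qed simp
 then show ?thesis by (simp add: mpres_def)
qed

text \<open>A field without diagonal part is approximated to first order by a composition of two shears,
  each of which preserves the measure.\<close>

lemma flow_mpres:
 fixes A :: "real => 'b::euclidean_space => 'a::euclidean_space" and B :: "real => 'a => 'b"
 assumes F: "lip_field L F" and F_eq: "!!t z. F t z = (A t (snd z), B t (fst z))"
 shows "mpres (flow F s t)"
proof -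
 let ?Phi = "flow F"
 have cA: "continuous_on S (%z. A t (f z))" if "continuous_on S f" for S :: "'z::topological_space set" and f t
 proof -
  have "continuous_on S (%z. fst (F t (0, f z)))"
   by (intro continuous_on_fst lip_fieldD(3)[OF F] continuous_on_Pair continuous_on_const that)
  then show ?thesis by (simp add: F_eq)
 qed
 have cB: "continuous_on S (%z. B t (f z))" if "continuous_on S f" for S :: "'z::topological_space set" and f t
 proof -
  have "continuous_on S (%z. snd (F t (f z, 0)))"
   by (intro continuous_on_snd lip_fieldD(3)[OF F] continuous_on_Pair continuous_on_const that)
  then show ?thesis by (simp add: F_eq)
 qed
 \<comment> \<open>One step of the symplectic Euler scheme: a shear in the first component followed
   by a shear in the second. \<open>S'\<close> is its explicit inverse.\<close>
 define S where "S t h z = (fst z + h *R A t (snd z), snd z + h *R B t (fst z + h *R A t (snd z)))" for t h and z :: "'a \<times> 'b"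
 define S' where "S' t h z = (fst z - h *R A t (snd z - h *R B t (fst z)), snd z - h *R B t (fst z))" for t h and z :: "'a \<times> 'b"
 have S'S: "S' t h (S t h z) = z" for t h z by (simp add: S_def S'_def)
 have mS: "mpres (S t h)" for t h
 proof -
  have 1: "(%q. h *R B t q) : bmeas" "(%p. h *R A t p) : bmeas"
   by (intro borel_measurable_continuous_onI continuous_intros cA cB)+
  from mpres_comp[OF mpres_shear_snd[OF 1(1)] mpres_shear_fst[OF 1(2)]]
  show ?thesis by (simp add: S_def[abs_def])
 qed
 have cS: "continuous_on U (%p. S t (fst p) (snd p))" "continuous_on U (%p. S' t (fst p) (snd p))" for t U
  unfolding S_def S'_def by (intro continuous_intros cA cB)+
 have loc: "\<exists>d>0. \<forall>s y. \<bar>s - t\<bar> < d --> dist y x0 < d --> norm (?Phi s t y - S t (t - s) y) <= e * \<bar>t - s\<bar>"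
  if e: "e > 0" for e t x0
 proof -
  obtain d1 where d1: "d1 > 0" "!!s y. \<bar>s - t\<bar> < d1 ==> dist y x0 < d1 ==>
    norm (?Phi s t y - y - (t - s) *R F t x0) <= e/2 * \<bar>t - s\<bar>"
   using flow_first_order[OF F half_gt_zero[OF e], of t x0] by (metis abs_zero diff_self)
  define G where "G = (%p. (A t (snd (snd p)), B t (fst (snd p) + fst p *R A t (snd (snd p)))))"
  have "continuous_on UNIV G" unfolding G_def by (intro continuous_intros cA cB)
  then have "isCont G (0, x0)" using continuous_on_eq_continuous_at[OF open_UNIV] by blast
  then obtain d2 where d2: "d2 > 0" "!!p. dist p (0, x0) < d2 ==> dist (G p) (G (0, x0)) < e/2"
   unfolding continuous_at_eps_delta using half_gt_zero[OF e] by blast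
  show ?thesis
  proof (intro exI[of _ "min d1 (d2/2)"] conjI allI impI)
   fix s y assume *: "\<bar>s - t\<bar> < min d1 (d2/2)" "dist y x0 < min d1 (d2/2)"
   have "dist (t - s, y) (0, x0) <= \<bar>t - s\<bar> + dist y x0"
    unfolding dist_Pair_Pair using sqrt_sum_squares_le_sum[of "dist (t - s) 0" "dist y x0"] by simp
   then have "dist (G (t - s, y)) (G (0, x0)) < e/2" using * by (intro d2) (auto simp: abs_minus_commute)
   then have "norm (G (t - s, y) - F t x0) <= e/2" by (simp add: G_def dist_norm F_eq)
   then have "\<bar>t - s\<bar> * norm (G (t - s, y) - F t x0) <= e/2 * \<bar>t - s\<bar>"
    by (subst mult.commute) (rule mult_right_mono, auto)
   moreover have "S t (t - s) y - y - (t - s) *R F t x0 = (t - s) *R (G (t - s, y) - F t x0)"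
    by (simp add: S_def G_def prod_eq_iff algebra_simps F_eq)
   ultimately have "norm (S t (t - s) y - y - (t - s) *R F t x0) <= e/2 * \<bar>t - s\<bar>" by simp
   moreover have "norm (?Phi s t y - y - (t - s) *R F t x0) <= e/2 * \<bar>t - s\<bar>" using * by (intro d1) auto
   moreover have "?Phi s t y - S t (t - s) y = (?Phi s t y - y - (t - s) *R F t x0) - (S t (t - s) y - y - (t - s) *R F t x0)" by simp
   ultimately show "norm (?Phi s t y - S t (t - s) y) <= e * \<bar>t - s\<bar>"
    using norm_triangle_ineq4[of "?Phi s t y - y - (t - s) *R F t x0" "S t (t - s) y - y - (t - s) *R F t x0"] by simp
  qed (use d1 d2 in auto)
 qed
 have unif: "\<exists>d>0. \<forall>s. \<forall>y\<in>K. \<bar>s - t\<bar> < d --> norm (?Phi s t y - S t (t - s) y) <= e * \<bar>t - s\<bar>"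
  if e: "e > 0" and K: "compact K" for e t K
 proof -
  obtain d where d: "!!x0. d x0 > 0" "!!x0 s y. \<bar>s - t\<bar> < d x0 ==> dist y x0 < d x0 ==> norm (?Phi s t y - S t (t - s) y) <= e * \<bar>t - s\<bar>"
   using loc[OF e, of t] by metis
  have "K <= (\<Union>x\<in>K. ball x (d x))" using d by force
  from compactE_image[OF K _ this] obtain C where C: "C <= K" "finite C" "K <= (\<Union>x\<in>C. ball x (d x))" by auto
  show ?thesis
  proof (intro exI[of _ "Min (insert 1 (d ` C))"] conjI allI ballI impI)
   show "Min (insert 1 (d ` C)) > 0" using C d by auto
   fix s y assume *: "y : K" "\<bar>s - t\<bar> < Min (insert 1 (d ` C))"
   then obtain x where "x : C" "y : ball x (d x)" using C by blast
   then show "norm (?Phi s t y - S t (t - s) y) <= e * \<bar>t - s\<bar>" using * C by (intro d(2)[of _ x]) (auto simp: dist_commute)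
  qed
 qed
 have cfl: "continuous_on U (%p. ?Phi (fst p) t (snd p))" "continuous_on U (%p. ?Phi t (fst p) (snd p))" "continuous_on V (?Phi s t)" for t s U V
  by (intro flow_continuous_on[OF F] continuous_intros)+
 show ?thesis
 proof (rule emeasure_lborel_box_eq_of_Lipschitz)
  show "continuous_on UNIV (?Phi s t)" by (rule cfl)
  show "compact (?Phi s t -` K)" if "compact K" for K
  proof -
   have "?Phi s t -` K = ?Phi t s ` K"
    by (auto simp: flow_inverse[OF F] image_iff) (metis flow_inverse[OF F])
   then show ?thesis using that cfl by (simp add: compact_continuous_image)
  qed
  fix phi :: "'a \<times> 'b => real" and Lam C0
  assume lip: "!!x y. \<bar>phi x - phi y\<bar> <= Lam * dist x y" and C0: "compact C0" and supp: "!!x. x ~: C0 ==> phi x = 0"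
  have Lam0: "Lam >= 0"
  proof -
   obtain b :: "'a \<times> 'b" where "b : Basis" using nonempty_Basis by blast
   then show ?thesis using lip[of b 0] abs_ge_zero order_trans by (fastforce simp: zero_le_mult_iff)
  qed
  have "Lam-lipschitz_on UNIV phi" by (intro lipschitz_onI Lam0) (use lip in \<open>auto simp: dist_real_def\<close>)
  then have cphi: "continuous_on U phi" for U using lipschitz_on_continuous_on continuous_on_subset by blast
  define m where "m r = (LI z. phi (?Phi r t z))" for r
  \<comment> \<open>The integral \<open>m\<close> has derivative 0 at every \<open>u\<close>.
    Between the times \<open>r\<close> and \<open>u\<close> the flow differs from a
    measure-preserving shear step by a small multiple of \<open>|r - u|\<close>, uniformly on
    compact sets; the rest of the flow, from \<open>u\<close> to \<open>t\<close>, is absorbed into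
    the Lipschitz function \<open>psi\<close>.\<close>
  have main: "\<exists>d>0. \<forall>r. \<bar>r - u\<bar> < d --> \<bar>m r - m u\<bar> <= e * \<bar>r - u\<bar>" if e: "e > 0" for e u
  proof -
   define psi where "psi z = phi (?Phi u t z)" for z
   define M where "M = Lam * exp (L * \<bar>t - u\<bar>)"
   have M0: "M >= 0" using Lam0 by (simp add: M_def)
   have psilip: "\<bar>psi x - psi y\<bar> <= M * norm (x - y)" for x y
    using order_trans[OF lip mult_left_mono[OF flow_lipschitz[OF F, of u t x y, folded dist_norm] Lam0]]
    by (simp add: psi_def M_def dist_norm mult.assoc)
   have cpsi: "continuous_on U psi" for U
    unfolding psi_def by (rule continuous_on_compose2[OF cphi[of UNIV]]) (auto intro: cfl)
   define C1 where "C1 = ?Phi t u ` C0"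
   have C1: "compact C1" unfolding C1_def by (intro compact_continuous_image cfl C0)
   have psi0: "psi z = 0" if "z ~: C1" for z
   proof -
    have "?Phi u t z ~: C0"
    proof
     assume "?Phi u t z : C0"
     then have "?Phi t u (?Phi u t z) : C1" unfolding C1_def by (rule imageI)
     then show False using that by (simp add: flow_inverse[OF F])
    qed
    then show ?thesis unfolding psi_def by (rule supp)
   qed
   \<comment> \<open>This set contains the supports of \<open>psi\<close> composed with the flow and
     with the shear step, for all times within 1 of \<open>u\<close>.\<close>
   define K where "K = (%p. ?Phi u (fst p) (snd p)) ` ({u-1..u+1} \<times> C1) \<union> (%p. S' u (fst p) (snd p)) ` ({-1..1} \<times> C1)"
   have K: "compact K" unfolding K_def
    by (intro compact_Un compact_continuous_image cfl cS compact_Times compact_Icc C1)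
   have K1: "psi (?Phi r u z) = 0" "psi (S u (u - r) z) = 0" if "z ~: K" "\<bar>r - u\<bar> <= 1" for r z
   proof -
    have "?Phi r u z ~: C1"
    proof
     assume "?Phi r u z : C1"
     then have "?Phi u r (?Phi r u z) : K" using that(2) unfolding K_def by (intro UnI1 image_eqI[of _ _ "(r, ?Phi r u z)"]) auto
     then show False using that by (simp add: flow_inverse[OF F])
    qed
    then show "psi (?Phi r u z) = 0" by (rule psi0)
    have "S u (u - r) z ~: C1"
    proof
     assume "S u (u - r) z : C1"
     then have "S' u (u - r) (S u (u - r) z) : K" using that(2) unfolding K_def by (intro UnI2 image_eqI[of _ _ "(u - r, S u (u - r) z)"]) auto
     then show False using that by (simp add: S'S)
    qed
    then show "psi (S u (u - r) z) = 0" by (rule psi0)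
   qed
   define e' where "e' = e / (M * measure lborel K + 1)"
   have e': "e' > 0" using e M0 by (auto simp: e'_def intro!: divide_pos_pos add_nonneg_pos)
   obtain d where d: "d > 0" "!!r y. y : K ==> \<bar>r - u\<bar> < d ==> norm (?Phi r u y - S u (u - r) y) <= e' * \<bar>u - r\<bar>"
    using unif[OF e' K, of u] by blast
   show ?thesis
   proof (intro exI[of _ "min d 1"] conjI allI impI)
    fix r assume r: "\<bar>r - u\<bar> < min d 1"
    have "continuous_on UNIV (S u (u - r))"
     unfolding S_def by (intro continuous_intros cA cB)
    then have cc: "continuous_on UNIV (%z. psi (?Phi r u z))" "continuous_on UNIV (%z. psi (S u (u - r) z))"
     by (auto intro: continuous_on_compose2[OF cpsi[of UNIV]] cfl)
    have i1: "integrable lborel (%z. psi (?Phi r u z))" "integrable lborel (%z. psi (S u (u - r) z))"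
     by (rule integrable_continuous_compact_support[OF _ K], use cc K1 r in auto)+
    have mr: "m r = (LI z. psi (?Phi r u z))" by (simp add: m_def psi_def flow_flow[OF F])
    have mu: "m u = (LI z. psi (S u (u - r) z))"
     unfolding mpres_integral[OF mS, of psi, OF borel_measurable_continuous_onI[OF cpsi]] by (simp add: m_def psi_def[abs_def])
    have "m r - m u = (LI z. psi (?Phi r u z) - psi (S u (u - r) z))"
     unfolding mr mu using i1 by simp
    also have "\<bar>...\<bar> <= (LI z. \<bar>psi (?Phi r u z) - psi (S u (u - r) z)\<bar>)" by (rule integral_abs_bound)
    also have "... <= (LI z. indicator K z * (M * (e' * \<bar>r - u\<bar>)))"
    proof (rule integral_mono)
     have "emeasure lborel K < \<infinity>" using K by (rule emeasure_compact_finite)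
     then show "integrable lborel (%z. indicator K z * (M * (e' * \<bar>r - u\<bar>)))"
      using K by (intro integrable_mult_left integrable_real_indicator) (auto simp: borel_compact)
     fix z
     show "\<bar>psi (?Phi r u z) - psi (S u (u - r) z)\<bar> <= indicator K z * (M * (e' * \<bar>r - u\<bar>))"
     proof (cases "z : K")
      case True
      have "\<bar>psi (?Phi r u z) - psi (S u (u - r) z)\<bar> <= M * norm (?Phi r u z - S u (u - r) z)" by (rule psilip)
      also have "... <= M * (e' * \<bar>u - r\<bar>)" using d(2)[OF True, of r] r M0 by (intro mult_left_mono) auto
      finally show ?thesis using True by (simp add: abs_minus_commute)
     qed (use K1 r in auto)
    qed (use i1 in auto)
    also have "... = (M * measure lborel K * e') * \<bar>r - u\<bar>"
     using K by (simp add: borel_compact)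
    also have "... <= e * \<bar>r - u\<bar>"
    proof (rule mult_right_mono)
     have "M * measure lborel K * e' <= (M * measure lborel K + 1) * e'" using e' by (intro mult_right_mono) auto
     also have "... = e"
     proof -
      have "M * measure lborel K + 1 > 0" using M0 by (intro add_nonneg_pos) auto
      then show ?thesis unfolding e'_def by simp
     qed
     finally show "M * measure lborel K * e' <= e" .
    qed simp
    finally show "\<bar>m r - m u\<bar> <= e * \<bar>r - u\<bar>" .
   qed (use d in auto)
  qed
  have "(m has_real_derivative 0) (at u)" for u
   unfolding has_field_derivative_def has_derivative_at_alt using main by (auto simp: bounded_linear_mult_right)
  then have "m s = m t" using DERIV_isconst_all by blast
  then show "(LI x. phi (?Phi s t x)) = (LI x. phi x)"
   by (simp add: m_def flow_init[OF F])
 qed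
qed

section \<open>Differentiation of convolutions and weak gradients\<close>

lemma kernel_taylor:
 fixes kap :: "'a::euclidean_space => 'b::euclidean_space"
 assumes d: "!!x. (kap has_derivative Dkap x) (at x)"
  and lip: "!!x y h. norm (Dkap x h - Dkap y h) <= Lam * norm (x - y) * norm h" and L0: "Lam >= 0"
 shows "norm (kap (x + h) - kap x - Dkap x h) <= Lam * (norm h)^2"
proof -
 have "norm (kap (x + h) - kap x - Dkap x ((x + h) - x)) <= norm ((x + h) - x) * (Lam * norm h)"
 proof (rule differentiable_bound_linearization[where S="cball x (norm h)" and f'=Dkap])
  show "x + t *R (x + h - x) : cball x (norm h)" if "t : {0..1}" for t
   using that by (auto simp: dist_norm mult_left_le_one_le)
  show "(kap has_derivative Dkap y) (at y within cball x (norm h))" for y using d has_derivative_at_withinI by blast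
  show "onorm (Dkap y - Dkap x) <= Lam * norm h" if "y : cball x (norm h)" for y
  proof (rule onorm_le)
   fix k
   have "norm (Dkap y k - Dkap x k) <= Lam * norm (y - x) * norm k" by (rule lip)
   also have "... <= Lam * norm h * norm k"
    using that L0 by (intro mult_right_mono mult_left_mono) (auto simp: dist_norm norm_minus_commute)
   finally show "norm ((Dkap y - Dkap x) k) <= Lam * norm h * norm k" by simp
  qed
 qed simp
 then show ?thesis by (simp add: power2_eq_square mult_ac)
qed

lemma kernel_integral:
 fixes kap :: "'a::euclidean_space => 'b::euclidean_space" and f :: "'m => real"
 assumes f: "integrable M f" and X[measurable]: "X : borel_measurable M"
  and kap: "kap : bmeas" "!!x. norm (kap x) <= S"
 shows "integrable M (%z. f z *R kap (q - X z))" "norm (LINT z|M. f z *R kap (q - X z)) <= S * (LINT z|M. \<bar>f z\<bar>)"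
proof -
 have [measurable]: "f : borel_measurable M" using f by auto
 have m: "(%z. kap (q - X z)) : borel_measurable M" by (rule measurable_compose[OF _ kap(1)]) measurable
 have le: "norm (f z *R kap (q - X z)) <= S * \<bar>f z\<bar>" for z
  using mult_left_mono[OF kap(2)[of "q - X z"] abs_ge_zero[of "f z"]] by (simp add: mult.commute)
 have i: "integrable M (%z. S * \<bar>f z\<bar>)" using f by auto
 show *: "integrable M (%z. f z *R kap (q - X z))"
  by (rule Bochner_Integration.integrable_bound[OF i]) (use m in \<open>auto intro!: order_trans[OF le] simp del: norm_scaleR\<close>)
 have "norm (LINT z|M. f z *R kap (q - X z)) <= (LINT z|M. norm (f z *R kap (q - X z)))" by (rule integral_norm_bound)
 also have "... <= (LINT z|M. S * \<bar>f z\<bar>)" by (rule integral_mono[OF integrable_norm[OF *] i le])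
 finally show "norm (LINT z|M. f z *R kap (q - X z)) <= S * (LINT z|M. \<bar>f z\<bar>)" using f by simp
qed

text \<open>The Taylor remainder of the kernel is quadratic uniformly in space, so integrability of
  \<open>f\<close> suffices for differentiating under the integral. The map \<open>X\<close> covers
  convolutions (identity) and potentials of phase-space densities (position).\<close>

lemma has_derivative_kernel_integral:
 fixes kap :: "'a::euclidean_space => 'b::euclidean_space" and f :: "'m => real"
 assumes f: "integrable M f" and X: "X : borel_measurable M"
  and d: "!!x. (kap has_derivative Dkap x) (at x)"
  and lip: "!!x y h. norm (Dkap x h - Dkap y h) <= Lam * norm (x - y) * norm h"
  and bd: "!!x. norm (kap x) <= S" and bd': "!!x h. norm (Dkap x h) <= S' * norm h"
 shows "((%q. LINT z|M. f z *R kap (q - X z)) has_derivative (%h. LINT z|M. f z *R Dkap (q - X z) h)) (at q)"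
proof -
 have L0: "Lam >= 0"
 proof -
  obtain b :: 'a where "b : Basis" using nonempty_Basis by blast
  then have "norm b = 1" by simp
  moreover have "0 <= Lam * norm (b - 0) * norm b" using order_trans[OF norm_ge_zero lip] .
  ultimately show ?thesis by simp
 qed
 have lin: "linear (Dkap x)" for x using d has_derivative_linear by blast
 have "continuous_on UNIV (%x. Dkap x h)" for h
 proof -
  have "(Lam * norm h)-lipschitz_on UNIV (%x. Dkap x h)"
   by (intro lipschitz_onI) (use lip[of _ h] L0 in \<open>auto simp: dist_norm mult_ac\<close>)
  then show ?thesis by (rule lipschitz_on_continuous_on)
 qed
 then have m': "(%x. Dkap x h) : bmeas" for h by (rule borel_measurable_continuous_onI)
 have "continuous_on UNIV kap" using d by (meson has_derivative_continuous continuous_at_imp_continuous_on)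
 then have m: "kap : bmeas" by (rule borel_measurable_continuous_onI)
 note i = kernel_integral(1)[OF f X m bd] and i' = kernel_integral[OF f X m' bd']
 let ?I = "LINT z|M. \<bar>f z\<bar>"
 have I: "?I >= 0" by simp
 show ?thesis
  unfolding has_derivative_at_alt
 proof (intro conjI allI impI)
  show "bounded_linear (%h. LINT z|M. f z *R Dkap (q - X z) h)"
  proof (rule bounded_linear_intro[where K="S' * ?I"])
   show "(LINT z|M. f z *R Dkap (q - X z) (a + b)) = (LINT z|M. f z *R Dkap (q - X z) a) + (LINT z|M. f z *R Dkap (q - X z) b)" for a b
    using i'(1) by (simp add: linear_add[OF lin] scaleR_add_right)
   show "(LINT z|M. f z *R Dkap (q - X z) (r *R a)) = r *R (LINT z|M. f z *R Dkap (q - X z) a)" for r a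
    by (simp only: linear_scale[OF lin] scaleR_left_commute integral_scaleR_right)
   show "norm (LINT z|M. f z *R Dkap (q - X z) h) <= norm h * (S' * ?I)" for h
    using i'(2)[of q h] by (simp add: mult_ac)
  qed
  fix e :: real assume e: "e > 0"
  define d where "d = e / (Lam * ?I + 1)"
  have pos: "Lam * ?I + 1 > 0" using L0 I by (intro add_nonneg_pos) auto
  then have d0: "d > 0" using e by (simp add: d_def)
  show "\<exists>d>0. \<forall>y. norm (y - q) < d --> norm ((LINT z|M. f z *R kap (y - X z)) - (LINT z|M. f z *R kap (q - X z)) - (LINT z|M. f z *R Dkap (q - X z) (y - q))) <= e * norm (y - q)"
  proof (intro exI[of _ d] conjI allI impI d0)
   fix y assume y: "norm (y - q) < d"
   let ?R = "%z. kap (y - X z) - kap (q - X z) - Dkap (q - X z) (y - q)"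
   have R: "norm (?R z) <= Lam * (norm (y - q))^2" for z
    using kernel_taylor[OF d lip L0, of "q - X z" "y - q"] by (simp add: algebra_simps)
   have "(LINT z|M. f z *R kap (y - X z)) - (LINT z|M. f z *R kap (q - X z)) - (LINT z|M. f z *R Dkap (q - X z) (y - q)) = (LINT z|M. f z *R ?R z)"
    using i i'(1) by (simp add: scaleR_diff_right)
   also have "norm ... <= (LINT z|M. norm (f z *R ?R z))" by (rule integral_norm_bound)
   also have "... <= (LINT z|M. (Lam * (norm (y - q))^2) * \<bar>f z\<bar>)"
   proof (rule integral_mono)
    have "integrable M (%z. f z *R ?R z)"
     using i i'(1) by (simp add: scaleR_diff_right)
    then show "integrable M (%z. norm (f z *R ?R z))" by (rule integrable_norm)
    show "norm (f z *R ?R z) <= Lam * (norm (y - q))^2 * \<bar>f z\<bar>" for z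
     using mult_left_mono[OF R[of z] abs_ge_zero[of "f z"]] by (simp add: mult_ac)
   qed (use f in auto)
   also have "... = (Lam * ?I) * norm (y - q) * norm (y - q)" using f by (simp add: power2_eq_square mult_ac)
   also have "... <= (Lam * ?I + 1) * d * norm (y - q)"
    using y L0 I d0 by (intro mult_mono mult_nonneg_nonneg) auto
   also have "... = e * norm (y - q)" using pos by (simp add: d_def)
   finally show "norm ((LINT z|M. f z *R kap (y - X z)) - (LINT z|M. f z *R kap (q - X z)) - (LINT z|M. f z *R Dkap (q - X z) (y - q))) <= e * norm (y - q)" .
  qed
 qed
qed

lemma mpres_translate: "mpres (%x. x + c :: 'a::euclidean_space)"
 using lborel_distr_plus[of c] by (simp add: mpres_def add.commute[of _ c])

text \<open>By translation invariance every difference quotient has integral 0. The quotients share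
  a compact support and a bound, so the limit may be taken under the integral.\<close>

lemma integral_derivative_compact_support:
 fixes psi :: "'a::euclidean_space => 'b::euclidean_space"
 assumes d: "!!x. (psi has_derivative Dpsi x) (at x)" and cD: "continuous_on UNIV (%x. Dpsi x h)"
  and K: "compact K" and supp: "!!x. x ~: K ==> psi x = 0"
 shows "integrable lborel (%x. Dpsi x h)" "(LI x. Dpsi x h) = 0"
proof -
 let ?q = "%x t. psi (x + t *R h) - psi x"
 have D0: "Dpsi x h = 0" if "x ~: K" for x
 proof -
  have "(psi has_derivative (%_. 0)) (at x)"
   by (rule has_derivative_transform_within_open[where s="- K" and f="%_. 0"])
     (use K that supp in \<open>auto simp: open_Compl compact_imp_closed\<close>)
  then show ?thesis using has_derivative_unique[OF d] by metis
 qed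
 show "integrable lborel (%x. Dpsi x h)" by (rule integrable_continuous_compact_support[OF cD K D0])
 have cpsi: "continuous_on S psi" for S using d by (meson has_derivative_continuous continuous_at_imp_continuous_on)
 have "bounded ((%x. Dpsi x h) ` K)" using K cD by (meson compact_continuous_image compact_imp_bounded continuous_on_subset subset_UNIV)
 then obtain C where C: "C > 0" "!!x. x : K ==> norm (Dpsi x h) <= C" by (auto simp: bounded_pos)
 have C': "norm (Dpsi x h) <= C" for x using C D0[of x] by (cases "x : K") auto
 have vd: "((%t. psi (x + t *R h)) has_vector_derivative Dpsi (x + t *R h) h) (at t)" for x t
 proof -
  have "((%t. x + t *R h) has_derivative (%r. r *R h)) (at t)" by (auto intro!: derivative_eq_intros)
  from has_derivative_compose[OF this d]
  show ?thesis using linear_scale[OF has_derivative_linear[OF d]] by (simp add: has_vector_derivative_def)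
 qed
 have diff: "norm (?q x t) <= C * \<bar>t\<bar>" for x t
 proof -
  have vd': "((%t. psi (x + t *R h) - psi x) has_vector_derivative Dpsi (x + r *R h) h) (at r)" for r
   using has_vector_derivative_diff[OF vd has_vector_derivative_const] by simp
  have "norm (?q x t) <= exp (0 * \<bar>t - 0\<bar>) * (norm (psi (x + 0 *R h) - psi x) + C * \<bar>t - 0\<bar>)"
   by (rule gronwall_const[where w="%t. psi (x + t *R h) - psi x" and w'="%t. Dpsi (x + t *R h) h", OF _ _ vd'])
     (use C C' in auto)
  then show ?thesis by simp
 qed
 define u where "u n x = real (Suc n) *R (psi (x + (1 / real (Suc n)) *R h) - psi x)" for n x
 define K' where "K' = (%p. fst p - snd p *R h) ` (K \<times> {0..1})"
 have K': "compact K'" unfolding K'_def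
  by (intro compact_continuous_image compact_Times K compact_Icc continuous_intros)
 have u0: "u n x = 0" if "x ~: K'" for n x
 proof -
  have "x ~: K" using that by (force simp: K'_def intro: image_eqI[of _ _ "(x, 0)"])
  moreover have "x + (1 / real (Suc n)) *R h ~: K"
  proof
   assume "x + (1 / real (Suc n)) *R h : K"
   then have "x : K'" unfolding K'_def by (intro image_eqI[of _ _ "(x + (1 / real (Suc n)) *R h, 1 / real (Suc n))"]) auto
   then show False using that by simp
  qed
  ultimately show ?thesis by (simp add: u_def supp)
 qed
 have ub: "norm (u n x) <= C" for n x
 proof -
  have "norm (u n x) <= real (Suc n) * (C * \<bar>1 / real (Suc n)\<bar>)"
   unfolding u_def norm_scaleR using diff[of x "1 / real (Suc n)"] by (simp add: divide_simps mult.commute)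
  then show ?thesis by simp
 qed
 have cu: "continuous_on UNIV (u n)" for n unfolding u_def
  by (intro continuous_intros cpsi continuous_on_compose2[OF cpsi[of UNIV]]) auto
 have lim: "(%n. u n x) ----> Dpsi x h" for x
 proof -
  have "((%t. psi (x + t *R h)) has_vector_derivative Dpsi x h) (at 0)" using vd[of x 0] by simp
  have "((%t. (?q x t) /\<^sub>R t) \<longlongrightarrow> Dpsi x h) (at 0)"
   unfolding tendsto_iff eventually_at
  proof (intro allI impI)
   fix e :: real assume e: "e > 0"
   have "((%t. psi (x + t *R h)) has_derivative (%t. t *R Dpsi x h)) (at 0)"
    using vd[of x 0] by (simp add: has_vector_derivative_def)
   then obtain d where d: "d > 0" "!!t. norm (t - 0) < d ==> norm (psi (x + t *R h) - psi (x + 0 *R h) - (t - 0) *R Dpsi x h) <= (e/2) * norm (t - 0)"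
    unfolding has_derivative_at_alt using half_gt_zero[OF e] by blast
   show "\<exists>d>0. \<forall>t\<in>UNIV. t ~= 0 & dist t 0 < d --> dist ((?q x t) /\<^sub>R t) (Dpsi x h) < e"
   proof (intro exI[of _ d] conjI ballI impI d(1))
    fix t :: real assume t: "t ~= 0 & dist t 0 < d"
    have "(?q x t) /\<^sub>R t - Dpsi x h = (psi (x + t *R h) - psi x - t *R Dpsi x h) /\<^sub>R t"
     using t by (simp add: scaleR_diff_right)
    then have "norm ((?q x t) /\<^sub>R t - Dpsi x h) <= (e/2 * \<bar>t\<bar>) / \<bar>t\<bar>"
     using d(2)[of t] t by (simp add: divide_simps mult.commute)
    then show "dist ((?q x t) /\<^sub>R t) (Dpsi x h) < e" using t e by (simp add: dist_norm)
   qed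
  qed
  moreover have "filterlim (%n. 1 / real (Suc n)) (at 0) sequentially"
   using LIMSEQ_inverse_real_of_nat unfolding inverse_eq_divide by (auto simp: filterlim_at)
  ultimately have "(%n. (psi (x + (1 / real (Suc n)) *R h) - psi x) /\<^sub>R (1 / real (Suc n))) ----> Dpsi x h"
   by (rule filterlim_compose)
  then show ?thesis by (simp add: u_def)
 qed
 have i0: "(LI x. u n x) = 0" for n
 proof -
  have i: "integrable lborel psi" by (rule integrable_continuous_compact_support[OF cpsi K supp])
  have m: "psi : bmeas" using cpsi by (rule borel_measurable_continuous_onI)
  show ?thesis unfolding u_def
   using i mpres_integrable[OF mpres_translate m, of "(1 / real (Suc n)) *R h"] mpres_integral[OF mpres_translate m, of "(1 / real (Suc n)) *R h"] by simp
 qed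
 have "(%n. LI x. u n x) ----> (LI x. Dpsi x h)"
 proof (rule integral_dominated_convergence[where w="%x. C * indicator K' x"])
  show "integrable lborel (%x. C * indicator K' x)"
   using K' emeasure_compact_finite[OF K'] by (intro integrable_mult_right integrable_real_indicator) (auto simp: borel_compact)
  show "AE x in lborel. norm (u n x) <= C * indicator K' x" for n
   using ub u0 by (intro AE_I2) (auto simp: indicator_def)
  show "(%x. Dpsi x h) : borel_measurable lborel" using borel_measurable_continuous_onI[OF cD] by simp
  show "u n : borel_measurable lborel" for n using borel_measurable_continuous_onI[OF cu] by simp
 qed (use lim in auto)
 then show "(LI x. Dpsi x h) = 0" by (simp add: i0 LIMSEQ_const_iff)
qed

subsection \<open>Mollification\<close>

text \<open>A squared truncated parabola is enough: it is \<open>C^1\<close> with Lipschitz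
  gradient, as asked of a test function in \<open>weak_gradient_on\<close>, and all its bounds are
  explicit.\<close>

definition bump :: "real => 'a::euclidean_space => real"
 where "bump eta x = (max 0 (eta^2 - x <.> x))^2"

definition Dbump :: "real => 'a::euclidean_space => 'a"
 where "Dbump eta x = (- 4 * max 0 (eta^2 - x <.> x)) *R x"

lemma max0_power2_deriv: "((%t::real. (max 0 t)^2) has_real_derivative 2 * max 0 t) (at t)"
proof -
 consider "t > 0" | "t < 0" | "t = 0" by linarith
 then show ?thesis
 proof cases
  case 1
  have "((%t. t^2) has_real_derivative 2 * t) (at t)" by (auto intro!: derivative_eq_intros)
  then have "((%t::real. (max 0 t)^2) has_real_derivative 2 * t) (at t)"
   by (rule DERIV_cong_ev[THEN iffD1, rotated -1]) (use 1 eventually_nhds_in_open[of "{0<..}" t] in \<open>auto elim!: eventually_mono\<close>)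
  then show ?thesis using 1 by simp
 next
  case 2
  have "((%t. 0) has_real_derivative 0) (at t)" by simp
  then have "((%t::real. (max 0 t)^2) has_real_derivative 0) (at t)"
   by (rule DERIV_cong_ev[THEN iffD1, rotated -1]) (use 2 eventually_nhds_in_open[of "{..<0}" t] in \<open>auto elim!: eventually_mono\<close>)
  then show ?thesis using 2 by simp
 next
  case 3
  have "((%t::real. (max 0 t)^2) has_derivative (%h. 0 * h)) (at 0)"
   unfolding has_derivative_at_alt
  proof (intro conjI allI impI)
   show "bounded_linear ((*) (0::real))" by (rule bounded_linear_mult_right)
   fix e :: real assume e: "e > 0"
   show "\<exists>d>0. \<forall>y. norm (y - 0) < d --> norm ((max 0 y)^2 - (max 0 0)^2 - 0 * (y - 0)) <= e * norm (y - (0::real))"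
    by (intro exI[of _ e] conjI allI impI e) (use e in \<open>auto simp: power2_eq_square max_def mult_nonneg_nonpos intro!: mult_right_mono\<close>)
  qed
  then have "((%t::real. (max 0 t)^2) has_real_derivative 0) (at 0)" unfolding has_field_derivative_def .
  then show ?thesis using 3 by simp
 qed
qed

lemma bump_deriv: "(bump eta has_derivative (%h. h <.> Dbump eta x)) (at x)"
proof -
 have "((%x. eta^2 - x <.> x) has_derivative (%h. - 2 * (h <.> x))) (at x)"
  by (auto intro!: derivative_eq_intros simp: inner_commute)
 from has_derivative_compose[OF this, of "%t. (max 0 t)^2" "(*) (2 * max 0 (eta^2 - x <.> x))"] max0_power2_deriv[of "eta^2 - x <.> x"]
 show ?thesis unfolding bump_def[abs_def] Dbump_def
  by (simp add: has_field_derivative_def mult_ac)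
qed

lemma bump_facts:
 assumes "eta > 0"
 shows "bump eta x >= 0" "eta <= norm x ==> bump eta x = 0" "eta <= norm x ==> Dbump eta x = 0"
  "norm x < eta ==> bump eta x > 0" "bump eta (- x) = bump eta x" "bump eta x <= (eta^2)^2" "norm (Dbump eta x) <= 4 * eta^2 * eta"
  "norm (Dbump eta x - Dbump eta y) <= 12 * eta^2 * norm (x - y)"
proof -
 have m1: "max 0 (eta^2 - x <.> x) = 0" if "eta <= norm x" for x :: 'a
 proof -
  have "eta^2 <= (norm x)^2" using that assms by (intro power_mono) auto
  then show ?thesis by (simp add: power2_norm_eq_inner)
 qed
 have m2: "max 0 (eta^2 - x <.> x) = eta^2 - (norm x)^2" "(norm x)^2 < eta^2" if "norm x < eta" for x :: 'a
 proof -
  show "(norm x)^2 < eta^2" using that assms by (intro power_strict_mono) auto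
  then show "max 0 (eta^2 - x <.> x) = eta^2 - (norm x)^2" by (simp add: power2_norm_eq_inner)
 qed
 show "bump eta x >= 0" by (simp add: bump_def)
 show "eta <= norm x ==> bump eta x = 0" "eta <= norm x ==> Dbump eta x = 0" using m1[of x] by (auto simp: bump_def Dbump_def)
 show "norm x < eta ==> bump eta x > 0" using m2[of x] by (auto simp: bump_def)
 show "bump eta (- x) = bump eta x" by (simp add: bump_def)
 have m3: "0 <= max 0 (eta^2 - x <.> x)" "max 0 (eta^2 - x <.> x) <= eta^2" for x :: 'a by auto
 show "bump eta x <= (eta^2)^2" unfolding bump_def by (intro power_mono m3)
 show "norm (Dbump eta x) <= 4 * eta^2 * eta"
 proof (cases "norm x < eta")
  case True
  then show ?thesis unfolding Dbump_def norm_scaleR using m3[of x] by (intro mult_mono) auto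
 next
  case False
  then show ?thesis using m1[of x] assms by (simp add: Dbump_def)
 qed
 define m where "m x = max 0 (eta^2 - x <.> x)" for x :: 'a
 have key: "norm (m x *R x - m y *R y) <= 3 * eta^2 * norm (x - y)" if xy: "norm x <= norm y" for x y
 proof (cases "norm x < eta")
  case True
  have md: "\<bar>m x - m y\<bar> <= 2 * eta * norm (x - y)"
  proof (cases "norm y < eta")
   case True2: True
   have "m x - m y = (norm y - norm x) * (norm y + norm x)"
    using m2[OF True] m2[OF True2] by (simp add: m_def power2_eq_square algebra_simps)
   also have "\<bar>...\<bar> <= norm (x - y) * (2 * eta)"
    unfolding abs_mult using True True2 norm_triangle_ineq3[of x y] by (intro mult_mono) (auto simp: abs_minus_commute)
   finally show ?thesis by (simp add: mult_ac)
  next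
   case False
   have "m x - m y = (eta - norm x) * (eta + norm x)"
    using m2[OF True] m1[of y] False by (simp add: m_def power2_eq_square algebra_simps)
   also have "\<bar>...\<bar> <= norm (x - y) * (2 * eta)"
    unfolding abs_mult using True False assms norm_triangle_ineq3[of x y] by (intro mult_mono) auto
   finally show ?thesis by (simp add: mult_ac)
  qed
  have "norm (m x *R x - m y *R y) = norm ((m x - m y) *R x + m y *R (x - y))" by (simp add: algebra_simps)
  also have "... <= \<bar>m x - m y\<bar> * norm x + \<bar>m y\<bar> * norm (x - y)" by (metis norm_scaleR norm_triangle_ineq)
  also have "... <= (2 * eta * norm (x - y)) * eta + eta^2 * norm (x - y)"
   using True md m3[of y] assms by (intro add_mono mult_mono) (auto simp: m_def)
  finally show ?thesis by (simp add: power2_eq_square algebra_simps)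
 next
  case False
  then show ?thesis using m1[of x] m1[of y] xy assms by (simp add: m_def)
 qed
 have "norm (m x *R x - m y *R y) <= 3 * eta^2 * norm (x - y)"
  using key[of x y] key[of y x] norm_minus_commute[of x y] norm_minus_commute[of "m x *R x" "m y *R y"]
  by (cases "norm x <= norm y") simp_all
 moreover have "Dbump eta x - Dbump eta y = (- 4) *R (m x *R x - m y *R y)"
  by (simp add: Dbump_def m_def algebra_simps)
 ultimately show "norm (Dbump eta x - Dbump eta y) <= 12 * eta^2 * norm (x - y)" by (simp add: mult_ac)
qed

lemma bump_continuous: "continuous_on S (bump eta)"
 using bump_deriv by (meson has_derivative_continuous continuous_at_imp_continuous_on)

lemma bump_integral:
 assumes "eta > 0"
 shows "integrable lborel (bump eta :: 'a::euclidean_space => real)" "(LI x. bump eta (x::'a)) > 0"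
proof -
 show i: "integrable lborel (bump eta :: 'a => real)"
  by (rule integrable_continuous_compact_support[OF bump_continuous compact_cball[of 0 eta]]) (simp add: bump_facts(2)[OF assms])
 have "(LI x. bump eta (x::'a)) ~= 0"
 proof
  assume "(LI x. bump eta (x::'a)) = 0"
  then have "AE x in lborel. bump eta (x::'a) = 0"
   using integral_nonneg_eq_0_iff_AE[OF i] bump_facts(1)[OF assms] by auto
  then have "AE x::'a in lborel. x ~: ball 0 eta"
   by eventually_elim (use bump_facts(4)[OF assms] in fastforce)
  then have "emeasure lborel (ball (0::'a) eta) = 0" by (subst (asm) AE_iff_null_sets[symmetric]) auto
  then show False using content_ball_pos[OF assms, of "0::'a"] by (simp add: measure_def)
 qed
 moreover have "(LI x. bump eta (x::'a)) >= 0" by (intro integral_nonneg_AE AE_I2 bump_facts(1)[OF assms])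
 ultimately show "(LI x. bump eta (x::'a)) > 0" by linarith
qed

definition moll :: "real => 'a::euclidean_space => real"
 where "moll eta x = bump eta x / (LI x. bump eta (x::'a))"

definition Dmoll :: "real => 'a::euclidean_space => 'a"
 where "Dmoll eta x = Dbump eta x /\<^sub>R (LI x. bump eta (x::'a))"

lemma moll_facts:
 fixes x y :: "'a::euclidean_space"
 assumes "eta > 0"
 shows "moll eta x >= 0" "eta <= norm x ==> moll eta x = 0" "eta <= norm x ==> Dmoll eta x = 0" "moll eta (- x) = moll eta x"
  "(moll eta has_derivative (%h. h <.> Dmoll eta x)) (at x)" "continuous_on S (moll eta :: 'a => real)"
  "integrable lborel (moll eta :: 'a => real)" "(LI x. moll eta (x::'a)) = 1"
  "(LI y. moll eta (x - y)) = 1" "(NNI y. ennreal (moll eta (x - y))) = 1" "(NNI x. ennreal (moll eta (x - y))) = 1"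
  "integrable lborel (%y. moll eta (x - y))"
proof -
 note b = bump_facts[OF assms, where 'a='a] and i = bump_integral[OF assms, where 'a='a]
 show 0: "moll eta x >= 0" for x :: 'a using b(1)[of x] i(2) by (simp add: moll_def divide_nonneg_pos)
 show "eta <= norm x ==> moll eta x = 0" "eta <= norm x ==> Dmoll eta x = 0" using b by (auto simp: moll_def Dmoll_def)
 show sym: "moll eta (- x) = moll eta x" for x :: 'a using b by (simp add: moll_def)
 show d: "(moll eta has_derivative (%h. h <.> Dmoll eta x)) (at x)" for x :: 'a
  unfolding moll_def[abs_def] Dmoll_def
  using has_derivative_mult_left[OF bump_deriv[of eta x], of "inverse (LI x. bump eta (x::'a))"]
  by (simp add: divide_inverse mult.commute)
 show c: "continuous_on S (moll eta)" for S :: "'a set" using d by (meson has_derivative_continuous continuous_at_imp_continuous_on)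
 show im: "integrable lborel (moll eta :: 'a => real)" using i by (simp add: moll_def[abs_def])
 show one: "(LI x. moll eta (x::'a)) = 1" using i by (simp add: moll_def[abs_def])
 have m: "(moll eta :: 'a => real) : bmeas" using c by (rule borel_measurable_continuous_onI)
 have e: "moll eta (x - y) = moll eta (y + - x)" for x y :: 'a using sym[of "x - y"] by simp
 show "(LI y. moll eta (x - y)) = 1"
  unfolding e using mpres_integral[OF mpres_translate m, of "- x"] one by auto
 show "integrable lborel (%y. moll eta (x - y))"
  unfolding e using mpres_integrable[OF mpres_translate m, of "- x"] im by auto
 have nn: "(NNI y. ennreal (moll eta (y::'a))) = 1" using nn_integral_eq_integral[OF im] 0 one by simp
 show "(NNI y. ennreal (moll eta (x - y))) = 1"
  unfolding e using mpres_nn_integral[OF mpres_translate, of "%y. ennreal (moll eta y)" "- x"] m nn by simp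
 show "(NNI x. ennreal (moll eta (x - y))) = 1"
  using mpres_nn_integral[OF mpres_translate, of "%y. ennreal (moll eta y)" "- y"] m nn by simp
qed

definition mollify :: "real => ('a::euclidean_space => 'b::euclidean_space) => 'a => 'b"
 where "mollify eta f x = (LI y. moll eta (x - y) *R f y)"

lemma moll_bounded: "eta > 0 ==> \<exists>S. \<forall>x::'a::euclidean_space. \<bar>moll eta x\<bar> <= S & norm (Dmoll eta x) <= S & (\<forall>y. norm (Dmoll eta x - Dmoll eta y) <= S * norm (x - y))"
proof -
 assume e: "eta > 0"
 let ?Z = "LI x. bump eta (x::'a)"
 have Z: "?Z > 0" by (rule bump_integral[OF e])
 define S where "S = ((eta^2)^2 + 4 * eta^2 * eta + 12 * eta^2) / ?Z"
 have "\<bar>moll eta x\<bar> <= S" for x :: 'a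
  unfolding moll_def S_def abs_div using Z bump_facts(1,6)[OF e, of x] e by (auto intro!: divide_right_mono add_increasing2)
 moreover have "norm (Dmoll eta x) <= S" for x :: 'a
 proof -
  have "norm (Dbump eta x) <= (eta^2)^2 + 4 * eta^2 * eta + 12 * eta^2" using bump_facts(7)[OF e, of x] zero_le_power2[of "eta^2"] zero_le_power2[of eta] by linarith
  then show ?thesis unfolding Dmoll_def S_def using Z by (simp add: divide_inverse mult.commute)
 qed
 moreover have "norm (Dmoll eta x - Dmoll eta y) <= S * norm (x - y)" for x y :: 'a
 proof -
  have "norm (Dbump eta x - Dbump eta y) <= 12 * eta^2 * norm (x - y)" by (rule bump_facts(8)[OF e])
  also have "... <= ((eta^2)^2 + 4 * eta^2 * eta + 12 * eta^2) * norm (x - y)" using e by (intro mult_right_mono) auto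
  finally show ?thesis unfolding Dmoll_def S_def scaleR_diff_right[symmetric] norm_scaleR using Z by (simp add: divide_simps mult_ac)
 qed
 ultimately show ?thesis by blast
qed

lemma mollify_integrable:
 fixes f :: "'a::euclidean_space => 'b::euclidean_space"
 assumes e: "eta > 0" and f: "integrable lborel f"
 shows "integrable lborel (%y. moll eta (x - y) *R f y)"
proof -
 obtain S where S: "!!x::'a. \<bar>moll eta x\<bar> <= S" using moll_bounded[OF e] by metis
 have [measurable]: "f : bmeas" "(%y. moll eta (x - y)) : bmeas"
  using f moll_facts(12)[OF e, of x] by auto
 show ?thesis
 proof (rule Bochner_Integration.integrable_bound)
  show "integrable lborel (%y. S * norm (f y))" using f by auto
  show "AE y in lborel. norm (moll eta (x - y) *R f y) <= norm (S * norm (f y))"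
   using S by (intro AE_I2) (auto intro!: order_trans[OF _ abs_ge_self] mult_right_mono)
 qed measurable
qed

lemma mollify_deriv:
 fixes f :: "'a::euclidean_space => real"
 assumes e: "eta > 0" and f: "integrable lborel f"
 shows "(mollify eta f has_derivative (%h. LI y. f y * (h <.> Dmoll eta (x - y)))) (at x)"
  and "continuous_on UNIV (%x. LI y. f y * (h <.> Dmoll eta (x - y)))"
proof -
 let ?D = "%h x y. h <.> Dmoll eta (x - y)"
 obtain S where S: "!!x::'a. \<bar>moll eta x\<bar> <= S" "!!x::'a. norm (Dmoll eta x) <= S" "!!x y::'a. norm (Dmoll eta x - Dmoll eta y) <= S * norm (x - y)"
  using moll_bounded[OF e] by metis
 have S0: "S >= 0" using S(1)[of 0] by linarith
 have h1: "\<bar>h <.> Dmoll eta x\<bar> <= S * norm h" for h x :: 'a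
  using Cauchy_Schwarz_ineq2[of h "Dmoll eta x"] mult_left_mono[OF S(2)[of x] norm_ge_zero[of h]] by (simp add: mult.commute)
 have h2: "\<bar>h <.> Dmoll eta x - h <.> Dmoll eta y\<bar> <= S * norm (x - y) * norm h" for h x y :: 'a
  using Cauchy_Schwarz_ineq2[of h "Dmoll eta x - Dmoll eta y"] mult_left_mono[OF S(3)[of x y] norm_ge_zero[of h]] by (simp add: inner_diff_right mult_ac)
 have "((%q. LI z. f z *R moll eta (q - z)) has_derivative (%h. LI z. f z *R (h <.> Dmoll eta (x - z)))) (at x)"
  by (rule has_derivative_kernel_integral[where X="%x. x" and kap="moll eta" and Dkap="%x h. h <.> Dmoll eta x" and S=S and S'=S and Lam=S])
    (use f S h1 h2 moll_facts(5)[OF e] in auto)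
 then show "(mollify eta f has_derivative (%h. LI y. f y * ?D h x y)) (at x)"
  by (simp add: mollify_def[abs_def] mult.commute)
 have m: "(%x. h <.> Dmoll eta x) : bmeas"
 proof (rule borel_measurable_continuous_onI)
  have "S-lipschitz_on UNIV (Dmoll eta :: 'a => 'a)" by (intro lipschitz_onI S0) (use S(3) in \<open>auto simp: dist_norm\<close>)
  from lipschitz_on_continuous_on[OF this] show "continuous_on UNIV (%x. h <.> Dmoll eta x)" by (intro continuous_intros)
 qed
 have i: "integrable lborel (%y. f y *R ?D h x y)" for x
  by (rule kernel_integral(1)[where S="S * norm h"]) (use f m h1 in auto)
 have "(S * norm h * (LI y. \<bar>f y\<bar>))-lipschitz_on UNIV (%x. LI y. f y * ?D h x y)"
 proof (rule lipschitz_onI)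
  fix x x' :: 'a
  have "(LI y. f y * ?D h x y) - (LI y. f y * (h <.> Dmoll eta (x' - y)))
    = (LI y. f y * (h <.> Dmoll eta (x - y) - h <.> Dmoll eta (x' - y)))"
   using i by (simp add: right_diff_distrib)
  also have "\<bar>...\<bar> <= (LI y. \<bar>f y * (h <.> Dmoll eta (x - y) - h <.> Dmoll eta (x' - y))\<bar>)" by (rule integral_abs_bound)
  also have "... <= (LI y. \<bar>f y\<bar> * (S * norm (x - x') * norm h))"
  proof (rule integral_mono)
   have "integrable lborel (%y. f y * (h <.> Dmoll eta (x - y) - h <.> Dmoll eta (x' - y)))"
    using i by (simp add: right_diff_distrib)
   then show "integrable lborel (%y. \<bar>f y * (h <.> Dmoll eta (x - y) - h <.> Dmoll eta (x' - y))\<bar>)" by (rule integrable_abs)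
   show "integrable lborel (%y. \<bar>f y\<bar> * (S * norm (x - x') * norm h))" using f by auto
   show "\<bar>f y * (h <.> Dmoll eta (x - y) - h <.> Dmoll eta (x' - y))\<bar> <= \<bar>f y\<bar> * (S * norm (x - x') * norm h)" for y
    unfolding abs_mult using h2[of h "x - y" "x' - y"] by (intro mult_left_mono) auto
  qed
  finally show "dist (LI y. f y * ?D h x y) (LI y. f y * (h <.> Dmoll eta (x' - y))) <= S * norm h * (LI y. \<bar>f y\<bar>) * dist x x'"
   using f by (simp add: dist_norm mult_ac)
 qed (use S0 in auto)
 then show "continuous_on UNIV (%x. LI y. f y * ?D h x y)" by (rule lipschitz_on_continuous_on)
qed

lemma mollify_measurable:
 fixes f :: "'a::euclidean_space => 'b::euclidean_space"
 assumes e: "eta > 0" and f: "f : bmeas"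
 shows "mollify eta f : bmeas" "(%z. moll eta (fst z - snd z) *R f (snd z)) : bmeas"
proof -
 have [measurable]: "(moll eta :: 'a => real) : bmeas" using moll_facts(6)[OF e] by (rule borel_measurable_continuous_onI)
 note f[measurable]
 show m: "(%z. moll eta (fst z - snd z) *R f (snd z)) : bmeas"
  unfolding borel_prod[symmetric] by measurable
 show "mollify eta f : bmeas"
  unfolding mollify_def[abs_def] by measurable
qed

text \<open>Fubini, since the kernel has mass 1 also as a function of \<open>x\<close>.\<close>

lemma mollify_contraction:
 fixes f :: "'a::euclidean_space => 'b::euclidean_space"
 assumes e: "eta > 0" and f: "integrable lborel f"
 shows "(NNI x. norm (mollify eta f x)) <= (NNI x. norm (f x))"
proof -
 have fm[measurable]: "f : bmeas" using f by auto
 have [measurable]: "(moll eta :: 'a => real) : bmeas" using moll_facts(6)[OF e] by (rule borel_measurable_continuous_onI)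
 have "(NNI x. norm (mollify eta f x)) <= (NNI x. NNI y. norm (moll eta (x - y) *R f y))"
  unfolding mollify_def by (intro nn_integral_mono integral_norm_bound_ennreal mollify_integrable e f)
 also have "... = (NNI y. NNI x. norm (moll eta (x - y) *R f y))"
 proof -
  have "(%z. ennreal (norm (moll eta (fst z - snd z) *R f (snd z)))) : bmeas"
   using mollify_measurable(2)[OF e fm] by measurable
  from nn_integral_lborel_pair[OF this] show ?thesis by simp
 qed
 also have "... = (NNI y. norm (f y) * (NNI x. moll eta (x - y)))"
  by (subst nn_integral_cmult[symmetric]) (auto simp: ennreal_mult' mult.commute moll_facts(1)[OF e] abs_of_nonneg)
 also have "... = (NNI x. norm (f x))" by (simp add: moll_facts(11)[OF e])
 finally show ?thesis .
qed

text \<open>Lusin's theorem, in the form of \<^const>\<open>measurable_on\<close>, gives density of the continuous functions.\<close>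

lemma continuous_dense_L1:
 fixes f :: "'a::euclidean_space => 'b::euclidean_space"
 assumes f: "integrable lborel f" and K: "compact K" "!!x. x ~: K ==> f x = 0" and e: "e > 0"
 shows "\<exists>k K'. continuous_on UNIV k & compact K' & (\<forall>x. x ~: K' --> k x = 0) & (NNI x. norm (f x - k x)) <= ennreal e"
proof -
 have fm[measurable]: "f : bmeas" using f by auto
 \<comment> \<open>Radial truncation at height \<open>R\<close>, continuous in \<open>v\<close>.
   Together with the spatial cut-off \<open>ct\<close> below it turns the Lusin approximants into
   uniformly bounded functions with a common compact support.\<close>
 define c where "c R v = (R / max R (norm v)) *R v" for R :: real and v :: 'b
 have cn: "norm (c R v) <= R" "norm (c R v) <= norm v" "norm v <= R ==> c R v = v" if "R > 0" for R v
  using that by (auto simp: c_def divide_simps max_def)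
 have cc: "continuous_on S (%x. c R (g x))" if "R > 0" "continuous_on S g" for R S and g :: "'a => 'b"
  unfolding c_def by (intro continuous_intros that) (use that in auto)
 have [measurable]: "(%x. c R (f x)) : bmeas" for R unfolding c_def by measurable
 have "(%n. LI x. norm (f x - c (real (Suc n)) (f x))) ----> (LINT x|(lborel::'a measure). 0)"
 proof (rule integral_dominated_convergence[where w="%x. 2 * norm (f x)"])
  show "AE x in lborel. (%n. norm (f x - c (real (Suc n)) (f x))) ----> 0"
  proof (rule AE_I2, rule tendsto_eventually)
   fix x
   obtain N where N: "norm (f x) <= real N" using real_arch_simple by blast
   show "\<forall>\<^sub>F n in sequentially. norm (f x - c (real (Suc n)) (f x)) = 0"
    unfolding eventually_sequentially using N cn(3)[of "real (Suc _)" "f x"] by (intro exI[of _ N]) auto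
  qed
  show "AE x in lborel. norm (norm (f x - c (real (Suc n)) (f x))) <= 2 * norm (f x)" for n
   using cn(2)[of "real (Suc n)"] norm_triangle_ineq4[of "f _" "c (real (Suc n)) (f _)"] by (intro AE_I2) (smt (verit) norm_ge_zero of_nat_0_less_iff real_norm_def zero_less_Suc)
 qed (use f in auto)
 then have "\<forall>\<^sub>F n in sequentially. (LI x. norm (f x - c (real (Suc n)) (f x))) < e/2"
  using e by (intro order_tendstoD(2)[where a="e/2"]) auto
 then obtain n where n: "(LI x. norm (f x - c (real (Suc n)) (f x))) < e/2" by (auto dest: eventually_happens)
 define R where "R = real (Suc n)"
 have R: "R > 0" by (simp add: R_def)
 have ic: "integrable lborel (%x. c R (f x))"
  by (rule Bochner_Integration.integrable_bound[OF f]) (use cn(2)[OF R] in auto)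
 have "f measurable_on UNIV" by (rule lebesgue_measurable_imp_measurable_on) (auto intro: borel_measurable_if_I measurable_completion)
 then obtain N g where N: "negligible N" and g: "!!n. continuous_on UNIV (g n)" "!!x. x ~: N ==> (%n. g n x) ----> f x"
  unfolding measurable_on_def by auto
 obtain B where B: "B > 0" "K <= ball 0 B" using compact_imp_bounded[OF K(1)] by (meson bounded_subset_ballD)
 define ct where "ct x = max 0 (min 1 (B + 1 - norm x))" for x :: 'a
 have ct: "0 <= ct x" "ct x <= 1" "x : K ==> ct x = 1" "x ~: cball 0 (B + 1) ==> ct x = 0" for x
  using B by (auto simp: ct_def subset_iff)
 define k where "k m x = ct x *R c R (g m x)" for m x
 have ck: "continuous_on UNIV (k m)" for m unfolding k_def ct_def by (intro continuous_intros cc R g)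
 have [measurable]: "k m : bmeas" for m using ck by (rule borel_measurable_continuous_onI)
 have ik: "integrable lborel (k m)" for m
  by (rule integrable_continuous_compact_support[OF ck compact_cball[of 0 "B+1"]]) (simp add: k_def ct(4))
 have "(%m. LI x. norm (c R (f x) - k m x)) ----> (LINT x|(lborel::'a measure). 0)"
 proof (rule integral_dominated_convergence[where w="%x. 2 * R * indicator (cball 0 (B+1)) x"])
  have "N : null_sets lebesgue" using N by (simp add: negligible_iff_null_sets)
  then have "AE x in lebesgue. x ~: N" by (rule AE_not_in)
  then have "AE x in lborel. x ~: N" by (simp add: AE_completion_iff)
  then show "AE x in lborel. (%m. norm (c R (f x) - k m x)) ----> 0"
  proof eventually_elim
   case (elim x)
   have "isCont (c R) (f x)" unfolding c_def using R by (intro continuous_intros) auto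
   then have "(%m. c R (g m x)) ----> c R (f x)" using g(2)[OF elim] isCont_tendsto_compose by blast
   then have "(%m. norm (c R (f x) - k m x)) ----> norm (c R (f x) - ct x *R c R (f x))" unfolding k_def by (intro tendsto_intros)
   moreover have "c R (f x) - ct x *R c R (f x) = 0" using ct(3)[of x] K(2)[of x] by (cases "x : K") (auto simp: c_def)
   ultimately show ?case by simp
  qed
  show "AE x in lborel. norm (norm (c R (f x) - k m x)) <= 2 * R * indicator (cball 0 (B+1)) x" for m
  proof (rule AE_I2)
   fix x
   show "norm (norm (c R (f x) - k m x)) <= 2 * R * indicator (cball 0 (B+1)) x"
   proof (cases "x : cball 0 (B+1)")
    case True
    have "norm (k m x) <= 1 * R" unfolding k_def norm_scaleR using ct[of x] cn(1)[OF R] by (intro mult_mono) auto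
    then show ?thesis using True cn(1)[OF R, of "f x"] norm_triangle_ineq4[of "c R (f x)" "k m x"] by simp
   next
    case False
    then have "x ~: K" using B by auto
    then show ?thesis using False K(2) ct(4) by (simp add: k_def c_def)
   qed
  qed
  show "integrable lborel (%x::'a. 2 * R * indicator (cball 0 (B+1)) x)"
   using emeasure_compact_finite[OF compact_cball[of "0::'a" "B+1"]] by (intro integrable_mult_right integrable_real_indicator) auto
 qed (use ic in auto)
 then have "\<forall>\<^sub>F m in sequentially. (LI x. norm (c R (f x) - k m x)) < e/2"
  using e by (intro order_tendstoD(2)[where a="e/2"]) auto
 then obtain m where m: "(LI x. norm (c R (f x) - k m x)) < e/2" by (auto dest: eventually_happens)
 have "(NNI x. norm (f x - k m x)) = ennreal (LI x. norm (f x - k m x))"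
  by (rule nn_integral_eq_integral) (use f ik in auto)
 also have "(LI x. norm (f x - k m x)) <= (LI x. norm (f x - c R (f x)) + norm (c R (f x) - k m x))"
 proof (rule integral_mono)
  show "norm (f x - k m x) <= norm (f x - c R (f x)) + norm (c R (f x) - k m x)" for x
   using norm_triangle_ineq[of "f x - c R (f x)" "c R (f x) - k m x"] by simp
 qed (use f ik ic in auto)
 also have "... <= e" using n m f ik ic by (simp add: R_def)
 finally have "(NNI x. norm (f x - k m x)) <= ennreal e" by (simp add: ennreal_leI)
 then show ?thesis using ck ct(4) by (intro exI[of _ "k m"] exI[of _ "cball 0 (B+1)"]) (auto simp: k_def)
qed

lemma mollify_pointwise:
 fixes f :: "'a::euclidean_space => 'b::euclidean_space"
 assumes eta: "eta > 0" and f: "integrable lborel f" and d: "!!y. dist y x <= eta ==> norm (f y - f x) <= d"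
 shows "norm (mollify eta f x - f x) <= d"
proof -
 have i: "integrable lborel (%y. moll eta (x - y) *R f y)" by (rule mollify_integrable[OF eta f])
 have i2: "integrable lborel (%y. moll eta (x - y) *R f x)" by (intro integrable_scaleR_left moll_facts(12)[OF eta])
 have "mollify eta f x - f x = (LI y. moll eta (x - y) *R f y) - (LI y. moll eta (x - y) *R f x)"
  using moll_facts(12,9)[OF eta, of x] by (simp add: mollify_def)
 also have "... = (LI y. moll eta (x - y) *R (f y - f x))"
  using i i2 by (simp add: scaleR_diff_right)
 also have "norm ... <= (LI y. norm (moll eta (x - y) *R (f y - f x)))" by (rule integral_norm_bound)
 also have "... <= (LI y. moll eta (x - y) * d)"
 proof (rule integral_mono)
  have "integrable lborel (%y. moll eta (x - y) *R (f y - f x))" using i i2 by (simp add: scaleR_diff_right)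
  then show "integrable lborel (%y. norm (moll eta (x - y) *R (f y - f x)))" by (rule integrable_norm)
  show "integrable lborel (%y. moll eta (x - y) * d)" using moll_facts(12)[OF eta] by auto
  show "norm (moll eta (x - y) *R (f y - f x)) <= moll eta (x - y) * d" for y
  proof (cases "eta <= norm (x - y)")
   case True then show ?thesis by (simp add: moll_facts(2)[OF eta])
  next
   case False
   then show ?thesis using d[of y] moll_facts(1)[OF eta, of "x - y"] by (auto simp: dist_norm norm_minus_commute intro!: mult_left_mono)
  qed
 qed
 also have "... = d" using moll_facts(9)[OF eta, of x] by simp
 finally show ?thesis .
qed

text \<open>The contraction property reduces the claim to a continuous, compactly supported
  \<open>k\<close>, whose mollifications converge uniformly. For radii below 1 they live in the ball
  of radius \<open>B + 1\<close>, and evaluating them there involves \<open>k\<close> up to radius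
  \<open>B + 2\<close> only.\<close>

lemma mollify_L1:
 fixes f :: "'a::euclidean_space => 'b::euclidean_space"
 assumes f: "integrable lborel f" and K: "compact K" "!!x. x ~: K ==> f x = 0"
  and eta: "!!n. eta n > 0" "eta ----> 0" and e: "e > 0"
 shows "\<forall>\<^sub>F n in sequentially. (NNI x. norm (mollify (eta n) f x - f x)) <= ennreal e"
proof -
 have "e/3 > 0" using e by simp
 from continuous_dense_L1[OF f K this] obtain k K' where ck: "continuous_on UNIV k" and K': "compact K'"
  and k0: "!!x. x ~: K' ==> k x = 0" and fk: "(NNI x. norm (f x - k x)) <= ennreal (e/3)"
  by blast
 have ik: "integrable lborel k" by (rule integrable_continuous_compact_support[OF ck K' k0])
 obtain B where B: "B > 0" "K' <= ball 0 B" using compact_imp_bounded[OF K'] by (meson bounded_subset_ballD)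
 let ?C = "cball (0::'a) (B + 1)"
 have fin: "emeasure lborel ?C < \<infinity>" by (rule emeasure_compact_finite) simp
 define e' where "e' = e / (3 * (measure lborel ?C + 1))"
 have e': "e' > 0" using e by (auto simp: e'_def intro!: divide_pos_pos add_nonneg_pos)
 have "uniformly_continuous_on (cball 0 (B + 2)) k"
  by (rule compact_uniformly_continuous) (auto intro: continuous_on_subset[OF ck])
 then obtain d where d: "d > 0" "!!x y. x : cball 0 (B+2) ==> y : cball 0 (B+2) ==> dist y x < d ==> dist (k y) (k x) < e'"
  unfolding uniformly_continuous_on_def using e' by metis
 have "\<forall>\<^sub>F n in sequentially. eta n < min d 1" using eta(2) d by (intro order_tendstoD(2)) auto
 then show ?thesis
 proof eventually_elim
  case (elim n)
  let ?m = "mollify (eta n)"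
  have bound: "norm (?m k x - k x) <= e' * indicator ?C x" for x
  proof (cases "x : ?C")
   case True
   have "norm (k y - k x) <= e'" if "dist y x <= eta n" for y
   proof -
    have "norm y <= norm x + dist y x" by (metis dist_norm norm_triangle_sub add.commute)
    then show ?thesis using d(2)[of x y] True that elim by (auto simp: dist_norm)
   qed
   then show ?thesis using mollify_pointwise[OF eta(1) ik] True by simp
  next
   case False
   have "norm (k y - k x) <= 0" if "dist y x <= eta n" for y
   proof -
    have "norm x <= norm y + dist y x" by (metis dist_norm norm_triangle_sub norm_minus_commute add.commute)
    then have "y ~: K'" "x ~: K'" using False that elim B by (auto simp: subset_iff)
    then show ?thesis by (simp add: k0)
   qed
   then show ?thesis using mollify_pointwise[OF eta(1) ik] False by fastforce
  qed
  have mm: "?m (%x. f x - k x) x = ?m f x - ?m k x" for x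
   using mollify_integrable[OF eta(1) f] mollify_integrable[OF eta(1) ik] by (simp add: mollify_def scaleR_diff_right)
  have ifk: "integrable lborel (%x. f x - k x)" using f ik by simp
  have [measurable]: "f : bmeas" "k : bmeas" using f ik by auto
  note [measurable] = mollify_measurable(1)[OF eta(1)[of n]]
  have [measurable]: "?m (%x. f x - k x) : bmeas" "?m k : bmeas" by measurable
  have "(NNI x. norm (?m f x - f x)) <= (NNI x. ennreal (norm (?m (%x. f x - k x) x)) + ennreal (norm (?m k x - k x)) + ennreal (norm (f x - k x)))"
  proof (rule nn_integral_mono)
   fix x
   have "?m f x - f x = ?m (%x. f x - k x) x + (?m k x - k x) - (f x - k x)" by (simp add: mm)
   then have "norm (?m f x - f x) <= norm (?m (%x. f x - k x) x) + norm (?m k x - k x) + norm (f x - k x)"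
    using order_trans[OF norm_triangle_ineq4[of "?m (%x. f x - k x) x + (?m k x - k x)" "f x - k x"]
     add_right_mono[OF norm_triangle_ineq[of "?m (%x. f x - k x) x" "?m k x - k x"]]] by simp
   then show "ennreal (norm (?m f x - f x)) <= ennreal (norm (?m (%x. f x - k x) x)) + ennreal (norm (?m k x - k x)) + ennreal (norm (f x - k x))"
    by (simp add: ennreal_plus[symmetric] ennreal_leI del: ennreal_plus)
  qed
  also have "... = (NNI x. norm (?m (%x. f x - k x) x)) + (NNI x. norm (?m k x - k x)) + (NNI x. norm (f x - k x))"
   by (simp add: nn_integral_add)
  also have "... <= ennreal (e/3) + ennreal (e/3) + ennreal (e/3)"
  proof (intro add_mono fk)
   show "(NNI x. norm (?m (%x. f x - k x) x)) <= ennreal (e/3)"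
    using mollify_contraction[OF eta(1) ifk] fk by (rule order_trans)
   have "(NNI x. norm (?m k x - k x)) <= (NNI x. ennreal e' * indicator ?C x)"
   proof (rule nn_integral_mono)
    fix x
    have "ennreal (norm (?m k x - k x)) <= ennreal (e' * indicator ?C x)" by (rule ennreal_leI[OF bound])
    also have "... = ennreal e' * indicator ?C x" using e' by (simp add: indicator_def)
    finally show "ennreal (norm (?m k x - k x)) <= ennreal e' * indicator ?C x" .
   qed
   also have "... = ennreal e' * emeasure lborel ?C" by (rule nn_integral_cmult_indicator) simp
   also have "... = ennreal (e' * measure lborel ?C)" using fin e' by (simp add: emeasure_eq_ennreal_measure ennreal_mult less_top)
   also have "e' * measure lborel ?C <= e/3"
   proof -
    have "e' * measure lborel ?C <= e' * (measure lborel ?C + 1)" using e' by (intro mult_left_mono) auto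
    also have "... = e/3" unfolding e'_def using measure_nonneg[of lborel ?C] by (simp add: divide_simps add_nonneg_eq_0_iff)
    finally show ?thesis .
   qed
   finally show "(NNI x. norm (?m k x - k x)) <= ennreal (e/3)" by (simp add: ennreal_leI)
  qed
  also have "... = ennreal e" using e by (simp add: ennreal_plus[symmetric] del: ennreal_plus)
  finally show ?case .
 qed
qed

subsection \<open>Weak gradients\<close>

text \<open>All uses of weak gradients pass through this approximation. For \<open>x\<close> in
  \<open>K\<close> the mollifier centred at \<open>x\<close> is an admissible test function in
  \<open>V\<close>, so the classical derivative of the mollified \<open>f\<close> at
  \<open>x\<close> is the mollification of \<open>g\<close>. The last conclusions carry pointwise
  convergence, bounds and vanishing components over to the approximants.\<close>

lemma weak_gradient_approx:
 fixes f :: "'a::euclidean_space => real"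
 assumes wg: "weak_gradient_on V f g" and V: "open V" and K: "compact K" "K <= V"
 obtains F :: "nat => 'a => real" and DF and d :: "nat => 'a => 'a" where
  "!!n x. (F n has_derivative DF n x) (at x)"
  "!!n h. continuous_on UNIV (%x. DF n x h)"
  "!!n x h. x : K ==> DF n x h = h <.> d n x"
  "!!n. d n : bmeas" "!!n. set_integrable lborel K (d n)"
  "!!e. e > 0 ==> \<forall>\<^sub>F n in sequentially. (NNI x. ennreal (indicator K x * norm (F n x - f x))) <= ennreal e"
  "!!e. e > 0 ==> \<forall>\<^sub>F n in sequentially. (NNI x. ennreal (indicator K x * norm (d n x - g x))) <= ennreal e"
  "!!x. x : K ==> continuous_on V f ==> (%n. F n x) ----> f x"
  "!!M n x. (AE x in lborel. x : V --> norm (g x) <= M) ==> x : K ==> norm (d n x) <= M"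
  "!!e n x. (AE x in lborel. x : V --> g x <.> e = 0) ==> x : K ==> d n x <.> e = 0"
proof -
 obtain dl where dl: "dl > 0" "(\<Union>x\<in>K. cball x dl) <= V"
  using compact_subset_open_imp_cball_epsilon_subset[OF K(1) V K(2)] by blast
 \<comment> \<open>The closed \<open>dl\<close>-neighbourhood of \<open>K\<close>, still inside
   \<open>V\<close>. Outside it \<open>f\<close> and \<open>g\<close> are replaced by 0, which
   mollification with radius at most \<open>dl\<close> does not notice on \<open>K\<close>.\<close>
 define K2 where "K2 = (\<Union>x\<in>K. \<Union>y\<in>cball 0 dl. {x + y})"
 have K2: "compact K2" unfolding K2_def by (rule compact_sums'[OF K(1) compact_cball])
 have inK2: "y : K2" if "x : K" "dist y x <= dl" for x y
 proof -
  have "y - x : cball 0 dl" "y = x + (y - x)" using that by (auto simp: dist_norm norm_minus_commute)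
  then show ?thesis using that(1) unfolding K2_def by blast
 qed
 have K2V: "K2 <= V" using dl(2) unfolding K2_def by (fastforce simp: dist_norm)
 have KK2: "K <= K2" using inK2 dl(1) by fastforce
 define ft where "ft x = indicator K2 x *R f x" for x
 define gt where "gt x = indicator K2 x *R g x" for x
 have ift: "integrable lborel ft" and igt: "integrable lborel gt"
  using wg K2 K2V unfolding weak_gradient_on_def locally_integrable_on_def set_integrable_def ft_def gt_def by blast+
 have ftK: "ft x = f x" "gt x = g x" if "x : K2" for x using that by (auto simp: ft_def gt_def)
 have ft0: "ft x = 0" "gt x = 0" if "x ~: K2" for x using that by (auto simp: ft_def gt_def)
 define eta where "eta n = dl / real (Suc n)" for n
 have eta: "eta n > 0" "eta n <= dl" for n using dl by (auto simp: eta_def divide_simps intro: mult_left_mono)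
 have eta0: "eta ----> 0" unfolding eta_def using LIMSEQ_Suc[OF lim_const_over_n[of dl]] by simp
 let ?F = "%n. mollify (eta n) ft" and ?d = "%n. mollify (eta n) gt"
 let ?DF = "%n x h. LI y. ft y * (h <.> Dmoll (eta n) (x - y))"
 have mz: "moll (eta n) (x - y) = 0" "Dmoll (eta n) (x - y) = 0" if "x : K" "y ~: K2" for n x y
 proof -
  have "eta n <= norm (x - y)" using inK2[of x y] that eta(2)[of n] by (force simp: dist_norm norm_minus_commute)
  then show "moll (eta n) (x - y) = 0" "Dmoll (eta n) (x - y) = 0" using moll_facts(2,3)[OF eta(1)] by auto
 qed
 have mDm: "(Dmoll (eta n) :: 'a => 'a) : bmeas" "\<exists>S. \<forall>x::'a. norm (Dmoll (eta n) x) <= S" for n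
 proof -
  obtain S where S: "!!x::'a. norm (Dmoll (eta n) x) <= S" "!!x y::'a. norm (Dmoll (eta n) x - Dmoll (eta n) y) <= S * norm (x - y)"
   using moll_bounded[OF eta(1)] by metis
  have "S-lipschitz_on UNIV (Dmoll (eta n) :: 'a => 'a)"
   using S(2) order_trans[OF norm_ge_zero S(1)[of 0]] by (intro lipschitz_onI) (auto simp: dist_norm)
  then show "(Dmoll (eta n) :: 'a => 'a) : bmeas"
   by (intro borel_measurable_continuous_onI lipschitz_on_continuous_on)
  show "\<exists>S. \<forall>x::'a. norm (Dmoll (eta n) x) <= S" using S(1) by blast
 qed
 have DFd: "?DF n x h = h <.> ?d n x" if x: "x : K" for n x h
 proof -
  let ?phi = "%y. moll (eta n) (x - y)" and ?D = "%y. - Dmoll (eta n) (x - y)"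
  have der: "GDERIV ?phi y :> ?D y" for y
  proof -
   have "((%y. x - y) has_derivative (%h. - h)) (at y)" by (auto intro!: derivative_eq_intros)
   from has_derivative_compose[OF this moll_facts(5)[OF eta(1)]]
   show ?thesis unfolding gderiv_def by simp
  qed
  obtain S where S: "!!x y::'a. norm (Dmoll (eta n) x - Dmoll (eta n) y) <= S * norm (x - y)" "!!x::'a. norm (Dmoll (eta n) x) <= S"
   using moll_bounded[OF eta(1)] by metis
  have lipD: "S-lipschitz_on UNIV (Dmoll (eta n) :: 'a => 'a)"
   using S order_trans[OF norm_ge_zero S(2)[of 0]] by (intro lipschitz_onI) (auto simp: dist_norm)
  have "continuous_on UNIV (%y. x - y)" by (intro continuous_intros)
  from continuous_on_compose2[OF lipschitz_on_continuous_on[OF lipD] this subset_UNIV]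
  have "continuous_on UNIV (%y. Dmoll (eta n) (x - y))" .
  then have cD: "continuous_on UNIV ?D" by (intro continuous_intros)
  have sup: "closure (support_on UNIV ?phi) <= cball x (eta n)"
  proof (rule closure_minimal)
   show "support_on UNIV ?phi <= cball x (eta n)"
    using moll_facts(2)[OF eta(1)] by (force simp: in_support_on dist_norm)
  qed simp
  have "compact (closure (support_on UNIV ?phi))" using sup by (meson bounded_cball bounded_subset compact_closure closure_subset order_trans)
  moreover have "cball x (eta n) <= V" using dl(2) x eta(2)[of n] by (fastforce simp: subset_iff)
  ultimately have eq: "(LINT y:V|lborel. f y *R ?D y) = - (LINT y:V|lborel. ?phi y *R g y)"
   using wg[unfolded weak_gradient_on_def, THEN conjunct2, THEN conjunct2, rule_format, of ?phi ?D] der cD sup by blast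
  have e0: "indicator V y *R (f y *R ?D y) = - (ft y *R Dmoll (eta n) (x - y))" for y
   using mz(2)[OF x, of y] K2V by (cases "y : K2") (auto simp: ftK ft0)
  have e1: "indicator V y *R (?phi y *R g y) = ?phi y *R gt y" for y
   using mz(1)[OF x, of y] K2V by (cases "y : K2") (auto simp: ftK ft0)
  have e2: "(LI y. ft y *R Dmoll (eta n) (x - y)) = ?d n x"
   using eq unfolding set_lebesgue_integral_def e0 e1 Bochner_Integration.integral_minus neg_equal_iff_equal mollify_def .
  obtain S where "!!x::'a. norm (Dmoll (eta n) x) <= S" using mDm(2) by blast
  then have "integrable lborel (%y. ft y *R Dmoll (eta n) (x - y))"
   by (intro kernel_integral(1)[OF ift _ mDm(1)]) auto
  then have "(LI y. h <.> (ft y *R Dmoll (eta n) (x - y))) = h <.> (LI y. ft y *R Dmoll (eta n) (x - y))"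
   by (intro integral_inner_right)
  then show ?thesis using e2 by (simp only: inner_scaleR_right)
 qed
 show thesis
 proof (rule that[of ?F ?DF ?d])
  show "(?F n has_derivative ?DF n x) (at x)" for n x by (rule mollify_deriv(1)[OF eta(1) ift])
  show "continuous_on UNIV (%x. ?DF n x h)" for n h by (rule mollify_deriv(2)[OF eta(1) ift])
  show "?DF n x h = h <.> ?d n x" if "x : K" for n x h by (rule DFd[OF that])
  have gtm: "gt : bmeas" using igt by auto
  show md: "?d n : bmeas" for n by (rule mollify_measurable(1)[OF eta(1) gtm])
  have conv: "\<forall>\<^sub>F n in sequentially. (NNI x. ennreal (indicator K x * norm (mollify (eta n) ut x - u x))) <= ennreal e"
   if "integrable lborel ut" "!!x. x : K2 ==> ut x = u x" "!!x. x ~: K2 ==> ut x = 0" "e > 0"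
   for e and ut u :: "'a => 'c::euclidean_space"
  proof -
   have "\<forall>\<^sub>F n in sequentially. (NNI x. norm (mollify (eta n) ut x - ut x)) <= ennreal e"
    by (rule mollify_L1[OF that(1) K2 _ eta(1) eta0 that(4)]) (rule that(3))
   then show ?thesis
   proof eventually_elim
   case (elim n)
   have "(NNI x. ennreal (indicator K x * norm (mollify (eta n) ut x - u x))) <= (NNI x. norm (mollify (eta n) ut x - ut x))"
    using KK2 that(2) by (intro nn_integral_mono ennreal_leI) (auto simp: indicator_def subset_iff)
   then show ?case using elim by simp
   qed
  qed
  show "\<forall>\<^sub>F n in sequentially. (NNI x. ennreal (indicator K x * norm (?F n x - f x))) <= ennreal e" if "e > 0" for e
   by (rule conv) (use ift ftK ft0 that in auto)
  show "\<forall>\<^sub>F n in sequentially. (NNI x. ennreal (indicator K x * norm (?d n x - g x))) <= ennreal e" if "e > 0" for e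
   by (rule conv) (use igt ftK ft0 that in auto)
  show "set_integrable lborel K (?d n)" for n
  proof -
   have "integrable lborel (?d n)"
   proof (rule integrableI_bounded)
    show "(NNI x. ennreal (norm (?d n x))) < \<infinity>"
     using order_le_less_trans[OF mollify_contraction[OF eta(1) igt]] igt by (simp add: integrable_iff_bounded)
   qed (use md in simp)
   then show ?thesis unfolding set_integrable_def using K(1) by (intro integrable_mult_indicator) (auto simp: borel_compact)
  qed
  show "(%n. ?F n x) ----> f x" if x: "x : K" and cf: "continuous_on V f" for x
   unfolding LIMSEQ_iff
  proof (intro allI impI)
   fix r :: real assume r: "r > 0"
   have "isCont f x" using cf V x K(2) continuous_on_eq_continuous_at by blast
   then obtain s where s: "s > 0" "!!y. dist y x < s ==> dist (f y) (f x) < r/2"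
    unfolding continuous_at_eps_delta using half_gt_zero[OF r] by blast
   have "\<forall>\<^sub>F n in sequentially. eta n < s" using eta0 s(1) by (rule order_tendstoD)
   then obtain N where N: "!!n. n >= N ==> eta n < s" by (auto simp: eventually_sequentially)
   show "\<exists>no. \<forall>n\<ge>no. norm (?F n x - f x) < r"
   proof (intro exI[of _ N] allI impI)
    fix n assume n: "n >= N"
    have "norm (?F n x - ft x) <= r/2"
    proof (rule mollify_pointwise[OF eta(1) ift])
     fix y assume y: "dist y x <= eta n"
     then have "y : K2" "x : K2" using inK2[OF x, of y] eta(2)[of n] x KK2 by auto
     then show "norm (ft y - ft x) <= r/2" using s(2)[of y] y N[OF n] by (simp add: ftK dist_norm)
    qed
    then show "norm (?F n x - f x) < r" using r x KK2 by (auto simp: ftK subset_iff)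
   qed
  qed
  show "norm (?d n x) <= M" if M: "AE x in lborel. x : V --> norm (g x) <= M" and x: "x : K" for M n x
  proof -
   have i: "integrable lborel (%y. moll (eta n) (x - y) *R gt y)" by (rule mollify_integrable[OF eta(1) igt])
   have "norm (?d n x) <= (LI y. norm (moll (eta n) (x - y) *R gt y))"
    unfolding mollify_def by (rule integral_norm_bound)
   also have "... <= (LI y. moll (eta n) (x - y) * M)"
   proof (rule integral_mono_AE[OF integrable_norm[OF i]])
    show "integrable lborel (%y. moll (eta n) (x - y) * M)" by (intro integrable_mult_left moll_facts(12)[OF eta(1)])
    show "AE y in lborel. norm (moll (eta n) (x - y) *R gt y) <= moll (eta n) (x - y) * M"
     using M
    proof eventually_elim
     case (elim y)
     show ?case
     proof (cases "y : K2")
      case True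
      then have "norm (gt y) <= M" using elim K2V by (auto simp: ftK)
      then show ?thesis using moll_facts(1)[OF eta(1), of n "x - y"] by (simp add: mult_left_mono)
     qed (simp add: mz[OF x])
    qed
   qed
   also have "... = M" using moll_facts(9)[OF eta(1), of n x] by simp
   finally show ?thesis .
  qed
  show "?d n x <.> e = 0" if M: "AE x in lborel. x : V --> g x <.> e = 0" and x: "x : K" for e n x
  proof -
   have i: "integrable lborel (%y. moll (eta n) (x - y) *R gt y)" by (rule mollify_integrable[OF eta(1) igt])
   have "?d n x <.> e = (LI y. (moll (eta n) (x - y) *R gt y) <.> e)"
    unfolding mollify_def by (rule integral_inner_left[symmetric]) (rule i)
   also have "... = (LINT y|(lborel::'a measure). 0)"
   proof (rule integral_cong_AE)
    show "AE y in lborel. (moll (eta n) (x - y) *R gt y) <.> e = 0"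
     using M
    proof eventually_elim
     case (elim y)
     then show ?case using K2V by (cases "y : K2") (auto simp: ftK ft0)
    qed
    have "integrable lborel (%y. (moll (eta n) (x - y) *R gt y) <.> e)" using i by (rule integrable_inner_left)
    then show "(%y. (moll (eta n) (x - y) *R gt y) <.> e) : borel_measurable lborel" by (rule borel_measurable_integrable)
   qed simp
   finally show ?thesis by simp
  qed
 qed
qed

lemma lborel_continuous_AE_eq:
 fixes f g :: "'a::euclidean_space => 'b::t2_space"
 assumes "continuous_on UNIV f" "continuous_on UNIV g" "AE x in lborel. f x = g x"
 shows "f = g"
proof (rule ccontr)
 assume "f ~= g"
 then obtain x where x: "f x ~= g x" by auto
 have "open {x. f x ~= g x}" by (rule open_Collect_neq[OF assms(1,2)])
 then obtain r where r: "r > 0" "ball x r <= {x. f x ~= g x}" using x by (auto simp: open_contains_ball)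
 have "AE y in lborel. y ~: ball x r" using assms(3) by eventually_elim (use r in auto)
 then have "emeasure lborel (ball x r) = 0" by (subst (asm) AE_iff_null_sets[symmetric]) auto
 then show False using content_ball_pos[OF r(1), of x] by (simp add: measure_def)
qed

text \<open>Mollifications are \<open>M\<close>-Lipschitz on balls and converge almost everywhere
  along a subsequence. Hence \<open>f\<close> is \<open>M\<close>-Lipschitz off a null set; the
  complement of that set is dense, so \<open>f\<close> extends from it.\<close>

lemma weak_gradient_lipschitz:
 fixes f :: "'a::euclidean_space => real"
 assumes wg: "weak_gradient_on UNIV f g" and M: "AE x in lborel. norm (g x) <= M" "M >= 0"
 shows "\<exists>f'. M-lipschitz_on UNIV f' & (AE x in lborel. f x = f' x)"
proof -
 have step: "\<exists>N\<in>null_sets lborel. \<forall>x\<in>cball 0 R - N. \<forall>y\<in>cball 0 R - N. \<bar>f x - f y\<bar> <= M * norm (x - y)" for R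
 proof -
  let ?K = "cball (0::'a) R"
  obtain F DF d where F: "!!n x. (F n has_derivative DF n x) (at x)"
   "!!n x h. x : ?K ==> DF n x h = h <.> d n x"
   "!!e. e > 0 ==> \<forall>\<^sub>F n in sequentially. (NNI x. ennreal (indicator ?K x * norm (F n x - f x))) <= ennreal e"
   "!!M n x. (AE x in lborel. x : UNIV --> norm (g x) <= M) ==> x : ?K ==> norm (d n x) <= M"
   by (rule weak_gradient_approx[OF wg open_UNIV compact_cball[of "0::'a" R] subset_UNIV]) blast
  have dM: "norm (d n x) <= M" if "x : ?K" for n x using F(4)[OF _ that] M by simp
  have lip: "\<bar>F n x - F n y\<bar> <= M * norm (x - y)" if "x : ?K" "y : ?K" for n x y
  proof -
   have "norm (F n x - F n y) <= M * norm (x - y)"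
   proof (rule differentiable_bound[where S="?K" and f'="DF n"])
    fix z assume z: "z : ?K"
    show "(F n has_derivative DF n z) (at z within ?K)" by (rule has_derivative_at_withinI[OF F(1)])
    show "onorm (DF n z) <= M"
    proof (rule onorm_le)
     fix h show "norm (DF n z h) <= M * norm h"
      using Cauchy_Schwarz_ineq2[of h "d n z"] mult_left_mono[OF dM[OF z] norm_ge_zero[of h], of n] by (simp add: F(2)[OF z] mult.commute)
    qed
   qed (use that in auto)
   then show ?thesis by simp
  qed
  define u where "u n x = indicator ?K x * (F n x - f x)" for n x
  have cF: "continuous_on UNIV (F n)" for n using F(1) by (meson has_derivative_continuous continuous_at_imp_continuous_on)
  have ifK: "integrable lborel (%x. indicator ?K x *R f x)"
   using wg compact_cball unfolding weak_gradient_on_def locally_integrable_on_def set_integrable_def by blast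
  have iFK: "integrable lborel (%x. indicator ?K x *R F n x)" for n
   by (rule borel_integrable_compact) (auto intro: continuous_on_subset[OF cF])
  have iu: "integrable lborel (u n)" for n
   unfolding u_def right_diff_distrib using ifK iFK[of n] by simp
  have "(%n. LI x. norm (u n x)) ----> 0"
   unfolding LIMSEQ_iff
  proof (intro allI impI)
   fix e :: real assume e: "e > 0"
   have "\<forall>\<^sub>F n in sequentially. (LI x. norm (u n x)) < e"
    using F(3)[OF half_gt_zero[OF e]]
   proof eventually_elim
    case (elim n)
    have "(NNI x. ennreal (norm (u n x))) = ennreal (LI x. norm (u n x))"
     by (rule nn_integral_eq_integral) (use iu in auto)
    moreover have "(%x. norm (u n x)) = (%x. indicator ?K x * norm (F n x - f x))" by (auto simp: u_def abs_mult)
    ultimately have "ennreal (LI x. norm (u n x)) <= ennreal (e/2)" using elim by metis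
    then show ?case using e by (simp add: ennreal_le_iff)
   qed
   then show "\<exists>no. \<forall>n\<ge>no. norm ((LI x. norm (u n x)) - 0) < e" by (auto simp: eventually_sequentially)
  qed
  from tendsto_L1_AE_subseq[OF iu this] obtain r where r: "strict_mono (r :: nat => nat)" "AE x in lborel. (%n. u (r n) x) ----> 0"
   by blast
  then obtain N where N: "N : null_sets lborel" "{x. \<not> (%n. u (r n) x) ----> 0} <= N" by (auto simp: eventually_ae_filter)
  have lim: "(%n. F (r n) x) ----> f x" if "x : ?K - N" for x
  proof -
   have "(%n. u (r n) x) ----> 0" using N(2) that by blast
   moreover have "u (r n) x = F (r n) x - f x" for n using that by (auto simp: u_def)
   ultimately show ?thesis by (simp add: LIM_zero_iff)
  qed
  show ?thesis
  proof (intro bexI[of _ N] ballI N(1))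
   fix x y assume xy: "x : ?K - N" "y : ?K - N"
   have "(%n. \<bar>F (r n) x - F (r n) y\<bar>) ----> \<bar>f x - f y\<bar>" by (intro tendsto_intros lim xy)
   then show "\<bar>f x - f y\<bar> <= M * norm (x - y)" by (rule LIMSEQ_le_const2) (use lip xy in blast)
  qed
 qed
 then have "\<forall>k::nat. \<exists>N. N : null_sets lborel & (\<forall>x\<in>cball 0 (real k) - N. \<forall>y\<in>cball 0 (real k) - N. \<bar>f x - f y\<bar> <= M * norm (x - y))"
  by blast
 then obtain N where N: "!!k. N k : null_sets lborel" "!!k x y. x : cball 0 (real k) - N k ==> y : cball 0 (real k) - N k ==> \<bar>f x - f y\<bar> <= M * norm (x - y)"
  unfolding choice_iff by blast
 define D where "D = - (\<Union>k. N k)"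
 have nullU: "(\<Union>k. N k) : null_sets lborel" using N(1) by (intro null_sets_UN) auto
 have "M-lipschitz_on D f"
 proof (rule lipschitz_onI[OF _ M(2)])
  fix x y assume xy: "x : D" "y : D"
  obtain k where "max (norm x) (norm y) <= real k" using real_arch_simple by blast
  then show "dist (f x) (f y) <= M * dist x y" using N(2)[of x k y] xy by (auto simp: D_def dist_norm)
 qed
 from lipschitz_extend_closure[OF this] obtain f' where f': "M-lipschitz_on (closure D) f'" "\<forall>x\<in>D. f' x = f x" by blast
 have "closure D = UNIV"
 proof -
  have "interior (\<Union>k. N k) = {}"
  proof (rule ccontr)
   assume "interior (\<Union>k. N k) ~= {}"
   then obtain x r where r: "r > 0" "ball x r <= (\<Union>k. N k)" by (auto simp: mem_interior)
   have "ball x r : null_sets lborel" by (rule null_sets_subset[OF nullU _ r(2)]) simp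
   then have "emeasure lborel (ball x r) = 0" by auto
   then show False using content_ball_pos[OF r(1), of x] by (simp add: measure_def)
  qed
  then show ?thesis using closure_complement[of "\<Union>k. N k"] by (simp only: D_def) simp
 qed
 moreover have "AE x in lborel. f x = f' x"
  using AE_not_in[OF nullU] by eventually_elim (use f'(2) in \<open>auto simp: D_def\<close>)
 ultimately show ?thesis using f'(1) by auto
qed

text \<open>Mollification preserves the vanishing of the component along the segment, so the
  approximants are constant on it. Once characteristics have been straightened, this is how a weak
  solution is seen to be constant along them.\<close>

lemma weak_gradient_zero_const:
 fixes f :: "'a::euclidean_space => real"
 assumes wg: "weak_gradient_on V f g" and V: "open V" and cf: "continuous_on V f"
  and g0: "AE x in lborel. x : V --> g x <.> (y - x0) = 0" and seg: "closed_segment x0 y <= V"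
 shows "f y = f x0"
proof -
 obtain F DF d where F: "!!n x. (F n has_derivative DF n x) (at x)"
   "!!n x h. x : closed_segment x0 y ==> DF n x h = h <.> d n x"
   "!!x. x : closed_segment x0 y ==> (%n. F n x) ----> f x"
   "!!e n x. (AE x in lborel. x : V --> g x <.> e = 0) ==> x : closed_segment x0 y ==> d n x <.> e = 0"
  by (rule weak_gradient_approx[OF wg V compact_segment seg]) (use cf in blast)
 have "F n y = F n x0" for n
 proof -
  have "((%t. F n (x0 + t *R (y - x0))) has_vector_derivative 0) (at t within {0..1})" if t: "t : {0..1}" for t
  proof -
   let ?z = "x0 + t *R (y - x0)"
   have z: "?z : closed_segment x0 y" using t by (auto simp: in_segment algebra_simps intro!: exI[of _ t])
   have "((%t. x0 + t *R (y - x0)) has_derivative (%r. r *R (y - x0))) (at t within {0..1})" by (auto intro!: derivative_eq_intros)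
   from has_derivative_compose[OF this F(1)]
   have "((%t. F n (x0 + t *R (y - x0))) has_derivative (%r. DF n ?z (r *R (y - x0)))) (at t within {0..1})" .
   moreover have "(%r. DF n ?z (r *R (y - x0))) = (%r. r *R 0)"
    using F(4)[OF g0 z, of n] by (auto simp: F(2)[OF z] inner_commute)
   ultimately show ?thesis by (simp add: has_vector_derivative_def)
  qed
  then have "\<exists>c. \<forall>t\<in>{0..1}. F n (x0 + t *R (y - x0)) = c"
   by (metis has_vector_derivative_zero_constant convex_closed_interval[of "0::real" 1, simplified cbox_interval])
  then obtain c where c: "!!t. t : {0..1} ==> F n (x0 + t *R (y - x0)) = c" by blast
  from c[of 0] c[of 1] show ?thesis by simp
 qed
 then have "(%n. F n x0) ----> f y" using F(3)[of y] by simp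
 then show ?thesis using F(3)[of x0] LIMSEQ_unique by fastforce
qed

text \<open>The hypothesis \<open>push\<close> replaces a change of variables: it transfers
  smallness in the mean from the target to the source. In this form \<open>Psi\<close> may lower the
  dimension, as the map from space-time to initial points does. The new gradient is the transpose of
  \<open>DPsi\<close> applied to \<open>g\<close>.\<close>

lemma weak_gradient_compose:
 fixes f :: "'b::euclidean_space => real" and Psi :: "'a::euclidean_space => 'b"
 assumes wg: "weak_gradient_on V f g" and U: "open U" and V: "open V"
  and dPsi: "!!x. x : U ==> (Psi has_derivative DPsi x) (at x)" and cDPsi: "!!h. continuous_on U (%x. DPsi x h)"
  and UV: "Psi ` U <= V"
  and push: "!!K. compact K ==> K <= U ==> \<exists>C. \<forall>h. h : bmeas -->
   (NNI x. indicator K x * h (Psi x)) <= ennreal C * (NNI y. h y)"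
 shows "weak_gradient_on U (%x. f (Psi x)) (%x. \<Sum>e\<in>Basis. (g (Psi x) <.> DPsi x e) *R e)"
proof -
 let ?g = "%e x. g (Psi x) <.> DPsi x e"
 have cPsi: "continuous_on U Psi" using dPsi by (meson has_derivative_continuous continuous_at_imp_continuous_on)
 have push_int: "integrable lborel (%x. indicator K x * (w x * u (Psi x)))"
  if K: "compact K" "K <= U" and w: "continuous_on K w" and u: "set_integrable lborel (Psi ` K) u" for K w and u :: "'b => real"
 proof -
  have KPsi: "compact (Psi ` K)" using compact_continuous_image[OF continuous_on_subset[OF cPsi K(2)] K(1)] .
  \<comment> \<open>Measurability of the composition is obtained from Borel functions cut off by
    indicators, since \<open>Psi\<close> is continuous on \<open>U\<close> only and \<open>u\<close>
    is integrable on the image of \<open>K\<close> only.\<close>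
  have "(%x. indicator K x *R Psi x) : bmeas"
   using K by (intro borel_measurable_continuous_on_indicator continuous_on_subset[OF cPsi]) (auto simp: borel_compact)
  moreover have "(%x. indicator K x *R w x) : bmeas"
   using K w by (intro borel_measurable_continuous_on_indicator) (auto simp: borel_compact)
  moreover have um: "(%y. indicator (Psi ` K) y *R u y) : bmeas" using u by (auto simp: set_integrable_def)
  ultimately have "(%x. (indicator K x *R w x) * ((%y. indicator (Psi ` K) y *R u y) (indicator K x *R Psi x))) : bmeas"
   by measurable
  moreover have "(%x. (indicator K x *R w x) * ((%y. indicator (Psi ` K) y *R u y) (indicator K x *R Psi x))) = (%x. indicator K x * (w x * u (Psi x)))"
   by (auto simp: indicator_def)
  ultimately have m: "(%x. indicator K x * (w x * u (Psi x))) : bmeas" by simp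
  obtain W where W: "W >= 0" "!!x. x : K ==> \<bar>w x\<bar> <= W"
   using compact_imp_bounded[OF compact_continuous_image[OF w K(1)]] by (auto simp: bounded_iff) (metis abs_ge_zero order_trans)
  obtain C where C: "!!h. h : bmeas ==> (NNI x. indicator K x * h (Psi x)) <= ennreal C * (NNI y. h y)"
   using push[OF K] by blast
  define v where "v y = indicator (Psi ` K) y *R u y" for y
  have [measurable]: "v : bmeas" using um by (simp add: v_def[abs_def])
  show "integrable lborel (%x. indicator K x * (w x * u (Psi x)))"
  proof (rule integrableI_bounded)
   have "(NNI x. ennreal (norm (indicator K x * (w x * u (Psi x))))) <= (NNI x. indicator K x * (ennreal W * ennreal (norm (v (Psi x)))))"
   proof (rule nn_integral_mono)
    fix x show "ennreal (norm (indicator K x * (w x * u (Psi x)))) <= indicator K x * (ennreal W * ennreal (norm (v (Psi x))))"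
     using W by (auto simp: v_def indicator_def abs_mult ennreal_mult[symmetric] intro!: ennreal_leI mult_right_mono)
   qed
   also have "... <= ennreal C * (NNI y. ennreal W * ennreal (norm (v y)))" by (rule C) measurable
   also have "(NNI y. ennreal W * ennreal (norm (v y))) = ennreal W * (NNI y. norm (v y))"
    by (intro nn_integral_cmult) measurable
   also have "(NNI y. norm (v y)) < \<infinity>"
    using u unfolding set_integrable_def integrable_iff_bounded v_def by blast
   then have "ennreal C * (ennreal W * (NNI y. norm (v y))) < \<infinity>"
    by (simp add: ennreal_mult_less_top less_top)
   finally show "(NNI x. ennreal (norm (indicator K x * (w x * u (Psi x))))) < \<infinity>" .
  qed (use m in simp)
 qed
 have push_lim: "(%n. LI x. indicator K x * (w x * u n (Psi x))) ----> (LI x. indicator K x * (w x * v (Psi x)))"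
  if K: "compact K" "K <= U" and w: "continuous_on K w"
   and u: "!!n. set_integrable lborel (Psi ` K) (u n)" and v: "set_integrable lborel (Psi ` K) v"
   and lim: "!!e. e > 0 ==> \<forall>\<^sub>F n in sequentially. (NNI y. ennreal (indicator (Psi ` K) y * norm (u n y - v y))) <= ennreal e"
  for K w and u :: "nat => 'b => real" and v
  unfolding LIMSEQ_iff
 proof (intro allI impI)
  fix r :: real assume r: "r > 0"
  obtain W where W: "W > 0" "!!x. x : K ==> \<bar>w x\<bar> <= W"
   using compact_imp_bounded[OF compact_continuous_image[OF w K(1)]] by (auto simp: bounded_pos)
  obtain C0 where C0: "!!h. h : bmeas ==> (NNI x. indicator K x * h (Psi x)) <= ennreal C0 * (NNI y. h y)"
   using push[OF K] by blast
  define C where "C = max C0 1"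
  have C: "(NNI x. indicator K x * h (Psi x)) <= ennreal C * (NNI y. h y)" if "h : bmeas" for h
   by (rule order_trans[OF C0[OF that]]) (auto simp: C_def intro!: mult_right_mono ennreal_leI)
  have C1: "C >= 1" by (simp add: C_def)
  define e where "e = r / (2 * (W * C))"
  have e: "e > 0" using r W C1 by (simp add: e_def)
  have "\<forall>\<^sub>F n in sequentially. norm ((LI x. indicator K x * (w x * u n (Psi x))) - (LI x. indicator K x * (w x * v (Psi x)))) < r"
   using lim[OF e]
  proof eventually_elim
   case (elim n)
   let ?D = "%x. indicator K x * (w x * (u n (Psi x) - v (Psi x)))"
   let ?h = "%y. ennreal (indicator (Psi ` K) y * norm (u n y - v y))"
   have iu: "integrable lborel (%x. indicator K x * (w x * u n (Psi x)))" and iv: "integrable lborel (%x. indicator K x * (w x * v (Psi x)))"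
    by (rule push_int[OF K w u] push_int[OF K w v])+
   have eqD: "?D = (%x. indicator K x * (w x * u n (Psi x)) - indicator K x * (w x * v (Psi x)))"
    by (auto simp: algebra_simps)
   have iD: "integrable lborel ?D" unfolding eqD using iu iv by (rule Bochner_Integration.integrable_diff)
   define w1 where "w1 y = indicator (Psi ` K) y *R u n y" for y
   define w2 where "w2 y = indicator (Psi ` K) y *R v y" for y
   have [measurable]: "w1 : bmeas" "w2 : bmeas"
    using u[of n] v by (auto simp: set_integrable_def w1_def[abs_def] w2_def[abs_def] dest!: borel_measurable_integrable)
   have "(%y. ennreal (norm (w1 y - w2 y))) : bmeas" by measurable
   moreover have "(%y. ennreal (norm (w1 y - w2 y))) = ?h"
    by (auto simp: indicator_def w1_def w2_def)
   ultimately have hm: "?h : bmeas" by (simp only:)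
   have "ennreal (norm (LI x. ?D x)) <= (NNI x. ennreal (norm (?D x)))" by (rule integral_norm_bound_ennreal[OF iD])
   also have "... <= (NNI x. indicator K x * (ennreal W * ?h (Psi x)))"
   proof (rule nn_integral_mono)
    fix x show "ennreal (norm (?D x)) <= indicator K x * (ennreal W * ?h (Psi x))"
     using W by (auto simp: indicator_def abs_mult ennreal_mult[symmetric] intro!: ennreal_leI mult_right_mono)
   qed
   also have "... <= ennreal C * (NNI y. ennreal W * ?h y)" by (rule C) (use hm in measurable)
   also have "... = ennreal C * (ennreal W * (NNI y. ?h y))" using hm by (simp add: nn_integral_cmult)
   also have "... <= ennreal C * (ennreal W * ennreal e)" using elim by (intro mult_left_mono) auto
   also have "... = ennreal (C * (W * e))" using C1 W e by (simp add: ennreal_mult)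
   finally have "norm (LI x. ?D x) <= C * (W * e)" using C1 W e by (simp add: ennreal_le_iff)
   also have "... = r / 2" using C1 W by (simp add: e_def)
   finally have "norm (LI x. ?D x) < r" using r by simp
   then show ?case unfolding eqD using iu iv by simp
  qed
  then show "\<exists>no. \<forall>n\<ge>no. norm ((LI x. indicator K x * (w x * u n (Psi x))) - (LI x. indicator K x * (w x * v (Psi x)))) < r"
   by (auto simp: eventually_sequentially)
 qed
 have li: "set_integrable lborel K f" "set_integrable lborel K g" if "compact K" "K <= V" for K
  using wg that unfolding weak_gradient_on_def locally_integrable_on_def by auto
 have lib: "set_integrable lborel K (%y. u y <.> b)" if "set_integrable lborel K u" for K b and u :: "'b => 'b"
  using integrable_inner_left[of b lborel "%x. indicator K x *R u x"] that unfolding set_integrable_def by simp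
 have imK: "compact (Psi ` K)" "Psi ` K <= V" if "compact K" "K <= U" for K
  using compact_continuous_image[OF continuous_on_subset[OF cPsi that(2)] that(1)] UV that by auto
 have gD: "g (Psi x) <.> DPsi x e = (\<Sum>b\<in>Basis. (DPsi x e <.> b) * (g (Psi x) <.> b))" for x e
  by (subst euclidean_inner) (simp add: mult.commute)
 have cDb: "continuous_on K (%x. w x * (DPsi x e <.> b))" if "K <= U" "continuous_on K w" for K e b and w :: "'a => real"
  using that by (intro continuous_intros continuous_on_subset[OF cDPsi])
 have intG: "integrable lborel (%x. indicator K x * (w x * ?g e x))"
  and sumG: "(LI x. indicator K x * (w x * ?g e x)) = (\<Sum>b\<in>Basis. LI x. indicator K x * ((w x * (DPsi x e <.> b)) * (g (Psi x) <.> b)))"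
  if K: "compact K" "K <= U" and w: "continuous_on K w" for K e w
 proof -
  have eq: "indicator K x * (w x * ?g e x) = (\<Sum>b\<in>Basis. indicator K x * ((w x * (DPsi x e <.> b)) * (g (Psi x) <.> b)))" for x
   unfolding gD by (simp add: sum_distrib_left mult.assoc)
  have i: "integrable lborel (%x. indicator K x * ((w x * (DPsi x e <.> b)) * (g (Psi x) <.> b)))" for b
   by (rule push_int[OF K cDb[OF K(2) w] lib[OF li(2)[OF imK[OF K]]]])
  show "integrable lborel (%x. indicator K x * (w x * ?g e x))" unfolding eq by (intro Bochner_Integration.integrable_sum i)
  show "(LI x. indicator K x * (w x * ?g e x)) = (\<Sum>b\<in>Basis. LI x. indicator K x * ((w x * (DPsi x e <.> b)) * (g (Psi x) <.> b)))"
   unfolding eq by (intro Bochner_Integration.integral_sum i)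
 qed
 let ?G = "%x. \<Sum>e\<in>Basis. ?g e x *R e"
 have Ge: "?G x <.> e = g (Psi x) <.> DPsi x e" if "e : Basis" for x e
  using that by (simp add: inner_sum_left_Basis)
 show ?thesis
  unfolding weak_gradient_on_def
 proof (intro conjI allI impI)
  show "locally_integrable_on U (%x. f (Psi x))"
   unfolding locally_integrable_on_def set_integrable_def
  proof (intro allI impI)
   fix K assume K: "compact K & K <= U"
   then have "integrable lborel (%x. indicator K x * ((%_. 1) x * f (Psi x)))"
    by (intro push_int li(1) imK) auto
   then show "integrable lborel (%x. indicator K x *R f (Psi x))" by simp
  qed
  show "locally_integrable_on U ?G"
   unfolding locally_integrable_on_def set_integrable_def
  proof (intro allI impI)
   fix K assume K: "compact K & K <= U"
   have "integrable lborel (%x. (indicator K x * ((%_. 1) x * ?g e x)) *R e)" for e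
    using K by (intro integrable_scaleR_left intG) auto
   then have "integrable lborel (%x. \<Sum>e\<in>Basis. (indicator K x * ((%_. 1) x * ?g e x)) *R e)"
    by (intro Bochner_Integration.integrable_sum)
   then show "integrable lborel (%x. indicator K x *R ?G x)" by (simp add: scaleR_sum_right)
  qed
  fix phi :: "'a => real" and D :: "'a => 'a"
  assume asm: "(\<forall>x. GDERIV phi x :> D x) & continuous_on UNIV D & compact (closure (support_on UNIV phi)) & closure (support_on UNIV phi) <= U"
  define K where "K = closure (support_on UNIV phi)"
  have K: "compact K" "K <= U" using asm by (auto simp: K_def)
  have dphi: "(phi has_derivative (%h. h <.> D x)) (at x)" for x using asm by (simp add: gderiv_def)
  have cD: "continuous_on S D" for S using asm continuous_on_subset by blast
  have cphi: "continuous_on S phi" for S using dphi by (meson has_derivative_continuous continuous_at_imp_continuous_on)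
  have phi0: "phi x = 0" if "x ~: K" for x
   using that closure_subset[of "support_on UNIV phi"] by (auto simp: K_def in_support_on)
  have D0: "D x = 0" if "x ~: K" for x
  proof -
   have "(phi has_derivative (%_. 0)) (at x)"
    by (rule has_derivative_transform_within_open[where s="- K" and f="%_. 0"])
      (use K that phi0 in \<open>auto simp: open_Compl compact_imp_closed\<close>)
   then have "(%h. h <.> D x) = (%_. 0)" using has_derivative_unique[OF dphi] by blast
   then show ?thesis using inner_eq_zero_iff by metis
  qed
  obtain F DF d where F: "!!n x. (F n has_derivative DF n x) (at x)"
   "!!n h. continuous_on UNIV (%x. DF n x h)"
   "!!n x h. x : Psi ` K ==> DF n x h = h <.> d n x"
   "!!n. set_integrable lborel (Psi ` K) (d n)"
   "!!e. e > 0 ==> \<forall>\<^sub>F n in sequentially. (NNI x. ennreal (indicator (Psi ` K) x * norm (F n x - f x))) <= ennreal e"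
   "!!e. e > 0 ==> \<forall>\<^sub>F n in sequentially. (NNI x. ennreal (indicator (Psi ` K) x * norm (d n x - g x))) <= ennreal e"
   by (rule weak_gradient_approx[OF wg V imK[OF K]]) blast
 let ?d = "%n e x. phi x * (d n (Psi x) <.> DPsi x e)"
  have cF: "continuous_on S (F n)" for S n using F(1) by (meson has_derivative_continuous continuous_at_imp_continuous_on)
  have iF: "set_integrable lborel (Psi ` K) (F n)" for n
   unfolding set_integrable_def by (rule borel_integrable_compact[OF imK(1)[OF K] cF])
  have main: "(LI x. indicator K x * ((e <.> D x) * f (Psi x))) + (LI x. indicator K x * (phi x * ?g e x)) = 0" for e
  proof -
   have ibp: "(LI x. indicator K x * ((e <.> D x) * F n (Psi x))) + (LI x. indicator K x * ?d n e x) = 0" for n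
   proof -
    \<comment> \<open>Extension of the product by 0 outside \<open>U\<close> keeps it
      differentiable, because \<open>phi\<close> has its support in the compact set \<open>K\<close>
      inside \<open>U\<close>.\<close>
    define psi where "psi x = (if x : U then phi x * F n (Psi x) else 0)" for x
    define Dpsi where "Dpsi x h = (if x : U then (h <.> D x) * F n (Psi x) + phi x * DF n (Psi x) (DPsi x h) else 0)" for x h
    have der: "(psi has_derivative Dpsi x) (at x)" for x
    proof (cases "x : U")
     case True
     have "((%x. phi x * F n (Psi x)) has_derivative (%h. phi x * DF n (Psi x) (DPsi x h) + (h <.> D x) * F n (Psi x))) (at x)"
      by (rule has_derivative_mult[OF dphi has_derivative_compose[OF dPsi[OF True] F(1)]])
     moreover have "Dpsi x = (%h. phi x * DF n (Psi x) (DPsi x h) + (h <.> D x) * F n (Psi x))" using True by (auto simp: Dpsi_def)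
     ultimately have "((%x. phi x * F n (Psi x)) has_derivative Dpsi x) (at x)" by simp
     then show ?thesis by (rule has_derivative_transform_within_open[OF _ U True]) (simp add: psi_def)
    next
     case False
     have "(psi has_derivative (%_. 0)) (at x)"
      by (rule has_derivative_transform_within_open[where s="- K" and f="%_. 0"])
        (use K False phi0 in \<open>auto simp: open_Compl compact_imp_closed psi_def\<close>)
     moreover have "Dpsi x = (%_. 0)" using False by (auto simp: Dpsi_def)
     ultimately show ?thesis by simp
    qed
    have cont: "continuous_on UNIV (%x. Dpsi x e)"
    proof -
     have lin: "linear (DF n y)" for y using F(1) has_derivative_linear by blast
     have ex: "DF n y k = (\<Sum>b\<in>Basis. (k <.> b) * DF n y b)" for y k
     proof -
      have "DF n y k = DF n y (\<Sum>b\<in>Basis. (k <.> b) *R b)" by (simp add: euclidean_representation)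
      also have "... = (\<Sum>b\<in>Basis. (k <.> b) * DF n y b)" by (simp only: linear_sum[OF lin] linear_scale[OF lin] real_scaleR_def)
      finally show ?thesis .
     qed
     have "continuous_on U (%x. (e <.> D x) * F n (Psi x) + phi x * (\<Sum>b\<in>Basis. (DPsi x e <.> b) * DF n (Psi x) b))"
      by (intro continuous_intros cD cphi cDPsi continuous_on_compose2[OF cF cPsi] continuous_on_compose2[OF F(2) cPsi]) auto
     then have 1: "continuous_on U (%x. Dpsi x e)"
      by (rule continuous_on_eq) (simp add: Dpsi_def ex[symmetric])
     have 2: "continuous_on (- K) (%x. Dpsi x e)"
      by (rule continuous_on_eq[of _ "%_. 0"]) (auto simp: Dpsi_def phi0 D0)
     have "continuous_on (U \<union> - K) (%x. Dpsi x e)"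
      using 1 2 K by (intro continuous_on_open_Un U) (auto simp: open_Compl compact_imp_closed)
     moreover have "U \<union> - K = UNIV" using K by auto
     ultimately show ?thesis by simp
    qed
    have "(LI x. Dpsi x e) = 0"
     by (rule integral_derivative_compact_support(2)[OF der cont K(1)]) (simp add: psi_def phi0)
    moreover have "Dpsi x e = indicator K x * ((e <.> D x) * F n (Psi x)) + indicator K x * ?d n e x" for x
     using K by (cases "x : K") (auto simp: Dpsi_def F(3) phi0 D0 inner_commute)
    moreover have "integrable lborel (%x. indicator K x * ((e <.> D x) * F n (Psi x)))"
     by (rule push_int[OF K _ iF]) (intro continuous_intros cD)
    moreover have "integrable lborel (%x. indicator K x * ?d n e x)"
    proof -
     have eq: "indicator K x * ?d n e x = (\<Sum>b\<in>Basis. indicator K x * ((phi x * (DPsi x e <.> b)) * (d n (Psi x) <.> b)))" for x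
      by (subst euclidean_inner) (simp add: sum_distrib_left mult_ac)
     show ?thesis unfolding eq by (intro Bochner_Integration.integrable_sum push_int[OF K cDb[OF K(2) cphi]] lib F(4))
    qed
    ultimately show ?thesis by simp
   qed
   have l1: "(%n. LI x. indicator K x * ((e <.> D x) * F n (Psi x))) ----> (LI x. indicator K x * ((e <.> D x) * f (Psi x)))"
    by (rule push_lim[OF K _ iF li(1)[OF imK[OF K]] F(5)]) (intro continuous_intros cD)
   have l2: "(%n. LI x. indicator K x * ?d n e x) ----> (LI x. indicator K x * (phi x * ?g e x))"
   proof -
    have eq: "indicator K x * ?d n e x = (\<Sum>b\<in>Basis. indicator K x * ((phi x * (DPsi x e <.> b)) * (d n (Psi x) <.> b)))" for x n
     by (subst euclidean_inner) (simp add: sum_distrib_left mult_ac)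
    have seq: "(LI x. indicator K x * ?d n e x) = (\<Sum>b\<in>Basis. LI x. indicator K x * ((phi x * (DPsi x e <.> b)) * (d n (Psi x) <.> b)))" for n
     unfolding eq by (intro Bochner_Integration.integral_sum push_int[OF K cDb[OF K(2) cphi]] lib F(4))
    show ?thesis unfolding seq sumG[OF K cphi]
    proof (intro tendsto_sum push_lim[OF K cDb[OF K(2) cphi]] lib F(4) li(2) imK K)
     fix b :: 'b and r :: real assume b: "b : Basis" and r: "r > 0"
     show "\<forall>\<^sub>F n in sequentially. (NNI y. ennreal (indicator (Psi ` K) y * norm (d n y <.> b - g y <.> b))) <= ennreal r"
      using F(6)[OF r]
     proof eventually_elim
      case (elim n)
      have "(NNI y. ennreal (indicator (Psi ` K) y * norm (d n y <.> b - g y <.> b))) <= (NNI y. ennreal (indicator (Psi ` K) y * norm (d n y - g y)))"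
       using b by (intro nn_integral_mono ennreal_leI mult_left_mono) (auto simp: inner_diff_left[symmetric] Basis_le_norm)
      then show ?case using elim by simp
     qed
    qed
   qed
   have "(%n. (LI x. indicator K x * ((e <.> D x) * F n (Psi x))) + (LI x. indicator K x * ?d n e x)) ---->
    (LI x. indicator K x * ((e <.> D x) * f (Psi x))) + (LI x. indicator K x * (phi x * ?g e x))"
    by (intro tendsto_add l1 l2)
   then show ?thesis by (simp add: ibp LIMSEQ_const_iff)
  qed
  show "(LINT x:U|lborel. f (Psi x) *R D x) = - (LINT x:U|lborel. phi x *R ?G x)"
  proof (rule euclidean_eqI)
   fix e :: 'a assume e: "e : Basis"
   have i1: "integrable lborel (%x. indicator U x *R (f (Psi x) *R D x))"
   proof -
    have "integrable lborel (%x. (indicator K x * ((b <.> D x) * f (Psi x))) *R b)" for b :: 'a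
     by (intro integrable_scaleR_left push_int[OF K] li(1) imK K continuous_intros cD)
    then have "integrable lborel (%x. \<Sum>b\<in>Basis. (indicator K x * ((b <.> D x) * f (Psi x))) *R b)" by (intro Bochner_Integration.integrable_sum)
    moreover have "(\<Sum>b\<in>Basis. (indicator K x * ((b <.> D x) * f (Psi x))) *R b) = indicator U x *R (f (Psi x) *R D x)" for x
    proof (cases "x : K")
     case True
     have "(\<Sum>b\<in>Basis. ((b <.> D x) * f (Psi x)) *R b) = f (Psi x) *R (\<Sum>b\<in>Basis. (D x <.> b) *R b)"
      by (simp add: scaleR_sum_right inner_commute mult.commute)
     then show ?thesis using True K by (auto simp: euclidean_representation)
    qed (simp add: D0)
    ultimately show ?thesis by simp
   qed
   have i2: "integrable lborel (%x. indicator U x *R (phi x *R ?G x))"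
   proof -
    have "integrable lborel (%x. \<Sum>b\<in>Basis. (indicator K x * (phi x * (g (Psi x) <.> DPsi x b))) *R b)"
     by (intro Bochner_Integration.integrable_sum integrable_scaleR_left intG K cphi)
    moreover have "(\<Sum>b\<in>Basis. (indicator K x * (phi x * (g (Psi x) <.> DPsi x b))) *R b) = indicator U x *R (phi x *R ?G x)" for x
     using K by (cases "x : K") (auto simp: phi0 scaleR_sum_right)
    ultimately show ?thesis by simp
   qed
   have "(LINT x:U|lborel. f (Psi x) *R D x) <.> e = (LI x. (indicator U x *R (f (Psi x) *R D x)) <.> e)"
    unfolding set_lebesgue_integral_def by (rule integral_inner_left[symmetric]) (rule i1)
   also have "... = (LI x. indicator K x * ((e <.> D x) * f (Psi x)))"
   proof (rule Bochner_Integration.integral_cong[OF refl])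
    fix x show "(indicator U x *R (f (Psi x) *R D x)) <.> e = indicator K x * ((e <.> D x) * f (Psi x))"
     using K by (cases "x : K") (auto simp: D0 inner_commute)
   qed
   finally have r1: "(LINT x:U|lborel. f (Psi x) *R D x) <.> e = (LI x. indicator K x * ((e <.> D x) * f (Psi x)))" .
   have "(LINT x:U|lborel. phi x *R ?G x) <.> e = (LI x. (indicator U x *R (phi x *R ?G x)) <.> e)"
    unfolding set_lebesgue_integral_def by (rule integral_inner_left[symmetric]) (rule i2)
   also have "... = (LI x. indicator K x * (phi x * ?g e x))"
   proof (rule Bochner_Integration.integral_cong[OF refl])
    fix x show "(indicator U x *R (phi x *R ?G x)) <.> e = indicator K x * (phi x * ?g e x)"
     using K Ge[OF e, of x] by (cases "x : K") (auto simp: phi0)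
   qed
   finally show "(LINT x:U|lborel. f (Psi x) *R D x) <.> e = (- (LINT x:U|lborel. phi x *R ?G x)) <.> e"
    using r1 main[of e] by simp
  qed
 qed
qed

section \<open>The Coulomb kernel and its regularisations\<close>

definition coulomb :: "R3 => R3"
 where "coulomb x = (1 / norm x ^ 3) *R x"

text \<open>The profile agrees with \<open>t powr (-3/2)\<close> for \<open>t \<ge> 1\<close>; below, it is the Taylor polynomial of degree 2 at 1,
  so that the regularised kernel is \<open>C\<^sup>2\<close> and equals the Coulomb kernel outside the unit ball.\<close>

definition prof :: "real => real"
 where "prof t = (if 1 <= t then t powr (-3/2) else 1 - 3/2 * (t - 1) + 15/8 * (t - 1)^2)"
definition prof1 :: "real => real"
 where "prof1 t = (if 1 <= t then -3/2 * t powr (-5/2) else -3/2 + 15/4 * (t - 1))"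
definition prof2 :: "real => real"
 where "prof2 t = (if 1 <= t then 15/4 * t powr (-7/2) else 15/4)"

lemma DERIV_glue:
 fixes f g :: "real => real"
 assumes f: "!!t. t >= a ==> (f has_real_derivative f' t) (at t)" and g: "!!t. t <= a ==> (g has_real_derivative g' t) (at t)"
  and eq: "f a = g a" "f' a = g' a"
 shows "((%t. if a <= t then f t else g t) has_real_derivative (if a <= t then f' t else g' t)) (at t)"
proof -
 consider "t > a" | "t < a" | "t = a" by linarith
 then show ?thesis
 proof cases
  case 1
  have "((%t. if a <= t then f t else g t) has_real_derivative f' t) (at t)"
   by (rule DERIV_cong_ev[THEN iffD1, OF refl _ refl f[of t]])
     (use 1 eventually_nhds_in_open[of "{a<..}" t] in \<open>auto elim!: eventually_mono\<close>)
  then show ?thesis using 1 by simp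
 next
  case 2
  have "((%t. if a <= t then f t else g t) has_real_derivative g' t) (at t)"
   by (rule DERIV_cong_ev[THEN iffD1, OF refl _ refl g[of t]])
     (use 2 eventually_nhds_in_open[of "{..<a}" t] in \<open>auto elim!: eventually_mono\<close>)
  then show ?thesis using 2 by simp
 next
  case 3
  have "((%t. if a <= t then f t else g t) has_derivative (*) (f' a)) (at a)"
   unfolding has_derivative_at_alt
  proof (intro conjI allI impI)
   show "bounded_linear ((*) (f' a))" by (rule bounded_linear_mult_right)
   fix e :: real assume e: "e > 0"
   obtain d1 where d1: "d1 > 0" "!!y. norm (y - a) < d1 ==> norm (f y - f a - f' a * (y - a)) <= e * norm (y - a)"
    using f[of a] e unfolding has_field_derivative_def has_derivative_at_alt by auto
   obtain d2 where d2: "d2 > 0" "!!y. norm (y - a) < d2 ==> norm (g y - g a - g' a * (y - a)) <= e * norm (y - a)"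
    using g[of a] e unfolding has_field_derivative_def has_derivative_at_alt by auto
   show "\<exists>d>0. \<forall>y. norm (y - a) < d --> norm ((if a <= y then f y else g y) - (if a <= a then f a else g a) - f' a * (y - a)) <= e * norm (y - a)"
   proof (intro exI[of _ "min d1 d2"] conjI allI impI)
    fix y assume y: "norm (y - a) < min d1 d2"
    show "norm ((if a <= y then f y else g y) - (if a <= a then f a else g a) - f' a * (y - a)) <= e * norm (y - a)"
    proof (cases "a <= y")
     case True
     then show ?thesis using d1(2)[of y] y by (simp only: if_True order_refl min_less_iff_conj)
    next
     case False
     then show ?thesis using d2(2)[of y] y by (simp only: if_True if_False order_refl min_less_iff_conj eq)
    qed
   qed (use d1 d2 in auto)
  qed
  then show ?thesis using 3 by (simp add: has_field_derivative_def)
 qed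
qed

lemma prof_deriv: "(prof has_real_derivative prof1 t) (at t)" "(prof1 has_real_derivative prof2 t) (at t)"
proof -
 have "((%t. if 1 <= t then t powr (-3/2) else 1 - 3/2 * (t - 1) + 15/8 * (t - 1)^2) has_real_derivative
  (if 1 <= t then -3/2 * t powr (-5/2) else -3/2 + 15/4 * (t - 1))) (at t)"
  by (rule DERIV_glue) (auto intro!: derivative_eq_intros simp: field_simps)
 then show "(prof has_real_derivative prof1 t) (at t)" by (simp add: prof_def[abs_def] prof1_def)
 have "((%t. if 1 <= t then -3/2 * t powr (-5/2) else -3/2 + 15/4 * (t - 1)) has_real_derivative
  (if 1 <= t then 15/4 * t powr (-7/2) else 15/4)) (at t)"
  by (rule DERIV_glue) (auto intro!: derivative_eq_intros simp: field_simps)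
 then show "(prof1 has_real_derivative prof2 t) (at t)" by (simp add: prof1_def[abs_def] prof2_def)
qed

lemma inner_powr: "norm x >= 1 ==> (x <.> x) powr (- (real k / 2)) = 1 / norm x ^ k" for x :: "'a::real_inner"
proof -
 assume x: "norm x >= 1"
 then have "norm x > 0" by linarith
 then have "(x <.> x) = norm x powr 2" by (simp add: power2_norm_eq_inner[symmetric])
 then have "(x <.> x) powr (- (real k / 2)) = (norm x powr 2) powr (- (real k / 2))" by (rule arg_cong)
 also have "... = norm x powr (- real k)" by (simp only: powr_powr) simp
 finally have "(x <.> x) powr (- (real k / 2)) = norm x powr (- real k)" .
 then show ?thesis using \<open>norm x > 0\<close> by (simp add: powr_minus_divide powr_realpow)
qed

lemma inner_ge1: "1 <= x <.> x \<longleftrightarrow> 1 <= norm x" for x :: "'a::real_inner"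
 unfolding norm_eq_sqrt_inner by simp

lemma prof_norm:
 fixes x :: "'a::real_inner"
 shows "norm x >= 1 ==> prof (x <.> x) = 1 / norm x ^ 3" "norm x >= 1 ==> prof1 (x <.> x) = -3/2 / norm x ^ 5" "norm x >= 1 ==> prof2 (x <.> x) = 15/4 / norm x ^ 7"
  "norm x < 1 ==> \<bar>prof (x <.> x)\<bar> <= 5" "norm x < 1 ==> \<bar>prof1 (x <.> x)\<bar> <= 21/4" "norm x < 1 ==> \<bar>prof2 (x <.> x)\<bar> <= 15/4"
proof -
 show "norm x >= 1 ==> prof (x <.> x) = 1 / norm x ^ 3" using inner_powr[of x 3] by (simp add: prof_def inner_ge1)
 show "norm x >= 1 ==> prof1 (x <.> x) = -3/2 / norm x ^ 5" using inner_powr[of x 5] by (simp add: prof1_def inner_ge1)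
 show "norm x >= 1 ==> prof2 (x <.> x) = 15/4 / norm x ^ 7" using inner_powr[of x 7] by (simp add: prof2_def inner_ge1)
 assume x: "norm x < 1"
 then have "\<not> 1 <= x <.> x" by (simp add: inner_ge1)
 then have t: "x <.> x < 1" "0 <= x <.> x" by auto
 have "\<bar>1 - 3/2 * (y - 1) + 15/8 * (y - 1)^2\<bar> <= 5" if y: "0 <= y" "y < 1" for y :: real
 proof -
  have "(y - 1)^2 <= 1^2" using y by (intro power2_le_iff_abs_le[THEN iffD2]) auto
  moreover have "0 <= (y - 1)^2" by simp
  moreover have "1 - 3/2 * (y - 1) + 15/8 * z <= 5" "- (1 - 3/2 * (y - 1) + 15/8 * z) <= 5" if "0 <= z" "z <= 1" for z
   using y that by (simp_all add: field_simps)
  ultimately show ?thesis by (intro abs_leI) simp_all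
 qed
 then have "\<bar>1 - 3/2 * (x <.> x - 1) + 15/8 * (x <.> x - 1)^2\<bar> <= 5" using t by blast
 then show "\<bar>prof (x <.> x)\<bar> <= 5" using t by (simp add: prof_def)
 have "\<bar>-3/2 + 15/4 * (y - 1)\<bar> <= 21/4" if "0 <= y" "y < 1" for y :: real
  using that by (intro abs_leI) (simp_all add: field_simps)
 then have "\<bar>-3/2 + 15/4 * (x <.> x - 1)\<bar> <= 21/4" using t by blast
 then show "\<bar>prof1 (x <.> x)\<bar> <= 21/4" using t by (simp add: prof1_def)
 show "\<bar>prof2 (x <.> x)\<bar> <= 15/4" using t by (simp add: prof2_def)
qed

definition ker1 :: "R3 => R3" where "ker1 x = prof (x <.> x) *R x"
definition Dker1 :: "R3 => R3 => R3" where "Dker1 x h = prof (x <.> x) *R h + (2 * prof1 (x <.> x) * (x <.> h)) *R x"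

lemma prof_inner_deriv:
 fixes x :: "'a::real_inner"
 shows "((%x. prof (x <.> x)) has_derivative (%h. 2 * prof1 (x <.> x) * (x <.> h))) (at x)"
  and "((%x. prof1 (x <.> x)) has_derivative (%h. 2 * prof2 (x <.> x) * (x <.> h))) (at x)"
proof -
 have i: "((%x. x <.> x) has_derivative (%h. 2 * (x <.> h))) (at x)"
  by (auto intro!: derivative_eq_intros simp: inner_commute)
 show "((%x. prof (x <.> x)) has_derivative (%h. 2 * prof1 (x <.> x) * (x <.> h))) (at x)"
  using has_derivative_compose[OF i prof_deriv(1)[unfolded has_field_derivative_def]] by (simp add: mult_ac)
 show "((%x. prof1 (x <.> x)) has_derivative (%h. 2 * prof2 (x <.> x) * (x <.> h))) (at x)"
  using has_derivative_compose[OF i prof_deriv(2)[unfolded has_field_derivative_def]] by (simp add: mult_ac)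
qed

lemma ker1_deriv: "(ker1 has_derivative Dker1 x) (at x)"
 unfolding ker1_def[abs_def] Dker1_def[abs_def]
 by (rule has_derivative_eq_rhs, rule has_derivative_scaleR[OF prof_inner_deriv(1) has_derivative_ident]) (auto simp: fun_eq_iff)

lemma ker1_bounds:
 shows "norm (ker1 x) <= 5" "x ~= 0 ==> norm (ker1 x) <= 5 / (norm x)^2" "norm x >= 1 ==> ker1 x = coulomb x"
  "norm (Dker1 x h) <= 16 * norm h" "x ~= 0 ==> norm (Dker1 x h) <= 16 * norm h / (norm x)^2"
proof -
 have D: "norm (Dker1 x h) <= (\<bar>prof (x <.> x)\<bar> + 2 * \<bar>prof1 (x <.> x)\<bar> * (norm x)^2) * norm h"
 proof -
  have "norm (Dker1 x h) <= \<bar>prof (x <.> x)\<bar> * norm h + \<bar>2 * prof1 (x <.> x) * (x <.> h)\<bar> * norm x"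
   unfolding Dker1_def by (metis norm_scaleR norm_triangle_ineq)
  also have "\<bar>2 * prof1 (x <.> x) * (x <.> h)\<bar> * norm x <= (2 * \<bar>prof1 (x <.> x)\<bar> * (norm x * norm h)) * norm x"
   unfolding abs_mult using Cauchy_Schwarz_ineq2[of x h] by (intro mult_right_mono mult_mono) auto
  finally show ?thesis by (simp add: power2_eq_square algebra_simps)
 qed
 show "norm x >= 1 ==> ker1 x = coulomb x" by (simp add: ker1_def coulomb_def prof_norm(1))
 have all: "norm (ker1 x) <= 5 & (x ~= 0 --> norm (ker1 x) <= 5 / (norm x)^2) & norm (Dker1 x h) <= 16 * norm h & (x ~= 0 --> norm (Dker1 x h) <= 16 * norm h / (norm x)^2)"
 proof (cases "norm x >= 1")
  case True
  then have n0: "norm x > 0" by linarith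
  have p: "1 <= norm x ^ k" for k using True by (rule one_le_power)
  have k: "norm (ker1 x) = 1 / (norm x)^2"
   using n0 by (simp add: ker1_def prof_norm(1-3)[OF True] power2_eq_square power3_eq_cube)
  have "\<bar>prof (x <.> x)\<bar> + 2 * \<bar>prof1 (x <.> x)\<bar> * (norm x)^2 = 4 / norm x ^ 3"
   using n0 by (simp add: prof_norm(1-3)[OF True] field_simps)
  then have d: "norm (Dker1 x h) <= 4 / norm x ^ 3 * norm h" using D by simp
  have e1: "1 / (norm x)^2 <= 1" using p[of 2] n0 by (simp add: divide_le_eq_1_pos)
  have e2: "4 / norm x ^ 3 <= 16" using p[of 3] by (simp add: divide_le_eq)
  have e3: "4 / norm x ^ 3 <= 16 / (norm x)^2"
  proof -
   have "norm x ^ 3 = norm x * (norm x)^2" by (simp add: power2_eq_square power3_eq_cube)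
   then have "(norm x)^2 <= norm x ^ 3" using True mult_right_mono[of 1 "norm x" "(norm x)^2"] by simp
   then have "4 / norm x ^ 3 <= 4 / (norm x)^2" using n0 by (intro divide_left_mono) auto
   also have "... <= 16 / (norm x)^2" by (intro divide_right_mono) auto
   finally show ?thesis .
  qed
  show ?thesis
  proof (intro conjI impI)
   show "norm (ker1 x) <= 5" using k e1 by linarith
   show "norm (ker1 x) <= 5 / (norm x)^2" unfolding k by (intro divide_right_mono) auto
   show "norm (Dker1 x h) <= 16 * norm h" using d mult_right_mono[OF e2 norm_ge_zero[of h]] by linarith
   show "norm (Dker1 x h) <= 16 * norm h / (norm x)^2" using d mult_right_mono[OF e3 norm_ge_zero[of h]] by simp
  qed
 next
  case False
  then have x: "norm x < 1" by simp
  have x2: "(norm x)^2 <= 1" using x by (simp add: power_le_one)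
  have "norm (ker1 x) <= 5 * 1" unfolding ker1_def norm_scaleR using x prof_norm(4)[OF x] by (intro mult_mono) auto
  \<comment> \<open>Inside the unit ball the two terms contribute at most 5 and 21/2; outside, their
    sum is \<open>4 / norm x ^ 3\<close>.\<close>
  moreover have "\<bar>prof (x <.> x)\<bar> + 2 * \<bar>prof1 (x <.> x)\<bar> * (norm x)^2 <= 16"
  proof -
   have "2 * \<bar>prof1 (x <.> x)\<bar> * (norm x)^2 <= 2 * (21/4) * 1" using prof_norm(5)[OF x] x2 by (intro mult_mono) auto
   then show ?thesis using prof_norm(4)[OF x] by simp
  qed
  then have "norm (Dker1 x h) <= 16 * norm h" using D mult_right_mono[of _ 16 "norm h"] norm_ge_zero[of h] by (meson order_trans)
  moreover have "c <= c / (norm x)^2" if "x ~= 0" "c >= 0" for c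
   using that x2 by (simp add: divide_simps mult_left_le)
  ultimately show ?thesis by (auto intro: order_trans)
 qed
 then show "norm (ker1 x) <= 5" "x ~= 0 ==> norm (ker1 x) <= 5 / (norm x)^2"
  "norm (Dker1 x h) <= 16 * norm h" "x ~= 0 ==> norm (Dker1 x h) <= 16 * norm h / (norm x)^2" by blast+
qed

text \<open>A bound on the second derivative: the estimate is \<open>24 / norm x ^ 4\<close> outside
  the unit ball and 63/2 + 15 inside.\<close>

lemma Dker1_lipschitz: "norm (Dker1 x h - Dker1 y h) <= 50 * norm (x - y) * norm h"
proof -
 let ?D = "%x k. (2 * prof1 (x <.> x) * (x <.> k)) *R h + ((2 * prof1 (x <.> x) * (k <.> h) + (4 * prof2 (x <.> x) * (x <.> k)) * (x <.> h)) *R x + (2 * prof1 (x <.> x) * (x <.> h)) *R k)"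
 have der: "((%x. Dker1 x h) has_derivative ?D x) (at x)" for x
 proof -
  have 1: "((%x. prof (x <.> x) *R h) has_derivative (%k. (2 * prof1 (x <.> x) * (x <.> k)) *R h)) (at x)"
   using has_derivative_scaleR_left[OF prof_inner_deriv(1)[of x]] .
  have 2: "((%x. 2 * prof1 (x <.> x) * (x <.> h)) has_derivative (%k. 2 * prof1 (x <.> x) * (k <.> h) + (4 * prof2 (x <.> x) * (x <.> k)) * (x <.> h))) (at x)"
   by (rule has_derivative_eq_rhs, rule has_derivative_mult[OF has_derivative_mult_right[OF prof_inner_deriv(2)] has_derivative_inner_left[OF has_derivative_ident]])
     (auto simp: fun_eq_iff)
  have 3: "((%x. (2 * prof1 (x <.> x) * (x <.> h)) *R x) has_derivative (%k. (2 * prof1 (x <.> x) * (k <.> h) + (4 * prof2 (x <.> x) * (x <.> k)) * (x <.> h)) *R x + (2 * prof1 (x <.> x) * (x <.> h)) *R k)) (at x)"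
   by (rule has_derivative_eq_rhs, rule has_derivative_scaleR[OF 2 has_derivative_ident]) (auto simp: fun_eq_iff)
  show ?thesis unfolding Dker1_def by (rule has_derivative_add[OF 1 3])
 qed
 have bd: "norm (?D x k) <= 50 * norm h * norm k" for x k
 proof -
  have c: "\<bar>x <.> k\<bar> <= norm x * norm k" "\<bar>k <.> h\<bar> <= norm k * norm h" "\<bar>x <.> h\<bar> <= norm x * norm h"
   by (rule Cauchy_Schwarz_ineq2)+
  have "norm (?D x k) <= norm ((2 * prof1 (x <.> x) * (x <.> k)) *R h) + (norm ((2 * prof1 (x <.> x) * (k <.> h) + (4 * prof2 (x <.> x) * (x <.> k)) * (x <.> h)) *R x) + norm ((2 * prof1 (x <.> x) * (x <.> h)) *R k))"
   by (rule order_trans[OF norm_triangle_ineq add_left_mono[OF norm_triangle_ineq]])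
  also have "... <= (2 * \<bar>prof1 (x <.> x)\<bar> * (norm x * norm k)) * norm h + ((2 * \<bar>prof1 (x <.> x)\<bar> * (norm k * norm h) + 4 * \<bar>prof2 (x <.> x)\<bar> * (norm x * norm k) * (norm x * norm h)) * norm x + (2 * \<bar>prof1 (x <.> x)\<bar> * (norm x * norm h)) * norm k)"
   unfolding norm_scaleR
  proof (intro add_mono mult_right_mono norm_ge_zero)
   show "\<bar>2 * prof1 (x <.> x) * (x <.> k)\<bar> <= 2 * \<bar>prof1 (x <.> x)\<bar> * (norm x * norm k)" unfolding abs_mult using c by (intro mult_mono) auto
   show "\<bar>2 * prof1 (x <.> x) * (x <.> h)\<bar> <= 2 * \<bar>prof1 (x <.> x)\<bar> * (norm x * norm h)" unfolding abs_mult using c by (intro mult_mono) auto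
   show "\<bar>2 * prof1 (x <.> x) * (k <.> h) + (4 * prof2 (x <.> x) * (x <.> k)) * (x <.> h)\<bar> <= 2 * \<bar>prof1 (x <.> x)\<bar> * (norm k * norm h) + 4 * \<bar>prof2 (x <.> x)\<bar> * (norm x * norm k) * (norm x * norm h)"
    by (rule order_trans[OF abs_triangle_ineq add_mono]; unfold abs_mult; use c in \<open>intro mult_mono\<close>) auto
  qed
  also have "... = (6 * (\<bar>prof1 (x <.> x)\<bar> * norm x) + 4 * (\<bar>prof2 (x <.> x)\<bar> * norm x ^ 3)) * (norm h * norm k)"
   by (simp add: algebra_simps power3_eq_cube)
  also have "... <= 50 * (norm h * norm k)"
  proof (rule mult_right_mono)
   show "6 * (\<bar>prof1 (x <.> x)\<bar> * norm x) + 4 * (\<bar>prof2 (x <.> x)\<bar> * norm x ^ 3) <= 50"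
   proof (cases "norm x >= 1")
    case True
    then have n0: "norm x > 0" by linarith
    have "1 <= norm x ^ 4" using True by (rule one_le_power)
    moreover have "6 * (\<bar>prof1 (x <.> x)\<bar> * norm x) + 4 * (\<bar>prof2 (x <.> x)\<bar> * norm x ^ 3) = 24 / norm x ^ 4"
     using n0 by (simp add: prof_norm(1-3)[OF True] field_simps) (simp add: eval_nat_numeral algebra_simps)
    ultimately show ?thesis by (simp add: divide_le_eq)
   next
    case False
    then have x: "norm x < 1" by simp
    have "\<bar>prof1 (x <.> x)\<bar> * norm x <= 21/4 * 1" using prof_norm(5)[OF x] x by (intro mult_mono) auto
    moreover have "\<bar>prof2 (x <.> x)\<bar> * norm x ^ 3 <= 15/4 * 1" using prof_norm(6)[OF x] x by (intro mult_mono) (auto simp: power_le_one)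
    ultimately show ?thesis by linarith
   qed
  qed simp
  finally show ?thesis by simp
 qed
 have "norm (Dker1 x h - Dker1 y h) <= (50 * norm h) * norm (x - y)"
  by (rule differentiable_bound[where S=UNIV and f'="?D"]) (use der bd in \<open>auto intro!: onorm_le\<close>)
 then show ?thesis by (simp add: mult_ac)
qed

text \<open>The scaling matches the homogeneity of degree -2, so that \<open>ker R\<close> coincides
  with the Coulomb kernel outside the ball of radius \<open>R\<close>.\<close>

definition ker :: "real => R3 => R3" where "ker R x = (1 / R^2) *R ker1 ((1/R) *R x)"
definition Dker :: "real => R3 => R3 => R3" where "Dker R x h = (1 / R ^ 3) *R Dker1 ((1/R) *R x) h"

text \<open>Two kinds of bounds are kept: uniform ones, with powers of \<open>1 / R\<close>, for
  particles whose positions are known to be close; and multiples of the inverse square of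
  \<open>norm x\<close>, integrable at the origin, for particles about which only the momentum is
  known.\<close>

lemma ker_bounds:
 assumes R: "R > 0"
 shows "(ker R has_derivative Dker R x) (at x)"
  "norm (ker R x) <= 5 / R^2" "x ~= 0 ==> norm (ker R x) <= 5 / (norm x)^2" "R <= norm x ==> ker R x = coulomb x"
  "norm (Dker R x h) <= 16 / R ^ 3 * norm h" "x ~= 0 ==> norm (Dker R x h) <= 16 * norm h / R / (norm x)^2"
  "norm (Dker R x h - Dker R y h) <= 50 / R ^ 4 * norm (x - y) * norm h" "norm (ker R x - ker R y) <= 16 / R ^ 3 * norm (x - y)"
proof -
 have lin: "linear (Dker1 x)" for x using ker1_deriv has_derivative_linear by blast
 show d: "(ker R has_derivative Dker R x) (at x)" for x
 proof -
  have "((%x. (1/R) *R x) has_derivative (%h. (1/R) *R h)) (at x)" by (auto intro!: derivative_eq_intros)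
  from has_derivative_scaleR_right[OF has_derivative_compose[OF this ker1_deriv], of "1 / R^2"]
  have "(ker R has_derivative (%h. (1 / R^2) *R Dker1 ((1/R) *R x) ((1/R) *R h))) (at x)" by (simp only: ker_def[abs_def])
  moreover have "(%h. (1 / R^2) *R Dker1 ((1/R) *R x) ((1/R) *R h)) = Dker R x"
   by (simp add: Dker_def fun_eq_iff linear_scale[OF lin] power2_eq_square power3_eq_cube)
  ultimately show ?thesis by simp
 qed
 show "norm (ker R x) <= 5 / R^2" using ker1_bounds(1)[of "(1/R) *R x"] R by (simp add: ker_def divide_simps)
 show "norm (ker R x) <= 5 / (norm x)^2" if "x ~= 0"
  using ker1_bounds(2)[of "(1/R) *R x"] R that by (simp add: ker_def divide_simps power_mult_distrib)
 show "ker R x = coulomb x" if "R <= norm x"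
  using ker1_bounds(3)[of "(1/R) *R x"] R that by (simp add: ker_def coulomb_def divide_simps power2_eq_square power3_eq_cube)
 show bd: "norm (Dker R x h) <= 16 / R ^ 3 * norm h" for x h
  using ker1_bounds(4)[of "(1/R) *R x" h] R by (simp add: Dker_def divide_simps)
 show "norm (Dker R x h) <= 16 * norm h / R / (norm x)^2" if "x ~= 0"
 proof -
  have "norm (Dker1 ((1/R) *R x) h) <= 16 * norm h / (norm ((1/R) *R x))^2" using R that by (intro ker1_bounds(5)) auto
  then have "norm (Dker1 ((1/R) *R x) h) / R ^ 3 <= (16 * norm h / (norm ((1/R) *R x))^2) / R ^ 3" using R by (intro divide_right_mono) auto
  also have "(norm ((1/R) *R x))^2 = (norm x)^2 / R^2" using R by (simp add: power_divide)
  also have "16 * norm h / ((norm x)^2 / R^2) / R ^ 3 = 16 * norm h / R / (norm x)^2" using R by (simp add: power2_eq_square power3_eq_cube)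
  finally show ?thesis using R by (simp add: Dker_def)
 qed
 show "norm (Dker R x h - Dker R y h) <= 50 / R ^ 4 * norm (x - y) * norm h"
 proof -
  have "norm (Dker1 ((1/R) *R x) h - Dker1 ((1/R) *R y) h) <= 50 * norm ((1/R) *R x - (1/R) *R y) * norm h" by (rule Dker1_lipschitz)
  also have "norm ((1/R) *R x - (1/R) *R y) = norm (x - y) / R" using R by (simp add: scaleR_diff_right[symmetric])
  finally have "norm (Dker1 ((1/R) *R x) h - Dker1 ((1/R) *R y) h) / R ^ 3 <= 50 * (norm (x - y) / R) * norm h / R ^ 3" using R by (intro divide_right_mono) auto
  also have "... = 50 / R ^ 4 * norm (x - y) * norm h" using R by (simp add: eval_nat_numeral)
  finally show ?thesis using R by (simp add: Dker_def scaleR_diff_right[symmetric])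
 qed
 show "norm (ker R x - ker R y) <= 16 / R ^ 3 * norm (x - y)"
  by (rule differentiable_bound[where S=UNIV and f'="Dker R"]) (use d bd in \<open>auto intro!: onorm_le simp: mult.commute\<close>)
qed

lemma ker_measurable [measurable]: "coulomb : bmeas"
 "R > 0 ==> ker R : bmeas" "R > 0 ==> (%x. Dker R x h) : bmeas"
 "R > 0 ==> continuous_on S (ker R)" "R > 0 ==> continuous_on S (%x. Dker R x h)"
proof -
 show "coulomb : bmeas" unfolding coulomb_def[abs_def] by measurable
 assume R: "R > 0"
 show "continuous_on S (ker R)" for S using ker_bounds(1)[OF R] by (meson has_derivative_continuous continuous_at_imp_continuous_on)
 then show "ker R : bmeas" by (rule borel_measurable_continuous_onI)
 have "(50 / R ^ 4 * norm h)-lipschitz_on S (%x. Dker R x h)" for S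
  by (intro lipschitz_onI) (use ker_bounds(7)[OF R, of _ h] R in \<open>auto simp: dist_norm mult_ac\<close>)
 then show "continuous_on S (%x. Dker R x h)" for S by (rule lipschitz_on_continuous_on)
 then show "(%x. Dker R x h) : bmeas" by (rule borel_measurable_continuous_onI)
qed

lemma coulomb_bound: "norm (coulomb x) <= 1 / (norm x)^2"
 by (cases "x = 0") (simp_all add: coulomb_def power2_eq_square power3_eq_cube)

section \<open>Integrals of singular kernels and weights\<close>

abbreviation ubv :: real where "ubv == unit_ball_vol 3"

lemma ball_R3: "r >= 0 ==> emeasure lborel (ball (c::R3) r) = ennreal (r ^ 3 * ubv)"
 "r >= 0 ==> emeasure lborel (cball (c::R3) r) = ennreal (r ^ 3 * ubv)"
 using emeasure_ball[of r c] emeasure_cball[of r c] by (auto simp: mult.commute)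

lemma pred_ball [measurable]: "Measurable.pred borel (%x. x : ball c r)"
proof -
 have "{x : space borel. x : ball c r} = ball c r" by auto
 then show ?thesis unfolding pred_def by (simp only: borel_open[OF open_ball])
qed

lemma pred_cball [measurable]: "Measurable.pred borel (%x. x : cball c r)"
proof -
 have "{x : space borel. x : cball c r} = cball c r" by auto
 then show ?thesis unfolding pred_def by (simp only: borel_closed[OF closed_cball])
qed

text \<open>Volumes of balls are the only geometric input. The function is dominated by a sum of
  multiples of indicators of balls, which replaces polar coordinates.\<close>

lemma nn_integral_dyadic:
 fixes g :: "R3 => ennreal"
 assumes g: "!!x. g x ~= 0 ==> \<exists>n. g x <= ennreal (a n) & norm x < rho n" and a: "!!n. a n >= 0" "!!n. rho n >= 0"
  and s: "(%n. a n * (rho n ^ 3 * ubv)) sums S"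
 shows "(NNI x. g x) <= ennreal S"
proof -
 have "(NNI x. g x) <= (NNI x. (\<Sum>n. ennreal (a n) * indicator (ball (0::R3) (rho n)) x))"
 proof (rule nn_integral_mono)
  fix x :: R3
  show "g x <= (\<Sum>n. ennreal (a n) * indicator (ball 0 (rho n)) x)"
  proof (cases "g x = 0")
   case False
   then obtain n where n: "g x <= ennreal (a n)" "norm x < rho n" using g by blast
   have "g x <= (\<Sum>n\<in>{n}. ennreal (a n) * indicator (ball 0 (rho n)) x)" using n by simp
   also have "... <= (\<Sum>n. ennreal (a n) * indicator (ball 0 (rho n)) x)" by (rule sum_le_suminf[OF summableI]) auto
   finally show ?thesis .
  qed simp
 qed
 also have "... = (\<Sum>n. NNI x. ennreal (a n) * indicator (ball (0::R3) (rho n)) x)"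
  by (rule nn_integral_suminf) measurable
 also have "... = (\<Sum>n. ennreal (a n * (rho n ^ 3 * ubv)))"
  using a by (simp add: nn_integral_cmult_indicator ball_R3 ennreal_mult'[symmetric])
 also have "... = ennreal S"
  using s a by (subst suminf_ennreal2) (auto simp: sums_iff)
 finally show ?thesis .
qed

text \<open>On the shell between \<open>R / 2 ^ (n+1)\<close> and \<open>R / 2 ^ n\<close> the
  integrand is at most \<open>4 ^ (n+1) / R^2\<close>; the shells contribute a geometric series of
  ratio 1/2.\<close>

lemma nn_integral_inverse_square:
 assumes R: "R > 0"
 shows "(NNI x. indicator (ball 0 R) x * ennreal (1 / (norm (x::R3))^2)) <= ennreal (8 * ubv * R)"
proof (rule nn_integral_dyadic[where a="%n. 4 ^ Suc n / R^2" and rho="%n. R / 2 ^ n"])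
 have "(%n. (4 * ubv * R) * (1/2) ^ n) sums ((4 * ubv * R) * (1 / (1 - 1/2)))"
  by (intro sums_mult geometric_sums) simp
 moreover have "(4 * ubv * R) * (1/2) ^ n = 4 ^ Suc n / R^2 * ((R / 2 ^ n) ^ 3 * ubv)" for n
 proof -
  have "(4::real) ^ n = 2 ^ n * 2 ^ n" by (simp add: power_mult_distrib[symmetric])
  then show ?thesis using R by (simp add: power_divide power3_eq_cube power2_eq_square field_simps power_one_over)
 qed
 ultimately show "(%n. 4 ^ Suc n / R^2 * ((R / 2 ^ n) ^ 3 * ubv)) sums (8 * ubv * R)" by (simp add: mult_ac)
 fix x :: R3
 assume "indicator (ball 0 R) x * ennreal (1 / (norm x)^2) ~= 0"
 then have x: "norm x < R" "x ~= 0" by (auto simp: indicator_def split: if_splits)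
 have "\<exists>n. R / 2 ^ n <= norm x"
 proof -
  obtain n where "R / norm x < 2 ^ n" using real_arch_pow[of 2 "R / norm x"] by auto
  then show ?thesis using x by (intro exI[of _ n]) (simp add: field_simps)
 qed
 define m where "m = (LEAST n. R / 2 ^ n <= norm x)"
 have m: "R / 2 ^ m <= norm x" unfolding m_def by (rule LeastI_ex) fact
 have "m ~= 0" using m x by (intro notI) simp
 then obtain n where n: "m = Suc n" using not0_implies_Suc by blast
 have n2: "norm x < R / 2 ^ n" using not_less_Least[of n "%n. R / 2 ^ n <= norm x"] unfolding m_def[symmetric] n by simp
 have "(R / 2 ^ Suc n)^2 <= (norm x)^2" using m R unfolding n by (intro power_mono) auto
 then have "1 / (norm x)^2 <= 1 / (R / 2 ^ Suc n)^2" using R x by (intro divide_left_mono) auto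
 also have "... = 4 ^ Suc n / R^2"
 proof -
  have "(2 ^ Suc n)^2 = (4::real) ^ Suc n" by (simp add: power2_eq_square power_mult_distrib[symmetric])
  then show ?thesis by (simp add: power_divide)
 qed
 finally show "\<exists>n. indicator (ball 0 R) x * ennreal (1 / (norm x)^2) <= ennreal (4 ^ Suc n / R^2) & norm x < R / 2 ^ n"
  using n2 x by (intro exI[of _ n]) (auto intro: ennreal_leI)
qed (use R in auto)

text \<open>The shell of radius about \<open>2 ^ n\<close> contributes a multiple of
  \<open>(8 * 4 powr (-a)) ^ n\<close>, and this ratio is below 1 exactly for
  \<open>a > 3/2\<close>.\<close>

lemma nn_integral_weight:
 assumes a: "a > 3/2"
 shows "(NNI u. ennreal ((1 + (norm (u::R3))^2) powr (-a))) < \<infinity>"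
proof -
 define r where "r = 8 * 4 powr (-a)"
 have r: "0 < r" "r < 1"
 proof -
  have "4 powr (-a) < (4::real) powr (- (3/2))" using a by (intro powr_less_mono) auto
  also have "(4::real) powr (- (3/2)) = 1 / 8"
  proof -
   have "(4::real) = 2 powr 2" by simp
   then have "(4::real) powr (- (3/2)) = 2 powr (-3)" by (simp only: powr_powr) simp
   then show ?thesis by (simp add: powr_minus)
  qed
  finally show "r < 1" by (simp add: r_def)
 qed (simp add: r_def)
 have "(NNI u. ennreal ((1 + (norm (u::R3))^2) powr (-a))) <= ennreal ((4 powr a * ubv) * 8 * (1 / (1 - r)))"
 proof (rule nn_integral_dyadic[where a="%n. 4 powr a * (4 powr (-a)) ^ n" and rho="%n. 2 * 2 ^ n"])
  have "(%n. (4 powr a * ubv * 8) * r ^ n) sums ((4 powr a * ubv * 8) * (1 / (1 - r)))"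
   using r by (intro sums_mult geometric_sums) simp
  moreover have "(4 powr a * ubv * 8) * r ^ n = 4 powr a * (4 powr (-a)) ^ n * ((2 * 2 ^ n) ^ 3 * ubv)" for n
  proof -
   have "(2::real) ^ n * (2 ^ n * 2 ^ n) = 8 ^ n" by (simp add: power_mult_distrib[symmetric])
   then show ?thesis by (simp add: r_def power_mult_distrib power3_eq_cube mult_ac)
  qed
  ultimately show "(%n. 4 powr a * (4 powr (-a)) ^ n * ((2 * 2 ^ n) ^ 3 * ubv)) sums ((4 powr a * ubv) * 8 * (1 / (1 - r)))" by simp
  fix u :: R3
  have "\<exists>n. norm u <= 2 ^ n" using real_arch_pow[of 2 "norm u"] by (auto intro: less_imp_le)
  define n where "n = (LEAST n. norm u <= 2 ^ n)"
  have n: "norm u <= 2 ^ n" unfolding n_def by (rule LeastI_ex) fact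
  have "(1 + (norm u)^2) powr (-a) <= 4 powr a * (4 powr (-a)) ^ n"
  proof (cases n)
   case 0
   have "(1 + (norm u)^2) powr (-a) <= 1 powr (-a)" using a by (intro powr_mono2') auto
   also have "... <= 4 powr a" using a by (simp add: ge_one_powr_ge_zero)
   finally show ?thesis using 0 by simp
  next
   case (Suc k)
   have "\<not> norm u <= 2 ^ k" using not_less_Least[of k "%n. norm u <= 2 ^ n"] unfolding n_def[symmetric] Suc by simp
   then have "(2 ^ k)^2 <= (norm u)^2" by (intro power_mono) auto
   then have "4 ^ k <= 1 + (norm u)^2" by (simp add: power2_eq_square power_mult_distrib[symmetric])
   then have "(1 + (norm u)^2) powr (-a) <= (4 ^ k) powr (-a)" using a by (intro powr_mono2') auto
   also have "... = (4 powr (-a)) ^ k" by (simp add: powr_realpow[symmetric] powr_powr mult.commute)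
   also have "... = 4 powr a * (4 powr (-a)) ^ n" unfolding Suc by (simp add: powr_add[symmetric] mult.assoc[symmetric])
   finally show ?thesis .
  qed
  moreover have "norm u < 2 * 2 ^ n" using n by (rule order_le_less_trans) simp
  ultimately show "\<exists>n. ennreal ((1 + (norm u)^2) powr (-a)) <= ennreal (4 powr a * (4 powr (-a)) ^ n) & norm u < 2 * 2 ^ n"
   by (intro exI[of _ n]) (auto intro: ennreal_leI)
 qed auto
 then show ?thesis by (rule order_le_less_trans) simp
qed

section \<open>Potentials of phase-space densities\<close>

text \<open>Both exponents exceed the integrability threshold 3/2. The first, 7/4, stays below the
  exponent 2 of a squared function with the decay of the data, which leaves room for Hoelder
  continuity and for logarithms. The gap 1/8 to the second yields the factor
  \<open>P powr (-1/4)\<close> for momenta of size at least \<open>P\<close>.\<close>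

definition wt :: "R3 => real" where "wt u = (1 + (norm u)^2) powr (-7/4)"
definition wq :: "R3 => real" where "wq u = (1 + (norm u)^2) powr (-13/8)"

definition Wc :: real where "Wc = (LI u. wt u) + (LI u. wq u)"

lemma wt_measurable [measurable]: "wt : bmeas" "wq : bmeas"
 unfolding wt_def[abs_def] wq_def[abs_def] by measurable

lemma wt_pos: "0 <= wt u" "0 <= wq u" by (auto simp: wt_def wq_def)

lemma wt_integrable: "integrable lborel wt" "integrable lborel wq"
proof -
 show "integrable lborel wt"
 proof (rule integrableI_bounded)
  show "(NNI u. ennreal (norm (wt u))) < \<infinity>"
   using nn_integral_weight[of "7/4"] by (simp add: wt_def)
 qed simp
 show "integrable lborel wq"
 proof (rule integrableI_bounded)
  show "(NNI u. ennreal (norm (wq u))) < \<infinity>"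
   using nn_integral_weight[of "13/8"] by (simp add: wq_def)
 qed simp
qed

lemma Wc: "Wc >= 0" "(NNI u. ennreal (wt u)) <= ennreal Wc" "(NNI u. ennreal (wq u)) <= ennreal Wc" "(LI u. wt u) <= Wc"
proof -
 have 0: "0 <= (LI u. wt u)" "0 <= (LI u. wq u)" using wt_pos by auto
 then show "Wc >= 0" "(LI u. wt u) <= Wc" by (auto simp: Wc_def)
 show "(NNI u. ennreal (wt u)) <= ennreal Wc"
  using nn_integral_eq_integral[OF wt_integrable(1)] wt_pos 0 by (simp add: Wc_def ennreal_leI)
 show "(NNI u. ennreal (wq u)) <= ennreal Wc"
  using nn_integral_eq_integral[OF wt_integrable(2)] wt_pos 0 by (simp add: Wc_def ennreal_leI)
qed

lemma wt_tail:
 assumes "P > 0" "P <= norm u"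
 shows "wt u <= P powr (-1/4) * wq u"
proof -
 have pos: "1 + (norm u)^2 > 0" by (simp add: add_pos_nonneg)
 have "P^2 <= 1 + (norm u)^2" using power_mono[OF assms(2), of 2] assms by (simp add: add_increasing)
 then have "(1 + (norm u)^2) powr (-1/8) <= (P^2) powr (-1/8)" using assms by (intro powr_mono2') auto
 also have "(P^2) powr (-1/8) = P powr (-1/4)"
 proof -
  have "P^2 = P powr 2" using assms by simp
  then have "(P^2) powr (-1/8) = (P powr 2) powr (-1/8)" by (rule arg_cong)
  then show ?thesis by (simp only: powr_powr) simp
 qed
 finally have "(1 + (norm u)^2) powr (-1/8) * wq u <= P powr (-1/4) * wq u" using wt_pos(2) by (rule mult_right_mono)
 moreover have "(1 + (norm u)^2) powr (-1/8) * wq u = wt u"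
  unfolding wq_def wt_def powr_add[symmetric] by simp
 ultimately show ?thesis by simp
qed

lemma measurable_phase [measurable]:
 fixes k :: "R3 => 'a::topological_space"
 assumes "k : bmeas"
 shows "(%z::phase. k (q - fst z)) : bmeas" "(%z::phase. k (snd z)) : bmeas" "(%z::phase. k (fst z)) : bmeas"
proof -
 have "continuous_on UNIV (%z::phase. q - fst z)" "continuous_on UNIV (snd :: phase => R3)" "continuous_on UNIV (fst :: phase => R3)"
  by (intro continuous_intros)+
 then have m: "(%z::phase. q - fst z) : bmeas" "(snd :: phase => R3) : bmeas" "(fst :: phase => R3) : bmeas"
  by (auto intro: borel_measurable_continuous_onI)
 show "(%z::phase. k (q - fst z)) : bmeas" by (rule measurable_compose[OF m(1) assms])
 show "(%z::phase. k (snd z)) : bmeas" by (rule measurable_compose[OF m(2) assms])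
 show "(%z::phase. k (fst z)) : bmeas" by (rule measurable_compose[OF m(3) assms])
qed

text \<open>The momentum integral is taken first and is bounded uniformly in the position; a kernel
  singular in position then merely has to be integrable.\<close>

lemma nn_integral_density_near:
 fixes f :: "phase => ennreal" and k :: "R3 => ennreal"
 assumes f[measurable]: "f : bmeas" and k[measurable]: "k : bmeas"
  and even: "!!x. k (- x) = k x" and w: "!!r u. f (r, u) <= w u" "(NNI u. w u) <= b"
 shows "(NNI z. k (q - fst z) * f z) <= b * (NNI x. k x)"
proof -
 have fm: "(%u. f (r, u)) : bmeas" for r
  by (rule measurable_compose[OF _ f]) (simp add: borel_prod[symmetric])
 have km: "(%r. k (q - r)) : bmeas" by (rule measurable_compose[OF _ k]) simp
 have "(NNI z. k (q - fst z) * f z) = (NNI r. NNI u. k (q - r) * f (r, u))"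
  by (subst nn_integral_lborel_pair(1)) auto
 also have "... = (NNI r. k (q - r) * (NNI u. f (r, u)))"
  by (intro nn_integral_cong nn_integral_cmult) (use fm in simp)
 also have "... <= (NNI r. k (q - r) * b)"
  by (intro nn_integral_mono mult_left_mono order_trans[OF nn_integral_mono w(2)] w(1)) auto
 also have "... = (NNI r. k (q - r)) * b" using km by (simp add: nn_integral_multc)
 also have "(NNI r. k (q - r)) = (NNI r. k (- q + r))"
  using even[of "q - _"] by (intro nn_integral_cong) (metis minus_diff_eq uminus_add_conv_diff)
 also have "... = (NNI x. k x)" by (rule nn_integral_lborel_translate[OF k])
 finally show ?thesis by (simp add: mult.commute)
qed

lemma AE_fst_neq: "AE z in (lborel :: phase measure). fst z ~= q"
proof -
 have m: "{z::phase. fst z = q} : sets borel"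
  by (intro borel_closed closed_Collect_eq continuous_intros)
 have "emeasure lborel {z::phase. fst z = q} = (NNI z. indicator {z::phase. fst z = q} z)"
  by (rule nn_integral_indicator[symmetric]) (simp add: m)
 also have "... = (NNI u. NNI r. indicator {z::phase. fst z = q} (r, u))"
  by (rule nn_integral_lborel_pair(2)) (simp add: m)
 also have "... = (NNI u::R3. NNI r::R3. indicator {q} r)"
  by (intro nn_integral_cong) (simp add: indicator_def)
 also have "... = 0" by simp
 finally have "{z::phase. fst z = q} : null_sets lborel" using m by (auto simp: null_sets_def)
 from AE_not_in[OF this] show ?thesis by simp
qed

lemma nn_integral_density_supported:
 fixes f :: "phase => ennreal" and kap :: "R3 => R3"
 assumes f[measurable]: "f : bmeas" and w: "!!r u. f (r, u) <= w u" "(NNI u. w u) <= ennreal b" and b: "b >= 0"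
  and N: "N >= 0" "!!x. x ~= 0 ==> norm (kap x) <= N / (norm x)^2" and L: "L > 0"
  and supp: "!!x. L <= norm x ==> kap x = 0"
 shows "(NNI z. ennreal (norm (kap (q - fst z))) * f z) <= ennreal (N * (8 * ubv * L * b))"
proof -
 let ?k = "%x::R3. ennreal N * (indicator (ball 0 L) x * ennreal (1 / (norm x)^2)) :: ennreal"
 have km[measurable]: "?k : bmeas" by measurable
 have kI: "(NNI x. ?k x) <= ennreal (N * (8 * ubv * L))"
 proof -
  have "(NNI x. ?k x) = ennreal N * (NNI x. indicator (ball 0 L) x * ennreal (1 / (norm (x::R3))^2))"
   by (rule nn_integral_cmult) measurable
  also have "... <= ennreal N * ennreal (8 * ubv * L)" by (intro mult_left_mono nn_integral_inverse_square L) simp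
  finally show ?thesis using N by (simp add: ennreal_mult')
 qed
 have "(NNI z. ennreal (norm (kap (q - fst z))) * f z) <= (NNI z. ?k (q - fst z) * f z)"
  using AE_fst_neq[of q]
 proof (intro nn_integral_mono_AE, eventually_elim)
  case (elim z)
  have x: "q - fst z ~= 0" using elim by simp
  have "ennreal (norm (kap (q - fst z))) <= ?k (q - fst z)"
  proof (cases "norm (q - fst z) < L")
   case True
   have "ennreal (norm (kap (q - fst z))) <= ennreal (N * (1 / (norm (q - fst z))^2))" using N(2)[OF x] by (simp add: ennreal_leI)
   also have "... = ?k (q - fst z)" using True N(1) by (subst ennreal_mult'') simp_all
   finally show ?thesis .
  qed (simp add: supp)
  from mult_right_mono[OF this, of "f z"] show ?case by simp
 qed
 also have "... <= ennreal b * (NNI x. ?k x)"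
  by (rule nn_integral_density_near[OF f km _ w]) (simp add: indicator_def)
 also have "... <= ennreal b * ennreal (N * (8 * ubv * L))" by (intro mult_left_mono kI) simp
 also have "... = ennreal (N * (8 * ubv * L * b))" using b by (simp add: ennreal_mult'[symmetric] mult_ac)
 finally show ?thesis .
qed

text \<open>The radius \<open>L\<close> is free: inside, the integrable singularity meets a bounded
  position density; outside, the kernel is at most \<open>N / L^2\<close> and the total mass is
  used.\<close>

lemma nn_integral_density_singular:
 fixes f :: "phase => ennreal" and kap :: "R3 => R3"
 assumes f[measurable]: "f : bmeas" and kap[measurable]: "kap : bmeas"
  and w: "!!r u. f (r, u) <= w u" "(NNI u. w u) <= ennreal b"
  and m: "(NNI z. f z) <= ennreal m" and b: "b >= 0" "m >= 0"
  and N: "N >= 0" "!!x. x ~= 0 ==> norm (kap x) <= N / (norm x)^2" and L: "L > 0"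
 shows "(NNI z. ennreal (norm (kap (q - fst z))) * f z) <= ennreal (N * (8 * ubv * L * b + m / L^2))"
proof -
 define kapn where "kapn x = indicator (ball 0 L) x *R kap x" for x
 have [measurable]: "kapn : bmeas" unfolding kapn_def[abs_def] by measurable
 have near: "(NNI z. ennreal (norm (kapn (q - fst z))) * f z) <= ennreal (N * (8 * ubv * L * b))"
  by (rule nn_integral_density_supported[OF f w b(1) N(1) _ L]) (use N in \<open>auto simp: kapn_def indicator_def\<close>)
 have "(NNI z. ennreal (norm (kap (q - fst z))) * f z) <= (NNI z. ennreal (norm (kapn (q - fst z))) * f z + ennreal (N / L^2) * f z)"
 proof (rule nn_integral_mono)
  fix z :: phase
  have "ennreal (norm (kap (q - fst z))) <= ennreal (norm (kapn (q - fst z))) + ennreal (N / L^2)"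
  proof (cases "norm (q - fst z) < L")
   case True
   then show ?thesis by (simp add: kapn_def)
  next
   case False
   have x: "q - fst z ~= 0" using False L by auto
   have "L^2 <= (norm (q - fst z))^2" using False L by (intro power_mono) auto
   then have "N / (norm (q - fst z))^2 <= N / L^2" using N(1) L x by (intro divide_left_mono mult_pos_pos) auto
   then have "ennreal (norm (kap (q - fst z))) <= ennreal (N / L^2)" using N(2)[OF x] by (intro ennreal_leI) linarith
   then show ?thesis by (rule order_trans) simp
  qed
  from mult_right_mono[OF this, of "f z"] show "ennreal (norm (kap (q - fst z))) * f z <= ennreal (norm (kapn (q - fst z))) * f z + ennreal (N / L^2) * f z"
   by (simp add: distrib_right)
 qed
 also have "... = (NNI z. ennreal (norm (kapn (q - fst z))) * f z) + ennreal (N / L^2) * (NNI z. f z)"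
  by (subst nn_integral_add) (auto simp: nn_integral_cmult)
 also have "... <= ennreal (N * (8 * ubv * L * b)) + ennreal (N / L^2) * ennreal m" by (intro add_mono near mult_left_mono m) simp
 also have "... = ennreal (N * (8 * ubv * L * b + m / L^2))"
  using N L b by (simp add: ennreal_mult'[symmetric] ennreal_plus[symmetric] algebra_simps del: ennreal_plus)
 finally show ?thesis .
qed

section \<open>Densities, singular kernels and their potentials\<close>

definition dens :: "real => (phase => real) => bool"
 where "dens B f \<longleftrightarrow> f : bmeas & (\<forall>r u. 0 <= f (r, u) & f (r, u) <= B * wt u) &
  integrable lborel f & (LI z. f z) <= B"

definition pot :: "(R3 => R3) => (phase => real) => R3 => R3"
 where "pot kap f q = (LI z. f z *R kap (q - fst z))"

lemma densD:
 assumes "dens B f"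
 shows "f : bmeas" "0 <= f z" "f (r, u) <= B * wt u" "integrable lborel f" "(LI z. f z) <= B" "0 <= B"
  "(NNI z. ennreal (f z)) <= ennreal B" "(NNI u. ennreal (B * wt u)) <= ennreal (B * Wc)" "ennreal (f (r, u)) <= ennreal (B * wt u)"
proof -
 show f0: "0 <= f z" for z using assms by (cases z) (auto simp: dens_def)
 show "f : bmeas" and fle: "f (r, u) <= B * wt u" and i: "integrable lborel f" and I: "(LI z. f z) <= B"
  using assms by (auto simp: dens_def)
 have "0 <= (LI z. f z)" using f0 by simp
 with I show B: "0 <= B" by linarith
 show "(NNI z. ennreal (f z)) <= ennreal B"
  using nn_integral_eq_integral[OF i] f0 I by (simp add: ennreal_leI)
 have "(NNI u. ennreal (B * wt u)) = ennreal B * (NNI u. ennreal (wt u))"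
  using B wt_pos by (simp add: ennreal_mult nn_integral_cmult)
 also have "... <= ennreal B * ennreal Wc" by (intro mult_left_mono Wc) simp
 finally show "(NNI u. ennreal (B * wt u)) <= ennreal (B * Wc)" using B by (simp add: ennreal_mult' )
 show "ennreal (f (r, u)) <= ennreal (B * wt u)" using fle by (rule ennreal_leI)
qed

definition kbound :: "real => (R3 => R3) => bool"
 where "kbound N kap \<longleftrightarrow> 0 <= N & kap : bmeas & (\<forall>x. x ~= 0 --> norm (kap x) <= N / (norm x)^2)"

lemma kbound_coulomb: "kbound 1 coulomb"
 using coulomb_bound by (simp add: kbound_def)

lemma kbound_kernels:
 assumes that: "R > 0"
 shows "kbound 5 (ker R)" "kbound (16 * norm h / R) (%x. Dker R x h)" "kbound 6 (%x. coulomb x - ker R x)"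
proof -
 show k: "kbound 5 (ker R)" using ker_bounds(3)[OF that] that by (simp add: kbound_def)
 show "kbound (16 * norm h / R) (%x. Dker R x h)" using ker_bounds(6)[OF that, of _ h] that by (simp add: kbound_def)
 have "norm (coulomb x - ker R x) <= 6 / (norm x)^2" if "x ~= 0" for x
 proof -
  have "norm (coulomb x - ker R x) <= 1 / (norm x)^2 + 5 / (norm x)^2"
   using norm_triangle_ineq4[of "coulomb x" "ker R x"] coulomb_bound[of x] k that unfolding kbound_def by force
  then show ?thesis by (simp add: add_divide_distrib[symmetric])
 qed
 then show "kbound 6 (%x. coulomb x - ker R x)" using that by (simp add: kbound_def)
qed

lemma pot_bound_nn:
 assumes f: "dens B f" and k: "kbound N kap" and L: "L > 0"
 shows "(NNI z. ennreal (norm (f z *R kap (q - fst z)))) <= ennreal (N * (8 * ubv * L * (B * Wc) + B / L^2))"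
  and "(!!x. L <= norm x ==> kap x = 0) ==> (NNI z. ennreal (norm (f z *R kap (q - fst z)))) <= ennreal (N * (8 * ubv * L * (B * Wc)))"
proof -
 note d = densD[OF f]
 have e: "ennreal (norm (f z *R kap (q - fst z))) = ennreal (norm (kap (q - fst z))) * ennreal (f z)" for z
  using d(2)[of z] by (simp add: ennreal_mult mult.commute)
 have fm: "(%z. ennreal (f z)) : bmeas" using d(1) by measurable
 have B: "B * Wc >= 0" using d(6) Wc(1) by simp
 note s = nn_integral_density_singular[OF fm _ d(9) d(8) d(7) B d(6) _ _ L, of kap N q]
 show "(NNI z. ennreal (norm (f z *R kap (q - fst z)))) <= ennreal (N * (8 * ubv * L * (B * Wc) + B / L^2))"
  unfolding e by (rule s) (use k in \<open>auto simp: kbound_def\<close>)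
 show "(!!x. L <= norm x ==> kap x = 0) ==> (NNI z. ennreal (norm (f z *R kap (q - fst z)))) <= ennreal (N * (8 * ubv * L * (B * Wc)))"
  unfolding e by (rule nn_integral_density_supported[OF fm d(9) d(8) B _ _ L]) (use k in \<open>auto simp: kbound_def\<close>)
qed

lemma pot_integrable:
 assumes f: "dens B f" and k: "kbound N kap"
 shows "integrable lborel (%z. f z *R kap (q - fst z))"
proof (rule integrableI_bounded)
 have [measurable]: "f : bmeas" "kap : bmeas" using densD(1)[OF f] k by (auto simp: kbound_def)
 show "(%z. f z *R kap (q - fst z)) : borel_measurable lborel" by measurable
 show "(NNI z. ennreal (norm (f z *R kap (q - fst z)))) < \<infinity>"
  using pot_bound_nn(1)[OF f k, of 1 q] by (rule order_le_less_trans) auto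
qed

lemma pot_bound:
 assumes f: "dens B f" and k: "kbound N kap" and L: "L > 0"
 shows "norm (pot kap f q) <= N * (8 * ubv * L * (B * Wc) + B / L^2)"
  and "(!!x. L <= norm x ==> kap x = 0) ==> norm (pot kap f q) <= N * (8 * ubv * L * (B * Wc))"
proof -
 have 0: "0 <= N * (8 * ubv * L * (B * Wc) + B / L^2)" "0 <= N * (8 * ubv * L * (B * Wc))"
  using k densD(6)[OF f] Wc(1) L by (auto simp: kbound_def intro!: mult_nonneg_nonneg add_nonneg_nonneg)
 note b = integral_norm_bound_ennreal[OF pot_integrable[OF f k, of q]]
 show "norm (pot kap f q) <= N * (8 * ubv * L * (B * Wc) + B / L^2)"
  using order_trans[OF b pot_bound_nn(1)[OF f k L]] 0 unfolding pot_def by (simp add: ennreal_le_iff)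
 show "norm (pot kap f q) <= N * (8 * ubv * L * (B * Wc))" if "!!x. L <= norm x ==> kap x = 0"
  using order_trans[OF b pot_bound_nn(2)[OF f k L that]] 0 unfolding pot_def by (simp add: ennreal_le_iff)
qed

lemma pot_diff_kernel:
 assumes f: "dens B f" and k: "kbound N kap" "kbound N' kap'"
 shows "pot (%x. kap x - kap' x) f q = pot kap f q - pot kap' f q"
 unfolding pot_def using pot_integrable[OF f k(1), of q] pot_integrable[OF f k(2), of q] by (simp add: scaleR_diff_right)

text \<open>The two kernels differ only inside the ball of radius \<open>R\<close>, where their
  difference is at most 6 times the inverse square; hence an error linear in
  \<open>R\<close>.\<close>

lemma pot_coulomb_ker:
 assumes f: "dens B f" and R: "R > 0"
 shows "norm (pot coulomb f q - pot (ker R) f q) <= 48 * ubv * Wc * R * B"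
proof -
 have "norm (pot (%x. coulomb x - ker R x) f q) <= 6 * (8 * ubv * R * (B * Wc))"
  by (rule pot_bound(2)[OF f kbound_kernels(3)[OF R] R]) (simp add: ker_bounds(4)[OF R])
 then show ?thesis unfolding pot_diff_kernel[OF f kbound_coulomb kbound_kernels(1)[OF R]] by (simp add: mult_ac)
qed

text \<open>Mass may escape to infinity in position, so there is no integrable majorant on the whole
  space. The far part of the kernel is small by the common mass bound, and for the near part the
  momentum weight dominates.\<close>

lemma pot_tendsto:
 assumes fsd: "!!n. dens B (fs n)" and f: "dens B g" and k: "kbound N kap" and lim: "!!z. (%n. fs n z) ----> g z"
 shows "(%n. pot kap (fs n) q) ----> pot kap g q"
proof -
 have [measurable]: "kap : bmeas" "g : bmeas" "!!n. fs n : bmeas"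
  using k densD(1)[OF f] densD(1)[OF fsd] by (auto simp: kbound_def)
 have N: "N >= 0" and B: "B >= 0" using k densD(6)[OF f] by (auto simp: kbound_def)
 show ?thesis
  unfolding LIMSEQ_iff
 proof (intro allI impI)
  fix e :: real assume e: "e > 0"
  define L where "L = sqrt (4 * (N * B + 1) / e) + 1"
  have NB: "N * B >= 0" using N B by simp
  have L: "L > 0" unfolding L_def using NB e by (intro add_nonneg_pos) auto
  have "4 * (N * B + 1) / e <= L^2"
  proof -
   have "sqrt (4 * (N * B + 1) / e) <= L" by (simp add: L_def)
   then show ?thesis using real_le_lsqrt sqrt_le_D by blast
  qed
  then have far: "N * B / L^2 <= e / 4" using e L NB by (simp add: field_simps)
  let ?n = "%x. indicator (ball 0 L) x *R kap x" and ?F = "%x. indicator (- ball 0 L) x *R kap x"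
  have kn: "kbound N ?n" and kF: "kbound N ?F" using k N by (auto simp: kbound_def indicator_def)
  have farb: "norm (pot ?F h q) <= e / 4" if h: "dens B h" for h
  proof -
   have "norm (?F x) <= N / L^2" for x
   proof (cases "x : ball 0 L")
    case False
    then have x: "x ~= 0" "L <= norm x" using L by auto
    have "L^2 <= (norm x)^2" using x L by (intro power_mono) auto
    then have "N / (norm x)^2 <= N / L^2" using N L x by (intro divide_left_mono mult_pos_pos) auto
    moreover have "norm (kap x) <= N / (norm x)^2" using k x by (simp add: kbound_def)
    ultimately show ?thesis using False by simp
   qed (use N in simp)
   then have "norm (pot ?F h q) <= N / L^2 * (LI z. \<bar>h z\<bar>)"
    unfolding pot_def using densD(4)[OF h] kF by (intro kernel_integral(2)) (auto simp: kbound_def borel_prod[symmetric])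
   also have "... <= N / L^2 * B" using densD(2,5)[OF h] N by (intro mult_left_mono) auto
   finally have "norm (pot ?F h q) <= N * B / L^2" by simp
   then show ?thesis using far by (rule order_trans)
  qed
  have split: "pot kap h q = pot ?n h q + pot ?F h q" if h: "dens B h" for h
  proof -
   have "kap x = ?n x + ?F x" for x by (simp add: indicator_def)
   then have "pot kap h q = (LI z. h z *R ?n (q - fst z) + h z *R ?F (q - fst z))"
    unfolding pot_def by (intro Bochner_Integration.integral_cong) (metis scaleR_add_right)+
   then show ?thesis unfolding pot_def
    using pot_integrable[OF h kn, of q] pot_integrable[OF h kF, of q] by (simp only: Bochner_Integration.integral_add)
  qed
  have "(%n. pot ?n (fs n) q) ----> pot ?n g q"
   unfolding pot_def
  proof (rule integral_dominated_convergence[where w="%z. B * wt (snd z) * norm (?n (q - fst z))"])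
   show "AE z in lborel. (%n. fs n z *R ?n (q - fst z)) ----> g z *R ?n (q - fst z)"
    by (intro AE_I2 tendsto_scaleR lim tendsto_const)
   show "AE z in lborel. norm (fs n z *R ?n (q - fst z)) <= B * wt (snd z) * norm (?n (q - fst z))" for n
   proof (rule AE_I2)
    fix z :: phase
    have "\<bar>fs n z\<bar> <= B * wt (snd z)" using densD(2,3)[OF fsd, of n] by (cases z) auto
    then show "norm (fs n z *R ?n (q - fst z)) <= B * wt (snd z) * norm (?n (q - fst z))"
     unfolding norm_scaleR by (rule mult_right_mono) simp
   qed
   have [measurable]: "?n : bmeas" using kn by (simp add: kbound_def)
   show "integrable lborel (%z. B * wt (snd z) * norm (?n (q - fst z)))"
   proof (rule integrableI_bounded)
    have wm: "(%z::phase. ennreal (B * wt (snd z))) : bmeas" by measurable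
    have "(NNI z. ennreal (norm (?n (q - fst z))) * ennreal (B * wt (snd z))) <= ennreal (N * (8 * ubv * L * (B * Wc)))"
     by (rule nn_integral_density_supported[OF wm _ densD(8)[OF f] _ N _ L]) (use kn B Wc(1) in \<open>auto simp: kbound_def\<close>)
    moreover have "(NNI z. ennreal (norm (B * wt (snd z) * norm (?n (q - fst z))))) = (NNI z. ennreal (norm (?n (q - fst z))) * ennreal (B * wt (snd z)))"
     using B wt_pos by (intro nn_integral_cong) (simp add: ennreal_mult'[symmetric] abs_mult mult_ac)
    ultimately have "(NNI z. ennreal (norm (B * wt (snd z) * norm (?n (q - fst z))))) <= ennreal (N * (8 * ubv * L * (B * Wc)))" by (simp only:)
    then show "(NNI z. ennreal (norm (B * wt (snd z) * norm (?n (q - fst z))))) < \<infinity>"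
     by (rule order_le_less_trans) simp
   qed measurable
  qed (use kn in \<open>auto simp: kbound_def\<close>)
  then have "\<forall>\<^sub>F n in sequentially. norm (pot ?n (fs n) q - pot ?n g q) < e / 2"
   unfolding LIMSEQ_iff eventually_sequentially using half_gt_zero[OF e] by blast
  then obtain M where M: "!!n. n >= M ==> norm (pot ?n (fs n) q - pot ?n g q) < e / 2" by (auto simp: eventually_sequentially)
  show "\<exists>no. \<forall>n\<ge>no. norm (pot kap (fs n) q - pot kap g q) < e"
  proof (intro exI[of _ M] allI impI)
   fix n assume n: "n >= M"
   define A where "A h = pot ?n h q" for h
   define C where "C h = pot ?F h q" for h
   have "pot kap (fs n) q = A (fs n) + C (fs n)" "pot kap g q = A g + C g"
    unfolding A_def C_def by (rule split[OF fsd], rule split[OF f])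
   have "norm (A (fs n) - A g) < e / 2" unfolding A_def by (rule M[OF n])
   moreover have "norm (C (fs n)) <= e / 4" "norm (C g) <= e / 4"
    unfolding C_def by (rule farb[OF fsd], rule farb[OF f])
   ultimately have "norm ((A (fs n) - A g) + (C (fs n) - C g)) < e"
    using norm_triangle_ineq[of "A (fs n) - A g" "C (fs n) - C g"] norm_triangle_ineq4[of "C (fs n)" "C g"] by linarith
   then show "norm (pot kap (fs n) q - pot kap g q) < e"
    unfolding \<open>pot kap (fs n) q = A (fs n) + C (fs n)\<close> \<open>pot kap g q = A g + C g\<close> by (simp only: add_diff_add)
  qed
 qed
qed

lemma dens_kernel_bounded:
 assumes f: "dens B f" and k: "kap : bmeas" "!!x. norm (kap x) <= S"
 shows "integrable lborel (%z. f z *R kap (q - fst z))" "norm (pot kap f q) <= S * B"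
proof -
 have S: "S >= 0" using order_trans[OF norm_ge_zero k(2)[of 0]] .
 have fm: "fst : borel_measurable (lborel :: phase measure)"
  using measurable_phase(3)[of "%x. x"] by simp
 show "integrable lborel (%z. f z *R kap (q - fst z))"
  by (rule kernel_integral(1)[OF densD(4)[OF f] fm k])
 have "norm (pot kap f q) <= S * (LI z. \<bar>f z\<bar>)"
  unfolding pot_def by (rule kernel_integral(2)[OF densD(4)[OF f] fm k])
 also have "... <= S * B" using densD(2,5)[OF f] S by (intro mult_left_mono) auto
 finally show "norm (pot kap f q) <= S * B" .
qed

lemma pot_ker_deriv:
 assumes f: "dens B f" and R: "R > 0"
 shows "(pot (ker R) f has_derivative (%h. pot (%x. Dker R x h) f q)) (at q)"
  "norm (pot (%x. Dker R x h) f q) <= 16 / R ^ 3 * B * norm h"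
  "norm (pot (%x. Dker R x h) f q - pot (%x. Dker R x h) f q') <= 50 / R ^ 4 * B * norm (q - q') * norm h"
proof -
 have fm: "fst : borel_measurable (lborel :: phase measure)"
  using measurable_phase(3)[of "%x. x"] by simp
 show "(pot (ker R) f has_derivative (%h. pot (%x. Dker R x h) f q)) (at q)"
  unfolding pot_def[abs_def]
  by (rule has_derivative_kernel_integral[OF densD(4)[OF f] fm ker_bounds(1)[OF R] ker_bounds(7)[OF R] ker_bounds(2)[OF R] ker_bounds(5)[OF R]])
 show "norm (pot (%x. Dker R x h) f q) <= 16 / R ^ 3 * B * norm h"
  using dens_kernel_bounded(2)[OF f ker_measurable(3)[OF R] ker_bounds(5)[OF R]] by (simp add: mult_ac)
 note i = dens_kernel_bounded(1)[OF f ker_measurable(3)[OF R] ker_bounds(5)[OF R]]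
 have "pot (%x. Dker R x h) f q - pot (%x. Dker R x h) f q' = (LI z. f z *R (Dker R (q - fst z) h - Dker R (q' - fst z) h))"
  unfolding pot_def using i by (simp add: scaleR_diff_right)
 also have "norm ... <= (LI z. norm (f z *R (Dker R (q - fst z) h - Dker R (q' - fst z) h)))" by (rule integral_norm_bound)
 also have "... <= (LI z. f z * (50 / R ^ 4 * norm (q - q') * norm h))"
 proof (rule integral_mono)
  show "integrable lborel (%z. norm (f z *R (Dker R (q - fst z) h - Dker R (q' - fst z) h)))"
   using i by (intro integrable_norm) (simp add: scaleR_diff_right)
  show "norm (f z *R (Dker R (q - fst z) h - Dker R (q' - fst z) h)) <= f z * (50 / R ^ 4 * norm (q - q') * norm h)" for z
   using mult_left_mono[OF ker_bounds(7)[OF R, of "q - fst z" h "q' - fst z"] densD(2)[OF f, of z]] densD(2)[OF f, of z] by simp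
 qed (use densD(4)[OF f] in auto)
 also have "... = (LI z. f z) * (50 / R ^ 4 * norm (q - q') * norm h)" by simp
 also have "... <= B * (50 / R ^ 4 * norm (q - q') * norm h)" using densD(5)[OF f] R by (intro mult_right_mono) auto
 finally show "norm (pot (%x. Dker R x h) f q - pot (%x. Dker R x h) f q') <= 50 / R ^ 4 * B * norm (q - q') * norm h"
  by (simp add: mult_ac)
qed

text \<open>The exponent 1/4 is what remains of a Lipschitz bound once the other powers are spent on
  the weight \<open>wt\<close>, see \<open>adm_holder\<close>.\<close>

definition holder :: "real => (phase => real) => bool"
 where "holder H f \<longleftrightarrow> H >= 0 & (\<forall>r r' u. \<bar>f (r, u) - f (r', u)\<bar> <= H * norm (r - r') powr (1/4) * wt u)"

text \<open>Each dyadic piece of the kernel gradient has mean zero, so only the oscillation of the density enters.\<close>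

lemma pot_Dker_piece:
 assumes f: "dens B f" and H: "holder H f" and R: "R > 0"
 shows "norm (pot (%x. Dker (R/2) x h) f q - pot (%x. Dker R x h) f q) <= 144 * ubv * Wc * H * R powr (1/4) * norm h"
proof -
 let ?E = "144 / R ^ 3 * norm h * (H * R powr (1/4))"
 have R2: "R/2 > 0" using R by simp
 define D where "D x = Dker (R/2) x h - Dker R x h" for x
 have cD: "continuous_on S D" for S unfolding D_def by (intro continuous_intros ker_measurable R R2)
 then have [measurable]: "D : bmeas" by (rule borel_measurable_continuous_onI)
 have D0: "D x = 0" if "R < norm x" for x
 proof -
  have "((%x. ker (R/2) x - ker R x) has_derivative (%h. Dker (R/2) x h - Dker R x h)) (at x)"
   by (intro has_derivative_diff ker_bounds(1) R R2)
  moreover have "((%x. ker (R/2) x - ker R x) has_derivative (%h. 0)) (at x)"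
  proof (rule has_derivative_transform_within_open[where s="- cball 0 R" and f="%_. 0"])
   show "0 = ker (R/2) y - ker R y" if "y : - cball 0 R" for y
    using that R by (simp add: ker_bounds(4))
  qed (use that in auto)
  ultimately have "(%h. Dker (R/2) x h - Dker R x h) = (%h. 0)" by (rule has_derivative_unique)
  then show ?thesis by (metis D_def)
 qed
 have Db: "norm (D x) <= 144 / R ^ 3 * norm h" for x
 proof -
  have "norm (D x) <= 16 / (R/2) ^ 3 * norm h + 16 / R ^ 3 * norm h"
   unfolding D_def by (rule order_trans[OF norm_triangle_ineq4 add_mono]) (rule ker_bounds(5)[OF R2] ker_bounds(5)[OF R])+
  also have "... = 144 / R ^ 3 * norm h" using R by (simp add: power_divide field_simps)
  finally show ?thesis .
 qed
 \<comment> \<open>The piece is the derivative of a compactly supported kernel, hence has integral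
   0.\<close>
 have intD: "integrable lborel (%r. D (q - r))" and meanD: "(LI r. D (q - r)) = 0"
 proof -
  let ?psi = "%r. ker (R/2) (q - r) - ker R (q - r)"
  have d: "(?psi has_derivative (%k. Dker (R/2) (q - r) (- k) - Dker R (q - r) (- k))) (at r)" for r
  proof -
   have "((%r. q - r) has_derivative (%k. - k)) (at r)" by (auto intro!: derivative_eq_intros)
   from has_derivative_diff[OF has_derivative_compose[OF this ker_bounds(1)[OF R2]] has_derivative_compose[OF this ker_bounds(1)[OF R]]]
   show ?thesis .
  qed
  have eq: "Dker (R/2) x (- (- h)) - Dker R x (- (- h)) = D x" for x by (simp add: D_def)
  have c: "continuous_on UNIV (%r. D (q - r))" by (rule continuous_on_compose2[OF cD[of UNIV]]) (auto intro!: continuous_intros)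
  have s: "?psi r = 0" if "r ~: cball q R" for r using that R by (simp add: ker_bounds(4) dist_norm)
  note I = integral_derivative_compact_support[where psi="?psi" and h="- h", OF d _ compact_cball[of q R] s, unfolded eq, OF c]
  show "integrable lborel (%r. D (q - r))" "(LI r. D (q - r)) = 0" using I by auto
 qed
 have k1: "integrable lborel (%z. f z *R D (q - fst z))" by (rule dens_kernel_bounded(1)[OF f _ Db]) measurable
 have fq: "integrable lborel (%u. f (q, u))"
 proof (rule Bochner_Integration.integrable_bound)
  show "integrable lborel (%u. B * wt u)" using wt_integrable by simp
  show "(%u. f (q, u)) : borel_measurable lborel"
   using measurable_compose[OF _ densD(1)[OF f], of "%u. (q, u)" lborel] by (simp add: borel_prod[symmetric])
  show "AE u in lborel. norm (f (q, u)) <= norm (B * wt u)"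
   using densD(2,3)[OF f] by (intro AE_I2) (auto intro!: order_trans[OF _ abs_ge_self])
 qed
 have fqm[measurable]: "(%u. f (q, u)) : bmeas" using fq by auto
 have gm: "(%z. f (q, snd z) *R D (q - fst z)) : borel_measurable (lborel \<Otimes>\<^sub>M lborel)"
  unfolding lborel_prod using measurable_phase(2)[OF fqm] by measurable
 have k2': "integrable (lborel \<Otimes>\<^sub>M lborel) (%z. f (q, snd z) *R D (q - fst z))"
 proof (rule lborel_pair.Fubini_integrable[OF gm])
  show "integrable lborel (%x. LI y. norm (f (q, snd (x, y)) *R D (q - fst (x, y))))"
   using integrable_norm[OF intD] integrable_norm[OF fq] by simp
  show "AE x in lborel. integrable lborel (%y. f (q, snd (x, y)) *R D (q - fst (x, y)))" using fq by simp
 qed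
 then have k2: "integrable lborel (%z. f (q, snd z) *R D (q - fst z))" by (simp add: lborel_prod)
 have z: "(LI z. f (q, snd z) *R D (q - fst z)) = 0"
 proof -
  have "(LI z. f (q, snd z) *R D (q - fst z)) = (LI r. LI u. f (q, snd (r, u)) *R D (q - fst (r, u)))"
   using lborel_pair.integral_fst'[OF k2'] by (simp add: lborel_prod)
  also have "... = (LI r. (LI u. f (q, u)) *R D (q - r))" using fq by simp
  also have "... = (LI u. f (q, u)) *R (LI r. D (q - r))" by simp
  finally show ?thesis by (simp add: meanD)
 qed
 have H0: "H >= 0" using H by (simp add: holder_def)
 have "pot (%x. Dker (R/2) x h) f q - pot (%x. Dker R x h) f q = (LI z. f z *R D (q - fst z))"
  unfolding pot_def D_def
  using dens_kernel_bounded(1)[OF f ker_measurable(3)[OF R] ker_bounds(5)[OF R], of q h] dens_kernel_bounded(1)[OF f ker_measurable(3)[OF R2] ker_bounds(5)[OF R2], of q h]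
  by (simp add: scaleR_diff_right)
 also have "... = (LI z. (f z - f (q, snd z)) *R D (q - fst z))"
  using k1 k2 z by (simp add: scaleR_diff_left)
 finally have eq: "pot (%x. Dker (R/2) x h) f q - pot (%x. Dker R x h) f q = (LI z. (f z - f (q, snd z)) *R D (q - fst z))" .
 have i3: "integrable lborel (%z. (f z - f (q, snd z)) *R D (q - fst z))" using k1 k2 by (simp add: scaleR_diff_left)
 let ?k = "%x::R3. indicator (cball 0 R) x * ennreal ?E"
 have "ennreal (norm (pot (%x. Dker (R/2) x h) f q - pot (%x. Dker R x h) f q)) <= (NNI z. ennreal (norm ((f z - f (q, snd z)) *R D (q - fst z))))"
  unfolding eq by (rule integral_norm_bound_ennreal[OF i3])
 also have "... <= (NNI z. ?k (q - fst z) * ennreal (wt (snd z)))"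
 proof (rule nn_integral_mono)
  fix z :: phase
  obtain r u where ru: "z = (r, u)" by (cases z)
  show "ennreal (norm ((f z - f (q, snd z)) *R D (q - fst z))) <= ?k (q - fst z) * ennreal (wt (snd z))"
  proof (cases "norm (q - r) <= R")
   case True
   have "\<bar>f (r, u) - f (q, u)\<bar> <= H * norm (r - q) powr (1/4) * wt u" using H by (simp add: holder_def)
   also have "... <= H * R powr (1/4) * wt u"
    using True H0 wt_pos by (intro mult_right_mono mult_left_mono powr_mono2) (auto simp: norm_minus_commute)
   finally have "\<bar>f (r, u) - f (q, u)\<bar> * norm (D (q - r)) <= (H * R powr (1/4) * wt u) * (144 / R ^ 3 * norm h)"
    using Db[of "q - r"] H0 wt_pos by (intro mult_mono) auto
   also have "... = ?E * wt u" by (simp add: mult_ac)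
   finally have "ennreal (\<bar>f (r, u) - f (q, u)\<bar> * norm (D (q - r))) <= ennreal ?E * ennreal (wt u)"
    using R H0 wt_pos by (subst ennreal_mult[symmetric]) (auto intro: ennreal_leI)
   then show ?thesis using True by (simp add: ru)
  next
   case False
   then show ?thesis by (simp add: ru D0)
  qed
 qed
 also have "... <= ennreal Wc * (NNI x. ?k x)"
 proof (rule nn_integral_density_near[where w="%u. ennreal (wt u)"])
  show "(%z::phase. ennreal (wt (snd z))) : bmeas" by measurable
  show "?k : bmeas" by measurable
 qed (auto simp: Wc indicator_def)
 also have "(NNI x. ?k x) = ennreal (R ^ 3 * ubv) * ennreal ?E"
  using R by (subst nn_integral_multc) (auto simp: ball_R3)
 also have "ennreal Wc * ... = ennreal (Wc * ((R ^ 3 * ubv) * ?E))"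
  using R H0 Wc(1) by (simp add: ennreal_mult'[symmetric])
 also have "Wc * ((R ^ 3 * ubv) * ?E) = 144 * ubv * Wc * H * R powr (1/4) * norm h"
  using R by (simp add: field_simps)
 finally show ?thesis using R H0 Wc(1) by (subst (asm) ennreal_le_iff) auto
qed

text \<open>The sum of the dyadic pieces, a geometric series of ratio
  \<open>(1/2) powr (1/4)\<close>.\<close>

definition Ch :: real where "Ch = 144 * ubv * Wc / (1 - (1/2) powr (1/4))"

lemma half_powr: "0 < (1/2::real) powr (1/4)" "(1/2::real) powr (1/4) < 1"
 using powr_less_mono'[of "1/2" 0 "1/4"] by auto

lemma Ch_nonneg: "Ch >= 0"
 using half_powr Wc(1) by (auto simp: Ch_def intro!: divide_nonneg_pos)

text \<open>As the gradient of the Coulomb kernel is not integrable, the derivative is constructed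
  as the limit of the regularised ones along \<open>R / 2 ^ n\<close>, where the dyadic pieces sum
  up. The error bound for arbitrary \<open>R\<close> is part of the conclusion because later
  comparisons let \<open>R\<close> depend on time.\<close>

lemma pot_coulomb_deriv:
 assumes f: "dens B f" and H: "holder H f"
 shows "\<exists>D. \<forall>q. (pot coulomb f has_derivative D q) (at q) &
  (\<forall>R>0. \<forall>h. norm (D q h - pot (%x. Dker R x h) f q) <= Ch * H * R powr (1/4) * norm h)"
proof -
 have H0: "H >= 0" using H by (simp add: holder_def)
 let ?r = "(1/2::real) powr (1/4)"
 have step: "\<exists>D. \<forall>q. (pot coulomb f has_derivative D q) (at q) & (\<forall>h. norm (D q h - pot (%x. Dker R x h) f q) <= Ch * H * R powr (1/4) * norm h)"
  if R: "R > 0" for R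
 proof -
  have Rn: "R / 2 ^ n > 0" for n using R by simp
  define d where "d n q h = pot (%x. Dker (R / 2 ^ n) x h) f q" for n q h
  define c where "c h = 144 * ubv * Wc * H * R powr (1/4) * norm h" for h :: R3
  have diff: "norm (d (Suc n) q h - d n q h) <= c h * ?r ^ n" for n q h
  proof -
   have "(R / 2 ^ n) powr (1/4) = R powr (1/4) * ?r ^ n"
   proof -
    have "(R / 2 ^ n) = R * (1/2) powr n" by (simp add: powr_realpow power_one_over)
    then have "(R / 2 ^ n) powr (1/4) = R powr (1/4) * ((1/2) powr n) powr (1/4)" using R by (simp add: powr_mult)
    also have "((1/2) powr n) powr (1/4) = ((1/2::real) powr (1/4)) powr n" by (simp add: powr_powr mult.commute)
    finally show ?thesis by (simp add: powr_realpow)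
   qed
   then show ?thesis using pot_Dker_piece[OF f H Rn[of n], of h q] by (simp add: d_def c_def mult_ac)
  qed
  define D where "D q h = lim (%n. d n q h)" for q h
  have c1: "(%n. d n q h) ----> D q h" and c2: "norm (D q h - d n q h) <= c h * ?r ^ n / (1 - ?r)" for q h n
   using geometric_Cauchy[of ?r "%n. d n q h" "c h", OF _ half_powr(2) diff] half_powr by (auto simp: D_def convergent_LIMSEQ_iff)
  have cl: "(%n. pot (ker (R / 2 ^ n)) f q) ----> pot coulomb f q" for q
  proof -
   have "(%n. pot (ker (R / 2 ^ n)) f q - pot coulomb f q) ----> 0"
   proof (rule Lim_null_comparison)
    show "\<forall>\<^sub>F n in sequentially. norm (pot (ker (R / 2 ^ n)) f q - pot coulomb f q) <= 48 * ubv * Wc * R * B * (1/2) ^ n"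
    proof (intro always_eventually allI)
     fix n
     have "48 * ubv * Wc * (R / 2 ^ n) * B = 48 * ubv * Wc * R * B * (1/2) ^ n" by (simp add: power_one_over)
     then show "norm (pot (ker (R / 2 ^ n)) f q - pot coulomb f q) <= 48 * ubv * Wc * R * B * (1/2) ^ n"
      using pot_coulomb_ker[OF f Rn[of n], of q] by (simp only: norm_minus_commute)
    qed
    have "(%n. 48 * ubv * Wc * R * B * (1/2) ^ n) ----> 48 * ubv * Wc * R * B * 0" by (intro tendsto_intros LIMSEQ_realpow_zero) auto
    then show "(%n. 48 * ubv * Wc * R * B * (1/2) ^ n) ----> 0" by simp
   qed
   then show ?thesis by (rule LIM_zero_cancel)
  qed
  have "\<exists>g. \<forall>x\<in>UNIV. (%n. pot (ker (R / 2 ^ n)) f x) ----> g x & (g has_derivative D x) (at x within UNIV)"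
  proof (rule has_derivative_sequence[where f'="d" and ?x0.0=0 and l="pot coulomb f 0"])
   show "(pot (ker (R / 2 ^ n)) f has_derivative d n x) (at x within UNIV)" for n x
    using pot_ker_deriv(1)[OF f Rn, of n x] by (simp add: d_def[abs_def])
   show "\<forall>\<^sub>F n in sequentially. \<forall>x\<in>UNIV. \<forall>h. norm (d n x h - D x h) <= e * norm h" if e: "e > 0" for e
   proof -
    have "(%n. 144 * ubv * Wc * H * R powr (1/4) * ?r ^ n / (1 - ?r)) ----> 144 * ubv * Wc * H * R powr (1/4) * 0 / (1 - ?r)"
     using half_powr by (intro tendsto_intros LIMSEQ_realpow_zero) auto
    then have "(%n. 144 * ubv * Wc * H * R powr (1/4) * ?r ^ n / (1 - ?r)) ----> 0" by (simp only: mult_zero_right div_0)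
    from order_tendstoD(2)[OF this e] have "\<forall>\<^sub>F n in sequentially. 144 * ubv * Wc * H * R powr (1/4) * ?r ^ n / (1 - ?r) < e" .
    then show ?thesis
    proof eventually_elim
     case (elim n)
     show ?case
     proof (intro ballI allI)
      fix x h
      have "norm (d n x h - D x h) <= c h * ?r ^ n / (1 - ?r)" using c2[of x h n] by (simp add: norm_minus_commute)
      also have "... = (144 * ubv * Wc * H * R powr (1/4) * ?r ^ n / (1 - ?r)) * norm h" by (simp add: c_def)
      also have "... <= e * norm h" using elim by (intro mult_right_mono) auto
      finally show "norm (d n x h - D x h) <= e * norm h" .
     qed
    qed
   qed
   show "(%n. pot (ker (R / 2 ^ n)) f 0) ----> pot coulomb f 0" by (rule cl)
  qed auto
  then obtain g where g: "!!x. (%n. pot (ker (R / 2 ^ n)) f x) ----> g x" "!!x. (g has_derivative D x) (at x)" by auto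
  have "g = pot coulomb f" using LIMSEQ_unique[OF g(1) cl] by blast
  moreover have "norm (D q h - pot (%x. Dker R x h) f q) <= Ch * H * R powr (1/4) * norm h" for q h
   using c2[of q h 0] by (simp add: d_def c_def Ch_def)
  ultimately show ?thesis using g(2) by blast
 qed
 obtain D where D: "!!q. (pot coulomb f has_derivative D q) (at q)" using step[of 1] by auto
 show ?thesis
 proof (intro exI[of _ D] allI conjI impI D)
  fix q h and R :: real assume "R > 0"
  from step[OF this] obtain D' where D': "!!q. (pot coulomb f has_derivative D' q) (at q)" "!!q h. norm (D' q h - pot (%x. Dker R x h) f q) <= Ch * H * R powr (1/4) * norm h" by blast
  \<comment> \<open>Each \<open>R\<close> has its own dyadic sequence; uniqueness of the derivative
    identifies the limits.\<close>
  have "D q = D' q" by (rule has_derivative_unique[OF D D'(1)])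
  then show "norm (D q h - pot (%x. Dker R x h) f q) <= Ch * H * R powr (1/4) * norm h" using D'(2)[of q h] by simp
 qed
qed

subsection \<open>Comparison of two densities transported from the same one\<close>

text \<open>Both potentials are written over common particle labels \<open>w\<close>, on which the
  two densities agree. What remains is the kernel at the two positions of the same particle.\<close>

lemma pot_transport_diff:
 assumes f: "dens B f" and g: "dens B g" and X: "mpres X" and Y: "mpres Y" and fg: "!!w. f (X w) = g (Y w)"
  and k: "kbound N kap"
 shows "ennreal (norm (pot kap f q - pot kap g q)) <= (NNI w. ennreal (f (X w)) * ennreal (norm (kap (q - fst (X w)) - kap (q - fst (Y w)))))"
proof -
 have km: "kap : bmeas" using k by (simp add: kbound_def)
 have m: "(%z. f z *R kap (q - fst z)) : bmeas" "(%z. g z *R kap (q - fst z)) : bmeas"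
  using borel_measurable_integrable[OF pot_integrable[OF f k, of q]] borel_measurable_integrable[OF pot_integrable[OF g k, of q]] by auto
 have i: "integrable lborel (%w. f (X w) *R kap (q - fst (X w)))" "integrable lborel (%w. g (Y w) *R kap (q - fst (Y w)))"
  using mpres_integrable[OF X m(1)] mpres_integrable[OF Y m(2)] pot_integrable[OF f k] pot_integrable[OF g k] by auto
 have "pot kap f q - pot kap g q = (LI w. f (X w) *R kap (q - fst (X w))) - (LI w. g (Y w) *R kap (q - fst (Y w)))"
  unfolding pot_def mpres_integral[OF X m(1)] mpres_integral[OF Y m(2)] ..
 also have "... = (LI w. f (X w) *R (kap (q - fst (X w)) - kap (q - fst (Y w))))"
  using i by (simp add: fg scaleR_diff_right)
 also have "ennreal (norm ...) <= (NNI w. ennreal (norm (f (X w) *R (kap (q - fst (X w)) - kap (q - fst (Y w))))))"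
  using i by (intro integral_norm_bound_ennreal) (simp add: fg scaleR_diff_right)
 also have "... = (NNI w. ennreal (f (X w)) * ennreal (norm (kap (q - fst (X w)) - kap (q - fst (Y w)))))"
  using densD(2)[OF f] by (intro nn_integral_cong) (simp add: ennreal_mult)
 finally show ?thesis .
qed

lemma dens_transport_mass:
 assumes f: "dens B f" and X: "mpres X"
 shows "(NNI w. ennreal (f (X w))) <= ennreal B" "(%w. ennreal (f (X w))) : bmeas"
proof -
 have m: "(%z. ennreal (f z)) : bmeas" using densD(1)[OF f] by measurable
 show "(NNI w. ennreal (f (X w))) <= ennreal B"
  using mpres_nn_integral[OF X m] densD(7)[OF f] by simp
 show "(%w. ennreal (f (X w))) : bmeas" by (rule measurable_compose[OF mpres_measurable[OF X] m])
qed

text \<open>For labels in \<open>S\<close> the positions differ by at most \<open>d\<close> and the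
  Lipschitz bound applies. For the others nothing is known about positions, but both momenta are
  large; each density is then estimated separately with the tail of its weight, hence the factor
  2.\<close>

lemma pot_time_diff:
 assumes f: "dens B f" and g: "dens B g" and X: "mpres X" and Y: "mpres Y" and fg: "!!w. f (X w) = g (Y w)"
  and k: "kbound N kap" and lip: "!!x y. norm (kap x - kap y) <= Lam * norm (x - y)" and pos: "Lam >= 0" "d >= 0" "P > 0" "L > 0"
  and slow: "!!w. w : S ==> norm (fst (X w) - fst (Y w)) <= d"
  and fast: "!!w. w ~: S ==> P <= norm (snd (X w)) & P <= norm (snd (Y w))"
 shows "norm (pot kap f q - pot kap g q) <= Lam * d * B + 2 * N * (8 * ubv * L * (B * P powr (-1/4) * Wc) + B / L^2)"
proof -
 let ?E = "8 * ubv * L * (B * P powr (-1/4) * Wc) + B / L^2"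
 have N: "N >= 0" and km[measurable]: "kap : bmeas" using k by (auto simp: kbound_def)
 have B: "B >= 0" by (rule densD(6)[OF f])
 have kn: "(%x. ennreal (norm (kap x))) : bmeas" by measurable
 define T where "T f z = ennreal (norm (kap (q - fst z))) * (ennreal (f z) * indicator {z. P <= norm (snd z)} z)" for f and z :: phase
 have closedP: "{z::phase. P <= norm (snd z)} : sets borel"
  by (intro borel_closed closed_Collect_le continuous_intros)
 have Tm: "T f : bmeas" and Tb: "(NNI z. T f z) <= ennreal (N * ?E)" if f: "dens B f" for f
 proof -
  have fm: "(%z. ennreal (f z) * indicator {z. P <= norm (snd z)} z) : bmeas"
   using densD(1)[OF f] closedP by (intro borel_measurable_times_ennreal borel_measurable_indicator) auto
  show "T f : bmeas" unfolding T_def[abs_def] by (intro borel_measurable_times_ennreal fm measurable_phase(1)[OF kn])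
  show "(NNI z. T f z) <= ennreal (N * ?E)"
   unfolding T_def
  proof (rule nn_integral_density_singular[OF fm km, where w="%u. ennreal (B * P powr (-1/4) * wq u)"])
   fix r u
   show "ennreal (f (r, u)) * indicator {z. P <= norm (snd z)} (r, u) <= ennreal (B * P powr (-1/4) * wq u)"
   proof (cases "P <= norm u")
    case True
    have "f (r, u) <= B * wt u" by (rule densD(3)[OF f])
    also have "... <= B * (P powr (-1/4) * wq u)" using wt_tail[OF pos(3) True] B by (rule mult_left_mono)
    finally show ?thesis using True by (simp add: ennreal_leI mult.assoc)
   qed simp
  next
   have "(NNI u. ennreal (B * P powr (-1/4) * wq u)) = ennreal (B * P powr (-1/4)) * (NNI u. ennreal (wq u))"
    using B wt_pos by (simp add: ennreal_mult nn_integral_cmult)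
   also have "... <= ennreal (B * P powr (-1/4)) * ennreal Wc" by (intro mult_left_mono Wc) simp
   finally show "(NNI u. ennreal (B * P powr (-1/4) * wq u)) <= ennreal (B * P powr (-1/4) * Wc)" using B by (simp add: ennreal_mult')
   have "(NNI z. ennreal (f z) * indicator {z. P <= norm (snd z)} z) <= (NNI z. ennreal (f z))"
    by (intro nn_integral_mono) (auto simp: indicator_def)
   then show "(NNI z. ennreal (f z) * indicator {z. P <= norm (snd z)} z) <= ennreal B" using densD(7)[OF f] by (rule order_trans)
  qed (use k B N Wc(1) pos in \<open>auto simp: kbound_def\<close>)
 qed
 note tm = dens_transport_mass[OF f X]
 have TX: "(%w. T f (X w)) : bmeas" "(%w. T g (Y w)) : bmeas"
  by (rule measurable_compose[OF mpres_measurable[OF X] Tm[OF f]], rule measurable_compose[OF mpres_measurable[OF Y] Tm[OF g]])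
 have "ennreal (norm (pot kap f q - pot kap g q)) <= (NNI w. ennreal (f (X w)) * ennreal (norm (kap (q - fst (X w)) - kap (q - fst (Y w)))))"
  by (rule pot_transport_diff[OF f g X Y fg k])
 also have "... <= (NNI w. ennreal (f (X w)) * ennreal (Lam * d) + T f (X w) + T g (Y w))"
 proof (rule nn_integral_mono)
  fix w
  show "ennreal (f (X w)) * ennreal (norm (kap (q - fst (X w)) - kap (q - fst (Y w)))) <= ennreal (f (X w)) * ennreal (Lam * d) + T f (X w) + T g (Y w)"
  proof (cases "w : S")
   case True
   have "norm (kap (q - fst (X w)) - kap (q - fst (Y w))) <= Lam * norm (fst (Y w) - fst (X w))" using lip[of "q - fst (X w)" "q - fst (Y w)"] by simp
   also have "... <= Lam * d" using slow[OF True] pos by (intro mult_left_mono) (auto simp: norm_minus_commute)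
   finally have "ennreal (f (X w)) * ennreal (norm (kap (q - fst (X w)) - kap (q - fst (Y w)))) <= ennreal (f (X w)) * ennreal (Lam * d)"
    by (intro mult_left_mono ennreal_leI) auto
   then show ?thesis by (rule order_trans) (simp add: add.assoc)
  next
   case False
   have "ennreal (norm (kap (q - fst (X w)) - kap (q - fst (Y w)))) <= ennreal (norm (kap (q - fst (X w)))) + ennreal (norm (kap (q - fst (Y w))))"
    by (simp add: ennreal_plus[symmetric] ennreal_leI norm_triangle_ineq4 del: ennreal_plus)
   then have "ennreal (f (X w)) * ennreal (norm (kap (q - fst (X w)) - kap (q - fst (Y w)))) <= ennreal (f (X w)) * (ennreal (norm (kap (q - fst (X w)))) + ennreal (norm (kap (q - fst (Y w)))))"
    by (rule mult_left_mono) simp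
   also have "... = T f (X w) + T g (Y w)" using fast[OF False] by (simp add: T_def distrib_left fg mult_ac)
   finally show ?thesis by (rule order_trans) (simp add: add.assoc)
  qed
 qed
 also have "... = (NNI w. ennreal (f (X w))) * ennreal (Lam * d) + (NNI w. T f (X w)) + (NNI w. T g (Y w))"
  using TX tm(2) by (simp add: nn_integral_add nn_integral_multc)
 also have "... <= ennreal B * ennreal (Lam * d) + ennreal (N * ?E) + ennreal (N * ?E)"
  unfolding mpres_nn_integral[OF X Tm[OF f]] mpres_nn_integral[OF Y Tm[OF g]]
  by (intro add_mono mult_right_mono tm(1) Tb f g) simp
 also have "... = ennreal (Lam * d * B + 2 * N * ?E)"
 proof -
  have "0 <= N * ?E" using N B pos Wc(1) by simp
  then show ?thesis using B pos by (simp add: ennreal_mult'[symmetric] ennreal_plus[symmetric] algebra_simps del: ennreal_plus)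
 qed
 finally show ?thesis
  using N B pos Wc(1) by (subst (asm) ennreal_le_iff) auto
qed

text \<open>The piece of the kernel at scale \<open>R\<close> has Lipschitz constant of order
  \<open>1 / R^3\<close> and lives on a volume of order \<open>R^3\<close>, so each of the
  \<open>n\<close> scales contributes a multiple of \<open>d\<close>, while the scales below
  \<open>(1/2) ^ n\<close> contribute their radius. Leaving \<open>n\<close> free encodes the
  modulus \<open>d * ln (1 / d)\<close>.\<close>

lemma pot_osgood:
 assumes f: "dens B f" and g: "dens B g" and X: "mpres X" and Y: "mpres Y" and fg: "!!w. f (X w) = g (Y w)"
  and d: "!!w. norm (fst (X w) - fst (Y w)) <= d"
 shows "norm (pot coulomb f q - pot coulomb g q) <= B * (96 * ubv * Wc * (1/2) ^ n + (16 + real n * (288 * ubv * Wc)) * d)"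
proof -
 have B: "B >= 0" by (rule densD(6)[OF f])
 have d0: "d >= 0" using order_trans[OF norm_ge_zero d] .
 have Rn: "(1/2::real) ^ n > 0" for n by simp
 have ind: "norm (pot (ker ((1/2) ^ n)) f q - pot (ker ((1/2) ^ n)) g q) <= B * ((16 + real n * (288 * ubv * Wc)) * d)" for n
 proof (induction n)
  case 0
  have "norm (pot (ker 1) f q - pot (ker 1) g q) <= 16 * d * B + 2 * 5 * 0"
  proof -
   note tm = dens_transport_mass[OF f X]
   have "ennreal (norm (pot (ker 1) f q - pot (ker 1) g q)) <= (NNI w. ennreal (f (X w)) * ennreal (norm (ker 1 (q - fst (X w)) - ker 1 (q - fst (Y w)))))"
    by (rule pot_transport_diff[OF f g X Y fg kbound_kernels(1)]) auto
   also have "... <= (NNI w. ennreal (f (X w)) * ennreal (16 * d))"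
   proof (intro nn_integral_mono mult_left_mono ennreal_leI)
    fix w
    show "norm (ker 1 (q - fst (X w)) - ker 1 (q - fst (Y w))) <= 16 * d"
     using ker_bounds(8)[of 1 "q - fst (X w)" "q - fst (Y w)"] d[of w] by (simp add: norm_minus_commute)
   qed simp
   also have "... <= ennreal B * ennreal (16 * d)" using tm by (simp add: nn_integral_multc mult_right_mono)
   finally show ?thesis using B d0 by (simp add: ennreal_mult'[symmetric] ennreal_le_iff mult_ac)
  qed
  then show ?case by (simp add: mult_ac)
 next
  case (Suc n)
  define R where "R = (1/2::real) ^ n"
  have R: "R > 0" "R/2 > 0" "(1/2) ^ Suc n = R / 2" by (auto simp: R_def)
  define k where "k x = ker (R/2) x - ker R x" for x
  have kb: "kbound 10 k"
  proof -
   have "norm (k x) <= 10 / (norm x)^2" if "x ~= 0" for x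
    using norm_triangle_ineq4[of "ker (R/2) x" "ker R x"] ker_bounds(3)[OF R(1) that] ker_bounds(3)[OF R(2) that] unfolding k_def by (simp add: add_divide_distrib[symmetric])
   moreover have "k : bmeas" unfolding k_def[abs_def] using ker_measurable(2)[OF R(1)] ker_measurable(2)[OF R(2)] by measurable
   ultimately show ?thesis by (simp add: kbound_def)
  qed
  have k0: "k x = 0" if "R < norm x" for x using that R by (simp add: k_def ker_bounds(4))
  have klip: "norm (k x - k y) <= 144 / R ^ 3 * norm (x - y)" for x y
  proof -
   have "norm (k x - k y) <= norm (ker (R/2) x - ker (R/2) y) + norm (ker R x - ker R y)"
    unfolding k_def using norm_triangle_ineq4[of "ker (R/2) x - ker (R/2) y" "ker R x - ker R y"] by (simp add: algebra_simps)
   also have "... <= 16 / (R/2) ^ 3 * norm (x - y) + 16 / R ^ 3 * norm (x - y)" by (intro add_mono ker_bounds(8) R)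
   also have "... = 144 / R ^ 3 * norm (x - y)" using R by (simp add: power_divide field_simps)
   finally show ?thesis .
  qed
  let ?I = "%x::R3. indicator (cball 0 R) x :: ennreal"
  \<comment> \<open>The difference is 0 unless one of the two points lies in the ball, which
    attaches the volume factor to the position of either particle.\<close>
  have kd: "ennreal (norm (k x - k y)) <= ennreal (144 / R ^ 3 * d) * (?I x + ?I y)" if "norm (x - y) <= d" for x y
  proof (cases "R < norm x & R < norm y")
   case False
   then have 1: "(1::ennreal) <= ?I x + ?I y" by (auto simp: indicator_def)
   have "norm (k x - k y) <= 144 / R ^ 3 * d" using R by (intro order_trans[OF klip mult_left_mono[OF that]]) simp
   then have "ennreal (norm (k x - k y)) <= ennreal (144 / R ^ 3 * d) * 1" by (simp add: ennreal_leI)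
   also have "... <= ennreal (144 / R ^ 3 * d) * (?I x + ?I y)" by (intro mult_left_mono 1) simp
   finally show ?thesis .
  qed (simp add: k0)
  have Im: "?I : bmeas" by measurable
  define T where "T f z = ?I (q - fst z) * ennreal (f z)" for f and z :: phase
  have Tm: "T f : bmeas" and Tb: "(NNI z. T f z) <= ennreal (B * Wc * (R ^ 3 * ubv))" if f: "dens B f" for f
  proof -
   have fm: "(%z. ennreal (f z)) : bmeas" using densD(1)[OF f] by measurable
   show "T f : bmeas" unfolding T_def[abs_def] by (intro borel_measurable_times_ennreal fm measurable_phase(1)[OF Im])
   have "(NNI z. T f z) <= ennreal (B * Wc) * (NNI x. ?I x)"
    unfolding T_def by (rule nn_integral_density_near[OF fm Im _ densD(9)[OF f] densD(8)[OF f]]) (simp add: indicator_def)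
   also have "... = ennreal (B * Wc * (R ^ 3 * ubv))" using R B Wc(1) by (simp add: ball_R3 ennreal_mult'[symmetric])
   finally show "(NNI z. T f z) <= ennreal (B * Wc * (R ^ 3 * ubv))" .
  qed
  have TX: "(%w. T f (X w)) : bmeas" "(%w. T g (Y w)) : bmeas"
   by (rule measurable_compose[OF mpres_measurable[OF X] Tm[OF f]], rule measurable_compose[OF mpres_measurable[OF Y] Tm[OF g]])
  have "ennreal (norm (pot k f q - pot k g q)) <= (NNI w. ennreal (f (X w)) * ennreal (norm (k (q - fst (X w)) - k (q - fst (Y w)))))"
   by (rule pot_transport_diff[OF f g X Y fg kb])
  also have "... <= (NNI w. ennreal (144 / R ^ 3 * d) * (T f (X w) + T g (Y w)))"
  proof (rule nn_integral_mono)
   fix w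
   have "ennreal (f (X w)) * ennreal (norm (k (q - fst (X w)) - k (q - fst (Y w)))) <= ennreal (f (X w)) * (ennreal (144 / R ^ 3 * d) * (?I (q - fst (X w)) + ?I (q - fst (Y w))))"
    using d[of w] by (intro mult_left_mono kd) (auto simp: norm_minus_commute)
   also have "... = ennreal (144 / R ^ 3 * d) * (T f (X w) + T g (Y w))" unfolding T_def fg by (simp only: distrib_left mult_ac)
   finally show "ennreal (f (X w)) * ennreal (norm (k (q - fst (X w)) - k (q - fst (Y w)))) <= ennreal (144 / R ^ 3 * d) * (T f (X w) + T g (Y w))" .
  qed
  also have "... = ennreal (144 / R ^ 3 * d) * ((NNI z. T f z) + (NNI z. T g z))"
   using TX by (simp add: nn_integral_cmult nn_integral_add mpres_nn_integral[OF X Tm[OF f]] mpres_nn_integral[OF Y Tm[OF g]])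
  also have "... <= ennreal (144 / R ^ 3 * d) * (ennreal (B * Wc * (R ^ 3 * ubv)) + ennreal (B * Wc * (R ^ 3 * ubv)))"
   by (intro mult_left_mono add_mono Tb f g) simp
  also have "... = ennreal ((144 / R ^ 3 * d) * (2 * (B * Wc * (R ^ 3 * ubv))))"
   using R d0 B Wc(1) by (simp add: ennreal_plus[symmetric] ennreal_mult'[symmetric] del: ennreal_plus)
  also have "(144 / R ^ 3 * d) * (2 * (B * Wc * (R ^ 3 * ubv))) = B * (288 * ubv * Wc * d)" using R by simp
  finally have piece: "norm (pot k f q - pot k g q) <= B * (288 * ubv * Wc * d)"
   using B d0 Wc(1) by (subst (asm) ennreal_le_iff) auto
  have spl: "pot k h q = pot (ker (R/2)) h q - pot (ker R) h q" if "dens B h" for h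
   unfolding k_def[abs_def] by (rule pot_diff_kernel[OF that kbound_kernels(1)[OF R(2)] kbound_kernels(1)[OF R(1)]])
  have "pot (ker (R/2)) f q - pot (ker (R/2)) g q = (pot (ker R) f q - pot (ker R) g q) + (pot k f q - pot k g q)"
   by (simp add: spl[OF f] spl[OF g])
  then have "norm (pot (ker (R/2)) f q - pot (ker (R/2)) g q) <= B * ((16 + real n * (288 * ubv * Wc)) * d) + B * (288 * ubv * Wc * d)"
   using norm_triangle_le[OF add_mono[OF Suc.IH[folded R_def] piece]] by simp
  then show ?case unfolding R(3) by (simp add: algebra_simps)
 qed
 have "norm (pot coulomb f q - pot coulomb g q) <= norm (pot coulomb f q - pot (ker ((1/2) ^ n)) f q) + norm (pot (ker ((1/2) ^ n)) f q - pot (ker ((1/2) ^ n)) g q) + norm (pot coulomb g q - pot (ker ((1/2) ^ n)) g q)"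
 proof -
  have e: "x - y = (x - a) + (a - b) - (y - b)" for x y a b :: R3 by simp
  show ?thesis unfolding e[of "pot coulomb f q" "pot coulomb g q" "pot (ker ((1/2) ^ n)) f q" "pot (ker ((1/2) ^ n)) g q"]
   by (rule order_trans[OF norm_triangle_ineq4 add_right_mono[OF norm_triangle_ineq]])
 qed
 also have "... <= 48 * ubv * Wc * (1/2) ^ n * B + B * ((16 + real n * (288 * ubv * Wc)) * d) + 48 * ubv * Wc * (1/2) ^ n * B"
  by (intro add_mono ind pot_coulomb_ker f g Rn)
 finally show ?thesis by (simp add: algebra_simps)
qed

section \<open>The field of an admissible function\<close>

definition adm :: "real => (phase => real) => bool"
 where "adm J gam \<longleftrightarrow> 0 <= J & gam : bmeas & integrable lborel (%z. (gam z)^2) & (LI z. (gam z)^2) <= J^2 &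
  (\<forall>q p. \<bar>gam (q, p)\<bar> <= J / (1 + (norm p)^2)) & (\<forall>q q' p. \<bar>gam (q, p) - gam (q', p)\<bar> <= J * norm (q - q'))"

lemma inverse_le_wt: "(1 / (1 + (norm p)^2))^2 <= wt p"
proof -
 have 1: "1 + (norm p)^2 >= 1" by simp
 have "(1 / (1 + (norm p)^2))^2 = (1 + (norm p)^2) powr (-2)"
  using 1 by (simp add: powr_minus_divide power_divide)
 also have "... <= wt p" unfolding wt_def using 1 by (intro powr_mono) auto
 finally show ?thesis .
qed

lemma adm_dens: assumes "adm J gam" shows "dens (J^2) (%z. (gam z)^2)"
proof -
 have [measurable]: "gam : bmeas" using assms by (simp add: adm_def)
 have "(gam (r, u))^2 <= J^2 * wt u" for r u
 proof -
  have "\<bar>gam (r, u)\<bar> <= J * (1 / (1 + (norm u)^2))" using assms by (simp add: adm_def)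
  then have "\<bar>gam (r, u)\<bar>^2 <= (J * (1 / (1 + (norm u)^2)))^2" by (intro power_mono) auto
  also have "... = J^2 * (1 / (1 + (norm u)^2))^2" by (rule power_mult_distrib)
  also have "... <= J^2 * wt u" by (intro mult_left_mono inverse_le_wt) simp
  finally show ?thesis by simp
 qed
 moreover have "(%z. (gam z)^2) : bmeas" by measurable
 ultimately show ?thesis using assms by (simp add: dens_def adm_def)
qed

text \<open>A difference of squares is a difference times a sum. The difference is split into its
  powers 3/4 and 1/4, the former bounded by the decay and the latter by the Lipschitz bound. With
  the decay of the sum this gives the exponent 3/4 + 1 = 7/4 of \<open>wt\<close>.\<close>

lemma adm_holder: assumes "adm J gam" shows "holder (4 * J^2) (%z. (gam z)^2)"
 unfolding holder_def
proof (intro conjI allI)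
 fix r r' u :: R3
 define b where "b = 1 + (norm u)^2"
 have b: "b >= 1" by (simp add: b_def)
 have J: "J >= 0" using assms by (simp add: adm_def)
 let ?x = "\<bar>gam (r, u) - gam (r', u)\<bar>" and ?n = "norm (r - r')"
 have g: "\<bar>gam (r, u)\<bar> <= J / b" "\<bar>gam (r', u)\<bar> <= J / b" "?x <= J * ?n" using assms by (auto simp: adm_def b_def)
 have 2: "2 * J / b = J / b + J / b" by simp
 have x: "?x <= 2 * J / b" "\<bar>gam (r, u) + gam (r', u)\<bar> <= 2 * J / b" unfolding 2 using g(1,2) by linarith+
 have "?x = ?x powr (3/4) * ?x powr (1/4)" by (simp add: powr_add[symmetric])
 also have "... <= (2 * J / b) powr (3/4) * (J * ?n) powr (1/4)"
  using x g by (intro mult_mono powr_mono2) auto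
 finally have "?x * \<bar>gam (r, u) + gam (r', u)\<bar> <= ((2 * J / b) powr (3/4) * (J * ?n) powr (1/4)) * (2 * J / b)"
  using x by (intro mult_mono) auto
 also have "... = 2 * (2 powr (3/4)) * (J powr (3/4) * J powr (1/4) * J) * ?n powr (1/4) * (b powr (-(3/4)) * b powr (-1))"
  using J b by (simp add: powr_mult powr_divide powr_minus_divide mult_ac)
 also have "b powr (-(3/4)) * b powr (-1) = b powr (-7/4)" unfolding powr_add[symmetric] by simp
 also have "J powr (3/4) * J powr (1/4) * J = J^2" using J by (simp add: powr_add[symmetric] power2_eq_square)
 also have "2 * (2 powr (3/4)) * J^2 * ?n powr (1/4) * b powr (-7/4) <= 4 * J^2 * ?n powr (1/4) * b powr (-7/4)"
 proof -
  have "(2::real) powr (3/4) <= 2 powr 1" by (intro powr_mono) auto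
  then show ?thesis by (intro mult_right_mono) auto
 qed
 finally have "?x * \<bar>gam (r, u) + gam (r', u)\<bar> <= 4 * J^2 * ?n powr (1/4) * wt u" by (simp add: wt_def b_def)
 moreover have "\<bar>(gam (r, u))^2 - (gam (r', u))^2\<bar> = ?x * \<bar>gam (r, u) + gam (r', u)\<bar>"
  unfolding abs_mult[symmetric] by (simp add: power2_eq_square algebra_simps)
 ultimately show "\<bar>(gam (r, u))^2 - (gam (r', u))^2\<bar> <= 4 * J^2 * norm (r - r') powr (1/4) * wt u" by simp
qed simp

lemma E_field_pot: "E_field gam q = (1 / (4 * pi)) *R pot coulomb (%z. (gam z)^2) q"
 and field_integrand_coulomb: "field_integrand gam q = (%z. (gam z)^2 *R coulomb (q - fst z))"
proof -
 show *: "field_integrand gam q = (%z. (gam z)^2 *R coulomb (q - fst z))"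
  by (auto simp: field_integrand_def coulomb_def)
 show "E_field gam q = (1 / (4 * pi)) *R pot coulomb (%z. (gam z)^2) q" by (simp add: E_field_def pot_def *)
qed

definition DE :: "(phase => real) => R3 => R3 => R3"
 where "DE gam q = frechet_derivative (E_field gam) (at q)"

lemma pi4: "norm ((1 / (4 * pi)) *R x) <= norm (x::'a::real_normed_vector)"
proof -
 have "1 / (4 * pi) <= 1" using pi_ge_two by (simp add: field_simps)
 then show ?thesis using mult_right_mono[of "1 / (4 * pi)" 1 "norm x"] by simp
qed

lemma E_field_static:
 assumes a: "adm J gam"
 shows "E_field_converges gam" "norm (E_field gam q) <= (8 * ubv * Wc + 1) * J^2"
  "(E_field gam has_derivative DE gam q) (at q)"
  "R > 0 ==> norm (DE gam q h - (1 / (4 * pi)) *R pot (%x. Dker R x h) (%z. (gam z)^2) q) <= 4 * Ch * J^2 * R powr (1/4) * norm h"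
  "norm (DE gam q h) <= (4 * Ch + 16) * J^2 * norm h"
proof -
 let ?f = "%z. (gam z)^2"
 note d = adm_dens[OF a] and h = adm_holder[OF a]
 show "E_field_converges gam"
  unfolding E_field_converges_def field_integrand_coulomb using pot_integrable[OF d kbound_coulomb] by blast
 have "norm (pot coulomb ?f q) <= (8 * ubv * Wc + 1) * J^2"
  using pot_bound(1)[OF d kbound_coulomb, of 1 q] by (simp add: algebra_simps)
 then show "norm (E_field gam q) <= (8 * ubv * Wc + 1) * J^2"
  unfolding E_field_pot using pi4 order_trans by blast
 obtain D where D: "!!q. (pot coulomb ?f has_derivative D q) (at q)"
  "!!q R h. R > 0 ==> norm (D q h - pot (%x. Dker R x h) ?f q) <= Ch * (4 * J^2) * R powr (1/4) * norm h"
  using pot_coulomb_deriv[OF d h] by blast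
 have E: "(E_field gam has_derivative (%h. (1 / (4 * pi)) *R D q h)) (at q)" for q
  unfolding E_field_pot[abs_def] by (intro has_derivative_scaleR_right D)
 then have DE: "DE gam q = (%h. (1 / (4 * pi)) *R D q h)" for q
  unfolding DE_def by (rule frechet_derivative_at[symmetric])
 show "(E_field gam has_derivative DE gam q) (at q)" using E[of q] DE by simp
 have *: "norm (DE gam q h - (1 / (4 * pi)) *R pot (%x. Dker R x h) ?f q) <= 4 * Ch * J^2 * R powr (1/4) * norm h" if "R > 0" for R
  unfolding DE scaleR_diff_right[symmetric] using order_trans[OF pi4 D(2)[OF that]] by (simp add: mult_ac)
 then show "R > 0 ==> norm (DE gam q h - (1 / (4 * pi)) *R pot (%x. Dker R x h) ?f q) <= 4 * Ch * J^2 * R powr (1/4) * norm h" .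
 have "norm ((1 / (4 * pi)) *R pot (%x. Dker 1 x h) ?f q) <= 16 * J^2 * norm h"
  using order_trans[OF pi4 pot_ker_deriv(2)[OF d, of 1]] by simp
 then show "norm (DE gam q h) <= (4 * Ch + 16) * J^2 * norm h"
  using *[of 1] norm_triangle_sub[of "DE gam q h" "(1 / (4 * pi)) *R pot (%x. Dker 1 x h) ?f q"] by (simp add: algebra_simps)
qed

lemma continuous_on_Lipschitz_joint:
 fixes G :: "real => 'a::real_normed_vector => 'b::real_normed_vector"
 assumes lip: "!!t q q'. t : S ==> norm (G t q - G t q') <= Lam * norm (q - q')" and c: "!!q. continuous_on S (%t. G t q)"
 shows "continuous_on (S \<times> UNIV) (%(t, q). G t q)"
 unfolding continuous_on_iff
proof (intro ballI allI impI)
 fix x :: "real \<times> 'a" and e :: real assume x: "x : S \<times> UNIV" and e: "e > 0"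
 obtain t q where tq: "x = (t, q)" "t : S" using x by auto
 obtain d where d: "d > 0" "!!t'. t' : S ==> dist t' t < d ==> dist (G t' q) (G t q) < e/2"
  using c[of q] tq(2) half_gt_zero[OF e] unfolding continuous_on_iff by blast
 define d' where "d' = min d (e / (2 * (\<bar>Lam\<bar> + 1)))"
 have d': "d' > 0" using d e by (simp add: d'_def)
 show "\<exists>d>0. \<forall>x'\<in>S \<times> UNIV. dist x' x < d --> dist (case x' of (t, q) => G t q) (case x of (t, q) => G t q) < e"
 proof (intro exI[of _ d'] conjI ballI impI d')
  fix x' assume x': "x' : S \<times> UNIV" "dist x' x < d'"
  obtain t' q' where tq': "x' = (t', q')" "t' : S" using x' by auto
  have dt: "dist t' t < d'" and dq: "dist q' q < d'"
   using x'(2) dist_fst_le[of x' x] dist_snd_le[of x' x] by (auto simp: tq tq')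
  have "dist (G t' q') (G t' q) <= Lam * dist q' q" using lip[OF tq'(2)] by (simp add: dist_norm)
  also have "... <= \<bar>Lam\<bar> * (e / (2 * (\<bar>Lam\<bar> + 1)))" using dq by (intro mult_mono) (auto simp: d'_def)
  also have "... <= (\<bar>Lam\<bar> + 1) * (e / (2 * (\<bar>Lam\<bar> + 1)))" using e by (intro mult_right_mono) auto
  also have "... = e / 2" by (simp add: field_simps)
  finally have "dist (G t' q') (G t' q) <= e / 2" .
  moreover have "dist (G t' q) (G t q) < e / 2" using d(2)[OF tq'(2)] dt by (simp add: d'_def)
  ultimately show "dist (case x' of (t, q) => G t q) (case x of (t, q) => G t q) < e"
   using dist_triangle[of "G t' q'" "G t q" "G t' q"] by (simp add: tq tq')
 qed
qed

text \<open>Potentials are continuous in time by \<open>pot_tendsto\<close>, and Lipschitz bounds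
  uniform in time add the position. For the gradient this works for each regularisation; the Hoelder
  error bound then makes the limit in \<open>R\<close> uniform.\<close>

lemma E_field_continuous:
 fixes S :: "real set" and gam :: "real => phase => real"
 assumes a: "!!t. t : S ==> adm J (gam t)" and c: "!!z. continuous_on S (%t. gam t z)"
 shows "continuous_on (S \<times> UNIV) (%(t, q). E_field (gam t) q)" "continuous_on (S \<times> UNIV) (%(t, q). DE (gam t) q h)"
proof -
 let ?f = "%t. %z. (gam t z)^2"
 have pc: "continuous_on S (%t. pot kap (?f t) q)" if "kbound N kap" for N kap q
 proof (rule continuous_on_sequentially[THEN iffD2], intro allI ballI impI)
  fix x :: "nat => real" and t :: real assume t: "t : S" and x: "(\<forall>n. x n : S) & x ----> t"
  have "(%n. (gam (x n) z)^2) ----> (gam t z)^2" for z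
   using c[of z] t x unfolding continuous_on_sequentially by (auto intro!: tendsto_power simp: o_def)
  then have "(%n. pot kap (%z. (gam (x n) z)^2) q) ----> pot kap (?f t) q"
   using x t by (intro pot_tendsto[where B="J^2" and N=N] adm_dens a that) auto
  then show "((%t. pot kap (?f t) q) \<circ> x) ----> pot kap (?f t) q" by (simp add: o_def)
 qed
 show "continuous_on (S \<times> UNIV) (%(t, q). E_field (gam t) q)"
 proof (rule continuous_on_Lipschitz_joint)
  show "norm (E_field (gam t) q - E_field (gam t) q') <= (4 * Ch + 16) * J^2 * norm (q - q')" if t: "t : S" for t q q'
   by (rule differentiable_bound[where S=UNIV and f'="DE (gam t)"])
     (use E_field_static(3,5)[OF a[OF t]] in \<open>auto intro!: onorm_le\<close>)
  show "continuous_on S (%t. E_field (gam t) q)" for q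
   unfolding E_field_pot by (intro continuous_intros pc[OF kbound_coulomb])
 qed
 define G where "G R = (%(t, q). (1 / (4 * pi)) *R pot (%x. Dker R x h) (?f t) q)" for R
 have cG: "continuous_on (S \<times> UNIV) (G R)" if R: "R > 0" for R
  unfolding G_def
 proof (rule continuous_on_Lipschitz_joint)
  show "norm ((1 / (4 * pi)) *R pot (%x. Dker R x h) (?f t) q - (1 / (4 * pi)) *R pot (%x. Dker R x h) (?f t) q')
   <= (50 / R ^ 4 * J^2 * norm h) * norm (q - q')" if t: "t : S" for t q q'
   unfolding scaleR_diff_right[symmetric]
   using order_trans[OF pi4 pot_ker_deriv(3)[OF adm_dens[OF a[OF t]] R]] by (simp add: mult_ac)
  show "continuous_on S (%t. (1 / (4 * pi)) *R pot (%x. Dker R x h) (?f t) q)" for q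
   by (intro continuous_intros pc[OF kbound_kernels(2)[OF R]])
 qed
 show "continuous_on (S \<times> UNIV) (%(t, q). DE (gam t) q h)"
 proof (rule uniform_limit_theorem[where F=sequentially and f="%n. G (1 / real (Suc n))"])
  show "\<forall>\<^sub>F n in sequentially. continuous_on (S \<times> UNIV) (G (1 / real (Suc n)))"
   by (intro always_eventually allI cG) simp
  show "uniform_limit (S \<times> UNIV) (%n. G (1 / real (Suc n))) (%(t, q). DE (gam t) q h) sequentially"
   unfolding uniform_limit_iff
  proof (intro allI impI)
   fix e :: real assume e: "e > 0"
   have "(%n. 1 / real (Suc n)) ----> 0" using LIMSEQ_inverse_real_of_nat by (simp add: inverse_eq_divide)
   then have "(%n. (1 / real (Suc n)) powr (1/4)) ----> 0 powr (1/4)"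
    by (intro tendsto_powr'[OF _ tendsto_const]) (auto intro: always_eventually)
   then have "(%n. 4 * Ch * J^2 * (1 / real (Suc n)) powr (1/4) * norm h) ----> 4 * Ch * J^2 * (0 powr (1/4)) * norm h"
    by (intro tendsto_mult_left tendsto_mult_right)
   then have "(%n. 4 * Ch * J^2 * (1 / real (Suc n)) powr (1/4) * norm h) ----> 0" by simp
   from order_tendstoD(2)[OF this e]
   show "\<forall>\<^sub>F n in sequentially. \<forall>x\<in>S \<times> UNIV. dist (G (1 / real (Suc n)) x) (case x of (t, q) => DE (gam t) q h) < e"
   proof eventually_elim
    case (elim n)
    show ?case
    proof
     fix x :: "real \<times> R3" assume "x : S \<times> UNIV"
     then obtain t q where x: "x = (t, q)" "t : S" by auto
     have "norm (DE (gam t) q h - G (1 / real (Suc n)) (t, q)) <= 4 * Ch * J^2 * (1 / real (Suc n)) powr (1/4) * norm h"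
      unfolding G_def by (simp only: prod.case) (rule E_field_static(4)[OF a[OF x(2)]], simp)
     also have "... < e" by (rule elim)
     finally show "dist (G (1 / real (Suc n)) x) (case x of (t, q) => DE (gam t) q h) < e"
      by (simp add: x dist_norm norm_minus_commute)
    qed
   qed
  qed
 qed simp
qed

text \<open>One constant that dominates all coefficients arising in the field comparisons
  below.\<close>

definition CT :: real where "CT = 400 + 96 * ubv * Wc + 8 * Ch + 256 * ubv * Wc + 288 * ubv * Wc"

lemma pot_coulomb_time_diff:
 assumes df: "dens B f" and dg: "dens B g" and X: "mpres X" and Y: "mpres Y" and fg: "!!w. f (X w) = g (Y w)"
  and pos: "d >= 0" "P > 0" "L > 0" "R > 0"
  and slow: "!!w. w : S ==> norm (fst (X w) - fst (Y w)) <= d"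
  and fast: "!!w. w ~: S ==> P <= norm (snd (X w)) & P <= norm (snd (Y w))"
 shows "norm (pot coulomb f q - pot coulomb g q) <= CT * B * (R + d / R ^ 3 + L * P powr (-1/4) + 1 / L^2)"
proof -
 have B: "B >= 0" by (rule densD(6)[OF df])
 define U where "U = ubv * Wc"
 define p where "p = P powr (-1/4)"
 have U: "U >= 0" using Wc(1) by (simp add: U_def)
 have CT: "400 <= CT" "96 * U <= CT" "80 * U <= CT" "8 * Ch <= CT" "256 * U <= CT" "10 <= CT" "50 <= CT" "32 <= CT"
  using U Ch_nonneg by (auto simp: CT_def U_def algebra_simps)
 have p0: "p >= 0" by (simp add: p_def)
 have k: "norm (pot (ker R) f q - pot (ker R) g q) <= (16 / R ^ 3) * d * B + 2 * 5 * (8 * ubv * L * (B * p * Wc) + B / L^2)"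
  unfolding p_def by (rule pot_time_diff[OF df dg X Y fg kbound_kernels(1)[OF pos(4)] ker_bounds(8)[OF pos(4)] _ pos(1-3) slow fast]) (use pos in auto)
 have tri: "norm (x - y) <= norm (x - a) + norm (a - b) + norm (y - b)" for x y a b :: R3
  using order_trans[OF norm_triangle_ineq4[of "(x - a) + (a - b)" "y - b"] add_right_mono[OF norm_triangle_ineq[of "x - a" "a - b"]]] by simp
 have "norm (pot coulomb f q - pot coulomb g q) <= norm (pot coulomb f q - pot (ker R) f q) + norm (pot (ker R) f q - pot (ker R) g q) + norm (pot coulomb g q - pot (ker R) g q)"
  by (rule tri)
 also have "... <= 48 * ubv * Wc * R * B + ((16 / R ^ 3) * d * B + 2 * 5 * (8 * ubv * L * (B * p * Wc) + B / L^2)) + 48 * ubv * Wc * R * B"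
  by (intro add_mono k pot_coulomb_ker df dg pos)
 also have "... = B * ((96 * U) * R + 16 * (d / R ^ 3) + (80 * U) * (L * p) + 10 * (1 / L^2))"
  by (simp add: U_def algebra_simps)
 also have "... <= B * (CT * R + CT * (d / R ^ 3) + CT * (L * p) + CT * (1 / L^2))"
  using CT pos p0 B by (intro mult_left_mono add_mono mult_right_mono) auto
 finally show "norm (pot coulomb f q - pot coulomb g q) <= CT * B * (R + d / R ^ 3 + L * P powr (-1/4) + 1 / L^2)" by (simp add: algebra_simps p_def)
qed

text \<open>For the field, the part of the kernel below scale \<open>R\<close> costs
  \<open>R\<close>. For its gradient only Hoelder continuity helps there, at the cost
  \<open>R powr (1/4)\<close>, and the other terms worsen by one factor
  \<open>1 / R\<close>.\<close>

lemma E_field_time_diff: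
 assumes a: "adm J gam" and b: "adm J gam'" and X: "mpres X" and Y: "mpres Y" and fg: "!!w. gam (X w) = gam' (Y w)"
  and pos: "d >= 0" "P > 0" "L > 0" "R > 0"
  and slow: "!!w. w : S ==> norm (fst (X w) - fst (Y w)) <= d"
  and fast: "!!w. w ~: S ==> P <= norm (snd (X w)) & P <= norm (snd (Y w))"
 shows "norm (E_field gam q - E_field gam' q) <= CT * J^2 * (R + d / R ^ 3 + L * P powr (-1/4) + 1 / L^2)"
  "norm (DE gam q h - DE gam' q h) <= CT * J^2 * (R powr (1/4) + d / R ^ 4 + (L * P powr (-1/4) + 1 / L^2) / R) * norm h"
proof -
 let ?f = "%z. (gam z)^2" and ?g = "%z. (gam' z)^2"
 note df = adm_dens[OF a] and dg = adm_dens[OF b]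
 have fg2: "?f (X w) = ?g (Y w)" for w by (simp add: fg)
 define U where "U = ubv * Wc"
 define p where "p = P powr (-1/4)"
 have U: "U >= 0" using Wc(1) by (simp add: U_def)
 have CT: "400 <= CT" "96 * U <= CT" "80 * U <= CT" "8 * Ch <= CT" "256 * U <= CT" "10 <= CT" "50 <= CT" "32 <= CT"
  using U Ch_nonneg by (auto simp: CT_def U_def algebra_simps)
 have p0: "p >= 0" by (simp add: p_def)
 have tri: "norm (x - y) <= norm (x - a) + norm (a - b) + norm (y - b)" for x y a b :: R3
  using order_trans[OF norm_triangle_ineq4[of "(x - a) + (a - b)" "y - b"] add_right_mono[OF norm_triangle_ineq[of "x - a" "a - b"]]] by simp
 have "norm (pot coulomb ?f q - pot coulomb ?g q) <= CT * J^2 * (R + d / R ^ 3 + L * P powr (-1/4) + 1 / L^2)"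
  by (rule pot_coulomb_time_diff[OF df dg X Y fg2 pos slow fast])
 then show "norm (E_field gam q - E_field gam' q) <= CT * J^2 * (R + d / R ^ 3 + L * P powr (-1/4) + 1 / L^2)"
  unfolding E_field_pot scaleR_diff_right[symmetric] by (rule order_trans[OF pi4])
 let ?D = "%f. (1 / (4 * pi)) *R pot (%x. Dker R x h) f q"
 have "norm (pot (%x. Dker R x h) ?f q - pot (%x. Dker R x h) ?g q) <= (50 / R ^ 4 * norm h) * d * J^2 + 2 * (16 * norm h / R) * (8 * ubv * L * (J^2 * p * Wc) + J^2 / L^2)"
  unfolding p_def
  by (rule pot_time_diff[OF df dg X Y fg2 kbound_kernels(2)[OF pos(4)] _ _ pos(1-3) slow fast]) (use pos ker_bounds(7)[OF pos(4)] in \<open>auto simp: mult_ac\<close>)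
 then have kD: "norm (?D ?f - ?D ?g) <= (50 / R ^ 4 * norm h) * d * J^2 + 2 * (16 * norm h / R) * (8 * ubv * L * (J^2 * p * Wc) + J^2 / L^2)"
  unfolding scaleR_diff_right[symmetric] using pi4 order_trans by blast
 have "norm (DE gam q h - DE gam' q h) <= norm (DE gam q h - ?D ?f) + norm (?D ?f - ?D ?g) + norm (DE gam' q h - ?D ?g)"
  by (rule tri)
 also have "... <= 4 * Ch * J^2 * R powr (1/4) * norm h + ((50 / R ^ 4 * norm h) * d * J^2 + 2 * (16 * norm h / R) * (8 * ubv * L * (J^2 * p * Wc) + J^2 / L^2)) + 4 * Ch * J^2 * R powr (1/4) * norm h"
  by (intro add_mono kD E_field_static(4)[OF a pos(4)] E_field_static(4)[OF b pos(4)])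
 also have "... = J^2 * norm h * ((8 * Ch) * R powr (1/4) + 50 * (d / R ^ 4) + (256 * U) * (L * p / R) + 32 * (1 / L^2 / R))"
  by (simp add: U_def algebra_simps)
 also have "... <= J^2 * norm h * (CT * R powr (1/4) + CT * (d / R ^ 4) + CT * (L * p / R) + CT * (1 / L^2 / R))"
  using CT pos p0 by (intro mult_left_mono add_mono mult_right_mono) auto
 finally show "norm (DE gam q h - DE gam' q h) <= CT * J^2 * (R powr (1/4) + d / R ^ 4 + (L * P powr (-1/4) + 1 / L^2) / R) * norm h"
  by (simp add: p_def algebra_simps add_divide_distrib)
qed

lemma E_field_osgood:
 assumes a: "adm J gam" and b: "adm J gam'" and X: "mpres X" and Y: "mpres Y" and fg: "!!w. gam (X w) = gam' (Y w)"
  and d: "!!w. norm (fst (X w) - fst (Y w)) <= d"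
 shows "norm (E_field gam q - E_field gam' q) <= CT * J^2 * ((1/2) ^ n + real (n + 1) * d)"
proof -
 have d0: "d >= 0" using order_trans[OF norm_ge_zero d] .
 define U where "U = ubv * Wc"
 have U: "U >= 0" using Wc(1) by (simp add: U_def)
 have CT: "96 * U <= CT" "16 <= CT" "288 * U <= CT" using U Ch_nonneg by (auto simp: CT_def U_def algebra_simps)
 have "norm (pot coulomb (%z. (gam z)^2) q - pot coulomb (%z. (gam' z)^2) q) <= J^2 * (96 * ubv * Wc * (1/2) ^ n + (16 + real n * (288 * ubv * Wc)) * d)"
  by (rule pot_osgood[OF adm_dens[OF a] adm_dens[OF b] X Y _ d]) (simp add: fg)
 also have "... = J^2 * ((96 * U) * (1/2) ^ n + 16 * d + (288 * U) * (real n * d))" by (simp add: U_def algebra_simps)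
 also have "... <= J^2 * (CT * (1/2) ^ n + CT * d + CT * (real n * d))"
  using CT d0 by (intro mult_left_mono add_mono mult_right_mono) auto
 finally have *: "norm (pot coulomb (%z. (gam z)^2) q - pot coulomb (%z. (gam' z)^2) q) <= CT * J^2 * ((1/2) ^ n + real (n + 1) * d)"
  by (simp add: algebra_simps)
 show ?thesis unfolding E_field_pot scaleR_diff_right[symmetric] using order_trans[OF pi4 *] .
qed

section \<open>The characteristic flow in logarithmic time\<close>

text \<open>With \<open>t = - ln s\<close> the characteristics solve \<open>q' = - exp (- t) p\<close>, \<open>p' = - l B(t, q)\<close>. Negative
  times are frozen at \<open>0\<close>, so that the field is defined for all real times.\<close>

definition vfield :: "real => (real => R3 => R3) => real => phase => phase"
 where "vfield l B t z = (- (exp (- max t 0) *R snd z), - (l *R B (max t 0) (fst z)))"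

text \<open>The condition \<open>1 <= M\<close> lets the same constant bound the Lipschitz constant
  of the free part of the vector field as well.\<close>

definition okfield :: "real => (real => R3 => R3) => bool"
 where "okfield M B \<longleftrightarrow> 1 <= M & continuous_on ({0..} \<times> UNIV) (%(t, q). B t q) &
  (\<forall>t\<ge>0. \<forall>q q'. norm (B t q) <= M & norm (B t q - B t q') <= M * norm (q - q'))"

lemma okfieldD:
 assumes "okfield M B"
 shows "1 <= M" "t >= 0 ==> norm (B t q) <= M" "t >= 0 ==> norm (B t q - B t q') <= M * norm (q - q')"
  "continuous_on ({0..} \<times> UNIV) (%(t, q). B t q)"
 using assms by (auto simp: okfield_def)

lemma continuous_on_clamp:
 fixes f :: "real => 'a::topological_space => 'b::topological_space"
 assumes "continuous_on ({0..} \<times> UNIV) (%(t, q). f t q)" "continuous_on S g" "continuous_on S h"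
 shows "continuous_on S (%x. f (max (g x) 0) (h x))"
proof -
 have "continuous_on S (%x. (max (g x) 0, h x))" using assms(2,3) by (intro continuous_on_Pair continuous_intros)
 from continuous_on_compose2[OF assms(1) this] show ?thesis by (simp add: image_subset_iff)
qed

lemma norm_Pair_le_scale:
 assumes "norm x <= M * norm a" "norm y <= M * norm b" "M >= 0"
 shows "norm (x, y) <= M * norm (a, b)"
proof -
 have "(norm x)^2 + (norm y)^2 <= (M * norm a)^2 + (M * norm b)^2" using assms by (intro add_mono power_mono) auto
 also have "... = M^2 * ((norm a)^2 + (norm b)^2)" by (simp add: power_mult_distrib algebra_simps)
 finally have "sqrt ((norm x)^2 + (norm y)^2) <= sqrt (M^2 * ((norm a)^2 + (norm b)^2))" by simp
 then show ?thesis using assms(3) by (simp add: norm_Pair real_sqrt_mult)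
qed

context
 fixes l M :: real and B :: "real => R3 => R3"
 assumes l: "\<bar>l\<bar> = 1" and B: "okfield M B"
begin

lemma vfield_lip: "lip_field M (vfield l B)"
 unfolding lip_field_def
proof (intro conjI allI)
 show "0 <= M" using okfieldD(1)[OF B] by simp
 show "continuous_on UNIV (%(t, x). vfield l B t x)"
  unfolding vfield_def case_prod_unfold by (intro continuous_intros continuous_on_clamp[OF okfieldD(4)[OF B]])
 fix t :: real and x y :: phase
 have "norm (exp (- max t 0) *R (snd x - snd y)) <= 1 * norm (snd x - snd y)"
  unfolding norm_scaleR by (intro mult_right_mono) auto
 also have "... <= M * norm (snd x - snd y)" using okfieldD(1)[OF B] by (intro mult_right_mono) auto
 finally have 1: "norm (exp (- max t 0) *R (snd x - snd y)) <= M * norm (snd x - snd y)" .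
 have 2: "norm (l *R (B (max t 0) (fst x) - B (max t 0) (fst y))) <= M * norm (fst x - fst y)"
  using okfieldD(3)[OF B, of "max t 0" "fst x" "fst y"] l by simp
 have "vfield l B t x - vfield l B t y = - (exp (- max t 0) *R (snd x - snd y), l *R (B (max t 0) (fst x) - B (max t 0) (fst y)))"
  by (simp add: vfield_def scaleR_diff_right)
 then have "norm (vfield l B t x - vfield l B t y) <= M * norm (snd x - snd y, fst x - fst y)"
  using norm_Pair_le_scale[OF 1 2] okfieldD(1)[OF B] by (simp only: norm_minus_cancel)
 also have "norm (snd x - snd y, fst x - fst y) = norm (x - y)" by (simp add: norm_prod_def add.commute)
 finally show "norm (vfield l B t x - vfield l B t y) <= M * norm (x - y)" .
qed

lemma vfield_mpres: "mpres (flow (vfield l B) s t)"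
 by (rule flow_mpres[OF vfield_lip, where A="%t p. - (exp (- max t 0) *R p)" and B="%t q. - (l *R B (max t 0) q)"])
  (simp add: vfield_def)

lemma vfield_flow_deriv:
 "((%t. fst (flow (vfield l B) s t z)) has_vector_derivative - (exp (- max t 0) *R snd (flow (vfield l B) s t z))) (at t)"
 "((%t. snd (flow (vfield l B) s t z)) has_vector_derivative - (l *R B (max t 0) (fst (flow (vfield l B) s t z)))) (at t)"
 using bounded_linear.has_vector_derivative[OF bounded_linear_fst flow_vderiv[OF vfield_lip, of s z t]]
  bounded_linear.has_vector_derivative[OF bounded_linear_snd flow_vderiv[OF vfield_lip, of s z t]]
 by (auto simp: vfield_def)

lemma vector_derivative_norm_bound:
 fixes f :: "real => 'a::real_normed_vector"
 assumes "!!r. r : closed_segment s t ==> (f has_vector_derivative f' r) (at r)" "!!r. r : closed_segment s t ==> norm (f' r) <= K"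
 shows "norm (f t - f s) <= K * \<bar>t - s\<bar>"
proof -
 have "norm (f t - f s) <= K * norm (t - s)"
 proof (rule differentiable_bound[where S="closed_segment s t" and f'="%r h. h *R f' r"])
  show "(f has_derivative (%h. h *R f' r)) (at r within closed_segment s t)" if "r : closed_segment s t" for r
   using assms(1)[OF that] unfolding has_vector_derivative_def by (rule has_derivative_at_withinI)
  show "onorm (%h. h *R f' r) <= K" if "r : closed_segment s t" for r
   using assms(2)[OF that] by (simp add: onorm_scaleR_left bounded_linear_ident onorm_id)
 qed auto
 then show ?thesis by simp
qed

lemma momentum_drift: "norm (snd (flow (vfield l B) s t z) - snd z) <= M * \<bar>t - s\<bar>"
 using vector_derivative_norm_bound[of s t "%t. snd (flow (vfield l B) s t z)", OF vfield_flow_deriv(2), of M]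
  okfieldD(2)[OF B] l flow_init[OF vfield_lip] by simp

lemma position_drift:
 assumes "0 <= s" "s <= t" "t <= s + 1"
 shows "norm (fst (flow (vfield l B) s t z) - fst z) <= exp (- s) * (norm (snd z) + M)"
proof -
 let ?w = "flow (vfield l B) s"
 have "norm (fst (?w t z) - fst (?w s z)) <= (exp (- s) * (norm (snd z) + M)) * \<bar>t - s\<bar>"
 proof (rule vector_derivative_norm_bound[OF vfield_flow_deriv(1)])
  fix r assume "r : closed_segment s t"
  then have r: "s <= r" "r <= t" using assms by (auto simp: closed_segment_eq_real_ivl)
  have "norm (snd (?w r z)) <= norm (snd z) + norm (snd (?w r z) - snd z)" by (rule norm_triangle_sub)
  also have "... <= norm (snd z) + M * \<bar>r - s\<bar>" using momentum_drift by simp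
  also have "... <= norm (snd z) + M * 1" using r assms okfieldD(1)[OF B] by (intro add_left_mono mult_left_mono) auto
  finally show "norm (- (exp (- max r 0) *R snd (?w r z))) <= exp (- s) * (norm (snd z) + M)"
   using r assms by (auto intro!: mult_mono)
 qed
 also have "... <= (exp (- s) * (norm (snd z) + M)) * 1" using assms okfieldD(1)[OF B] by (intro mult_left_mono) auto
 finally show ?thesis by (simp add: flow_init[OF vfield_lip])
qed

end

lemma power4_le_exp: assumes "t >= (0::real)" shows "(1 + t) ^ 4 <= 256 * exp t"
proof -
 have "1 + t <= 4 * (1 + t / 4)" using assms by simp
 also have "... <= 4 * exp (t / 4)" using exp_ge_add_one_self[of "t/4"] by (intro mult_left_mono) auto
 finally have "(1 + t) ^ 4 <= (4 * exp (t / 4)) ^ 4" using assms by (intro power_mono) auto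
 also have "... = 256 * exp t" by (simp add: power_mult_distrib exp_of_nat_mult[symmetric])
 finally show ?thesis .
qed

text \<open>The quantity \<open>(1 + t)\<^sup>4 |\<delta>q|\<^sup>2 + |\<delta>p|\<^sup>2\<close> changes at a relative rate that is integrable in time:
  this keeps the growth of the Lipschitz constant polynomial.\<close>

lemma flow_vfield_lipschitz:
 assumes l: "\<bar>l\<bar> = 1" and B: "okfield 1 B" and tau: "tau >= 0"
 shows "norm (flow (vfield l B) tau 0 z - flow (vfield l B) tau 0 z') <= exp 129 * (1 + tau)^2 * norm (z - z')"
proof -
 define a where "a t = fst (flow (vfield l B) tau t z) - fst (flow (vfield l B) tau t z')" for t
 define b where "b t = snd (flow (vfield l B) tau t z) - snd (flow (vfield l B) tau t z')" for t
 define c where "c t = l *R (B (max t 0) (fst (flow (vfield l B) tau t z)) - B (max t 0) (fst (flow (vfield l B) tau t z')))" for t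
 have c: "norm (c t) <= norm (a t)" if "t >= 0" for t
  using okfieldD(3)[OF B, of "max t 0"] l by (simp add: c_def a_def)
 have da: "(a has_vector_derivative - (exp (- max t 0) *R b t)) (at t)" for t
  using has_vector_derivative_diff[OF vfield_flow_deriv(1)[OF l B] vfield_flow_deriv(1)[OF l B]]
  by (simp add: a_def[abs_def] b_def scaleR_diff_right)
 have db: "(b has_vector_derivative - c t) (at t)" for t
  using has_vector_derivative_diff[OF vfield_flow_deriv(2)[OF l B] vfield_flow_deriv(2)[OF l B]]
  by (simp add: b_def[abs_def] c_def scaleR_diff_right)
 define Y where "Y t = (1 + t) ^ 4 * (a t <.> a t) + b t <.> b t" for t
 \<comment> \<open>Trajectories are followed backwards from \<open>tau\<close>, so a lower bound for
   the derivative of \<open>Y\<close> suffices. The relative loss is at most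
   \<open>257 / (1 + t)^2\<close>, which this integrating factor compensates: 256 bounds
   \<open>(1 + t)^4 * exp (- t)\<close>, and 1 comes from the Lipschitz constant of the
   field.\<close>
 define Z where "Z t = Y t * exp (- 257 / (1 + t))" for t
 have "Z 0 <= Z tau"
 proof (rule DERIV_nonneg_imp_nondecreasing[OF tau])
  fix t assume t: "0 <= t" "t <= tau"
  define x where "x = norm (a t)" define y where "y = norm (b t)" define T where "T = 1 + t"
  define Y' where "Y' = 4 * T ^ 3 * (a t <.> a t) + T ^ 4 * (2 * (a t <.> (- (exp (- t) *R b t)))) + 2 * (b t <.> (- c t))"
  have dinner: "((%t. f t <.> f t) has_real_derivative 2 * (f t <.> f')) (at t)"
   if "(f has_vector_derivative f') (at t)" for f :: "real => R3" and f'
   unfolding has_field_derivative_def using that unfolding has_vector_derivative_def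
   by (auto intro!: derivative_eq_intros simp: inner_commute)
  have T: "T >= 1" "T ^ 4 * exp (- t) <= 256" using t power4_le_exp[of t] by (auto simp: T_def exp_minus field_simps)
  have dY: "(Y has_real_derivative Y') (at t)"
   unfolding Y_def Y'_def T_def using t dinner[OF da] dinner[OF db]
   by (auto intro!: derivative_eq_intros)
  have dZ: "(Z has_real_derivative (Y' + 257 / T^2 * Y t) * exp (- 257 / T)) (at t)"
   unfolding Z_def[abs_def] T_def using t dY
   by (auto intro!: derivative_eq_intros simp: power2_eq_square field_simps)
  have xy: "x >= 0" "y >= 0" "a t <.> a t = x^2" "b t <.> b t = y^2" by (auto simp: x_def y_def power2_norm_eq_inner)
  \<comment> \<open>The mixed term gains \<open>1 / T^2\<close> because \<open>T^2\<close> is the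
    square root of the weight \<open>T^4\<close> in \<open>Y\<close>.\<close>
  have "(T ^ 2 * x - y)^2 >= 0" by simp
  then have xyY: "2 * (x * y) <= Y t / T^2"
   using T by (simp add: Y_def xy field_simps power2_eq_square power4_eq_xxxx T_def[symmetric])
  have "\<bar>a t <.> b t\<bar> <= x * y" unfolding x_def y_def by (rule Cauchy_Schwarz_ineq2)
  then have "(T ^ 4 * exp (- t)) * (2 * (a t <.> b t)) <= (T ^ 4 * exp (- t)) * (2 * (x * y))"
   using T by (intro mult_left_mono) auto
  also have "... <= 256 * (Y t / T^2)" using T xyY xy by (intro mult_mono) auto
  finally have 1: "T ^ 4 * (2 * (a t <.> (- (exp (- t) *R b t)))) >= - (256 * (Y t / T^2))" by (simp add: mult_ac)
  have "\<bar>b t <.> c t\<bar> <= y * norm (c t)" unfolding y_def by (rule Cauchy_Schwarz_ineq2)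
  also have "... <= y * x" unfolding x_def using c[OF t(1)] xy by (intro mult_left_mono) auto
  finally have 2: "2 * (b t <.> (- c t)) >= - (Y t / T^2)" using xyY by (simp add: mult_ac)
  have "4 * T ^ 3 * (a t <.> a t) >= 0" using T by simp
  moreover have "257 / T^2 * Y t = 256 * (Y t / T^2) + Y t / T^2" by (simp add: field_simps)
  ultimately have "Y' + 257 / T^2 * Y t >= 0" unfolding Y'_def using 1 2 by linarith
  then show "\<exists>y. (Z has_real_derivative y) (at t) & y >= 0" using dZ by (intro exI[of _ "(Y' + 257 / T^2 * Y t) * exp (- 257 / T)"] conjI) auto
 qed
 then have "Y 0 * exp (-257) <= Y tau * exp (- 257 / (1 + tau))" by (simp add: Z_def)
 also have "... <= Y tau * 1" using tau by (intro mult_left_mono) (auto simp: Y_def)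
 finally have "Y 0 <= exp 257 * Y tau" by (simp add: exp_minus field_simps)
 also have "Y tau <= (1 + tau) ^ 4 * (norm (z - z'))^2"
 proof -
  have "b tau <.> b tau <= (1 + tau) ^ 4 * (b tau <.> b tau)" using tau one_le_power[of "1 + tau" 4] mult_right_mono[of 1 "(1 + tau) ^ 4" "b tau <.> b tau"] by simp
  then have "Y tau <= (1 + tau) ^ 4 * (a tau <.> a tau + b tau <.> b tau)" by (simp add: Y_def algebra_simps)
  also have "a tau <.> a tau + b tau <.> b tau = (norm (z - z'))^2"
   unfolding a_def b_def by (simp add: power2_norm_eq_inner inner_prod_def flow_init[OF vfield_lip[OF l B]])
  finally show ?thesis .
 qed
 also have "exp (257::real) * ((1 + tau) ^ 4 * (norm (z - z'))^2) <= (exp 129 * (1 + tau)^2 * norm (z - z'))^2"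
 proof -
  \<comment> \<open>The constant 129 is half of 257, rounded up, as \<open>Y\<close> is quadratic in
    the distance.\<close>
  have "exp (257::real) <= (exp 129)^2" by (simp add: power2_eq_square exp_add[symmetric])
  then show ?thesis unfolding power_mult_distrib power_mult[symmetric] by (simp add: mult.assoc mult_right_mono)
 qed
 finally have "Y 0 <= (exp 129 * (1 + tau)^2 * norm (z - z'))^2" by simp
 moreover have "Y 0 = (norm (flow (vfield l B) tau 0 z - flow (vfield l B) tau 0 z'))^2"
  by (simp add: Y_def a_def b_def power2_norm_eq_inner inner_prod_def)
 ultimately show ?thesis by (auto intro: power2_le_imp_le)
qed

text \<open>The hypotheses on the data, imposed at every point instead of almost everywhere: they
  are those of the Lipschitz representative.\<close>

definition datum :: "real => (phase => real) => bool"
 where "datum eps f \<longleftrightarrow> 0 <= eps & (\<forall>z z'. \<bar>f z - f z'\<bar> <= eps * norm (z - z')) & (\<forall>q p. \<bar>f (q, p)\<bar> <= eps / (1 + (norm p)^2)) &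
  integrable lborel (%z. (f z)^2) & (LI z. (f z)^2) <= eps^2"

lemma datum_continuous: assumes "datum eps f" shows "continuous_on S f"
proof -
 have "eps-lipschitz_on S f" using assms by (intro lipschitz_onI) (auto simp: datum_def dist_norm)
 then show ?thesis by (rule lipschitz_on_continuous_on)
qed

definition pull :: "real => (phase => real) => (real => R3 => R3) => real => phase => real"
 where "pull l f B t z = f (flow (vfield l B) t 0 z)"

text \<open>A form of Peetre's inequality: a bounded shift of the momentum changes the weight by a
  bounded factor only.\<close>

lemma weight_shift: "1 + (norm p)^2 <= 2 * (1 + norm (p - p'))^2 * (1 + (norm (p'::R3))^2)"
proof -
 define x y where "x = norm (p - p')" and "y = norm p'"
 have "norm p <= x + y" unfolding x_def y_def using norm_triangle_sub[of p p'] by simp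
 then have "(norm p)^2 <= (x + y)^2" by (intro power_mono) auto
 also have "... <= 2 * x^2 + 2 * y^2" using sum_squares_bound[of x y] by (simp add: power2_sum)
 finally have "1 + (norm p)^2 <= 2 * (1 + x^2) * (1 + y^2)" by (simp add: algebra_simps) (smt (verit) mult_nonneg_nonneg zero_le_power2)
 also have "... <= 2 * (1 + x)^2 * (1 + y^2)" by (intro mult_right_mono mult_left_mono) (auto simp: power2_sum x_def)
 finally show ?thesis by (simp add: x_def y_def)
qed

lemma pull_decay:
 assumes l: "\<bar>l\<bar> = 1" and B: "okfield M B" and f: "datum eps f" and t: "t >= 0"
 shows "\<bar>pull l f B t (q, p)\<bar> <= eps * (2 * (1 + M * t)^2) / (1 + (norm p)^2)"
proof -
 obtain q' p' where z: "flow (vfield l B) t 0 (q, p) = (q', p')" by fastforce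
 have "norm (p - p') <= M * t" using momentum_drift[OF l B, of t 0 "(q, p)"] t by (simp add: z norm_minus_commute)
 then have "2 * (1 + norm (p - p'))^2 * (1 + (norm p')^2) <= 2 * (1 + M * t)^2 * (1 + (norm p')^2)"
  by (intro mult_right_mono mult_left_mono power_mono) auto
 then have w: "1 + (norm p)^2 <= 2 * (1 + M * t)^2 * (1 + (norm p')^2)" using weight_shift[of p p'] by linarith
 have pos: "1 + (norm p)^2 > 0" "1 + (norm p')^2 > 0" by (auto intro: add_pos_nonneg)
 have "\<bar>pull l f B t (q, p)\<bar> <= eps / (1 + (norm p')^2)" using f by (simp add: pull_def z datum_def)
 also have "... <= eps * (2 * (1 + M * t)^2) / (1 + (norm p)^2)"
  using w pos mult_left_mono[OF w, of eps] f by (simp add: divide_simps datum_def mult_ac)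
 finally show ?thesis .
qed

lemma pull_square_integral:
 assumes l: "\<bar>l\<bar> = 1" and B: "okfield M B" and f: "datum eps f"
 shows "pull l f B t : bmeas" "integrable lborel (%z. (pull l f B t z)^2)"
  "(LI z. (pull l f B t z)^2) = (LI z. (f z)^2)"
proof -
 have [measurable]: "f : bmeas" using datum_continuous[OF f] by (rule borel_measurable_continuous_onI)
 note m = vfield_mpres[OF l B, of t 0]
 have [measurable]: "flow (vfield l B) t 0 : bmeas" using m by (rule mpres_measurable)
 have f2: "(%z. (f z)^2) : bmeas" by measurable
 show "pull l f B t : bmeas" unfolding pull_def[abs_def] by measurable
 show "integrable lborel (%z. (pull l f B t z)^2)" "(LI z. (pull l f B t z)^2) = (LI z. (f z)^2)"
  unfolding pull_def using mpres_integrable[OF m f2] mpres_integral[OF m f2] f by (auto simp: datum_def)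
qed

lemma adm_pull:
 assumes l: "\<bar>l\<bar> = 1" and B: "okfield M B" and f: "datum eps f" and t: "0 <= t" "t <= T"
  and lip: "!!z z'. norm (flow (vfield l B) t 0 z - flow (vfield l B) t 0 z') <= Lam * norm (z - z')"
  and J: "eps * (2 * (1 + M * T)^2 + Lam) <= J" "Lam >= 0"
 shows "adm J (pull l f B t)"
proof -
 have e: "eps >= 0" using f by (simp add: datum_def)
 have M: "M >= 1" using okfieldD(1)[OF B] .
 have mono: "(1 + M * t)^2 <= (1 + M * T)^2" using M t by (intro power_mono add_left_mono mult_left_mono) auto
 have one: "1 <= (1 + M * T)^2" using M t by (simp add: one_le_power)
 have c: "eps * (2 * (1 + M * t)^2) <= J" "eps * 1 <= J" "eps * Lam <= J"
  using mono one J(2) e by (intro order_trans[OF mult_left_mono J(1)]; simp)+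
 show ?thesis unfolding adm_def
 proof (intro conjI allI pull_square_integral[OF l B f])
  show "0 <= J" using c e by simp
  have "(LI z. (pull l f B t z)^2) <= eps^2" using f pull_square_integral(3)[OF l B f] by (simp add: datum_def)
  also have "... <= J^2" using c e by (intro power_mono) auto
  finally show "(LI z. (pull l f B t z)^2) <= J^2" .
  fix q q' p :: R3
  have "\<bar>pull l f B t (q, p)\<bar> <= eps * (2 * (1 + M * t)^2) / (1 + (norm p)^2)" by (rule pull_decay[OF l B f t(1)])
  also have "... <= J / (1 + (norm p)^2)" by (intro divide_right_mono c) simp
  finally show "\<bar>pull l f B t (q, p)\<bar> <= J / (1 + (norm p)^2)" .
  have "\<bar>pull l f B t (q, p) - pull l f B t (q', p)\<bar> <= eps * (Lam * norm ((q, p) - (q', p)))"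
   using f e unfolding pull_def datum_def by (blast intro: order_trans mult_left_mono[OF lip])
  also have "... = (eps * Lam) * norm (q - q')" by simp
  also have "... <= J * norm (q - q')" by (intro mult_right_mono c) simp
  finally show "\<bar>pull l f B t (q, p) - pull l f B t (q', p)\<bar> <= J * norm (q - q')" .
 qed
qed

text \<open>A crude constant, exponential in \<open>T\<close>, but available for every
  \<open>M\<close>. It serves wherever time is bounded: for continuity of the field and for the
  contraction argument.\<close>

lemma adm_pull_local:
 assumes l: "\<bar>l\<bar> = 1" and B: "okfield M B" and f: "datum eps f" and t: "0 <= t" "t <= T"
 shows "adm (eps * (2 * (1 + M * T)^2 + exp (M * T))) (pull l f B t)"
proof (rule adm_pull[OF l B f t])
 show "norm (flow (vfield l B) t 0 z - flow (vfield l B) t 0 z') <= exp (M * T) * norm (z - z')" for z z'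
  using flow_lipschitz[OF vfield_lip[OF l B], of t 0 z z'] t okfieldD(1)[OF B]
  by (elim order_trans) (auto intro!: mult_right_mono)
qed auto

definition CJ :: real where "CJ = 2 + exp 129"

text \<open>The quantitative counterpart for fields bounded by 1, where the constant grows only
  quadratically; the increments of the field over large times are estimated with it.\<close>

lemma adm_pull_global:
 assumes l: "\<bar>l\<bar> = 1" and B: "okfield 1 B" and f: "datum eps f" and t: "0 <= t" "t <= T"
 shows "adm (CJ * eps * (1 + T)^2) (pull l f B t)"
proof (rule adm_pull[OF l B f t])
 show "norm (flow (vfield l B) t 0 z - flow (vfield l B) t 0 z') <= (exp 129 * (1 + T)^2) * norm (z - z')" for z z'
  by (rule order_trans[OF flow_vfield_lipschitz[OF l B t(1)]]) (use t in \<open>auto intro!: mult_right_mono mult_left_mono power_mono\<close>)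
qed (auto simp: CJ_def algebra_simps)

lemma pull_continuous:
 assumes l: "\<bar>l\<bar> = 1" and B: "okfield M B" and f: "datum eps f" and c: "continuous_on S g" "continuous_on S h"
 shows "continuous_on S (%x. pull l f B (g x) (h x))"
 unfolding pull_def
 by (rule continuous_on_compose2[OF datum_continuous[OF f, of UNIV]]) (auto intro: flow_continuous_on[OF vfield_lip[OF l B]] c)

lemma continuous_on_halfline:
 fixes f :: "real \<times> 'a::t2_space => 'b::topological_space"
 assumes "!!T. continuous_on ({0..T} \<times> UNIV) f"
 shows "continuous_on ({0..} \<times> UNIV) f"
 unfolding continuous_on_eq_continuous_within
proof
 fix x :: "real \<times> 'a" assume x: "x : {0..} \<times> UNIV"
 have "at x within ({0..} \<times> UNIV) = at x within ({0..fst x + 1} \<times> UNIV)"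
  by (rule at_within_nhd[where S="{..<fst x + 1} \<times> UNIV"]) (auto simp: open_Times mem_Times_iff)
 moreover have "continuous (at x within ({0..fst x + 1} \<times> UNIV)) f"
  using assms[of "fst x + 1"] unfolding continuous_on_eq_continuous_within by (rule bspec) (use x in \<open>auto simp: mem_Times_iff\<close>)
 ultimately show "continuous (at x within {0..} \<times> UNIV) f" by simp
qed

section \<open>The field map and its increments in time\<close>

definition Tfield :: "real => (phase => real) => (real => R3 => R3) => real => R3 => R3"
 where "Tfield l f B t = E_field (pull l f B t)"

lemma Tfield_continuous:
 assumes l: "\<bar>l\<bar> = 1" and B: "okfield M B" and f: "datum eps f"
 shows "continuous_on ({0..} \<times> UNIV) (%(t, q). Tfield l f B t q)" "continuous_on ({0..} \<times> UNIV) (%(t, q). DE (pull l f B t) q h)"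
proof -
 have c: "continuous_on {0..T} (%t. pull l f B t z)" for T z by (intro pull_continuous[OF l B f] continuous_intros)
 have a: "t : {0..T} ==> adm (eps * (2 * (1 + M * T)^2 + exp (M * T))) (pull l f B t)" for t T
  using adm_pull_local[OF l B f, of t T] by simp
 show "continuous_on ({0..} \<times> UNIV) (%(t, q). Tfield l f B t q)" "continuous_on ({0..} \<times> UNIV) (%(t, q). DE (pull l f B t) q h)"
  unfolding Tfield_def
  by (rule continuous_on_halfline, rule E_field_continuous[OF a c], assumption)+
qed

lemma exp_Cauchy:
 fixes f :: "real => 'a::banach"
 assumes kap: "kap > 0" and step: "!!t t'. 0 <= t ==> t <= t' ==> t' <= t + 1 ==> norm (f t' - f t) <= c * exp (- kap * t)"
 shows "0 <= t ==> t <= t' ==> norm (f t' - f t) <= c * exp (- kap * t) / (1 - exp (- kap))"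
  and "\<exists>L. (f \<longlongrightarrow> L) at_top & (\<forall>t\<ge>0. norm (L - f t) <= c * exp (- kap * t) / (1 - exp (- kap)))"
proof -
 define r where "r = exp (- kap)"
 have r: "0 < r" "r < 1" using kap by (auto simp: r_def)
 have c0: "c >= 0" using order_trans[OF norm_ge_zero step[of 0 0]] by simp
 have main: "norm (f t' - f t) <= c * exp (- kap * t) / (1 - r)" if "0 <= t" "t <= t'" "t' <= t + real n" for t t' n
  using that
 proof (induction n arbitrary: t)
  case 0
  then have "t' = t" by simp
  then show ?case using c0 r by simp
 next
  case (Suc n)
  show ?case
  proof (cases "t' <= t + 1")
   case True
   have "norm (f t' - f t) <= c * exp (- kap * t)" using Suc.prems True by (intro step) auto
   also have "... <= c * exp (- kap * t) / (1 - r)"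
    using r c0 by (simp add: pos_le_divide_eq mult_left_le)
   finally show ?thesis .
  next
   case False
   have "norm (f t' - f t) <= norm (f t' - f (t + 1)) + norm (f (t + 1) - f t)"
    using norm_triangle_ineq[of "f t' - f (t + 1)" "f (t + 1) - f t"] by simp
   also have "... <= c * exp (- kap * (t + 1)) / (1 - r) + c * exp (- kap * t)"
    using Suc.prems False by (intro add_mono Suc.IH step) auto
   also have "exp (- kap * (t + 1)) = r * exp (- kap * t)" by (simp add: r_def exp_add[symmetric] algebra_simps)
   also have "c * (r * exp (- kap * t)) / (1 - r) + c * exp (- kap * t) = c * exp (- kap * t) / (1 - r)"
    using r by (simp add: field_simps)
   finally show ?thesis .
  qed
 qed
 have far: "norm (f t' - f t) <= c * exp (- kap * t) / (1 - r)" if "0 <= t" "t <= t'" for t t'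
 proof -
  obtain n where "t' - t <= real n" using real_arch_simple by blast
  then show ?thesis using that by (intro main[where n=n]) auto
 qed
 then show "0 <= t ==> t <= t' ==> norm (f t' - f t) <= c * exp (- kap * t) / (1 - exp (- kap))" unfolding r_def .
 have "norm (f (real (Suc n)) - f (real n)) <= c * r ^ n" for n
  using step[of "real n" "real (Suc n)"] by (simp add: r_def exp_of_nat_mult[symmetric] mult.commute)
 then have "convergent (%n. f (real n))" using r by (intro geometric_Cauchy(1)[where r=r and c=c]) auto
 then obtain L where L: "(%n. f (real n)) ----> L" by (auto simp: convergent_def)
 have b: "norm (L - f t) <= c * exp (- kap * t) / (1 - r)" if "t >= 0" for t
 proof (rule LIMSEQ_le_const2)
  show "(%n. norm (f (real n) - f t)) ----> norm (L - f t)" by (intro tendsto_intros L)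
  obtain N where "t <= real N" using real_arch_simple by blast
  then show "\<exists>N. \<forall>n\<ge>N. norm (f (real n) - f t) <= c * exp (- kap * t) / (1 - r)"
   using that by (intro exI[of _ N] allI impI far) auto
 qed
 have "((%t. f t - L) \<longlongrightarrow> 0) at_top"
 proof (rule Lim_null_comparison)
  show "\<forall>\<^sub>F t in at_top. norm (f t - L) <= c * exp (- kap * t) / (1 - r)"
   using eventually_ge_at_top[of 0] by eventually_elim (use b in \<open>simp add: norm_minus_commute\<close>)
  have "((%t. exp (- kap * t)) \<longlongrightarrow> 0) at_top"
   using kap by (intro filterlim_compose[OF exp_at_bot] filterlim_tendsto_neg_mult_at_bot[OF tendsto_const _ filterlim_ident]) auto
  then have "((%t. c * exp (- kap * t) / (1 - r)) \<longlongrightarrow> c * 0 / (1 - r)) at_top" using r by (intro tendsto_intros) auto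
  then show "((%t. c * exp (- kap * t) / (1 - r)) \<longlongrightarrow> 0) at_top" by simp
 qed
 then have "(f \<longlongrightarrow> L) at_top" by (rule Lim_null[THEN iffD2])
 then show "\<exists>L. (f \<longlongrightarrow> L) at_top & (\<forall>t\<ge>0. norm (L - f t) <= c * exp (- kap * t) / (1 - exp (- kap)))"
  using b unfolding r_def by blast
qed

lemma mpres_id: "mpres (%x. x)"
 by (intro mpresI_nn_integral) auto

definition KE :: real where "KE = 6 * CT * CJ^2 * 1024 ^ 4"

lemma CT_nonneg: "CT >= 0" using Wc(1) Ch_nonneg by (simp add: CT_def)

lemma KE_nonneg: "KE >= 0" using CT_nonneg by (simp add: KE_def)

text \<open>All scales are powers of \<open>exp tau\<close>. In exponents, \<open>d / R^4\<close>
  has -1/2 + 1/8, \<open>L * P powr (-1/4)\<close> has 1/16 - 1/8, \<open>1 / L^2\<close> has -1/8,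
  and division by \<open>R\<close> adds 1/32, so every term decays. The slowest one is
  \<open>R powr (1/4)\<close>, with -1/128; the factor 6 counts four terms, one of them with the
  coefficient 3 of \<open>d\<close>.\<close>

lemma log_scales:
 fixes tau :: real
 assumes tau: "tau >= 0"
 defines "d == 3 * exp (- tau / 2)" and "P == exp (tau / 2)" and "L == exp (tau / 16)" and "R == exp (- tau / 32)"
 shows "R + d / R ^ 3 + L * P powr (-1/4) + 1 / L^2 <= 6 * exp (- tau / 128)"
  "R powr (1/4) + d / R ^ 4 + (L * P powr (-1/4) + 1 / L^2) / R <= 6 * exp (- tau / 128)"
proof -
 define E where "E a = exp (a * tau)" for a
 have E: "E a * E b = E (a + b)" "E a / E b = E (a - b)" "1 / E a = E (- a)" "E a ^ k = E (real k * a)" "E a powr b = E (b * a)" for a b k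
  unfolding E_def by (simp_all add: exp_add[symmetric] exp_diff[symmetric] exp_minus inverse_eq_divide exp_of_nat_mult[symmetric] powr_def algebra_simps)
 have e: "E a <= E (- 1 / 128)" if "a <= - 1 / 128" for a
  unfolding E_def using mult_right_mono[OF that tau] by simp
 have defs: "R = E (- 1 / 32)" "L = E (1 / 16)" "P = E (1 / 2)" "d = 3 * E (- 1 / 2)" "exp (- tau / 128) = E (- 1 / 128)"
  by (simp_all add: R_def L_def P_def d_def E_def)
 have "R + d / R ^ 3 + L * P powr (-1/4) + 1 / L^2 = E (- 1 / 32) + 3 * E (- 13 / 32) + E (- 1 / 16) + E (- 1 / 8)"
  unfolding defs E times_divide_eq_right[symmetric] by simp
 also have "... <= 6 * E (- 1 / 128)"
  using e[of "- 1 / 32"] e[of "- 13 / 32"] e[of "- 1 / 16"] e[of "- 1 / 8"] by simp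
 finally show "R + d / R ^ 3 + L * P powr (-1/4) + 1 / L^2 <= 6 * exp (- tau / 128)" unfolding defs(5) .
 have "R powr (1/4) + d / R ^ 4 + (L * P powr (-1/4) + 1 / L^2) / R = E (- 1 / 128) + 3 * E (- 3 / 8) + (E (- 1 / 32) + E (- 3 / 32))"
  unfolding defs E times_divide_eq_right[symmetric] add_divide_distrib by simp
 also have "... <= 6 * E (- 1 / 128)"
  using e[of "- 1 / 32"] e[of "- 3 / 8"] e[of "- 3 / 32"] e[of "- 1 / 128"] by simp
 finally show "R powr (1/4) + d / R ^ 4 + (L * P powr (-1/4) + 1 / L^2) / R <= 6 * exp (- tau / 128)" unfolding defs(5) .
qed

text \<open>The squared admissibility constant grows like \<open>(2 + tau)^4\<close>, which half of
  the rate 1/128 absorbs: each of the four factors is at most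
  \<open>1024 * exp (tau / 1024)\<close>.\<close>

lemma CJ_growth:
 assumes "tau >= 0"
 shows "CT * (CJ * eps * (1 + (tau + 1))^2)^2 * (6 * exp (- tau / 128)) <= KE * eps^2 * exp (- (1/256) * tau)"
proof -
 have "2 + tau <= 1024 * (1 + tau / 1024)" using assms by simp
 also have "... <= 1024 * exp (tau / 1024)" using exp_ge_add_one_self[of "tau / 1024"] by (intro mult_left_mono) auto
 finally have "(2 + tau) ^ 4 <= (1024 * exp (tau / 1024)) ^ 4" using assms by (intro power_mono) auto
 also have "... = 1024 ^ 4 * exp (tau / 256)" by (simp add: power_mult_distrib exp_of_nat_mult[symmetric])
 finally have g: "(2 + tau) ^ 4 <= 1024 ^ 4 * exp (tau / 256)" .
 have "CT * (CJ * eps * (1 + (tau + 1))^2)^2 * (6 * exp (- tau / 128)) = (6 * CT * CJ^2 * eps^2 * exp (- tau / 128)) * (2 + tau) ^ 4"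
  by (simp add: power_mult_distrib power_mult[symmetric] add_ac mult_ac)
 also have "... <= (6 * CT * CJ^2 * eps^2 * exp (- tau / 128)) * (1024 ^ 4 * exp (tau / 256))"
  using CT_nonneg by (intro mult_left_mono g) auto
 also have "... = KE * eps^2 * (exp (- tau / 128) * exp (tau / 256))" by (simp add: KE_def)
 also have "exp (- tau / 128) * exp (tau / 256) = exp (- (1/256) * tau)" by (simp add: exp_add[symmetric])
 finally show ?thesis .
qed

text \<open>The labels are the points at time \<open>t\<close>, the other configuration is their
  image under the flow to \<open>t'\<close>. A particle with momentum up to about
  \<open>exp (t / 2)\<close> moves by a multiple of \<open>exp (- t / 2)\<close>, since velocities
  carry the factor \<open>exp (- t)\<close>.\<close>

lemma Tfield_time_step:
 assumes l: "\<bar>l\<bar> = 1" and B: "okfield 1 B" and f: "datum eps f" and t: "0 <= t" "t <= t'" "t' <= t + 1"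
 shows "norm (Tfield l f B t' q - Tfield l f B t q) <= KE * eps^2 * exp (- (1/256) * t)"
  "norm (DE (pull l f B t') q h - DE (pull l f B t) q h) <= (KE * eps^2 * norm h) * exp (- (1/256) * t)"
proof -
 let ?J = "CJ * eps * (1 + (t + 1))^2"
 have a: "adm ?J (pull l f B t)" "adm ?J (pull l f B t')"
  using adm_pull_global[OF l B f, of t "t + 1"] adm_pull_global[OF l B f, of t' "t + 1"] t by simp_all
 \<comment> \<open>The summand 1 in the threshold is the largest change of a momentum in unit time,
   so fast particles stay above \<open>exp (t / 2)\<close>.\<close>
 let ?Y = "flow (vfield l B) t t'" and ?S = "{w::phase. norm (snd w) <= exp (t / 2) + 1}"
 have fg: "pull l f B t w = pull l f B t' (?Y w)" for w
  by (simp add: pull_def flow_flow[OF vfield_lip[OF l B]])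
 have slow: "norm (fst w - fst (?Y w)) <= 3 * exp (- t / 2)" if "w : ?S" for w
 proof -
  have "norm (fst (?Y w) - fst w) <= exp (- t) * (norm (snd w) + 1)" by (rule position_drift[OF l B t])
  also have "... <= exp (- t) * (3 * exp (t / 2))"
  proof (intro mult_left_mono)
   have "1 <= exp (t / 2)" using t by simp
   moreover have "norm (snd w) <= exp (t / 2) + 1" using that by simp
   ultimately show "norm (snd w) + 1 <= 3 * exp (t / 2)" by linarith
  qed simp
  also have "... = 3 * exp (- t / 2)" by (simp add: exp_add[symmetric])
  finally show ?thesis by (simp add: norm_minus_commute)
 qed
 have fast: "exp (t / 2) <= norm (snd w) & exp (t / 2) <= norm (snd (?Y w))" if "w ~: ?S" for w
 proof -
  have "norm (snd (?Y w) - snd w) <= 1 * \<bar>t' - t\<bar>" by (rule momentum_drift[OF l B])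
  then show ?thesis using that t norm_triangle_sub[of "snd w" "snd (?Y w)"] by (simp add: norm_minus_commute)
 qed
 note d = E_field_time_diff[OF a(1) a(2) mpres_id vfield_mpres[OF l B] fg, where d="3 * exp (- t / 2)" and P="exp (t / 2)" and L="exp (t / 16)" and R="exp (- t / 32)" and S="?S"]
 have "norm (Tfield l f B t q - Tfield l f B t' q) <= CT * ?J^2 * (exp (- t / 32) + 3 * exp (- t / 2) / exp (- t / 32) ^ 3 + exp (t / 16) * exp (t / 2) powr (-1/4) + 1 / (exp (t / 16))^2)"
  unfolding Tfield_def by (rule d(1)) (use slow fast in auto)
 also have "... <= CT * ?J^2 * (6 * exp (- t / 128))" using CT_nonneg by (intro mult_left_mono log_scales t(1)) auto
 also have "... <= KE * eps^2 * exp (- (1/256) * t)" by (rule CJ_growth[OF t(1)])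
 finally show "norm (Tfield l f B t' q - Tfield l f B t q) <= KE * eps^2 * exp (- (1/256) * t)" by (simp add: norm_minus_commute)
 have "norm (DE (pull l f B t) q h - DE (pull l f B t') q h) <= CT * ?J^2 * (exp (- t / 32) powr (1/4) + 3 * exp (- t / 2) / exp (- t / 32) ^ 4 + (exp (t / 16) * exp (t / 2) powr (-1/4) + 1 / (exp (t / 16))^2) / exp (- t / 32)) * norm h"
  by (rule d(2)) (use slow fast in auto)
 also have "... <= CT * ?J^2 * (6 * exp (- t / 128)) * norm h" using CT_nonneg by (intro mult_left_mono mult_right_mono log_scales t(1)) auto
 also have "... <= KE * eps^2 * exp (- (1/256) * t) * norm h" by (intro mult_right_mono CJ_growth t(1)) auto
 finally show "norm (DE (pull l f B t') q h - DE (pull l f B t) q h) <= (KE * eps^2 * norm h) * exp (- (1/256) * t)" by (simp add: norm_minus_commute mult_ac)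
qed

text \<open>The bounds at time 0 plus the sum of the geometric series of increments, for field and
  gradient together. The smallness condition on the data takes the form
  \<open>KF * eps^2 <= 1\<close>.\<close>

definition KF :: real where "KF = (8 * ubv * Wc + 4 * Ch + 17) * CJ^2 + KE / (1 - exp (- (1/256)))"

lemma KF_nonneg: "KF >= 0" using Wc(1) Ch_nonneg KE_nonneg by (simp add: KF_def)

text \<open>The increments of field and gradient are summed from time 0 on. Their quadratic
  dependence on the datum is what lets small data reproduce the bound 1.\<close>

lemma Tfield_okfield:
 assumes l: "\<bar>l\<bar> = 1" and B: "okfield 1 B" and f: "datum eps f" and small: "KF * eps^2 <= 1"
 shows "okfield 1 (Tfield l f B)"
proof -
 let ?e = "1 - exp (- (1/256::real))"
 have e: "?e > 0" by simp
 have a0: "adm (CJ * eps) (pull l f B 0)" using adm_pull_global[OF l B f, of 0 0] by simp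
 have DE0: "norm (DE (pull l f B t) q h) <= norm h" if t: "t >= 0" for t q h
 proof -
  have "norm (DE (pull l f B t) q h - DE (pull l f B 0) q h) <= KE * eps^2 * norm h * exp (- (1/256) * 0) / ?e"
   by (rule exp_Cauchy(1)[where f="%t. DE (pull l f B t) q h"]) (use t Tfield_time_step(2)[OF l B f] in auto)
  moreover have "norm (DE (pull l f B 0) q h) <= (4 * Ch + 16) * (CJ * eps)^2 * norm h" by (rule E_field_static(5)[OF a0])
  ultimately have "norm (DE (pull l f B t) q h) <= (4 * Ch + 16) * (CJ * eps)^2 * norm h + KE * eps^2 * norm h / ?e"
   using norm_triangle_sub[of "DE (pull l f B t) q h" "DE (pull l f B 0) q h"] by simp
  also have "... = ((4 * Ch + 16) * CJ^2 + KE / ?e) * eps^2 * norm h" by (simp add: power_mult_distrib algebra_simps)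
  also have "... <= KF * eps^2 * norm h"
   unfolding KF_def using Wc(1) by (intro mult_right_mono add_right_mono) auto
  also have "... <= 1 * norm h" by (intro mult_right_mono small) auto
  finally show ?thesis by simp
 qed
 have "norm (Tfield l f B t q) <= 1" if t: "t >= 0" for t q
 proof -
  have "norm (Tfield l f B t q - Tfield l f B 0 q) <= KE * eps^2 * exp (- (1/256) * 0) / ?e"
   by (rule exp_Cauchy(1)[where f="%t. Tfield l f B t q"]) (use t Tfield_time_step(1)[OF l B f] in auto)
  moreover have "norm (Tfield l f B 0 q) <= (8 * ubv * Wc + 1) * (CJ * eps)^2" unfolding Tfield_def by (rule E_field_static(2)[OF a0])
  ultimately have "norm (Tfield l f B t q) <= (8 * ubv * Wc + 1) * (CJ * eps)^2 + KE * eps^2 / ?e"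
   using norm_triangle_sub[of "Tfield l f B t q" "Tfield l f B 0 q"] by simp
  also have "... = ((8 * ubv * Wc + 1) * CJ^2 + KE / ?e) * eps^2" by (simp add: power_mult_distrib algebra_simps)
  also have "... <= KF * eps^2"
   unfolding KF_def using Ch_nonneg by (intro mult_right_mono add_right_mono) auto
  finally show ?thesis using small by simp
 qed
 moreover have "norm (Tfield l f B t q - Tfield l f B t q') <= 1 * norm (q - q')" if t: "t >= 0" for t q q'
 proof (rule differentiable_bound[where S=UNIV and f'="DE (pull l f B t)"])
  show "(Tfield l f B t has_derivative DE (pull l f B t) x) (at x within UNIV)" for x
   unfolding Tfield_def by (rule E_field_static(3)[OF adm_pull_global[OF l B f t order_refl]])
  show "onorm (DE (pull l f B t) x) <= 1" for x using DE0[OF t] by (intro onorm_bound) auto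
 qed auto
 ultimately show ?thesis using Tfield_continuous(1)[OF l B f] by (simp add: okfield_def)
qed

section \<open>Contraction with a logarithmic loss\<close>

lemma geometric_domination:
 fixes m :: "nat => real"
 assumes m: "m 0 = K" "!!N. m (Suc N) = m N / 2 + b" and "b > 0" "K >= 0"
 shows "\<exists>N. m N <= 3 * b"
proof -
 have eq: "m N = (K - 2 * b) * (1/2) ^ N + 2 * b" for N by (induction N) (auto simp: m field_simps)
 obtain N where "(1/2::real) ^ N < b / (K + 1)" using real_arch_pow_inv[of "b / (K + 1)" "1/2"] assms by auto
 then have N: "(K + 1) * (1/2) ^ N <= b" using assms by (simp add: field_simps)
 have "(K - 2 * b) * (1/2) ^ N <= (K + 1) * (1/2) ^ N" using assms by (intro mult_right_mono) auto
 then show ?thesis using N eq[of N] by (intro exI[of _ N]) linarith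
qed

text \<open>\<open>V N t\<close> collects the differences, at time \<open>t\<close>, of the members of the \<open>N\<close>-th generation. The
  free parameter \<open>n\<close> is the truncation of the logarithmic modulus of continuity; on time intervals
  of length \<open>1 / (8 C c)\<close> the exponential loss \<open>exp ((n + 1) / 4)\<close> is beaten by \<open>2\<^sup>-\<^sup>n\<close>.\<close>

lemma osgood_family:
 fixes V :: "nat => real => real set"
 assumes C: "C >= 1" "c >= 1" "T >= 0" "K >= 0"
  and dec: "!!N t. V (Suc N) t <= V N t"
  and bdd: "!!N t v. 0 <= t ==> t <= T ==> v : V N t ==> v <= K"
  and step: "!!N eta m nu s n t v. 0 <= eta ==> 0 <= m ==> 0 < nu ==> 0 <= t ==> t <= T ==>
   (!!r u. 0 <= r ==> r <= t ==> u : V N r ==> u <= eta + m * exp (nu * (r - s))) ==> v : V (Suc N) t ==>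
   v <= C * ((1/2) ^ n + real (n + 1) * (c * (eta * T + m / nu * exp (nu * (t - s)))))"
  and e: "e > 0"
 shows "\<exists>N. \<forall>t v. 0 <= t --> t <= T --> v : V N t --> v <= e"
proof -
 define dl where "dl = 1 / (8 * C * c)"
 have dl: "dl > 0" using C by (simp add: dl_def)
 have decN: "V N' t <= V N t" if "N <= N'" for N N' t
  using that by (induction rule: dec_induct) (use dec in blast)+
 define Q where "Q s \<longleftrightarrow> (\<forall>e>0. \<exists>N. \<forall>t v. 0 <= t --> t <= T --> t <= s --> v : V N t --> v <= e)" for s
 have next_step: "Q (s + dl)" if Q: "Q s" for s
  unfolding Q_def
 proof (intro allI impI)
  fix e :: real assume e: "e > 0"
  obtain n where "(3/4::real) ^ n < e / (12 * C)"
   using real_arch_pow_inv[of "e / (12 * C)" "3/4"] e C by auto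
  then have n: "(12 * C) * (3/4) ^ n <= e" using C by (simp add: field_simps)
  \<comment> \<open>Chosen so that the recursive term acquires exactly the factor 1/2. Over an
    interval of length \<open>dl\<close> the exponential weight then grows by
    \<open>exp ((n + 1) / 4)\<close>.\<close>
  define nu where "nu = 2 * C * c * real (n + 1)"
  have nu: "nu > 0" "nu * dl = real (n + 1) / 4" using C by (auto simp: nu_def dl_def)
  define b where "b = 2 * C * (1/2) ^ n"
  have b: "b > 0" using C by (simp add: b_def)
  \<comment> \<open>The tolerance demanded up to time \<open>s\<close>: even with the factor
    \<open>n + 1\<close> and the length \<open>T\<close> it costs no more than
    \<open>(1/2) ^ n\<close>.\<close>
  define eta where "eta = (1/2) ^ n / (real (n + 1) * c * (T + 1))"
  have eta: "eta > 0" using C by (simp add: eta_def)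
  have "eta * (real (n + 1) * c * (T + 1)) = (1/2) ^ n"
   unfolding eta_def using C by (subst nonzero_eq_divide_eq[symmetric]) auto
  moreover have "eta * (real (n + 1) * c * T) <= eta * (real (n + 1) * c * (T + 1))"
   using eta C by (intro mult_left_mono) auto
  ultimately have etaT: "real (n + 1) * (c * (eta * T)) <= (1/2) ^ n" by (simp add: mult_ac)
  obtain N0 where N0: "!!t v. 0 <= t ==> t <= T ==> t <= s ==> v : V N0 t ==> v <= eta"
   using Q eta unfolding Q_def by metis
  define m where "m = rec_nat K (%_ m. m / 2 + b)"
  have m: "m 0 = K" "!!N. m (Suc N) = m N / 2 + b" by (auto simp: m_def)
  have m0: "m N >= 0" for N by (induction N) (use m b C in auto)
  have main: "v <= eta + m N * exp (nu * (t - s))"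
   if "0 <= t" "t <= T" "t <= s + dl" "v : V (N0 + N) t" for N t v
   using that
  proof (induction N arbitrary: t v)
   case (0 t v)
   show ?case
   proof (cases "t <= s")
    case True
    then show ?thesis using N0[of t v] 0 m0[of 0] by (auto intro: add_increasing2)
   next
    case False
    then have "K * 1 <= K * exp (nu * (t - s))" using C nu by (intro mult_left_mono) auto
    then show ?thesis using bdd[of t v "N0 + 0"] 0 eta m by simp
   qed
  next
   case (Suc N t v)
   show ?case
   proof (cases "t <= s")
    case True
    have "v : V N0 t" using Suc.prems decN[of N0 "N0 + Suc N" t] by auto
    then have "v <= eta" using True Suc.prems N0 by blast
    then show ?thesis using m0[of "Suc N"] by (auto intro: add_increasing2)
   next
    case False
    have ex1: "1 <= exp (nu * (t - s))" using False nu by auto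
    have "v <= C * ((1/2) ^ n + real (n + 1) * (c * (eta * T + m N / nu * exp (nu * (t - s)))))"
    proof (rule step[of eta "m N" nu t "N0 + N" s v n])
     show "u <= eta + m N * exp (nu * (r - s))" if "0 <= r" "r <= t" "u : V (N0 + N) r" for r u
      using that Suc.prems by (intro Suc.IH) auto
    qed (use eta m0 nu Suc.prems in auto)
    also have "... = C * ((1/2) ^ n + real (n + 1) * (c * (eta * T))) + m N / 2 * exp (nu * (t - s))"
    proof -
     have "C * (k * (c * (x / (2 * C * c * k)))) = x / 2" if "k > 0" for k x :: real using C that by (simp add: field_simps)
     from this[of "real (n + 1)" "m N * exp (nu * (t - s))"]
     have "C * (real (n + 1) * (c * (m N * exp (nu * (t - s)) / nu))) = m N * exp (nu * (t - s)) / 2" by (simp add: nu_def del: of_nat_add)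
     then show ?thesis by (simp only: distrib_left add.assoc times_divide_eq_left)
    qed
    also have "... <= C * ((1/2) ^ n + (1/2) ^ n) + m N / 2 * exp (nu * (t - s))"
     using C etaT by (intro add_right_mono mult_left_mono add_left_mono) auto
    also have "... = b * 1 + m N / 2 * exp (nu * (t - s))" by (simp add: b_def)
    also have "... <= b * exp (nu * (t - s)) + m N / 2 * exp (nu * (t - s))"
     using b ex1 by (intro add_right_mono mult_left_mono) auto
    also have "... = m (Suc N) * exp (nu * (t - s))" by (simp add: m algebra_simps)
    finally show ?thesis using eta by simp
   qed
  qed
  obtain N where N: "m N <= 3 * b" using geometric_domination[of m K b] m b C by blast
  \<comment> \<open>By this bound the product of the growth with the gain \<open>(1/2) ^ n\<close>
    is still a multiple of \<open>(3/4) ^ n\<close>.\<close>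
  have "exp (1/4::real) <= 3/2"
   using exp_bound[of "1/4"] by (simp add: power2_eq_square)
  then have "exp (1/4::real) ^ (n + 1) <= (3/2) ^ (n + 1)" by (intro power_mono) auto
  then have ex: "exp (nu * dl) <= (3/2) ^ (n + 1)" unfolding nu(2) by (simp only: exp_of_nat_mult[symmetric]) simp
  have "eta <= C * (3/4) ^ n"
  proof -
   have "1 * 1 <= (real (n + 1) * c) * (T + 1)" using C mult_mono[of 1 "real (n+1)" 1 c] by (intro mult_mono) auto
   then have "eta <= (1/2) ^ n" unfolding eta_def by (intro divide_le_eq[THEN iffD2]) (auto simp: mult_le_cancel_left1)
   also have "... <= (3/4) ^ n" by (intro power_mono) auto
   also have "... <= C * (3/4) ^ n" using C by (simp add: mult_le_cancel_right1)
   finally show ?thesis .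
  qed
  have "3 * b * exp (nu * dl) <= 9 * C * (3/4) ^ n"
  proof -
   have "3 * b * exp (nu * dl) <= 3 * b * (3/2) ^ (n + 1)" using b ex by (intro mult_left_mono) auto
   also have "... = 9 * C * ((1/2) * (3/2)) ^ n" unfolding power_mult_distrib by (simp add: b_def)
   finally show ?thesis by simp
  qed
  have total: "eta + 3 * b * exp (nu * dl) <= e" proof -
   have "0 <= C * (3/4) ^ n" using C by simp
   then have "C * (3/4) ^ n + 9 * C * (3/4) ^ n <= 12 * C * (3/4) ^ n" by simp
   then show ?thesis using n \<open>eta <= C * (3/4) ^ n\<close> \<open>3 * b * exp (nu * dl) <= 9 * C * (3/4) ^ n\<close> by linarith
  qed
  show "\<exists>N. \<forall>t v. 0 <= t --> t <= T --> t <= s + dl --> v : V N t --> v <= e"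
  proof (intro exI[of _ "N0 + N"] allI impI)
   fix t v assume t: "0 <= t" "t <= T" "t <= s + dl" and v: "v : V (N0 + N) t"
   have "v <= eta + m N * exp (nu * (t - s))" by (rule main[OF t v])
   also have "... <= eta + 3 * b * exp (nu * dl)"
    using N m0 nu(1) t b by (intro add_left_mono mult_mono) auto
   finally show "v <= e" using total by linarith
  qed
 qed
 \<comment> \<open>No admissible time lies below -1, so the induction over intervals starts with an
   empty claim.\<close>
 have base: "Q (- 1)" unfolding Q_def by auto
 have "Q (real k * dl - 1)" for k
 proof (induction k)
  case (Suc k)
  have "real (Suc k) * dl - 1 = (real k * dl - 1) + dl" by (simp add: algebra_simps)
  then show ?case using next_step[OF Suc] by (simp only:)
 qed (use base in simp)
 moreover obtain k where "(T + 1) / dl <= real k" using real_arch_simple by blast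
 then have "T <= real k * dl - 1" using dl by (simp add: field_simps)
 ultimately show ?thesis using e unfolding Q_def by (meson order_trans)
qed

text \<open>Trajectories of both fields start from the same label at time 0. Gronwall's inequality
  bounds their distance, and integrating the exponential forcing gains the factor
  \<open>1 / nu\<close>, on which the contraction rests.\<close>

lemma Tfield_diff:
 assumes l: "\<bar>l\<bar> = 1" and A: "okfield M A" and B: "okfield M B" and f: "datum eps f"
  and p: "0 <= eta" "0 <= m" "0 < nu" "0 <= t" "t <= T"
  and AB: "!!r q. 0 <= r ==> r <= t ==> norm (A r q - B r q) <= eta + m * exp (nu * (r - s))"
 shows "norm (Tfield l f A t q - Tfield l f B t q) <=
  CT * (eps * (2 * (1 + M * T)^2 + exp (M * T)))^2 * ((1/2) ^ n + real (n + 1) * (exp (M * T) * (eta * T + m / nu * exp (nu * (t - s)))))"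
 unfolding Tfield_def
proof (rule E_field_osgood[OF adm_pull_local[OF l A f p(4,5)] adm_pull_local[OF l B f p(4,5)] vfield_mpres[OF l A, of 0 t] vfield_mpres[OF l B, of 0 t]])
 let ?a = "%w t. flow (vfield l A) 0 t w" and ?b = "%w t. flow (vfield l B) 0 t w"
 have M: "M >= 1" using okfieldD(1)[OF A] .
 fix w
 show "pull l f A t (flow (vfield l A) 0 t w) = pull l f B t (flow (vfield l B) 0 t w)"
  by (simp add: pull_def flow_inverse[OF vfield_lip[OF l A]] flow_inverse[OF vfield_lip[OF l B]])
 have "norm (?a w t - ?b w t) <= exp (M * \<bar>t - 0\<bar>) * (norm (?a w 0 - ?b w 0) + \<bar>(eta * t + m / nu * exp (nu * (t - s))) - (eta * 0 + m / nu * exp (nu * (0 - s)))\<bar>)"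
 proof (rule gronwall[where w'="%t. vfield l A t (?a w t) - vfield l B t (?b w t)" and g="%t. eta + m * exp (nu * (t - s))"])
  fix r assume "r : closed_segment 0 t"
  then have r: "0 <= r" "r <= t" using p by (auto simp: closed_segment_eq_real_ivl)
  show "((%t. ?a w t - ?b w t) has_vector_derivative vfield l A r (?a w r) - vfield l B r (?b w r)) (at r)"
   by (intro has_vector_derivative_diff flow_vderiv[OF vfield_lip[OF l A]] flow_vderiv[OF vfield_lip[OF l B]])
  show "((%t. eta * t + m / nu * exp (nu * (t - s))) has_real_derivative eta + m * exp (nu * (r - s))) (at r)"
   using p by (auto intro!: derivative_eq_intros)
  show "0 <= eta + m * exp (nu * (r - s))" using p by simp
  have "norm (vfield l A r (?a w r) - vfield l B r (?b w r)) <= norm (vfield l A r (?a w r) - vfield l A r (?b w r)) + norm (vfield l A r (?b w r) - vfield l B r (?b w r))"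
   using norm_triangle_ineq[of "vfield l A r (?a w r) - vfield l A r (?b w r)" "vfield l A r (?b w r) - vfield l B r (?b w r)"] by simp
  also have "norm (vfield l A r (?b w r) - vfield l B r (?b w r)) = norm (A r (fst (?b w r)) - B r (fst (?b w r)))"
   using r l by (simp add: vfield_def scaleR_diff_right[symmetric] norm_minus_commute)
  also have "... <= eta + m * exp (nu * (r - s))" by (rule AB[OF r])
  finally show "norm (vfield l A r (?a w r) - vfield l B r (?b w r)) <= M * norm (?a w r - ?b w r) + (eta + m * exp (nu * (r - s)))"
   using lip_fieldD(2)[OF vfield_lip[OF l A], of r "?a w r" "?b w r"] by linarith
 qed (use M in simp)
 also have "... <= exp (M * T) * (eta * T + m / nu * exp (nu * (t - s)))"
 proof (rule mult_mono)
  have "exp (nu * (0 - s)) <= exp (nu * (t - s))" using p mult_left_mono[of "0 - s" "t - s" nu] by simp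
  then have "m / nu * exp (nu * (0 - s)) <= m / nu * exp (nu * (t - s))" using p by (intro mult_left_mono) auto
  moreover have "0 <= m / nu * exp (nu * (0 - s))" "0 <= eta * t" "eta * t <= eta * T" using p by (auto intro: mult_left_mono)
  ultimately show "norm (?a w 0 - ?b w 0) + \<bar>(eta * t + m / nu * exp (nu * (t - s))) - (eta * 0 + m / nu * exp (nu * (0 - s)))\<bar> <= eta * T + m / nu * exp (nu * (t - s))"
   by (simp add: flow_init[OF vfield_lip[OF l A]] flow_init[OF vfield_lip[OF l B]])
 qed (use p M in \<open>auto intro!: mult_left_mono\<close>)
 finally have "norm (?a w t - ?b w t) <= exp (M * T) * (eta * T + m / nu * exp (nu * (t - s)))" .
 then show "norm (fst (?a w t) - fst (?b w t)) <= exp (M * T) * (eta * T + m / nu * exp (nu * (t - s)))"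
 proof -
  have "norm (fst z) <= norm z" for z :: phase by (metis norm_fst_le prod.collapse)
  from order_trans[OF this[of "?a w t - ?b w t"]] show ?thesis using \<open>norm (?a w t - ?b w t) <= exp (M * T) * (eta * T + m / nu * exp (nu * (t - s)))\<close> by simp
 qed
qed

text \<open>Existence and uniqueness share this statement: \<open>S N\<close> will be the tail of
  the iteration from \<open>N\<close> on, or constantly the set of two fixed points. Differences
  within one generation are controlled by those within the previous one.\<close>

lemma Tfield_family:
 fixes S :: "nat => (real => R3 => R3) set"
 assumes l: "\<bar>l\<bar> = 1" and f: "datum eps f" and T: "T >= 0" and dec: "!!N. S (Suc N) <= S N"
  and ok: "!!N A. A : S N ==> okfield M A"
  and im: "!!N A. A : S (Suc N) ==> \<exists>B\<in>S N. \<forall>t q. 0 <= t --> t <= T --> A t q = Tfield l f B t q"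
  and e: "e > 0"
 shows "\<exists>N. \<forall>A\<in>S N. \<forall>B\<in>S N. \<forall>t q. 0 <= t --> t <= T --> norm (A t q - B t q) <= e"
proof (cases "S 0 = {}")
 case True
 then show ?thesis by blast
next
 case False
 then have M: "M >= 1" using ok okfieldD(1) by blast
 define V where "V N t = {norm (A t q - B t q) |A B q. A : S N & B : S N}" for N t
 define C where "C = CT * (eps * (2 * (1 + M * T)^2 + exp (M * T)))^2"
 have C: "C >= 0" using CT_nonneg by (simp add: C_def)
 have "\<exists>N. \<forall>t v. 0 <= t --> t <= T --> v : V N t --> v <= e"
 proof (rule osgood_family[where C="C + 1" and c="exp (M * T)" and K="2 * M"])
  show "V (Suc N) t <= V N t" for N t unfolding V_def using dec[of N] by blast
  show "v <= 2 * M" if t: "0 <= t" "t <= T" and vV: "v : V N t" for N t v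
  proof -
   obtain A B q where AB: "A : S N" "B : S N" and v: "v = norm (A t q - B t q)" using vV by (auto simp: V_def)
   have "norm (A t q - B t q) <= norm (A t q) + norm (B t q)" by (rule norm_triangle_ineq4)
   also have "... <= M + M" using okfieldD(2)[OF ok[OF AB(1)] t(1)] okfieldD(2)[OF ok[OF AB(2)] t(1)] by (rule add_mono)
   finally show ?thesis by (simp add: v)
  qed
  fix N n and eta m nu s t v :: real
  assume p: "0 <= eta" "0 <= m" "0 < nu" "0 <= t" "t <= T" and v: "v : V (Suc N) t"
   and h: "!!r u. 0 <= r ==> r <= t ==> u : V N r ==> u <= eta + m * exp (nu * (r - s))"
  obtain A B q where AB: "A : S (Suc N)" "B : S (Suc N)" and v: "v = norm (A t q - B t q)" using v by (auto simp: V_def)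
  obtain A' where A': "A' : S N" "A t q = Tfield l f A' t q" using im[OF AB(1)] p by blast
  obtain B' where B': "B' : S N" "B t q = Tfield l f B' t q" using im[OF AB(2)] p by blast
  let ?x = "(1/2) ^ n + real (n + 1) * (exp (M * T) * (eta * T + m / nu * exp (nu * (t - s))))"
  have "v <= C * ?x" unfolding v A' B' C_def
   by (rule Tfield_diff[OF l ok[OF A'(1)] ok[OF B'(1)] f p], rule h) (use A' B' in \<open>auto simp: V_def\<close>)
  also have "... <= (C + 1) * ?x" using p T by (intro mult_right_mono) auto
  finally show "v <= (C + 1) * ?x" .
 qed (use C M T e in auto)
 then show ?thesis unfolding V_def by blast
qed

lemma Tfield_unique:
 assumes l: "\<bar>l\<bar> = 1" and f: "datum eps f" and A: "okfield M A" and B: "okfield M B"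
  and AT: "!!t q. 0 <= t ==> t <= T ==> A t q = Tfield l f A t q" and BT: "!!t q. 0 <= t ==> t <= T ==> B t q = Tfield l f B t q"
  and t: "0 <= t" "t <= T"
 shows "A t q = B t q"
proof -
 have "norm (A t q - B t q) <= e" if "e > 0" for e
 proof -
  have "\<exists>N::nat. \<forall>A'\<in>{A, B}. \<forall>B'\<in>{A, B}. \<forall>t q. 0 <= t --> t <= T --> norm (A' t q - B' t q) <= e"
   by (rule Tfield_family[OF l f _ _ _ _ that, where S="%_. {A, B}" and M=M]) (use t A B AT BT in auto)
  then show ?thesis using t by blast
 qed
 then show ?thesis by (metis dense_ge eq_iff_diff_eq_0 norm_le_zero_iff)
qed

lemma Tfield_fixed_point:
 assumes l: "\<bar>l\<bar> = 1" and f: "datum eps f" and small: "KF * eps^2 <= 1"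
 obtains B where "okfield 1 B" "!!t q. 0 <= t ==> B t q = Tfield l f B t q"
proof -
 define b where "b = rec_nat (%_ _. 0) (%_. Tfield l f)"
 have b: "b 0 = (%_ _. 0)" "b (Suc n) = Tfield l f (b n)" for n by (auto simp: b_def)
 have ok: "okfield 1 (b n)" for n
 proof (induction n)
  case 0
  show ?case by (simp add: b okfield_def)
 next
  case (Suc n)
  then show ?case unfolding b by (rule Tfield_okfield[OF l _ f small])
 qed
 have uc: "\<exists>N. \<forall>i\<ge>N. \<forall>j\<ge>N. \<forall>t q. 0 <= t --> t <= T --> norm (b i t q - b j t q) <= e" if "T >= 0" "e > 0" for T e
 proof -
  have "\<exists>N. \<forall>A\<in>b ` {N..}. \<forall>B\<in>b ` {N..}. \<forall>t q. 0 <= t --> t <= T --> norm (A t q - B t q) <= e"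
  proof (rule Tfield_family[OF l f that(1) _ _ _ that(2), where M=1])
   fix N A assume "A : b ` {Suc N..}"
   then obtain n where n: "A = b n" "Suc N <= n" by auto
   then obtain k where "n = Suc k" "N <= k" by (metis Suc_le_D Suc_le_mono)
   then show "\<exists>B\<in>b ` {N..}. \<forall>t q. 0 <= t --> t <= T --> A t q = Tfield l f B t q"
    using n by (intro bexI[of _ "b k"]) (auto simp: b)
  qed (auto simp: ok)
  then show ?thesis by (meson atLeast_iff imageI)
 qed
 define B where "B t q = lim (%n. b n t q)" for t q
 have conv: "(%n. b n t q) ----> B t q" if t: "t >= 0" for t q
 proof -
  have "Cauchy (%n. b n t q)"
  proof (rule metric_CauchyI)
   fix e :: real assume "e > 0"
   then obtain N where "\<forall>i\<ge>N. \<forall>j\<ge>N. norm (b i t q - b j t q) <= e / 2"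
    using uc[of t "e/2"] t by (metis half_gt_zero order_refl)
   then show "\<exists>N. \<forall>m\<ge>N. \<forall>n\<ge>N. dist (b m t q) (b n t q) < e"
    using \<open>e > 0\<close> by (intro exI[of _ N]) (fastforce simp: dist_norm intro: le_less_trans[of _ "e/2"])
  qed
  then show ?thesis unfolding B_def by (simp add: Cauchy_convergent convergent_LIMSEQ_iff[symmetric])
 qed
 have unif: "\<exists>N. \<forall>i\<ge>N. \<forall>t q. 0 <= t --> t <= T --> norm (b i t q - B t q) <= e" if T: "T >= 0" "e > 0" for T e
 proof -
  obtain N where N: "!!i j t q. i >= N ==> j >= N ==> 0 <= t ==> t <= T ==> norm (b i t q - b j t q) <= e" using uc[OF T] by blast
  have "norm (b i t q - B t q) <= e" if "i >= N" "0 <= t" "t <= T" for i t q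
  proof (rule LIMSEQ_le_const2)
   show "(%j. norm (b i t q - b j t q)) ----> norm (b i t q - B t q)" by (intro tendsto_intros conv that)
   show "\<exists>M. \<forall>j\<ge>M. norm (b i t q - b j t q) <= e" using N that by blast
  qed
  then show ?thesis by blast
 qed
 have okB: "okfield 1 B"
  unfolding okfield_def
 proof (intro conjI allI impI)
  show "continuous_on ({0..} \<times> UNIV) (%(t, q). B t q)"
  proof (rule continuous_on_halfline)
   fix T :: real
   show "continuous_on ({0..T} \<times> UNIV) (%(t, q). B t q)"
   proof (rule uniform_limit_theorem)
    show "\<forall>\<^sub>F n in sequentially. continuous_on ({0..T} \<times> UNIV) (%(t, q). b n t q)"
     by (intro always_eventually allI continuous_on_subset[OF okfieldD(4)[OF ok]]) auto
    show "uniform_limit ({0..T} \<times> UNIV) (%n (t, q). b n t q) (%(t, q). B t q) sequentially"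
     unfolding uniform_limit_iff
    proof (intro allI impI)
     fix e :: real assume e: "e > 0"
     obtain N where N: "\<forall>i\<ge>N. \<forall>t q. 0 <= t --> t <= max T 0 --> norm (b i t q - B t q) <= e / 2"
      using unif[of "max T 0" "e/2"] e by auto
     show "\<forall>\<^sub>F n in sequentially. \<forall>x\<in>{0..T} \<times> UNIV. dist (case x of (t, q) => b n t q) (case x of (t, q) => B t q) < e"
      unfolding eventually_sequentially
     proof (intro exI[of _ N] allI impI ballI)
      fix n and x :: "real \<times> R3" assume n: "N <= n" and x: "x : {0..T} \<times> UNIV"
      obtain t q where [simp]: "x = (t, q)" by fastforce
      have "norm (b n t q - B t q) <= e / 2" using N n x by auto
      then show "dist (case x of (t, q) => b n t q) (case x of (t, q) => B t q) < e" using e by (simp add: dist_norm)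
     qed
    qed
   qed simp
  qed
  fix t :: real and q q' assume t: "0 <= t"
  show "norm (B t q) <= 1"
   by (rule LIMSEQ_le_const2[OF tendsto_norm[OF conv[OF t]]]) (use okfieldD(2)[OF ok t] in auto)
  show "norm (B t q - B t q') <= 1 * norm (q - q')"
   by (rule LIMSEQ_le_const2[OF tendsto_norm[OF tendsto_diff[OF conv[OF t] conv[OF t]]]]) (use okfieldD(3)[OF ok t] in auto)
 qed simp
 moreover have "B t q = Tfield l f B t q" if t: "t >= 0" for t q
 proof -
  define C where "C = CT * (eps * (2 * (1 + 1 * t)^2 + exp (1 * t)))^2"
  have C: "C >= 0" using CT_nonneg by (simp add: C_def)
  have est: "norm (B t q - Tfield l f B t q) <= 3 * C * (1/2) ^ n + (1/2) ^ n" for n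
  proof -
   \<comment> \<open>The limit is taken in the fixed-point equation by means of the logarithmic
     estimate with \<open>m = 0\<close>. This \<open>eta\<close> keeps the term with the factor
     \<open>n + 1\<close> below \<open>(1/2) ^ n\<close>.\<close>
   define eta where "eta = (1/2) ^ n / (real (n + 1) * exp t * (t + 1))"
   have eta: "eta > 0" using t by (simp add: eta_def)
   have "eta * (real (n + 1) * exp t * (t + 1)) = (1/2) ^ n"
    unfolding eta_def using t by (subst nonzero_eq_divide_eq[symmetric]) auto
   moreover have "eta * (real (n + 1) * exp t * t) <= eta * (real (n + 1) * exp t * (t + 1))" using eta t by (intro mult_left_mono) auto
   ultimately have small: "real (n + 1) * (exp t * (eta * t)) <= (1/2) ^ n" by (simp add: mult_ac)
   obtain N where N: "\<forall>i\<ge>N. \<forall>r q. 0 <= r --> r <= t --> norm (b i r q - B r q) <= eta" using unif[OF t eta] by blast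
   obtain N' where N': "\<forall>i\<ge>N'. \<forall>r q. 0 <= r --> r <= t --> norm (b i r q - B r q) <= (1/2) ^ n" using unif[OF t, of "(1/2) ^ n"] by auto
   let ?i = "max N N'"
   have "norm (Tfield l f (b ?i) t q - Tfield l f B t q) <= C * ((1/2) ^ n + real (n + 1) * (exp (1 * t) * (eta * t + 0 / 1 * exp (1 * (t - 0)))))"
    unfolding C_def by (rule Tfield_diff[OF l ok okB f]) (use eta t N in auto)
   also have "... <= C * ((1/2) ^ n + (1/2) ^ n)" using small C by (intro mult_left_mono add_left_mono) auto
   finally have "norm (b (Suc ?i) t q - Tfield l f B t q) <= 2 * C * (1/2) ^ n" by (simp add: b)
   moreover have "norm (b (Suc ?i) t q - B t q) <= (1/2) ^ n" using N'[rule_format, of "Suc ?i" t q] t by simp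
   moreover have "0 <= C * (1/2) ^ n" using C by simp
   ultimately show ?thesis
    using norm_triangle_ineq4[of "b (Suc ?i) t q - Tfield l f B t q" "b (Suc ?i) t q - B t q"] by simp
  qed
  have "norm (B t q - Tfield l f B t q) <= 0"
  proof (rule LIMSEQ_le_const)
   have "(%n. 3 * C * (1/2) ^ n + (1/2) ^ n) ----> 3 * C * 0 + 0" by (intro tendsto_intros LIMSEQ_realpow_zero) auto
   then show "(%n. 3 * C * (1/2) ^ n + (1/2) ^ n) ----> 0" by simp
  qed (use est in auto)
  then show ?thesis by simp
 qed
 ultimately show ?thesis using that by blast
qed

section \<open>Weak gradients along the flow\<close>

text \<open>The sum over the basis is the transpose of \<open>D\<close> applied to
  \<open>g\<close>.\<close>

lemma adjoint_sum_inner: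
 fixes D :: "'a::euclidean_space => 'b::real_inner"
 assumes "linear D"
 shows "(\<Sum>e\<in>Basis. (g <.> D e) *R e) <.> h = g <.> D h"
proof -
 have "D h = D (\<Sum>e\<in>Basis. (h <.> e) *R e)" by (simp add: euclidean_representation)
 also have "... = (\<Sum>e\<in>Basis. (h <.> e) *R D e)" using assms by (simp add: linear_sum linear_scale)
 finally have "g <.> D h = (\<Sum>e\<in>Basis. (h <.> e) * (g <.> D e))" by (simp add: inner_sum_right)
 then show ?thesis by (simp add: inner_sum_left) (intro sum.cong refl, simp add: inner_commute mult.commute)
qed

lemma adjoint_sum_norm:
 fixes D :: "'a::euclidean_space => 'b::real_inner"
 assumes D: "linear D" and b: "!!h. norm (D h) <= Lam * norm h" and Lam: "Lam >= 0"
 shows "norm (\<Sum>e\<in>Basis. (g <.> D e) *R e) <= Lam * norm g"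
proof -
 define v where "v = (\<Sum>e\<in>Basis. (g <.> D e) *R e)"
 have "(norm v)^2 = g <.> D v" unfolding power2_norm_eq_inner by (subst (1) v_def) (rule adjoint_sum_inner[OF D])
 also have "... <= norm g * norm (D v)" by (rule norm_cauchy_schwarz)
 also have "... <= norm g * (Lam * norm v)" by (intro mult_left_mono b) auto
 finally have "norm v * norm v <= (Lam * norm g) * norm v" by (simp add: power2_eq_square mult_ac)
 then have "norm v <= Lam * norm g" using Lam by (cases "v = 0") auto
 then show ?thesis by (simp add: v_def)
qed

lemma continuous_on_linear_family:
 fixes v :: "'a::topological_space => 'b::euclidean_space" and D :: "'a => 'b => 'c::real_normed_vector"
 assumes "!!e. continuous_on S (%x. D x e)" "!!x. linear (D x)" "continuous_on S v"
 shows "continuous_on S (%x. D x (v x))"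
proof -
 have "D x (v x) = (\<Sum>e\<in>Basis. (v x <.> e) *R D x e)" for x
  using assms(2)[of x] by (subst euclidean_representation[symmetric, of "v x"]) (simp only: linear_sum linear_scale)
 then show ?thesis using assms by (auto intro!: continuous_intros)
qed

definition Dvfield :: "real => (real => R3 => R3 => R3) => real => phase => phase => phase"
 where "Dvfield l DB t z h = (- (exp (- max t 0) *R snd h), - (l *R DB (max t 0) (fst z) (fst h)))"

text \<open>The transposed Jacobian of the backward flow, applied to \<open>g\<close> at the initial
  point of the trajectory.\<close>

definition pgrad :: "real => (real => R3 => R3) => (real => R3 => R3 => R3) => (phase => phase) => real => phase => phase"
 where "pgrad l B DB g t z = (\<Sum>e\<in>Basis. (g (flow (vfield l B) t 0 z) <.> Dflow (vfield l B) (Dvfield l DB) t 0 z e) *R e)"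

context
 fixes l M :: real and B :: "real => R3 => R3" and DB :: "real => R3 => R3 => R3"
 assumes l: "\<bar>l\<bar> = 1" and B: "okfield M B"
  and dB: "!!t q. 0 <= t ==> (B t has_derivative DB t q) (at q)"
  and cDB: "!!h. continuous_on ({0..} \<times> UNIV) (%(t, q). DB t q h)"
begin

lemma vfield_deriv: "(vfield l B t has_derivative Dvfield l DB t z) (at z)"
 unfolding vfield_def[abs_def] Dvfield_def[abs_def]
proof (intro has_derivative_Pair has_derivative_minus has_derivative_scaleR_right)
 show "(snd has_derivative snd) (at z)" by (rule bounded_linear_imp_has_derivative[OF bounded_linear_snd])
 have "(fst has_derivative fst) (at z)" by (rule bounded_linear_imp_has_derivative[OF bounded_linear_fst])
 then show "((%z. B (max t 0) (fst z)) has_derivative (%h. DB (max t 0) (fst z) (fst h))) (at z)"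
  by (rule has_derivative_compose) (rule dB, simp)
qed

lemma Dvfield_continuous: "continuous_on UNIV (%(t, z). Dvfield l DB t z h)"
 unfolding Dvfield_def case_prod_unfold
 by (intro continuous_intros continuous_on_clamp[where f="%t q. DB t q (fst h)", OF cDB])

lemma Dflow_linear: "linear (Dflow (vfield l B) (Dvfield l DB) s t z)"
 by (rule has_derivative_linear[OF Dflow(1)[OF vfield_lip[OF l B] vfield_deriv Dvfield_continuous]])

lemma pull_weak_gradient:
 assumes wg: "weak_gradient_on UNIV f g"
 shows "weak_gradient_on UNIV (pull l f B t) (pgrad l B DB g t)"
  and "g : bmeas ==> pgrad l B DB g t : bmeas"
  and "(!!z z'. norm (flow (vfield l B) t 0 z - flow (vfield l B) t 0 z') <= Lam * norm (z - z')) ==> Lam >= 0 ==>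
   norm (pgrad l B DB g t z) <= Lam * norm (g (flow (vfield l B) t 0 z))"
proof -
 have cD: "continuous_on UNIV (%x. Dflow (vfield l B) (Dvfield l DB) t 0 x h)" for h
  by (intro Dflow_continuous_on[OF vfield_lip[OF l B] vfield_deriv Dvfield_continuous] continuous_intros)
 show "pgrad l B DB g t : bmeas" if [measurable]: "g : bmeas"
 proof -
  note [measurable] = mpres_measurable[OF vfield_mpres[OF l B]] borel_measurable_continuous_onI[OF cD]
  show ?thesis unfolding pgrad_def[abs_def] by measurable
 qed
 show "weak_gradient_on UNIV (pull l f B t) (pgrad l B DB g t)"
  unfolding pull_def pgrad_def
 proof (rule weak_gradient_compose[OF wg])
  show "(flow (vfield l B) t 0 has_derivative Dflow (vfield l B) (Dvfield l DB) t 0 x) (at x)" for x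
   by (rule Dflow(1)[OF vfield_lip[OF l B] vfield_deriv Dvfield_continuous])
  show "continuous_on UNIV (%x. Dflow (vfield l B) (Dvfield l DB) t 0 x h)" for h by (rule cD)
  show "\<exists>C. \<forall>h. h : bmeas --> (NNI x. indicator K x * h (flow (vfield l B) t 0 x)) <= ennreal C * (NNI y. h y)" for K
  proof (intro exI[of _ 1] allI impI)
   fix h :: "phase => ennreal" assume h: "h : bmeas"
   have "(NNI x. indicator K x * h (flow (vfield l B) t 0 x)) <= (NNI x. h (flow (vfield l B) t 0 x))"
    by (intro nn_integral_mono) (auto simp: indicator_def)
   then show "(NNI x. indicator K x * h (flow (vfield l B) t 0 x)) <= ennreal 1 * (NNI y. h y)"
    by (simp add: mpres_nn_integral[OF vfield_mpres[OF l B] h])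
  qed
 qed auto
 assume lip: "!!z z'. norm (flow (vfield l B) t 0 z - flow (vfield l B) t 0 z') <= Lam * norm (z - z')" and Lam: "Lam >= 0"
 show "norm (pgrad l B DB g t z) <= Lam * norm (g (flow (vfield l B) t 0 z))"
  unfolding pgrad_def
  by (intro adjoint_sum_norm Dflow_linear Lipschitz_derivative_bound[OF Dflow(1)[OF vfield_lip[OF l B] vfield_deriv Dvfield_continuous]] lip Lam)
qed

lemma log_flow_measurable [measurable]: "(%x. flow (vfield l B) 0 (- ln (fst x)) (snd x)) : borel_measurable (borel :: (real \<times> phase) measure)"
 "(%x. flow (vfield l B) (- ln (fst x)) 0 (snd x)) : borel_measurable (borel :: (real \<times> phase) measure)"
proof -
 have 1: "(%y::real \<times> phase. flow (vfield l B) 0 (fst y) (snd y)) : bmeas"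
  "(%y::real \<times> phase. flow (vfield l B) (fst y) 0 (snd y)) : bmeas"
  by (intro borel_measurable_continuous_onI flow_continuous_on[OF vfield_lip[OF l B]] continuous_intros)+
 have 2: "(%x::real \<times> phase. (- ln (fst x), snd x)) : bmeas"
  by (intro borel_measurable_Pair borel_measurable_uminus borel_measurable_ln) (auto intro!: borel_measurable_continuous_onI continuous_intros)
 from measurable_compose[OF 2 1(1)] measurable_compose[OF 2 1(2)]
 show "(%x. flow (vfield l B) 0 (- ln (fst x)) (snd x)) : borel_measurable (borel :: (real \<times> phase) measure)"
  "(%x. flow (vfield l B) (- ln (fst x)) 0 (snd x)) : borel_measurable (borel :: (real \<times> phase) measure)" by simp_all
qed

text \<open>The flow preserves the measure for each real time, so Fubini applies on every fibre,
  whatever value \<open>ln\<close> takes at nonpositive arguments.\<close>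

lemma log_flow_mpres: "mpres (%x. (fst x, flow (vfield l B) 0 (- ln (fst x)) (snd x)))"
proof (rule mpresI_nn_integral)
 show T: "(%x. (fst x, flow (vfield l B) 0 (- ln (fst x)) (snd x))) : borel_measurable (borel :: (real \<times> phase) measure)"
  by (intro borel_measurable_Pair log_flow_measurable) (auto intro!: borel_measurable_continuous_onI continuous_intros)
 fix h :: "real \<times> phase => ennreal" assume h: "h : bmeas"
 have hs: "(%y. h (s, y)) : bmeas" for s
  by (rule measurable_compose[OF _ h]) (auto intro!: borel_measurable_continuous_onI continuous_intros)
 have "(NNI x. h (fst x, flow (vfield l B) 0 (- ln (fst x)) (snd x))) =
   (NNI s. NNI y. h (s, flow (vfield l B) 0 (- ln s) y))"
  by (subst nn_integral_lborel_pair(1)) (auto intro: measurable_compose[OF T h])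
 also have "... = (NNI s. NNI y. h (s, y))"
  by (simp add: mpres_nn_integral[OF vfield_mpres[OF l B] hs])
 also have "... = (NNI x. h x)" by (rule nn_integral_lborel_pair(1)[OF h, symmetric])
 finally show "(NNI x. h (fst x, flow (vfield l B) 0 (- ln (fst x)) (snd x))) = (NNI x. h x)" .
qed

text \<open>The map to the initial point loses the time dimension; the bound persists because the
  time interval has length 1. It provides the hypothesis \<open>push\<close> of the chain
  rule.\<close>

lemma log_pull_integral:
 assumes h: "h : bmeas"
 shows "(NNI x. indicator ({0<..<1} \<times> UNIV) x * h (flow (vfield l B) (- ln (fst x)) 0 (snd x))) <= (NNI y. h y)"
proof -
 have "(NNI x. indicator ({0<..<1} \<times> UNIV) x * h (flow (vfield l B) (- ln (fst x)) 0 (snd x))) =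
   (NNI s. NNI y. indicator {0<..<1::real} s * h (flow (vfield l B) (- ln s) 0 y))"
 proof (subst nn_integral_lborel_pair(1))
  have [measurable]: "({0<..<1::real} \<times> (UNIV :: phase set)) : sets borel" by (intro borel_open open_Times) auto
  have [measurable]: "(%x. h (flow (vfield l B) (- ln (fst x)) 0 (snd x))) : bmeas" by (rule measurable_compose[OF log_flow_measurable(2) h])
  show "(%x. indicator ({0<..<1} \<times> UNIV) x * h (flow (vfield l B) (- ln (fst x)) 0 (snd x))) : bmeas"
   by measurable
 qed (simp add: indicator_times)
 also have "... = (NNI s. indicator {0<..<1::real} s * (NNI y. h y))"
  by (intro nn_integral_cong) (simp add: nn_integral_cmult measurable_compose[OF mpres_measurable[OF vfield_mpres[OF l B]] h] mpres_nn_integral[OF vfield_mpres[OF l B] h])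
 also have "... = (NNI y. h y)" by (simp add: nn_integral_multc)
 finally show ?thesis by simp
qed

lemma vfield_log: "0 < s ==> s < 1 ==> vfield l B (- ln s) (q, p) = (- (s *R p), - (l *R B (- ln s) q))"
 by (simp add: vfield_def max_def)

text \<open>The derivative of the map to the initial point annihilates the direction
  \<open>(1, p, (l / s) *R B)\<close> of the characteristic. The gradient of the pull-back is the
  transpose of that derivative, so the equation holds at every point.\<close>

lemma pull_spacetime_gradient:
 assumes wg: "weak_gradient_on UNIV f g"
 shows "\<exists>G. weak_gradient_on ({0<..<1} \<times> UNIV) (%(s, z). pull l f B (- ln s) z) G &
  (\<forall>s q p. 0 < s --> s < 1 --> (case G (s, q, p) of (Gs, Gq, Gp) => Gs + p <.> Gq + (l / s) * (B (- ln s) q <.> Gp) = 0))"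
proof -
 note D = vfield_lip[OF l B] vfield_deriv Dvfield_continuous
 let ?F = "vfield l B"
 define Psi where "Psi x = flow ?F (- ln (fst x)) 0 (snd x)" for x :: "real \<times> phase"
 define DPsi where "DPsi x h = Dflow ?F (Dvfield l DB) (- ln (fst x)) 0 (snd x) (snd h + (fst h / fst x) *R ?F (- ln (fst x)) (snd x))"
  for x h :: "real \<times> phase"
 let ?U = "{0<..<1::real} \<times> (UNIV :: phase set)"
 define G where "G x = (\<Sum>e\<in>Basis. (g (Psi x) <.> DPsi x e) *R e)" for x
 have dPsi: "(Psi has_derivative DPsi x) (at x)" if "x : ?U" for x
 proof -
  have x: "fst x > 0" using that by auto
  have "((%x. (- ln (fst x), snd x)) has_derivative (%h. (- (fst h / fst x), snd h))) (at x)"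
   using x by (auto intro!: derivative_eq_intros simp: divide_inverse)
  from has_derivative_compose[OF this flow_deriv_start(1)[OF D, of 0 "- ln (fst x)" "snd x"]]
  have "((%x. flow ?F (- ln (fst x)) 0 (snd x)) has_derivative (%h. Dflow ?F (Dvfield l DB) (- ln (fst x)) 0 (snd x) (snd h - (- (fst h / fst x)) *R ?F (- ln (fst x)) (snd x)))) (at x)"
   by (simp only: prod.case)
  then show ?thesis unfolding Psi_def[abs_def] DPsi_def[abs_def] by simp
 qed
 have "weak_gradient_on ?U (%x. f (Psi x)) G"
  unfolding G_def
 proof (rule weak_gradient_compose[OF wg _ _ dPsi])
  show "continuous_on ?U (%x. DPsi x h)" for h
   unfolding DPsi_def
  proof (rule continuous_on_linear_family[where D="%x. Dflow ?F (Dvfield l DB) (- ln (fst x)) 0 (snd x)"])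
   show "continuous_on ?U (%x. Dflow ?F (Dvfield l DB) (- ln (fst x)) 0 (snd x) e)" for e
    by (intro Dflow_continuous_on[OF D] continuous_intros) auto
   show "continuous_on ?U (%x. snd h + (fst h / fst x) *R ?F (- ln (fst x)) (snd x))"
    by (intro continuous_intros lip_fieldD(3)[OF D(1)]) auto
  qed (rule Dflow_linear)
  fix K assume K: "compact K" "K <= ?U"
  show "\<exists>C. \<forall>h. h : bmeas --> (NNI x. indicator K x * h (Psi x)) <= ennreal C * (NNI y. h y)"
  proof (intro exI[of _ 1] allI impI)
   fix h :: "phase => ennreal" assume h: "h : bmeas"
   have "(NNI x. indicator K x * h (Psi x)) <= (NNI x. indicator ?U x * h (Psi x))"
    using K by (intro nn_integral_mono mult_right_mono) (auto simp: indicator_def)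
   then show "(NNI x. indicator K x * h (Psi x)) <= ennreal 1 * (NNI y. h y)"
    using log_pull_integral[OF h] unfolding Psi_def by simp
  qed
 qed (auto intro!: open_Times)
 then have "weak_gradient_on ?U (%(s, z). pull l f B (- ln s) z) G"
  by (simp add: Psi_def pull_def case_prod_unfold)
 moreover have "case G (s, q, p) of (Gs, Gq, Gp) => Gs + p <.> Gq + (l / s) * (B (- ln s) q <.> Gp) = 0"
  if s: "0 < s" "s < 1" for s q p
 proof -
  let ?x = "(s, q, p)"
  obtain Gs Gq Gp where G: "G ?x = (Gs, Gq, Gp)" by (metis prod.exhaust)
  have "?x : ?U" using s by auto
  note lin = has_derivative_linear[OF dPsi[OF this]]
  have "DPsi ?x (1, p, (l / s) *R B (- ln s) q) = 0"
   unfolding DPsi_def using s linear_0[OF Dflow_linear] by (simp add: vfield_log zero_prod_def[symmetric])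
  then have "G ?x <.> (1, p, (l / s) *R B (- ln s) q) = 0"
   unfolding G_def by (simp add: adjoint_sum_inner[OF lin])
  then show ?thesis by (simp add: G inner_commute)
 qed
 ultimately show ?thesis by (intro exI[of _ G] conjI allI impI)
qed

text \<open>The map \<open>Th\<close> straightens the characteristics. After composition with it the
  equation says that the weak gradient is orthogonal to the time direction, and continuity yields
  constancy for every label \<open>y\<close>, not just almost every one. Restricting to
  \<open>s > a\<close> admits a field \<open>B\<close> that agrees with the field of the solution
  only there.\<close>

lemma constant_along_flow:
 assumes wg: "weak_gradient_on ({0<..<1} \<times> UNIV) (%(s, z). gam s z) G"
  and eq: "AE (s, q, p) in lborel. 0 < s & s < 1 --> (case G (s, q, p) of (Gs, Gq, Gp) => Gs + p <.> Gq + (l / s) * (E s q <.> Gp) = 0)"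
  and a: "0 < a" and E: "!!s q. a < s ==> s < 1 ==> E s q = B (- ln s) q"
  and c: "continuous_on ({0<..1} \<times> UNIV) (%(s, z). gam s z)"
  and s: "a < s" "s < 1" "a < s'" "s' < 1"
 shows "gam s (flow (vfield l B) 0 (- ln s) y) = gam s' (flow (vfield l B) 0 (- ln s') y)"
proof -
 note D = vfield_lip[OF l B] vfield_deriv Dvfield_continuous
 let ?F = "vfield l B" and ?U = "{a<..<1::real} \<times> (UNIV :: phase set)" and ?V = "{0<..<1::real} \<times> (UNIV :: phase set)"
 define Th where "Th x = (fst x, flow ?F 0 (- ln (fst x)) (snd x))" for x :: "real \<times> phase"
 define DTh where "DTh x h = (fst h, Dflow ?F (Dvfield l DB) 0 (- ln (fst x)) (snd x) (snd h) - (fst h / fst x) *R ?F (- ln (fst x)) (flow ?F 0 (- ln (fst x)) (snd x)))"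
  for x h :: "real \<times> phase"
 have dTh: "(Th has_derivative DTh x) (at x)" if "x : ?U" for x
 proof -
  have x: "fst x > 0" using that a by auto
  have "((%x. (- ln (fst x), snd x)) has_derivative (%h. (- (fst h / fst x), snd h))) (at x)"
   using x by (auto intro!: derivative_eq_intros simp: divide_inverse)
  from has_derivative_compose[OF this flow_deriv_start(2)[OF D, of 0 "- ln (fst x)" "snd x"]]
  have "((%x. flow ?F 0 (- ln (fst x)) (snd x)) has_derivative (%h. Dflow ?F (Dvfield l DB) 0 (- ln (fst x)) (snd x) (snd h) + (- (fst h / fst x)) *R ?F (- ln (fst x)) (flow ?F 0 (- ln (fst x)) (snd x)))) (at x)"
   by (simp only: prod.case)
  then show ?thesis unfolding Th_def[abs_def] DTh_def[abs_def]
   by (intro has_derivative_Pair) (auto intro: bounded_linear_imp_has_derivative bounded_linear_fst)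
 qed
 have m: "mpres Th" unfolding Th_def[abs_def] by (rule log_flow_mpres)
 have UV: "Th ` ?U <= ?V" using a by (auto simp: Th_def)
 have wg': "weak_gradient_on ?U (%x. case Th x of (s, z) => gam s z) (%x. \<Sum>e\<in>Basis. (G (Th x) <.> DTh x e) *R e)"
 proof (rule weak_gradient_compose[OF wg _ _ dTh _ UV])
  show "continuous_on ?U (%x. DTh x h)" for h
   unfolding DTh_def using a
   by (intro continuous_intros Dflow_continuous_on[OF D] lip_fieldD(3)[OF D(1)] flow_continuous_on[OF D(1)]) auto
  show "\<exists>C. \<forall>h. h : bmeas --> (NNI x. indicator K x * h (Th x)) <= ennreal C * (NNI y. h y)" for K
  proof (intro exI[of _ 1] allI impI)
   fix h :: "real \<times> phase => ennreal" assume h: "h : bmeas"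
   have "(NNI x. indicator K x * h (Th x)) <= (NNI x. h (Th x))"
    by (intro nn_integral_mono) (auto simp: indicator_def)
   then show "(NNI x. indicator K x * h (Th x)) <= ennreal 1 * (NNI y. h y)"
    by (simp add: mpres_nn_integral[OF m h])
  qed
 qed (auto intro!: open_Times)
 have zero: "AE x in lborel. x : ?U --> (\<Sum>e\<in>Basis. (G (Th x) <.> DTh x e) *R e) <.> ((s', y) - (s, y)) = 0"
  using mpres_AE[OF m eq]
 proof eventually_elim
  case (elim x)
  show ?case
  proof
   assume x: "x : ?U"
   note lin = has_derivative_linear[OF dTh[OF x]]
   obtain q p where qp: "flow ?F 0 (- ln (fst x)) (snd x) = (q, p)" by fastforce
   obtain Gs Gq Gp where G: "G (Th x) = (Gs, Gq, Gp)" by (metis prod.exhaust)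
   have xs: "a < fst x" "0 < fst x" "fst x < 1" using x a by auto
   have "Gs + p <.> Gq + (l / fst x) * (B (- ln (fst x)) q <.> Gp) = 0"
    using elim xs G by (simp add: Th_def qp E)
   moreover have "DTh x (1, 0) = (1, p, (l / fst x) *R B (- ln (fst x)) q)"
    unfolding DTh_def using linear_0[OF Dflow_linear] xs by (simp add: qp vfield_log)
   ultimately have "G (Th x) <.> DTh x (1, 0) = 0" by (simp add: G inner_commute)
   moreover have "(s', y) - (s, y) = (s' - s) *R (1, 0)" by simp
   ultimately show "(\<Sum>e\<in>Basis. (G (Th x) <.> DTh x e) *R e) <.> ((s', y) - (s, y)) = 0"
    by (simp only: inner_scaleR_right adjoint_sum_inner[OF lin] mult_zero_right)
  qed
 qed
 have "(case Th (s', y) of (s, z) => gam s z) = (case Th (s, y) of (s, z) => gam s z)"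
 proof (rule weak_gradient_zero_const[OF wg' _ _ zero])
  show "continuous_on ?U (%x. case Th x of (s, z) => gam s z)"
  proof (rule continuous_on_compose2[OF c])
   show "continuous_on ?U Th" using dTh has_derivative_continuous continuous_at_imp_continuous_on by blast
  qed (use UV in auto)
  show "closed_segment (s, y) (s', y) <= ?U"
   using s by (intro closed_segment_subset) (auto intro!: convex_Times)
 qed (auto intro!: open_Times)
 then show ?thesis by (simp add: Th_def)
qed

end

section \<open>Norms, solutions and uniqueness\<close>

lemma Linf_normI:
 assumes "f : bmeas" "AE x in lborel. norm (f x) <= M"
 shows "Linf_norm f <= ereal M"
 using assms by (auto simp: Linf_norm_def intro!: esssup_I)

lemma Linf_normD:
 assumes "Linf_norm f <= ereal M"
 shows "f : bmeas" "AE x in lborel. norm (f x) <= M"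
proof -
 have f: "f : borel_measurable lborel" using assms by (auto simp: Linf_norm_def split: if_splits)
 then show "f : bmeas" by simp
 have e: "esssup lborel (%x. ereal (norm (f x))) <= ereal M" using assms f by (simp add: Linf_norm_def)
 show "AE x in lborel. norm (f x) <= M"
  using esssup_AE[of "%x. ereal (norm (f x))" lborel]
 proof eventually_elim
  case (elim x)
  then have "ereal (norm (f x)) <= ereal M" using e by (rule order_trans)
  then show ?case by simp
 qed
qed

lemma Linf_norm_nonneg: "0 <= Linf_norm (f :: 'a::euclidean_space => 'b::real_normed_vector)"
proof (cases "f : borel_measurable lborel")
 case True
 then have "esssup lborel (%x::'a. 0 :: ereal) <= esssup lborel (%x. ereal (norm (f x)))"
  by (intro esssup_AE_mono) auto
 moreover have "esssup lborel (%x::'a. 0 :: ereal) = 0" by (intro esssup_const) simp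
 ultimately show ?thesis using True by (simp add: Linf_norm_def)
qed (simp add: Linf_norm_def)

lemma L2_normD:
 assumes "L2_norm f <= ereal M"
 shows "f : bmeas" "integrable lborel (%x. (f x)^2)" "(LI x. (f x)^2) <= M^2" "0 <= M"
proof -
 have m: "f : borel_measurable lborel & integrable lborel (%x. (f x)^2)"
  using assms unfolding L2_norm_def by (auto split: if_splits)
 then show "f : bmeas" "integrable lborel (%x. (f x)^2)" by auto
 have s: "sqrt (LI x. (f x)^2) <= M" using assms m by (simp add: L2_norm_def)
 have n: "0 <= (LI x. (f x)^2)" by (intro Bochner_Integration.integral_nonneg) simp
 then show "0 <= M" using s order_trans[OF real_sqrt_ge_zero] by blast
 show "(LI x. (f x)^2) <= M^2" by (rule sqrt_le_D[OF s])
qed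

lemma L2_norm_nonneg: "0 <= L2_norm f"
 unfolding L2_norm_def by (auto intro!: Bochner_Integration.integral_nonneg)

lemma L2_normI:
 assumes "f : bmeas" "integrable lborel (%x. (f x)^2)" "(LI x. (f x)^2) <= M^2" "0 <= M"
 shows "L2_norm f <= ereal M"
 using assms real_le_lsqrt[of M "LI x. (f x)^2"] by (auto simp: L2_norm_def intro!: real_le_lsqrt)

lemma ereal_sum3_le:
 fixes a b c :: ereal
 assumes "a + b + c <= ereal e" "0 <= a" "0 <= b" "0 <= c"
 shows "a <= ereal e" "b <= ereal e" "c <= ereal e"
proof -
 have "a <= a + b + c" "b <= a + b + c" "c <= a + b + c" using assms(2-4) by (auto intro: add_increasing add_increasing2)
 then show "a <= ereal e" "b <= ereal e" "c <= ereal e" using assms(1) order_trans by blast+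
qed

lemma continuous_AE_bound:
 fixes f :: "'a::euclidean_space => real"
 assumes c: "continuous_on UNIV f" and b: "AE x in lborel. f x <= M"
 shows "f x <= M"
proof -
 have "(%x. min (f x) M) = f"
  by (rule lborel_continuous_AE_eq) (use b in \<open>auto intro!: continuous_intros c elim!: eventually_mono\<close>)
 then show ?thesis by (metis min.cobounded2)
qed

lemma bracket_sq: "\<langle>x\<rangle>^2 = 1 + (norm x)^2" "1 <= \<langle>x\<rangle>"
 by (auto simp: japanese_bracket_def)

lemma continuous_weighted_bound:
 fixes f :: "phase => real"
 assumes c: "continuous_on UNIV f" and b: "AE z in lborel. norm (\<langle>snd z\<rangle>^2 * f z) <= M"
 shows "\<bar>f (q, p)\<bar> <= M / (1 + (norm p)^2)"
proof -
 have pos: "0 < 1 + (norm p)^2" by (simp add: add_pos_nonneg)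
 have "(1 + (norm (snd (q, p)))^2) * \<bar>f (q, p)\<bar> <= M"
  by (rule continuous_AE_bound[where f="%z. (1 + (norm (snd z))^2) * \<bar>f z\<bar>"])
   (use b in \<open>auto intro!: continuous_intros c simp: bracket_sq abs_mult\<close>)
 then show ?thesis using pos by (simp add: field_simps)
qed

lemma weak_gradient_on_AE_cong:
 fixes f f' :: "'a::euclidean_space => real"
 assumes wg: "weak_gradient_on UNIV f g" and eq: "AE x in lborel. f x = f' x"
  and m: "f : bmeas" "f' : bmeas"
 shows "weak_gradient_on UNIV f' g"
 unfolding weak_gradient_on_def
proof (intro conjI allI impI)
 show "locally_integrable_on UNIV f'"
  unfolding locally_integrable_on_def
 proof (intro allI impI)
  fix K :: "'a set" assume K: "compact K & K <= UNIV"
  then have [measurable]: "K : sets borel" by (simp add: borel_compact)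
  note [measurable] = m
  have "integrable lborel (%x. indicator K x *R f x)"
   using wg K unfolding weak_gradient_on_def locally_integrable_on_def set_integrable_def by blast
  then have "integrable lborel (%x. indicator K x *R f' x)"
   by (subst integrable_cong_AE[where g="%x. indicator K x *R f x"]) (use eq in auto)
  then show "set_integrable lborel K f'" by (simp add: set_integrable_def)
 qed
 show "locally_integrable_on UNIV g" using wg by (simp add: weak_gradient_on_def)
 fix phi :: "'a => real" and D :: "'a => 'a" assume D: "(\<forall>x. GDERIV phi x :> D x) & continuous_on UNIV D &
  compact (closure (support_on UNIV phi)) & closure (support_on UNIV phi) <= UNIV"
 then have [measurable]: "D : bmeas" by (intro borel_measurable_continuous_onI) auto
 note [measurable] = m
 have "(LINT x:UNIV|lborel. f' x *R D x) = (LINT x:UNIV|lborel. f x *R D x)"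
  unfolding set_lebesgue_integral_def by (rule integral_cong_AE) (use eq in auto)
 then show "(LINT x:UNIV|lborel. f' x *R D x) = - (LINT x:UNIV|lborel. phi x *R g x)"
  using wg D unfolding weak_gradient_on_def by auto
qed

text \<open>The data are given up to null sets. The bounded weak gradient provides a Lipschitz
  representative, for which the weighted bound holds at every point by continuity.\<close>

lemma datum_of_data:
 assumes wg: "weak_gradient_on UNIV gam g" and b: "L2_norm gam + Linf_norm (%(q, p). \<langle>p\<rangle>^2 * gam (q, p)) + Linf_norm g <= ereal eps"
 obtains f where "datum eps f" "AE z in lborel. gam z = f z" "weak_gradient_on UNIV f g" "g : bmeas" "AE z in lborel. norm (g z) <= eps" "0 <= eps"
proof -
 have 1: "L2_norm gam <= ereal eps" and 2: "Linf_norm (%(q, p). \<langle>p\<rangle>^2 * gam (q, p)) <= ereal eps" and 3: "Linf_norm g <= ereal eps"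
  using ereal_sum3_le[OF b L2_norm_nonneg Linf_norm_nonneg Linf_norm_nonneg] by auto
 note l2 = L2_normD[OF 1] and gb = Linf_normD[OF 3]
 obtain f where f: "eps-lipschitz_on UNIV f" "AE z in lborel. gam z = f z" using weak_gradient_lipschitz[OF wg gb(2) l2(4)] by blast
 have cf: "continuous_on UNIV f" using f(1) by (rule lipschitz_on_continuous_on)
 have [measurable]: "f : bmeas" "gam : bmeas" using cf l2(1) by (auto intro: borel_measurable_continuous_onI)
 have "AE z in lborel. norm (\<langle>snd z\<rangle>^2 * f z) <= eps"
  using Linf_normD(2)[OF 2] f(2) by eventually_elim (auto simp: case_prod_unfold)
 then have "\<bar>f (q, p)\<bar> <= eps / (1 + (norm p)^2)" for q p by (rule continuous_weighted_bound[OF cf])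
 moreover have "\<bar>f z - f z'\<bar> <= eps * norm (z - z')" for z z' using lipschitz_onD[OF f(1), of z z'] by (simp add: dist_norm)
 moreover have "integrable lborel (%z. (f z)^2) \<longleftrightarrow> integrable lborel (%z. (gam z)^2)"
  by (rule integrable_cong_AE) (use f(2) in auto)
 moreover have "(LI z. (f z)^2) = (LI z. (gam z)^2)" by (rule integral_cong_AE) (use f(2) in auto)
 ultimately have "datum eps f" using l2 by (simp add: datum_def)
 moreover have "weak_gradient_on UNIV f g" by (rule weak_gradient_on_AE_cong[OF wg f(2)]) auto
 ultimately show ?thesis using that f(2) gb l2(4) by blast
qed

lemma ln_bracket:
 assumes "0 < s" "s <= 1"
 shows "0 <= - ln s" "(1 - ln s)^2 <= 2 * \<langle>ln s\<rangle>^2" "1 - ln s <= 2 * \<langle>ln s\<rangle>"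
proof -
 show t: "0 <= - ln s" using assms by simp
 define x where "x = - ln s"
 have x: "x >= 0" "\<langle>ln s\<rangle>^2 = 1 + x^2" using t by (auto simp: x_def bracket_sq)
 have "(1 + x)^2 <= 2 * (1 + x^2)" using sum_squares_bound[of 1 x] by (simp add: power2_sum)
 then show *: "(1 - ln s)^2 <= 2 * \<langle>ln s\<rangle>^2" by (simp add: x x_def)
 also have "... <= (2 * \<langle>ln s\<rangle>)^2" by (simp add: power_mult_distrib)
 finally show "1 - ln s <= 2 * \<langle>ln s\<rangle>" by (rule power2_le_imp_le) (use bracket_sq(2)[of "ln s"] in simp)
qed

section \<open>Bounds, gradient and uniqueness for the transported datum\<close>

context
 fixes l eps :: real and f :: "phase => real" and B :: "real => R3 => R3"
 assumes l: "\<bar>l\<bar> = 1" and f: "datum eps f" and B: "okfield 1 B" and BT: "\<forall>t\<ge>0. \<forall>q. B t q = Tfield l f B t q"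
begin

lemma fixed_field_deriv: "0 <= t ==> (B t has_derivative DE (pull l f B t) q) (at q)"
 and fixed_field_deriv_continuous: "continuous_on ({0..} \<times> UNIV) (%(t, q). DE (pull l f B t) q h)"
proof -
 show "continuous_on ({0..} \<times> UNIV) (%(t, q). DE (pull l f B t) q h)" by (rule Tfield_continuous(2)[OF l B f])
 assume t: "0 <= t"
 have "B t = E_field (pull l f B t)" using BT t by (auto simp: Tfield_def)
 then show "(B t has_derivative DE (pull l f B t) q) (at q)"
  using E_field_static(3)[OF adm_pull_global[OF l B f t order_refl]] by simp
qed

lemma sc_bounds:
 assumes s: "0 < s" "s <= 1"
 shows "Linf_norm (pull l f B (- ln s)) <= ereal eps" "L2_norm (pull l f B (- ln s)) <= ereal eps"
  "Linf_norm (%(q, p). \<langle>p\<rangle>^2 * pull l f B (- ln s) (q, p)) <= ereal (4 * eps * \<langle>ln s\<rangle>^2)"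
proof -
 have e: "eps >= 0" using f by (simp add: datum_def)
 note m = pull_square_integral[OF l B f, of "- ln s"]
 show "L2_norm (pull l f B (- ln s)) <= ereal eps" using m f e by (intro L2_normI) (auto simp: datum_def)
 have "\<bar>f (q, p)\<bar> <= eps" for q p
 proof -
  have "\<bar>f (q, p)\<bar> <= eps / (1 + (norm p)^2)" using f by (simp add: datum_def)
  also have "... <= eps" using e by (simp add: divide_le_eq add_pos_nonneg algebra_simps)
  finally show ?thesis .
 qed
 then have "\<bar>pull l f B (- ln s) z\<bar> <= eps" for z unfolding pull_def by (metis surj_pair)
 then show "Linf_norm (pull l f B (- ln s)) <= ereal eps" using m by (intro Linf_normI) auto
 have [measurable]: "pull l f B (- ln s) : bmeas" by (rule m)
 have [measurable]: "(%z::phase. norm (snd z)) : bmeas" by (intro borel_measurable_continuous_onI continuous_intros)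
 show "Linf_norm (%(q, p). \<langle>p\<rangle>^2 * pull l f B (- ln s) (q, p)) <= ereal (4 * eps * \<langle>ln s\<rangle>^2)"
 proof (rule Linf_normI)
  show "(%(q, p). \<langle>p\<rangle>^2 * pull l f B (- ln s) (q, p)) : bmeas"
   unfolding bracket_sq case_prod_unfold prod.collapse by measurable
  have "(1 + (norm p)^2) * \<bar>pull l f B (- ln s) (q, p)\<bar> <= 4 * eps * \<langle>ln s\<rangle>^2" for q p
  proof -
   have "\<bar>pull l f B (- ln s) (q, p)\<bar> <= eps * (2 * (1 + 1 * - ln s)^2) / (1 + (norm p)^2)"
    by (rule pull_decay[OF l B f ln_bracket(1)[OF s]])
   then have "(1 + (norm p)^2) * \<bar>pull l f B (- ln s) (q, p)\<bar> <= eps * (2 * (1 - ln s)^2)"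
    by (simp add: pos_le_divide_eq add_pos_nonneg mult.commute)
   also have "... <= eps * (2 * (2 * \<langle>ln s\<rangle>^2))" using e ln_bracket(2)[OF s] by (intro mult_left_mono) auto
   finally show ?thesis by simp
  qed
  then show "AE z in lborel. norm (case z of (q, p) => \<langle>p\<rangle>^2 * pull l f B (- ln s) (q, p)) <= 4 * eps * \<langle>ln s\<rangle>^2"
   by (intro AE_I2) (auto simp: bracket_sq abs_mult)
 qed
qed

text \<open>Polynomial growth of the flow yields the powers 2 and 3 of the bracket, better than the
  powers 5 and 6 of the theorem. The weighted bound loses one further power because momenta drift by
  at most \<open>- ln s\<close>.\<close>

lemma sc_gradient:
 assumes s: "0 < s" "s <= 1" and wg: "weak_gradient_on UNIV f g" and gm: "g : bmeas" and gb: "AE z in lborel. norm (g z) <= eps"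
 defines "g' == pgrad l B (%t. DE (pull l f B t)) g (- ln s)"
 shows "weak_gradient_on UNIV (pull l f B (- ln s)) g'" "Linf_norm g' <= ereal (2 * exp 129 * eps * \<langle>ln s\<rangle>^2)"
  "AE z in lborel. norm (\<langle>snd z\<rangle> *R g z) <= eps ==> Linf_norm (%(q, p). \<langle>p\<rangle> *R g' (q, p)) <= ereal (8 * exp 129 * eps * \<langle>ln s\<rangle> ^ 3)"
proof -
 let ?tau = "- ln s"
 let ?w = "flow (vfield l B) ?tau 0"
 note tau = ln_bracket(1)[OF s]
 have e: "eps >= 0" using f by (simp add: datum_def)
 note P = pull_weak_gradient[OF l B fixed_field_deriv fixed_field_deriv_continuous wg, of ?tau]
 show "weak_gradient_on UNIV (pull l f B (- ln s)) g'" unfolding g'_def by (rule P(1))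
 have m[measurable]: "g' : bmeas" unfolding g'_def by (rule P(2)[OF _ gm])
 let ?L = "exp 129 * (1 + ?tau)^2"
 have pt: "norm (g' z) <= ?L * norm (g (?w z))" for z
  unfolding g'_def by (rule P(3)[OF _ flow_vfield_lipschitz[OF l B tau]]) simp_all
 have Lb: "?L <= 2 * exp 129 * \<langle>ln s\<rangle>^2" using ln_bracket(2)[OF s] by simp
 have "AE z in lborel. norm (g' z) <= 2 * exp 129 * eps * \<langle>ln s\<rangle>^2"
  using mpres_AE[OF vfield_mpres[OF l B, of ?tau 0] gb]
 proof eventually_elim
  case (elim z)
  have "norm (g' z) <= (2 * exp 129 * \<langle>ln s\<rangle>^2) * eps" by (rule order_trans[OF pt mult_mono[OF Lb elim]]) auto
  then show ?case by (simp add: mult_ac)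
 qed
 then show "Linf_norm g' <= ereal (2 * exp 129 * eps * \<langle>ln s\<rangle>^2)" by (rule Linf_normI[OF m])
 assume wb: "AE z in lborel. norm (\<langle>snd z\<rangle> *R g z) <= eps"
 have bs: "\<langle>snd z\<rangle> <= 4 * \<langle>ln s\<rangle> * \<langle>snd (?w z)\<rangle>" for z
 proof -
  have "norm (snd z - snd (?w z)) <= ?tau" using momentum_drift[OF l B, of ?tau 0 z] tau by (simp add: norm_minus_commute)
  then have "(1 + norm (snd z - snd (?w z)))^2 <= (2 * \<langle>ln s\<rangle>)^2"
   using ln_bracket(3)[OF s] by (intro power_mono) auto
  then have "2 * (1 + norm (snd z - snd (?w z)))^2 * \<langle>snd (?w z)\<rangle>^2 <= 2 * (2 * \<langle>ln s\<rangle>)^2 * \<langle>snd (?w z)\<rangle>^2"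
   by (intro mult_right_mono mult_left_mono) auto
  then have "\<langle>snd z\<rangle>^2 <= 2 * (2 * \<langle>ln s\<rangle>)^2 * \<langle>snd (?w z)\<rangle>^2"
   using weight_shift[of "snd z" "snd (?w z)"] by (simp add: bracket_sq)
  also have "... <= (4 * \<langle>ln s\<rangle> * \<langle>snd (?w z)\<rangle>)^2" by (simp add: power_mult_distrib)
  finally show ?thesis
   by (rule power2_le_imp_le) (use bracket_sq(2)[of "ln s"] bracket_sq(2)[of "snd (?w z)"] in auto)
 qed
 have "AE z in lborel. norm (\<langle>snd z\<rangle> *R g' z) <= 8 * exp 129 * eps * \<langle>ln s\<rangle> ^ 3"
  using mpres_AE[OF vfield_mpres[OF l B, of ?tau 0] wb]
 proof eventually_elim
  case (elim z)
  have b0: "0 <= \<langle>ln s\<rangle>" "0 <= \<langle>snd z\<rangle>" "0 <= \<langle>snd (?w z)\<rangle>" using bracket_sq(2) order_trans zero_le_one by blast+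
  have "norm (\<langle>snd z\<rangle> *R g' z) = \<langle>snd z\<rangle> * norm (g' z)" using b0 by simp
  also have "... <= (4 * \<langle>ln s\<rangle> * \<langle>snd (?w z)\<rangle>) * ((2 * exp 129 * \<langle>ln s\<rangle>^2) * norm (g (?w z)))"
   using b0 by (intro mult_mono bs order_trans[OF pt mult_right_mono[OF Lb]]) auto
  also have "... = (8 * exp 129 * \<langle>ln s\<rangle> ^ 3) * (\<langle>snd (?w z)\<rangle> * norm (g (?w z)))" by (simp add: power3_eq_cube power2_eq_square)
  also have "... <= (8 * exp 129 * \<langle>ln s\<rangle> ^ 3) * eps" using elim b0 by (intro mult_left_mono) auto
  finally show ?case by (simp add: mult_ac)
 qed
 moreover have "(%z. \<langle>snd z\<rangle> *R g' z) : bmeas"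
 proof -
  have [measurable]: "(%z::phase. norm (snd z)) : bmeas" by (intro borel_measurable_continuous_onI continuous_intros)
  show ?thesis unfolding japanese_bracket_def by measurable
 qed
 ultimately show "Linf_norm (%(q, p). \<langle>p\<rangle> *R g' (q, p)) <= ereal (8 * exp 129 * eps * \<langle>ln s\<rangle> ^ 3)"
  unfolding case_prod_unfold prod.collapse by (intro Linf_normI)
qed

lemma sc_field: "0 < s ==> s <= 1 ==> E_field (pull l f B (- ln s)) q = B (- ln s) q"
 using BT by (simp add: Tfield_def)

lemma sc_solution:
 assumes wg: "weak_gradient_on UNIV f g" and gm: "g : bmeas" and gb: "AE z in lborel. norm (g z) <= eps"
  and eq: "AE z in lborel. gam1 z = f z"
 shows "solution_with_data l gam1 (%s. pull l f B (- ln s))"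
 unfolding solution_with_data_def solution_def
proof (intro conjI ballI)
 have e: "eps >= 0" using f by (simp add: datum_def)
 show "continuous_on ({0<..1} \<times> UNIV) (%(s, z). pull l f B (- ln s) z)"
  unfolding case_prod_unfold by (intro pull_continuous[OF l B f] continuous_intros) auto
 fix a :: real assume a: "a : {0<..1}"
 define c where "c = \<langle>ln a\<rangle>^2"
 let ?E = "eps + 4 * eps * c + 2 * exp 129 * eps * c"
 show "\<exists>M. \<forall>s\<in>{a..1}. L2_norm (pull l f B (- ln s)) <= ereal M & Linf_norm (%(q, p). \<langle>p\<rangle>^2 * pull l f B (- ln s) (q, p)) <= ereal M &
  (\<exists>g. weak_gradient_on UNIV (pull l f B (- ln s)) g & Linf_norm g <= ereal M)"
 proof (intro exI[of _ "eps + 4 * eps * c + 2 * exp 129 * eps * c"] ballI conjI)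
  fix s assume "s : {a..1}"
  then have s: "0 < s" "s <= 1" "a <= s" using a by auto
  have "(ln s)^2 <= (ln a)^2" using s a by (subst abs_le_square_iff[symmetric]) auto
  then have c: "\<langle>ln s\<rangle>^2 <= c" "0 <= \<langle>ln s\<rangle>^2" by (auto simp: c_def bracket_sq)
  moreover have "0 <= c" by (simp add: c_def)
  ultimately have le: "4 * eps * \<langle>ln s\<rangle>^2 <= 4 * eps * c" "2 * exp 129 * eps * \<langle>ln s\<rangle>^2 <= 2 * exp 129 * eps * c" "0 <= 4 * eps * c" "0 <= 2 * exp 129 * eps * c"
   using e by (auto intro!: mult_left_mono)
  show "L2_norm (pull l f B (- ln s)) <= ereal ?E"
   by (rule order_trans[OF sc_bounds(2)[OF s(1,2)]]) (unfold ereal_less_eq(3), use le in linarith)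
  show "Linf_norm (%(q, p). \<langle>p\<rangle>^2 * pull l f B (- ln s) (q, p)) <= ereal ?E"
   by (rule order_trans[OF sc_bounds(3)[OF s(1,2)]]) (unfold ereal_less_eq(3), use le e in linarith)
  have "Linf_norm (pgrad l B (%t. DE (pull l f B t)) g (- ln s)) <= ereal ?E"
   by (rule order_trans[OF sc_gradient(2)[OF s(1,2) wg gm gb]]) (unfold ereal_less_eq(3), use le e in linarith)
  then show "\<exists>g. weak_gradient_on UNIV (pull l f B (- ln s)) g & Linf_norm g <= ereal ?E"
   using sc_gradient(1)[OF s(1,2) wg gm gb] by blast
 qed
next
 obtain G where G: "weak_gradient_on ({0<..<1} \<times> UNIV) (%(s, z). pull l f B (- ln s) z) G"
  "!!s q p. 0 < s ==> s < 1 ==> (case G (s, q, p) of (Gs, Gq, Gp) => Gs + p <.> Gq + (l / s) * (B (- ln s) q <.> Gp) = 0)"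
  using pull_spacetime_gradient[OF l B fixed_field_deriv fixed_field_deriv_continuous wg] by blast
 show "satisfies_equation l (%s. pull l f B (- ln s))"
  unfolding satisfies_equation_def
  by (intro exI[of _ G] conjI G(1) AE_I2) (use G(2) in \<open>auto simp: sc_field\<close>)
 show "AE z in lborel. pull l f B (- ln 1) z = gam1 z"
  using eq by eventually_elim (simp add: pull_def flow_init[OF vfield_lip[OF l B]])
qed

text \<open>Backward trajectories from time \<open>t\<close> only see the field on
  \<open>[0, t]\<close>.\<close>

lemma pull_cong:
 assumes B': "okfield M B'" and t: "0 <= t" and eq: "!!r q. 0 <= r ==> r <= t ==> B' r q = B r q"
 shows "pull l f B' t z = pull l f B t z"
proof -
 let ?y = "%r. flow (vfield l B) t r z"
 have "flow (vfield l B') t 0 (?y t) = ?y 0"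
 proof (rule flow_unique[OF vfield_lip[OF l B']])
  fix r assume "r : closed_segment t 0"
  then have r: "0 <= r" "r <= t" using t by (auto simp: closed_segment_eq_real_ivl split: if_splits)
  have "vfield l B' r (?y r) = vfield l B r (?y r)" using r eq by (simp add: vfield_def)
  then show "(?y has_vector_derivative vfield l B' r (?y r)) (at r)" using flow_vderiv[OF vfield_lip[OF l B], of t z r] by simp
 qed
 then show ?thesis by (simp add: pull_def flow_init[OF vfield_lip[OF l B]])
qed

text \<open>Continuity upgrades the almost-everywhere bounds in \<open>solution\<close> to pointwise
  bounds at every single time, with one constant down to \<open>a\<close>.\<close>

lemma solution_adm:
 assumes "solution l gam'" "a : {0<..1}"
 obtains J where "!!s. a <= s ==> s <= 1 ==> adm J (gam' s)"
proof -
 obtain M where M: "!!s. s : {a..1} ==> L2_norm (gam' s) <= ereal M" "!!s. s : {a..1} ==> Linf_norm (%(q, p). \<langle>p\<rangle>^2 * gam' s (q, p)) <= ereal M"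
  "!!s. s : {a..1} ==> \<exists>g. weak_gradient_on UNIV (gam' s) g & Linf_norm g <= ereal M"
  using assms unfolding solution_def by blast
 have "adm M (gam' s)" if "a <= s" "s <= 1" for s
 proof -
  have s: "s : {a..1}" using that by simp
  note l2 = L2_normD[OF M(1)[OF s]]
  have cs: "continuous_on UNIV (gam' s)"
  proof -
   have c: "continuous_on ({0<..1} \<times> UNIV) (%(s, z). gam' s z)" using assms(1) by (simp add: solution_def)
   have "continuous_on UNIV (%z. case (s, z) of (s, z) => gam' s z)"
    by (rule continuous_on_compose2[OF c]) (use assms(2) that in \<open>auto intro!: continuous_intros\<close>)
   then show ?thesis by simp
  qed
  obtain g where g: "weak_gradient_on UNIV (gam' s) g" "Linf_norm g <= ereal M" using M(3)[OF s] by blast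
  obtain h where h: "M-lipschitz_on UNIV h" "AE z in lborel. gam' s z = h z" using weak_gradient_lipschitz[OF g(1) Linf_normD(2)[OF g(2)] l2(4)] by blast
  have "gam' s = h" by (rule lborel_continuous_AE_eq[OF cs lipschitz_on_continuous_on[OF h(1)] h(2)])
  then have lip: "\<bar>gam' s (q, p) - gam' s (q', p)\<bar> <= M * norm (q - q')" for q q' p
   using lipschitz_onD[OF h(1), of "(q, p)" "(q', p)"] by (simp add: dist_norm)
  have "\<bar>gam' s (q, p)\<bar> <= M / (1 + (norm p)^2)" for q p
   by (rule continuous_weighted_bound[OF cs]) (use Linf_normD(2)[OF M(2)[OF s]] in \<open>simp add: case_prod_unfold\<close>)
  then show ?thesis using l2 lip by (simp add: adm_def)
 qed
 then show ?thesis using that by blast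
qed

text \<open>The field of an arbitrary solution, on times after \<open>a\<close>, is bounded and
  Lipschitz with some constant \<open>M\<close> that may exceed 1. The solution is constant along
  the characteristics of this field, so the field is a fixed point of \<open>Tfield\<close> there,
  and fixed points are unique for any common \<open>M\<close>.\<close>

lemma sc_unique:
 assumes sol: "solution_with_data l gam1 gam'" and eq: "AE z in lborel. gam1 z = f z" and s0: "0 < s0" "s0 <= 1"
 shows "gam' s0 = pull l f B (- ln s0)"
proof -
 have so: "solution l gam'" and d: "AE z in lborel. gam' 1 z = gam1 z" using sol by (auto simp: solution_with_data_def)
 have c: "continuous_on ({0<..1} \<times> UNIV) (%(s, z). gam' s z)" using so by (simp add: solution_def)
 have cc: "continuous_on S (%x. gam' (g x) (h x))" if "continuous_on S g" "continuous_on S h" "!!x. x : S ==> 0 < g x & g x <= 1"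
  for S :: "'a::topological_space set" and g h
 proof -
  have "continuous_on S (%x. case (g x, h x) of (s, z) => gam' s z)"
   by (rule continuous_on_compose2[OF c continuous_on_Pair[OF that(1,2)]]) (use that(3) in auto)
  then show ?thesis by simp
 qed
 have at1: "gam' 1 = f"
 proof (rule lborel_continuous_AE_eq)
  show "continuous_on UNIV (gam' 1)" by (intro cc continuous_intros) auto
  show "AE z in lborel. gam' 1 z = f z" using d eq by eventually_elim simp
 qed (rule datum_continuous[OF f])
 \<comment> \<open>The times between \<open>a\<close> and \<open>s0\<close> are a reserve: constancy
   along characteristics is available on open intervals.\<close>
 define a where "a = s0 / 2"
 have a: "0 < a" "a < s0" "a < 1" "a : {0<..1}" using s0 by (auto simp: a_def)
 obtain J where J: "!!s. a <= s ==> s <= 1 ==> adm J (gam' s)" using solution_adm[OF so a(4)] by blast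
 define T where "T = - ln a"
 have T: "T >= 0" using a by (simp add: T_def)
 \<comment> \<open>Freezing the time at \<open>T\<close> produces a field for all nonnegative times
   that keeps the bounds valid on \<open>[a, 1]\<close>.\<close>
 define \<Gamma> where "\<Gamma> t = gam' (exp (- min t T))" for t
 have tr: "a <= exp (- min t T)" "exp (- min t T) <= 1" if "0 <= t" for t
 proof -
  have "ln a <= - min t T" unfolding T_def by simp
  then show "a <= exp (- min t T)" using a(1) by (metis exp_le_cancel_iff exp_ln)
  show "exp (- min t T) <= 1" using that T by simp
 qed
 have adm: "adm J (\<Gamma> t)" if "t : {0..}" for t unfolding \<Gamma>_def using tr[of t] that by (intro J) auto
 have c\<Gamma>: "continuous_on {0..} (%t. \<Gamma> t z)" for z
  unfolding \<Gamma>_def by (intro cc continuous_intros) (use tr in auto)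
 define E where "E t = E_field (\<Gamma> t)" for t
 note cE = E_field_continuous[OF adm c\<Gamma>]
 define M where "M = 1 + (8 * ubv * Wc + 1) * J^2 + (4 * Ch + 16) * J^2"
 have pos: "(8 * ubv * Wc + 1) * J^2 >= 0" "(4 * Ch + 16) * J^2 >= 0" using Wc(1) Ch_nonneg by auto
 have dE: "(E t has_derivative DE (\<Gamma> t) q) (at q)" if "0 <= t" for t q
  unfolding E_def by (rule E_field_static(3)[OF adm]) (use that in simp)
 have okE: "okfield M E"
  unfolding okfield_def
 proof (intro conjI allI impI)
  show "1 <= M" using pos by (simp add: M_def)
  show "continuous_on ({0..} \<times> UNIV) (%(t, q). E t q)" unfolding E_def by (rule cE(1))
  fix t :: real and q q' assume t: "0 <= t"
  show "norm (E t q) <= M" unfolding E_def using E_field_static(2)[OF adm, of t q] t pos by (simp add: M_def)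
  show "norm (E t q - E t q') <= M * norm (q - q')"
  proof (rule differentiable_bound[where S=UNIV and f'="DE (\<Gamma> t)"])
   show "(E t has_derivative DE (\<Gamma> t) x) (at x within UNIV)" for x using dE[OF t] by simp
   show "onorm (DE (\<Gamma> t) x) <= M" for x
   proof (rule onorm_bound)
    show "norm (DE (\<Gamma> t) x h) <= M * norm h" for h
     using E_field_static(5)[OF adm, of t x h] t pos mult_right_mono[of "(4 * Ch + 16) * J^2" M "norm h"] by (simp add: M_def)
   qed (use pos in \<open>simp add: M_def\<close>)
  qed auto
 qed
 have M1: "1 <= M" using okfieldD(1)[OF okE] .
 have okB: "okfield M B"
  unfolding okfield_def
 proof (intro conjI allI impI M1 okfieldD(4)[OF B])
  fix t :: real and q q' assume t: "0 <= t"
  show "norm (B t q) <= M" using okfieldD(2)[OF B t] M1 by (rule order_trans)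
  have "norm (B t q - B t q') <= 1 * norm (q - q')" by (rule okfieldD(3)[OF B t])
  also have "... <= M * norm (q - q')" using M1 by (intro mult_right_mono) auto
  finally show "norm (B t q - B t q') <= M * norm (q - q')" .
 qed
 obtain G where G: "weak_gradient_on ({0<..<1} \<times> UNIV) (%(s, z). gam' s z) G"
  "AE (s, q, p) in lborel. 0 < s & s < 1 --> (case G (s, q, p) of (Gs, Gq, Gp) => Gs + p <.> Gq + (l / s) * (E_field (gam' s) q <.> Gp) = 0)"
  using so unfolding solution_def satisfies_equation_def by blast
 have Elog: "E_field (gam' s) q = E (- ln s) q" if "a < s" "s < 1" for s q
 proof -
  have "ln a < ln s" using that a by simp
  then have "min (- ln s) T = - ln s" by (simp add: T_def)
  then show ?thesis using that a by (simp add: E_def \<Gamma>_def)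
 qed
 have trans: "gam' s (flow (vfield l E) 0 (- ln s) y) = f y" if s: "a < s" "s <= 1" for s y
 proof -
  define phi where "phi s = gam' s (flow (vfield l E) 0 (- ln s) y)" for s
  define b where "b = (a + s) / 2"
  have b: "a < b" "b < s" "b < 1" using s by (auto simp: b_def)
  define m where "m = (b + 1) / 2"
  have m: "b < m" "m < 1" using b by (auto simp: m_def)
  have const: "phi r = phi m" if "r : {b<..<1}" for r
   unfolding phi_def
   by (rule constant_along_flow[OF l okE dE cE(2) G a(1) Elog c]) (use that b m in auto)
  \<comment> \<open>Constancy is known strictly between \<open>b\<close> and 1; continuity includes
    the time 1, at which the data are attained.\<close>
  have cl: "closure {b<..<1} = {b..1}" using b by simp
  have "phi r = phi m" if "r : closure {b<..<1}" for r
  proof (rule continuous_constant_on_closure[OF _ const that])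
   show "continuous_on (closure {b<..<1}) phi"
    unfolding cl phi_def using a b by (intro cc flow_continuous_on[OF vfield_lip[OF l okE]] continuous_intros) auto
  qed
  then have "phi s = phi m" "phi 1 = phi m" unfolding cl using b s by auto
  then show ?thesis by (simp add: phi_def at1 flow_init[OF vfield_lip[OF l okE]])
 qed
 have pulled: "gam' s z = pull l f E (- ln s) z" if "a < s" "s <= 1" for s z
  using trans[OF that, of "flow (vfield l E) (- ln s) 0 z"] by (simp add: pull_def flow_inverse[OF vfield_lip[OF l okE]])
 define T0 where "T0 = - ln s0"
 have T0: "0 <= T0" "T0 < T" using s0 a by (auto simp: T0_def T_def)
 have ET: "E t q = Tfield l f E t q" if t: "0 <= t" "t <= T0" for t q
 proof -
  have "ln a < - t" using t T0 by (simp add: T_def)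
  then have "a < exp (- t)" using a(1) by (metis exp_less_cancel_iff exp_ln)
  then have "gam' (exp (- t)) = pull l f E t" using pulled[of "exp (- t)"] t by auto
  then show ?thesis using t T0 by (simp add: E_def \<Gamma>_def Tfield_def min_def)
 qed
 have "E t q = B t q" if "0 <= t" "t <= T0" for t q
  by (rule Tfield_unique[OF l f okE okB ET BT[rule_format] that]) auto
 then have "pull l f E T0 z = pull l f B T0 z" for z by (intro pull_cong[OF okE T0(1)]) auto
 then show ?thesis using pulled[of s0] a s0 by (auto simp: T0_def)
qed

end

section \<open>Modified scattering\<close>

lemma dens_mono: assumes "dens B f" "B <= B'" shows "dens B' f"
proof -
 have "B * wt u <= B' * wt u" for u using assms(2) wt_pos(1) by (rule mult_right_mono)
 then show ?thesis using assms unfolding dens_def by (meson order_trans)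
qed

text \<open>Fatou's lemma for the mass; the pointwise bounds pass to the limit.\<close>

lemma dens_limit:
 assumes d: "!!n. dens B (g n)" and lim: "!!z. (%n. g n z) ----> h z"
 shows "dens B h"
proof -
 have m[measurable]: "h : bmeas" by (rule borel_measurable_LIMSEQ_metric[OF densD(1)[OF d] lim])
 have nn: "0 <= h z" for z by (rule LIMSEQ_le_const[OF lim]) (use densD(2)[OF d] in auto)
 have "(NNI z. ennreal (h z)) = (NNI z. liminf (%n. ennreal (g n z)))"
  by (intro nn_integral_cong lim_imp_Liminf[symmetric] tendsto_ennrealI lim) simp
 also have "... <= liminf (%n. NNI z. ennreal (g n z))"
  by (intro nn_integral_liminf) (use densD(1)[OF d] in measurable)
 also have "... <= ennreal B"
  by (intro Liminf_le always_eventually allI densD(7)[OF d]) simp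
 finally have b: "(NNI z. ennreal (h z)) <= ennreal B" .
 have i: "integrable lborel h"
  by (rule integrableI_nonneg) (use nn b in \<open>auto intro: le_less_trans\<close>)
 have "ennreal (LI z. h z) <= ennreal B" using b by (simp add: nn_integral_eq_integral[OF i] nn)
 then have "(LI z. h z) <= B" using densD(6)[OF d] by simp
 moreover have "h (r, u) <= B * wt u" for r u by (rule LIMSEQ_le_const2[OF lim]) (use densD(3)[OF d] in auto)
 ultimately show ?thesis using m nn i by (simp add: dens_def)
qed

text \<open>Half of the rate 1/256 absorbs the square, each factor being at most
  \<open>1024 * exp (t / 1024)\<close>.\<close>

lemma sqr_exp_growth:
 assumes "t >= (0::real)" shows "(1 + t)^2 * exp (- (1/256) * t) <= 1024^2 * exp (- (1/512) * t)"
proof -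
 have "1 + t <= 1024 * (1 + t / 1024)" using assms by simp
 also have "... <= 1024 * exp (t / 1024)" using exp_ge_add_one_self[of "t / 1024"] by (intro mult_left_mono) auto
 finally have "(1 + t)^2 <= (1024 * exp (t / 1024))^2" using assms by (intro power_mono) auto
 also have "... = 1024^2 * exp (t / 512)" by (simp add: power_mult_distrib exp_of_nat_mult[symmetric])
 finally have "(1 + t)^2 * exp (- (1/256) * t) <= (1024^2 * exp (t / 512)) * exp (- (1/256) * t)" by (rule mult_right_mono) simp
 also have "... = 1024^2 * exp (- (1/512) * t)" by (simp add: exp_add[symmetric])
 finally show ?thesis .
qed

text \<open>The logarithm is traded for a power 1/8 by \<open>ln x = 8 * ln (x powr (1/8))\<close>,
  whence 33 = 1 + 4 * 8. The remaining exponent -7/8 is taken because its power squares to the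
  weight \<open>wt\<close>.\<close>

lemma log_weight_bound:
 assumes b: "b >= 0"
 shows "2 * (1 + b + 4 * ln (1 + norm p))^2 / (1 + (norm (p::R3))^2) <= 4 * (33 + b)^2 * (1 + (norm p)^2) powr (-7/8)"
proof -
 define x where "x = 1 + norm p" define y where "y = x powr (1/8)" define v where "v = 1 + (norm p)^2"
 have x: "x >= 1" and v: "v >= 1" by (auto simp: x_def v_def)
 have y: "y >= 1" using x by (simp add: y_def ge_one_powr_ge_zero)
 have "ln x = 8 * ln y" using x by (simp add: y_def ln_powr)
 also have "... <= 8 * y" using ln_bound[of y] y by simp
 finally have "1 + b + 4 * ln x <= (33 + b) * y" using y b mult_left_mono[of 1 y "1 + b"] by (simp add: algebra_simps)
 then have "(1 + b + 4 * ln x)^2 <= ((33 + b) * y)^2" using x b by (intro power_mono) auto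
 also have "... = (33 + b)^2 * (x^2) powr (1/8)"
  using x by (simp add: y_def power2_eq_square powr_mult mult_ac)
 also have "(x^2) powr (1/8) <= (2 * v) powr (1/8)"
  using x sum_squares_bound[of 1 "norm p"] by (intro powr_mono2) (auto simp: x_def v_def power2_sum)
 also have "(2 * v) powr (1/8) = 2 powr (1/8) * v powr (1/8)" using v by (simp add: powr_mult)
 also have "... <= 2 powr 1 * v powr (1/8)" by (intro mult_right_mono powr_mono) auto
 finally have "(1 + b + 4 * ln x)^2 <= (33 + b)^2 * (2 powr 1 * v powr (1/8))" by (simp add: mult_left_mono)
 then have "2 * (1 + b + 4 * ln x)^2 / v <= 2 * ((33 + b)^2 * (2 * v powr (1/8))) / v" using v by (intro divide_right_mono mult_left_mono) auto
 also have "... = 4 * (33 + b)^2 * (v powr (1/8) * v powr (-1))" using v by (simp add: powr_minus_divide)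
 also have "v powr (1/8) * v powr (-1) = v powr (-7/8)" unfolding powr_add[symmetric] by simp
 finally show ?thesis by (simp add: x_def v_def)
qed

text \<open>The trajectory of the theorem in the time \<open>t = - ln s\<close>, where
  \<open>s * ln s\<close> becomes \<open>- t * exp (- t)\<close>.\<close>

definition scat :: "real => (R3 => R3) => real => phase => phase"
 where "scat l E t z = (fst z + exp (- t) *R (snd z - (l * t) *R E (fst z)), snd z - (l * t) *R E (fst z))"

text \<open>Here \<open>exp 129\<close> stems from the Lipschitz bound of the flow,
  \<open>exp 1 * 4\<close> from the defect over unit time, and \<open>1024^2\<close> from
  \<open>sqr_exp_growth\<close>.\<close>

definition K1 :: real where "K1 = exp 129 * (exp 1 * 4) * 1024^2"
definition K2 :: real where "K2 = K1 / (1 - exp (- (1/512)))"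
definition K3 :: real where "K3 = 4 * (33 + K2)^2"
definition K4 :: real where "K4 = (K1 + 2 * K3) / (1 - exp (- (1/512)))"

lemma K_nonneg: "0 <= K1" "0 <= K2" "0 <= K3" "0 <= K4"
 by (auto simp: K1_def K2_def K3_def K4_def intro!: divide_nonneg_pos add_nonneg_nonneg)

context
 fixes l eps :: real and f :: "phase => real" and B :: "real => R3 => R3" and E :: "R3 => R3"
 assumes l: "\<bar>l\<bar> = 1" and f: "datum eps f" and B: "okfield 1 B" and BT: "\<forall>t\<ge>0. \<forall>q. B t q = Tfield l f B t q"
  and BE: "!!t q. 0 <= t ==> norm (B t q - E q) <= exp (- (1/256) * t)"
  and E1: "!!q. norm (E q) <= 1" and EL: "continuous_on UNIV E"
begin

text \<open>A shear in momentum by the field followed by a shear in position by the new momentum;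
  this preserves the measure although \<open>E\<close> is merely continuous.\<close>

lemma scat_mpres: "mpres (scat l E t)"
proof -
 have [measurable]: "E : bmeas" using EL by (rule borel_measurable_continuous_onI)
 have 1: "mpres (%z::phase. (fst z, snd z + (- (l * t)) *R E (fst z)))"
  by (rule mpres_shear_snd[where b="%q. (- (l * t)) *R E q"]) measurable
 have 2: "mpres (%z::phase. (fst z + exp (- t) *R snd z, snd z))"
  by (rule mpres_shear_fst[where b="%p. exp (- t) *R p"]) measurable
 have "scat l E t = (%z. (%z. (fst z + exp (- t) *R snd z, snd z)) (fst z, snd z + (- (l * t)) *R E (fst z)))"
  by (auto simp: scat_def)
 then show ?thesis using mpres_comp[OF 2 1] by simp
qed

lemma scat_deriv: "((%t. scat l E t z) has_vector_derivative
  (- (exp (- t) *R snd (scat l E t z)) - (exp (- t) * l) *R E (fst z), - (l *R E (fst z)))) (at t)"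
proof -
 have "((%t. snd z - (l * t) *R E (fst z)) has_vector_derivative - (l *R E (fst z))) (at t)"
  by (auto intro!: derivative_eq_intros)
 moreover have "((%t. fst z + exp (- t) *R (snd z - (l * t) *R E (fst z))) has_vector_derivative
   - (exp (- t) *R (snd z - (l * t) *R E (fst z))) - (exp (- t) * l) *R E (fst z)) (at t)"
  by (auto intro!: derivative_eq_intros simp: has_real_derivative_iff_has_vector_derivative[symmetric])
 ultimately show ?thesis unfolding scat_def[abs_def] snd_conv by (rule has_vector_derivative_Pair[rotated])
qed

text \<open>The point at time 0 from which the true trajectory reaches the explicit one at time
  \<open>t\<close>. Modified scattering amounts to its convergence for large \<open>t\<close>, after
  application of \<open>f\<close> and uniformly in \<open>z\<close>.\<close>

definition orig :: "real => phase => phase"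
 where "orig t z = flow (vfield l B) t 0 (scat l E t z)"

text \<open>The explicit curve solves the characteristic equation up to a term of size
  \<open>exp (- t)\<close>, the distance of \<open>B t\<close> from \<open>E\<close>, and the
  displacement, which is \<open>exp (- t)\<close> times a momentum; hence the restriction on the
  latter. The polynomial Lipschitz bound carries the resulting error back to time 0.\<close>

lemma orig_step:
 assumes t: "0 <= t" "t <= t'" "t' <= t + 1" and p: "norm (snd z) <= exp (t / 2)"
 shows "norm (orig t' z - orig t z) <= K1 * exp (- (1/512) * t)"
proof -
 let ?X = "%r. scat l E r z" and ?F = "vfield l B"
 let ?X' = "%t. (- (exp (- t) *R snd (?X t)) - (exp (- t) * l) *R E (fst z), - (l *R E (fst z)))"
 have err: "norm (?X' r - ?F r (?X r)) <= 4 * exp (- (1/256) * t)" if "r : closed_segment t' t" for r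
 proof -
  have r: "t <= r" "0 <= r" "r <= t + 1" using that t by (auto simp: closed_segment_eq_real_ivl split: if_splits)
  have er: "exp (- r) <= exp (- t)" using r by simp
  have "norm (snd z - (l * r) *R E (fst z)) <= norm (snd z) + \<bar>l * r\<bar> * norm (E (fst z))"
   using norm_triangle_ineq4[of "snd z" "(l * r) *R E (fst z)"] by simp
  also have "... <= exp (t / 2) + (t + 1) * 1" using p l r E1 by (intro add_mono mult_mono) (auto simp: abs_mult)
  finally have P: "norm (snd z - (l * r) *R E (fst z)) <= exp (t / 2) + (t + 1)" by simp
  have "?X' r - ?F r (?X r) = - ((exp (- r) * l) *R E (fst z), l *R (E (fst z) - B r (fst (?X r))))"
   using r by (simp add: vfield_def scaleR_diff_right)
  then have "norm (?X' r - ?F r (?X r)) = norm ((exp (- r) * l) *R E (fst z), l *R (E (fst z) - B r (fst (?X r))))" by (simp only: norm_minus_cancel)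
  also have "... <= norm ((exp (- r) * l) *R E (fst z)) + norm (l *R (E (fst z) - B r (fst (?X r))))" by (rule norm_Pair_le)
  also have "... = exp (- r) * norm (E (fst z)) + norm (E (fst z) - B r (fst (?X r)))" using l by (simp add: abs_mult)
  also have "exp (- r) * norm (E (fst z)) <= exp (- t) * 1" using er E1 by (intro mult_mono) auto
  also have "norm (E (fst z) - B r (fst (?X r))) <= norm (B r (fst z) - E (fst z)) + norm (B r (fst (?X r)) - B r (fst z))"
   using norm_triangle_ineq4[of "E (fst z) - B r (fst z)" "B r (fst (?X r)) - B r (fst z)"] by (simp add: norm_minus_commute)
  also have "norm (B r (fst z) - E (fst z)) <= exp (- (1/256) * t)" by (rule order_trans[OF BE[OF r(2)]]) (use r in simp)
  also have "norm (B r (fst (?X r)) - B r (fst z)) <= 1 * norm (fst (?X r) - fst z)" by (rule okfieldD(3)[OF B r(2)])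
  also have "norm (fst (?X r) - fst z) = exp (- r) * norm (snd z - (l * r) *R E (fst z))" by (simp add: scat_def)
  also have "... <= exp (- t) * (exp (t / 2) + (t + 1))" using er P by (intro mult_mono) auto
  finally have "norm (?X' r - ?F r (?X r)) <= exp (- t) * (2 + t + exp (t / 2)) + exp (- (1/256) * t)"
   by (simp add: algebra_simps)
  also have "exp (- t) * (2 + t + exp (t / 2)) <= exp (- t) * (3 * exp (t / 2))"
  proof (intro mult_left_mono)
   have "1 + t / 2 <= exp (t / 2)" by (rule exp_ge_add_one_self)
   then show "2 + t + exp (t / 2) <= 3 * exp (t / 2)" by linarith
  qed simp
  also have "... = 3 * exp (- (1/2) * t)" by (simp add: exp_add[symmetric])
  also have "... <= 3 * exp (- (1/256) * t)" using t by simp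
  finally show ?thesis by simp
 qed
 have "norm (flow ?F t' t (?X t') - ?X t) <= exp (1 * \<bar>t - t'\<bar>) * (norm (?X t' - ?X t') + 4 * exp (- (1/256) * t) * \<bar>t - t'\<bar>)"
  by (rule flow_dist_solution[OF vfield_lip[OF l B] scat_deriv _ err]) auto
 also have "... <= exp 1 * (4 * exp (- (1/256) * t) * 1)" using t by (intro mult_mono) auto
 finally have d: "norm (flow ?F t' t (?X t') - ?X t) <= exp 1 * 4 * exp (- (1/256) * t)" by simp
 have "orig t' z = flow ?F t 0 (flow ?F t' t (?X t'))" by (simp add: orig_def flow_flow[OF vfield_lip[OF l B]])
 then have "norm (orig t' z - orig t z) <= exp 129 * (1 + t)^2 * norm (flow ?F t' t (?X t') - ?X t)"
  using flow_vfield_lipschitz[OF l B t(1)] by (simp add: orig_def)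
 also have "... <= exp 129 * (1 + t)^2 * (exp 1 * 4 * exp (- (1/256) * t))" by (intro mult_left_mono d) auto
 also have "... = exp 129 * (exp 1 * 4) * ((1 + t)^2 * exp (- (1/256) * t))" by simp
 also have "... <= exp 129 * (exp 1 * 4) * (1024^2 * exp (- (1/512) * t))" by (intro mult_left_mono sqr_exp_growth t(1)) auto
 finally show ?thesis by (simp add: K1_def)
qed

text \<open>Up to the logarithmic time \<open>sig = 2 ln (1 + |p|)\<close> the momentum moves by at most \<open>2 sig\<close>; afterwards
  the particle is slow, and its initial position in phase space converges at an exponential rate.\<close>

lemma orig_momentum:
 assumes t: "0 <= t"
 shows "norm (snd z - snd (orig t z)) <= K2 + 4 * ln (1 + norm (snd z))"
proof -
 define sig where "sig = 2 * ln (1 + norm (snd z))"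
 have sig: "sig >= 0" "exp (sig / 2) = 1 + norm (snd z)" by (auto simp: sig_def add_pos_nonneg)
 have early: "norm (snd z - snd (orig r z)) <= 2 * r" if "0 <= r" for r
 proof -
  have "norm (snd (orig r z) - snd (scat l E r z)) <= 1 * \<bar>0 - r\<bar>" unfolding orig_def by (rule momentum_drift[OF l B])
  moreover have "norm (snd z - snd (scat l E r z)) <= r * 1" using l that mult_left_mono[OF E1 that] by (simp add: scat_def abs_mult)
  ultimately show ?thesis using that norm_triangle_ineq4[of "snd z - snd (scat l E r z)" "snd (orig r z) - snd (scat l E r z)"] by simp
 qed
 show ?thesis
 proof (cases "t <= sig")
  case True
  then show ?thesis using early[OF t] K_nonneg(2) by (simp add: sig_def)
 next
  case False
  have "norm ((%r. orig (sig + r) z) (t - sig) - (%r. orig (sig + r) z) 0) <= K1 * exp (- (1/512) * 0) / (1 - exp (- (1/512)))"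
  proof (rule exp_Cauchy(1))
   fix r r' :: real assume r: "0 <= r" "r <= r'" "r' <= r + 1"
   have "exp (sig / 2) <= exp ((sig + r) / 2)" using r by simp
   then have "norm (orig (sig + r') z - orig (sig + r) z) <= K1 * exp (- (1/512) * (sig + r))"
    using sig r by (intro orig_step) auto
   also have "... <= K1 * exp (- (1/512) * r)" using sig K_nonneg by (intro mult_left_mono) auto
   finally show "norm (orig (sig + r') z - orig (sig + r) z) <= K1 * exp (- (1/512) * r)" .
  qed (use False in auto)
  then have "norm (orig t z - orig sig z) <= K2" by (simp add: K2_def)
  moreover have "norm (snd w) <= norm w" for w :: phase by (metis norm_snd_le prod.collapse)
  ultimately have "norm (snd (orig t z) - snd (orig sig z)) <= K2" by (metis order_trans snd_diff)
  then show ?thesis using early[OF sig(1)] norm_triangle_ineq4[of "snd z - snd (orig sig z)" "snd (orig t z) - snd (orig sig z)"] by (simp add: sig_def)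
 qed
qed

lemma orig_decay:
 assumes t: "0 <= t"
 shows "\<bar>f (orig t (q, p))\<bar> <= eps * (K3 * (1 + (norm p)^2) powr (-7/8))"
proof -
 have e: "eps >= 0" using f by (simp add: datum_def)
 obtain q' p' where o: "orig t (q, p) = (q', p')" by fastforce
 have pos: "1 + (norm p)^2 > 0" "1 + (norm p')^2 > 0" by (auto intro: add_pos_nonneg)
 let ?c = "2 * (1 + K2 + 4 * ln (1 + norm p))^2"
 have "norm (p - p') <= K2 + 4 * ln (1 + norm p)" using orig_momentum[OF t, of "(q, p)"] by (simp add: o)
 then have "2 * (1 + norm (p - p'))^2 * (1 + (norm p')^2) <= ?c * (1 + (norm p')^2)"
  by (intro mult_right_mono mult_left_mono power_mono) auto
 then have w: "1 + (norm p)^2 <= ?c * (1 + (norm p')^2)" using weight_shift[of p p'] by linarith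
 have "\<bar>f (orig t (q, p))\<bar> <= eps / (1 + (norm p')^2)" using f by (simp add: o datum_def)
 also have "... <= eps * (?c / (1 + (norm p)^2))"
  using w pos mult_left_mono[OF w e] by (simp add: divide_simps mult_ac)
 also have "... <= eps * (4 * (33 + K2)^2 * (1 + (norm p)^2) powr (-7/8))" by (intro mult_left_mono log_weight_bound K_nonneg e)
 finally show ?thesis by (simp add: K3_def)
qed

text \<open>For momenta above \<open>exp (t / 2)\<close> the initial points need not be close, but
  then both values of the datum are small by \<open>orig_decay\<close>, at a rate better than
  1/512.\<close>

lemma f_orig_step:
 assumes t: "0 <= t" "t <= t'" "t' <= t + 1"
 shows "norm (f (orig t' z) - f (orig t z)) <= (eps * (K1 + 2 * K3)) * exp (- (1/512) * t)"
proof -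
 have e: "eps >= 0" using f by (simp add: datum_def)
 show ?thesis
 proof (cases "norm (snd z) <= exp (t / 2)")
  case True
  have "norm (f (orig t' z) - f (orig t z)) <= eps * norm (orig t' z - orig t z)" using f unfolding datum_def real_norm_def by blast
  also have "... <= eps * (K1 * exp (- (1/512) * t))" by (intro mult_left_mono orig_step t True e)
  also have "... <= eps * ((K1 + 2 * K3) * exp (- (1/512) * t))" using K_nonneg e by (intro mult_left_mono mult_right_mono) auto
  finally show ?thesis by (simp add: mult_ac)
 next
  case False
  obtain q p where z: "z = (q, p)" by fastforce
  have "exp t = (exp (t / 2))^2" by (simp add: exp_of_nat_mult[symmetric])
  also have "... <= (norm p)^2" using False z by (intro power_mono) auto
  finally have "exp t <= 1 + (norm p)^2" by simp
  then have "(1 + (norm p)^2) powr (-7/8) <= exp t powr (-7/8)" by (intro powr_mono2') auto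
  also have "... <= exp (- (1/512) * t)" using t by (simp add: powr_def)
  finally have p: "(1 + (norm p)^2) powr (-7/8) <= exp (- (1/512) * t)" .
  have a: "\<bar>f (orig r z)\<bar> <= eps * (K3 * exp (- (1/512) * t))" if "0 <= r" for r
   unfolding z by (rule order_trans[OF orig_decay[OF that] mult_left_mono[OF mult_left_mono[OF p K_nonneg(3)] e]])
  have "norm (f (orig t' z) - f (orig t z)) <= eps * (K3 * exp (- (1/512) * t)) + eps * (K3 * exp (- (1/512) * t))"
   using a[of t] a[of t'] t unfolding real_norm_def by linarith
  also have "... = eps * ((2 * K3) * exp (- (1/512) * t))" by simp
  also have "... <= eps * ((K1 + 2 * K3) * exp (- (1/512) * t))" using K_nonneg e by (intro mult_left_mono mult_right_mono) auto
  finally show ?thesis by (simp add: mult_ac)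
 qed
qed

text \<open>The decay of \<open>f\<close> along \<open>orig\<close> squares exactly to
  \<open>wt\<close>, so the densities stay in the class whose potentials converge, with a bound
  uniform in time.\<close>

lemma f_orig_dens: assumes t: "0 <= t" shows "dens ((1 + K3^2) * eps^2) (%z. (f (orig t z))^2)"
proof -
 have e: "eps >= 0" using f by (simp add: datum_def)
 have [measurable]: "f : bmeas" using datum_continuous[OF f] by (rule borel_measurable_continuous_onI)
 have m: "mpres (orig t)" unfolding orig_def[abs_def] by (rule mpres_comp[OF vfield_mpres[OF l B] scat_mpres])
 have [measurable]: "orig t : bmeas" using m by (rule mpres_measurable)
 have f2: "(%z. (f z)^2) : bmeas" by measurable
 have le: "eps^2 <= (1 + K3^2) * eps^2" by (simp add: algebra_simps)
 have "(LI z. (f (orig t z))^2) = (LI z. (f z)^2)" by (rule mpres_integral[OF m f2])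
 also have "... <= (1 + K3^2) * eps^2" using f le by (simp add: datum_def)
 finally have "(LI z. (f (orig t z))^2) <= (1 + K3^2) * eps^2" .
 moreover have "integrable lborel (%z. (f (orig t z))^2)" using mpres_integrable[OF m f2] f by (simp add: datum_def)
 moreover have "(f (orig t (q, p)))^2 <= (1 + K3^2) * eps^2 * wt p" for q p
 proof -
  have "\<bar>f (orig t (q, p))\<bar>^2 <= (eps * (K3 * (1 + (norm p)^2) powr (-7/8)))^2" by (intro power_mono orig_decay t) simp
  also have "... = eps^2 * K3^2 * ((1 + (norm p)^2) powr (-7/8))^2" by (simp add: power_mult_distrib)
  also have "((1 + (norm p)^2) powr (-7/8))^2 = wt p" by (simp add: wt_def power2_eq_square powr_add[symmetric])
  also have "eps^2 * K3^2 * wt p <= (1 + K3^2) * eps^2 * wt p" using wt_pos(1) by (intro mult_right_mono) (auto simp: algebra_simps)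
  finally show ?thesis by simp
 qed
 ultimately show ?thesis by (simp add: dens_def)
qed

text \<open>Besides the limit of the data its field has to be identified. The field of
  \<open>f\<close> along \<open>orig\<close> is compared with \<open>B t\<close>, the field of the
  transported datum; the two densities differ by the map \<open>scat\<close>, and the splitting into
  slow and fast particles applies again. One field tends to \<open>E_field gam0\<close>, the other
  to \<open>E\<close>.\<close>

lemma scattering_limit:
 obtains gam0 where "!!t z. 0 <= t ==> norm (gam0 z - f (orig t z)) <= eps * K4 * exp (- (1/512) * t)"
  "Linf_norm gam0 < \<infinity>" "E_field_converges gam0" "E = E_field gam0"
proof -
 define Bd where "Bd = (1 + K3^2) * eps^2"
 define gam0 where "gam0 z = lim (%n. f (orig (real n) z))" for z
 have lim: "(%n. f (orig (real n) z)) ----> gam0 z" and rate: "0 <= t ==> norm (gam0 z - f (orig t z)) <= eps * K4 * exp (- (1/512) * t)" for z t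
 proof -
  obtain L where L: "((%t. f (orig t z)) \<longlongrightarrow> L) at_top" "\<forall>t\<ge>0. norm (L - f (orig t z)) <= (eps * (K1 + 2 * K3)) * exp (- (1/512) * t) / (1 - exp (- (1/512)))"
   using exp_Cauchy(2)[of "1/512" "%t. f (orig t z)" "eps * (K1 + 2 * K3)"] f_orig_step[of _ _ z] by auto
  have "(%n. f (orig (real n) z)) ----> L" by (rule filterlim_compose[OF L(1) filterlim_real_sequentially])
  then show 1: "(%n. f (orig (real n) z)) ----> gam0 z" unfolding gam0_def by (simp add: limI)
  then have "gam0 z = L" using \<open>_ ----> L\<close> by (rule LIMSEQ_unique)
  then show "0 <= t ==> norm (gam0 z - f (orig t z)) <= eps * K4 * exp (- (1/512) * t)" using L(2) by (simp add: K4_def)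
 qed
 have lim2: "(%n. (f (orig (real n) z))^2) ----> (gam0 z)^2" for z by (intro tendsto_power lim)
 have dn: "dens Bd (%z. (f (orig (real n) z))^2)" for n unfolding Bd_def by (rule f_orig_dens) simp
 have d0: "dens Bd (%z. (gam0 z)^2)" by (rule dens_limit[OF dn lim2])
 have e: "eps >= 0" using f by (simp add: datum_def)
 have "E q = E_field gam0 q" for q
 proof -
  have cv: "(%n. E_field (%z. f (orig (real n) z)) q) ----> E_field gam0 q"
   unfolding E_field_pot by (intro tendsto_intros pot_tendsto[OF dn d0 kbound_coulomb lim2])
  define b where "b t = KE * eps^2 * exp (- (1/256) * t) + CT * Bd * 6 * exp (- (1/128) * t)" for t
  have diff: "norm (B t q - E_field (%z. f (orig t z)) q) <= b t" if t: "0 <= t" for t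
  proof -
   let ?J = "CJ * eps * (1 + (t + 1))^2"
   let ?B = "?J^2 + Bd"
   have ap: "dens ?B (%z. (pull l f B t z)^2)"
    by (rule dens_mono[OF adm_dens[OF adm_pull_global[OF l B f t, of "t + 1"]]]) (use densD(6)[OF d0] in auto)
   have ao: "dens ?B (%z. (f (orig t z))^2)" by (rule dens_mono[OF f_orig_dens[OF t]]) (simp add: Bd_def)
   \<comment> \<open>The explicit trajectories shift momenta by up to \<open>t\<close>, so the
     threshold exceeds \<open>exp (t / 2)\<close> by \<open>t\<close>. As
     \<open>t <= exp (t / 2)\<close>, slow particles still move by at most
     \<open>3 * exp (- t / 2)\<close>.\<close>
   let ?S = "{w::phase. norm (snd w) <= exp (t / 2) + t}"
   have sq: "t <= exp (t / 2)"
   proof -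
    have "t <= (1 + t / 4)^2" using zero_le_power2[of "1 - t / 4"] by (simp add: power2_eq_square algebra_simps)
    also have "... <= (exp (t / 4))^2" using exp_ge_add_one_self[of "t / 4"] t by (intro power_mono) auto
    also have "... = exp (t / 2)" by (simp add: exp_of_nat_mult[symmetric])
    finally show ?thesis .
   qed
   have sm: "norm (snd (scat l E t w) - snd w) <= t" for w
    using l t mult_left_mono[OF E1 t, of "fst w"] by (simp add: scat_def abs_mult)
   have slow: "norm (fst w - fst (scat l E t w)) <= 3 * exp (- t / 2)" if "w : ?S" for w
   proof -
    have "norm (snd (scat l E t w)) <= 3 * exp (t / 2)"
     using sm[of w] that sq norm_triangle_sub[of "snd (scat l E t w)" "snd w"] by simp
    then have "exp (- t) * norm (snd (scat l E t w)) <= exp (- t) * (3 * exp (t / 2))" by (intro mult_left_mono) auto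
    also have "... = 3 * exp (- t / 2)" by (simp add: exp_add[symmetric])
    finally show ?thesis by (simp add: scat_def)
   qed
   have fast: "exp (t / 2) <= norm (snd w) & exp (t / 2) <= norm (snd (scat l E t w))" if "w ~: ?S" for w
    using sm[of w] that t norm_triangle_sub[of "snd w" "snd (scat l E t w)"] by (simp add: norm_minus_commute)
   have "norm (pot coulomb (%z. (f (orig t z))^2) q - pot coulomb (%z. (pull l f B t z)^2) q) <=
     CT * ?B * (exp (- t / 32) + 3 * exp (- t / 2) / exp (- t / 32) ^ 3 + exp (t / 16) * exp (t / 2) powr (-1/4) + 1 / (exp (t / 16))^2)"
    by (rule pot_coulomb_time_diff[OF ao ap mpres_id scat_mpres, where S="?S"]) (use slow fast in \<open>auto simp: orig_def pull_def\<close>)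
   also have "... <= CT * ?B * (6 * exp (- t / 128))" using CT_nonneg densD(6)[OF d0] by (intro mult_left_mono log_scales t) auto
   also have "... = CT * ?J^2 * (6 * exp (- t / 128)) + CT * Bd * 6 * exp (- (1/128) * t)" by (simp add: algebra_simps)
   also have "... <= b t" unfolding b_def by (intro add_right_mono CJ_growth t)
   finally have "norm (E_field (%z. f (orig t z)) q - E_field (pull l f B t) q) <= b t"
    unfolding E_field_pot scaleR_diff_right[symmetric] by (rule order_trans[OF pi4])
   then show ?thesis using BT t by (simp add: Tfield_def norm_minus_commute)
  qed
  have ez: "(%n. exp (- kap * real n)) ----> 0" if "kap > 0" for kap :: real
   using that by (intro filterlim_compose[OF exp_at_bot] filterlim_tendsto_neg_mult_at_bot[OF tendsto_const _ filterlim_real_sequentially]) auto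
  have bz: "(%n. b (real n)) ----> 0"
  proof -
   have "(%n. b (real n)) ----> KE * eps^2 * 0 + CT * Bd * 6 * 0"
    unfolding b_def by (intro tendsto_add tendsto_mult_left ez) auto
   then show ?thesis by simp
  qed
  have "(%n. B (real n) q - E_field (%z. f (orig (real n) z)) q) ----> 0"
   by (rule Lim_null_comparison[OF _ bz]) (use diff in auto)
  moreover have "(%n. B (real n) q - E q) ----> 0"
   by (rule Lim_null_comparison[OF _ ez[of "1/256"]]) (use BE in auto)
  ultimately have "(%n. (B (real n) q - E q) - (B (real n) q - E_field (%z. f (orig (real n) z)) q)) ----> 0 - 0"
   by (intro tendsto_diff)
  then have "(%n. E_field (%z. f (orig (real n) z)) q - E q) ----> 0" by simp
  then have "(%n. E_field (%z. f (orig (real n) z)) q) ----> E q" by (rule Lim_null[THEN iffD2])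
  then show ?thesis using cv by (rule LIMSEQ_unique)
 qed
 then have "E = E_field gam0" by (rule ext)
 moreover have "E_field_converges gam0"
  unfolding E_field_converges_def field_integrand_coulomb using pot_integrable[OF d0 kbound_coulomb] by blast
 moreover have "Linf_norm gam0 <= ereal (sqrt Bd)"
 proof (rule Linf_normI)
  have "(%z. f (orig (real n) z)) : bmeas" for n
  proof -
   have "mpres (orig (real n))" unfolding orig_def[abs_def] by (rule mpres_comp[OF vfield_mpres[OF l B] scat_mpres])
   from measurable_compose[OF mpres_measurable[OF this] borel_measurable_continuous_onI[OF datum_continuous[OF f]]]
   show ?thesis .
  qed
  then show "gam0 : bmeas" by (rule borel_measurable_LIMSEQ_metric[OF _ lim])
  have "norm (gam0 (r, u)) <= sqrt Bd" for r u
  proof -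
   have "wt u <= 1" unfolding wt_def by (rule order_trans[OF powr_mono[of "-7/4" 0]]) (auto simp: powr_zero_eq_one)
   then have "Bd * wt u <= Bd * 1" using densD(6)[OF d0] by (intro mult_left_mono)
   then have "(gam0 (r, u))^2 <= Bd" using densD(3)[OF d0, of r u] by simp
   then show ?thesis by (simp add: real_le_rsqrt)
  qed
  then show "AE z in lborel. norm (gam0 z) <= sqrt Bd" by (intro AE_I2) auto
 qed
 then have "Linf_norm gam0 < \<infinity>" by (rule le_less_trans) simp
 ultimately show ?thesis using that rate by blast
qed

end

text \<open>The constant of the geometric tail is at most \<open>KF * eps^2\<close>, hence at most
  1, which gives the convergence rate with constant 1.\<close>

lemma fixed_field_limit:
 assumes l: "\<bar>l\<bar> = 1" and f: "datum eps f" and B: "okfield 1 B" and BT: "\<forall>t\<ge>0. \<forall>q. B t q = Tfield l f B t q" and small: "KF * eps^2 <= 1"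
 obtains E where "!!t q. 0 <= t ==> norm (B t q - E q) <= exp (- (1/256) * t)" "!!q. norm (E q) <= 1" "continuous_on UNIV E"
proof -
 have step: "norm (B t' q - B t q) <= KE * eps^2 * exp (- (1/256) * t)" if "0 <= t" "t <= t'" "t' <= t + 1" for t t' q
  using Tfield_time_step(1)[OF l B f that, of q] BT that by simp
 have "\<exists>L. ((%t. B t q) \<longlongrightarrow> L) at_top & (\<forall>t\<ge>0. norm (L - B t q) <= KE * eps^2 * exp (- (1/256) * t) / (1 - exp (- (1/256))))" for q
  by (rule exp_Cauchy(2)) (use step in auto)
 then obtain E where E: "!!q. ((%t. B t q) \<longlongrightarrow> E q) at_top" "!!q t. 0 <= t ==> norm (E q - B t q) <= KE * eps^2 * exp (- (1/256) * t) / (1 - exp (- (1/256)))"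
  by metis
 have "KE * eps^2 / (1 - exp (- (1/256))) <= KF * eps^2"
  using Wc(1) Ch_nonneg unfolding KF_def distrib_right by simp
 then have "KE * eps^2 / (1 - exp (- (1/256))) <= 1" using small by linarith
 then have "KE * eps^2 / (1 - exp (- (1/256))) * exp (- (1/256) * t) <= 1 * exp (- (1/256) * t)" for t
  by (rule mult_right_mono) simp
 then have c: "norm (B t q - E q) <= exp (- (1/256) * t)" if "0 <= t" for t q
  using E(2)[OF that, of q] order_trans by (fastforce simp: norm_minus_commute)
 have E': "(%n. B (real n) q) ----> E q" for q by (rule filterlim_compose[OF E(1) filterlim_real_sequentially])
 have "norm (E q) <= 1" for q
  by (rule LIMSEQ_le_const2[OF tendsto_norm[OF E']]) (use okfieldD(2)[OF B] in auto)
 moreover have "1-lipschitz_on UNIV E"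
 proof (rule lipschitz_onI)
  show "dist (E q) (E q') <= 1 * dist q q'" for q q'
   unfolding dist_norm
   by (rule LIMSEQ_le_const2[OF tendsto_norm[OF tendsto_diff[OF E' E']]]) (use okfieldD(3)[OF B] in auto)
 qed simp
 then have "continuous_on UNIV E" by (rule lipschitz_on_continuous_on)
 ultimately show ?thesis using that c by blast
qed

lemma scattering:
 assumes l: "\<bar>l\<bar> = 1" and f: "datum eps f" and B: "okfield 1 B" and BT: "\<forall>t\<ge>0. \<forall>q. B t q = Tfield l f B t q" and small: "KF * eps^2 <= 1"
 shows "\<exists>gam0 E. Linf_norm gam0 < \<infinity> & E_field_converges gam0 & E = E_field gam0 & Linf_norm E < \<infinity> &
  uniform_limit UNIV (%s (q, p). pull l f B (- ln s) (q + s *R p + (l * s * ln s) *R E q, p + (l * ln s) *R E q)) gam0 (at_right 0)"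
proof -
 let ?S = "%E s q p. (q + s *R p + (l * s * ln s) *R E q, p + (l * ln s) *R E q)"
 obtain E where E: "!!t q. 0 <= t ==> norm (B t q - E q) <= exp (- (1/256) * t)" "!!q. norm (E q) <= 1" "continuous_on UNIV E"
  using fixed_field_limit[OF l f B BT small] by blast
 obtain gam0 where g: "!!t z. 0 <= t ==> norm (gam0 z - f (orig l B E t z)) <= eps * K4 * exp (- (1/512) * t)"
  "Linf_norm gam0 < \<infinity>" "E_field_converges gam0" "E = E_field gam0"
  using scattering_limit[OF l f B BT E] by blast
 have "Linf_norm E <= ereal 1" using E by (intro Linf_normI borel_measurable_continuous_onI) auto
 then have "Linf_norm E < \<infinity>" by (rule le_less_trans) simp
 moreover have "uniform_limit UNIV (%s (q, p). pull l f B (- ln s) (?S E s q p)) gam0 (at_right 0)"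
  unfolding uniform_limit_iff
 proof (intro allI impI)
  fix e :: real assume e: "e > 0"
  have "((%s::real. exp (1/512 * ln s)) \<longlongrightarrow> 0) (at_right 0)"
   by (intro filterlim_compose[OF exp_at_bot] filterlim_tendsto_pos_mult_at_bot[OF tendsto_const _ ln_at_0]) auto
  then have "((%s::real. eps * K4 * exp (1/512 * ln s)) \<longlongrightarrow> eps * K4 * 0) (at_right 0)" by (rule tendsto_mult_left)
  then have "\<forall>\<^sub>F s in at_right 0. eps * K4 * exp (1/512 * ln s) < e" using e by (intro order_tendstoD(2)) auto
  moreover have "\<forall>\<^sub>F s::real in at_right 0. s < 1" by (rule order_tendstoD(2)[OF tendsto_ident_at]) simp
  moreover have "\<forall>\<^sub>F s::real in at_right 0. 0 < s" by (rule eventually_at_right_less)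
  ultimately show "\<forall>\<^sub>F s in at_right 0. \<forall>z\<in>UNIV. dist (case z of (q, p) => pull l f B (- ln s) (?S E s q p)) (gam0 z) < e"
  proof eventually_elim
   case (elim s)
   show ?case
   proof
    fix z :: phase
    obtain q p where z: "z = (q, p)" by fastforce
    have "scat l E (- ln s) (q, p) = (?S E s q p)"
     using elim by (simp add: scat_def scaleR_add_right mult_ac)
    then have eq: "f (orig l B E (- ln s) (q, p)) = pull l f B (- ln s) (?S E s q p)"
     using orig_def[OF l f B BT E] by (simp add: pull_def)
    have "norm (gam0 z - f (orig l B E (- ln s) z)) <= eps * K4 * exp (- (1/512) * - ln s)" using elim by (intro g) simp
    also have "... < e" using elim by simp
    finally show "dist (case z of (q, p) => pull l f B (- ln s) (?S E s q p)) (gam0 z) < e"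
     by (simp add: z eq dist_norm norm_minus_commute)
   qed
  qed
 qed
 ultimately show ?thesis using g by blast
qed

theorem theorem3p1:
  fixes l :: real
  assumes "l \<in> {-1, 1}"
  shows "\<exists>\<epsilon>>0. \<exists>C>0. \<forall>(\<epsilon>\<^sub>0::real) (\<gamma>\<^sub>1 :: phase \<Rightarrow> real) (g\<^sub>1 :: phase \<Rightarrow> phase).
    \<epsilon>\<^sub>0 \<le> \<epsilon> \<and> weak_gradient_on UNIV \<gamma>\<^sub>1 g\<^sub>1 \<and>
    L2_norm \<gamma>\<^sub>1 + Linf_norm (\<lambda>(q, p). \<langle>p\<rangle>\<^sup>2 * \<gamma>\<^sub>1 (q, p)) + Linf_norm g\<^sub>1 \<le> ereal \<epsilon>\<^sub>0 \<longrightarrow>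
    (\<exists>(\<gamma> :: real \<Rightarrow> phase \<Rightarrow> real) (g :: real \<Rightarrow> phase \<Rightarrow> phase).
       solution_with_data l \<gamma>\<^sub>1 \<gamma> \<and>
       (\<forall>\<gamma>'. solution_with_data l \<gamma>\<^sub>1 \<gamma>' \<longrightarrow> (\<forall>s\<in>{0<..1}. \<gamma>' s = \<gamma> s)) \<and>
       (\<exists>M::real. \<forall>s\<in>{0<..1}. Linf_norm (\<gamma> s) \<le> ereal M \<and> L2_norm (\<gamma> s) \<le> ereal M) \<and>
       (\<forall>s\<in>{0<..1}.
          weak_gradient_on UNIV (\<gamma> s) (g s) \<and>
          Linf_norm (\<lambda>(q, p). \<langle>p\<rangle>\<^sup>2 * \<gamma> s (q, p)) \<le> ereal (C * \<epsilon>\<^sub>0 * \<langle>ln s\<rangle>\<^sup>2) \<and>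
          Linf_norm (g s) \<le> ereal (C * \<epsilon>\<^sub>0 * \<langle>ln s\<rangle> ^ 5)) \<and>
       (Linf_norm (\<lambda>(q, p). \<langle>p\<rangle> *\<^sub>R g\<^sub>1 (q, p)) \<le> ereal \<epsilon>\<^sub>0 \<longrightarrow>
          (\<forall>s\<in>{0<..1}.
             Linf_norm (\<lambda>(q, p). \<langle>p\<rangle> *\<^sub>R g s (q, p)) \<le> ereal (C * \<epsilon>\<^sub>0 * \<langle>ln s\<rangle> ^ 6)) \<and>
          (\<exists>(\<gamma>\<^sub>0 :: phase \<Rightarrow> real) (E\<^sub>0 :: R3 \<Rightarrow> R3).
             Linf_norm \<gamma>\<^sub>0 < \<infinity> \<and> E_field_converges \<gamma>\<^sub>0 \<and> E\<^sub>0 = E_field \<gamma>\<^sub>0 \<and> Linf_norm E\<^sub>0 < \<infinity> \<and>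
             uniform_limit UNIV
               (\<lambda>s (q, p). \<gamma> s (q + s *\<^sub>R p + (l * s * ln s) *\<^sub>R E\<^sub>0 q, p + (l * ln s) *\<^sub>R E\<^sub>0 q))
               \<gamma>\<^sub>0 (at_right 0))))"
proof (rule exI[of _ "1 / (1 + KF)"], intro exI[of _ "4 + 8 * exp 129"] conjI allI impI, goal_cases)
 case (3 \<epsilon>\<^sub>0 \<gamma>\<^sub>1 g\<^sub>1)
 let ?C = "4 + 8 * exp 129 :: real"
 have l: "\<bar>l\<bar> = 1" using assms by auto
 obtain f where f: "datum \<epsilon>\<^sub>0 f" "AE z in lborel. \<gamma>\<^sub>1 z = f z" "weak_gradient_on UNIV f g\<^sub>1" "g\<^sub>1 : bmeas"
   "AE z in lborel. norm (g\<^sub>1 z) <= \<epsilon>\<^sub>0" "0 <= \<epsilon>\<^sub>0"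
  by (rule datum_of_data[of "\<gamma>\<^sub>1" "g\<^sub>1" "\<epsilon>\<^sub>0"]) (use 3 in blast)+
 \<comment> \<open>The threshold \<open>1 / (1 + KF)\<close> is itself at most 1, so the square of
   the size of the data is below it too, and \<open>KF * eps^2 <= 1\<close> follows.\<close>
 have e: "\<epsilon>\<^sub>0 <= 1 / (1 + KF)" using 3 by simp
 have "1 / (1 + KF) <= 1" using KF_nonneg by simp
 with e have "\<epsilon>\<^sub>0 <= 1" by (rule order_trans)
 with e have "\<epsilon>\<^sub>0 * \<epsilon>\<^sub>0 <= 1 / (1 + KF) * 1" using f(6) KF_nonneg by (intro mult_mono) simp_all
 then have "KF * \<epsilon>\<^sub>0^2 <= KF * (1 / (1 + KF))" using KF_nonneg unfolding power2_eq_square by (intro mult_left_mono) auto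
 also have "... <= 1" using KF_nonneg by simp
 finally have small: "KF * \<epsilon>\<^sub>0^2 <= 1" .
 obtain B where B: "okfield 1 B" and BT: "\<forall>t\<ge>0. \<forall>q. B t q = Tfield l f B t q"
  using Tfield_fixed_point[OF l f(1) small] by metis
 let ?g = "%s. pgrad l B (%t. DE (pull l f B t)) g\<^sub>1 (- ln s)"
 note sol = sc_bounds[OF l f(1) B BT] and grad = sc_gradient[OF l f(1) B BT _ _ f(3-5)]
 \<comment> \<open>The sharper powers of the bracket are weakened to those of the theorem. In the
   constant, \<open>4\<close> belongs to the weighted bound on the function and
   \<open>8 * exp 129\<close> to the weighted bound on the gradient.\<close>
 have pw: "c * \<epsilon>\<^sub>0 * \<langle>ln s\<rangle> ^ m <= ?C * \<epsilon>\<^sub>0 * \<langle>ln s\<rangle> ^ n" if "m <= n" "0 <= c" "c <= ?C" for c m n and s :: real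
  using that f(6) bracket_sq(2)[of "ln s"] by (intro mult_mono power_increasing) auto
 show ?case
 proof (intro exI[of _ "%s. pull l f B (- ln s)"] exI[of _ ?g] conjI ballI allI impI)
  show "solution_with_data l \<gamma>\<^sub>1 (%s. pull l f B (- ln s))" by (rule sc_solution[OF l f(1) B BT f(3-5,2)])
  show "\<gamma>' s = pull l f B (- ln s)" if "solution_with_data l \<gamma>\<^sub>1 \<gamma>'" "s : {0<..1}" for \<gamma>' s
   by (rule sc_unique[OF l f(1) B BT that(1) f(2)]) (use that in auto)
  show "\<exists>M::real. \<forall>s\<in>{0<..1}. Linf_norm (pull l f B (- ln s)) <= ereal M & L2_norm (pull l f B (- ln s)) <= ereal M"
   using sol(1,2) by (intro exI[of _ \<epsilon>\<^sub>0]) auto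
 next
  fix s :: real assume "s : {0<..1}"
  then have s: "0 < s" "s <= 1" by auto
  show "weak_gradient_on UNIV (pull l f B (- ln s)) (?g s)" by (rule grad(1)[OF s])
  show "Linf_norm (%(q, p). \<langle>p\<rangle>^2 * pull l f B (- ln s) (q, p)) <= ereal (?C * \<epsilon>\<^sub>0 * \<langle>ln s\<rangle>^2)"
   by (rule order_trans[OF sol(3)[OF s]]) (unfold ereal_less_eq(3), rule pw, auto)
  show "Linf_norm (?g s) <= ereal (?C * \<epsilon>\<^sub>0 * \<langle>ln s\<rangle> ^ 5)"
   by (rule order_trans[OF grad(2)[OF s]]) (unfold ereal_less_eq(3), rule pw, auto)
  assume "Linf_norm (%(q, p). \<langle>p\<rangle> *R g\<^sub>1 (q, p)) <= ereal \<epsilon>\<^sub>0"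
  then have "AE z in lborel. norm (\<langle>snd z\<rangle> *R g\<^sub>1 z) <= \<epsilon>\<^sub>0" using Linf_normD(2) by (fastforce simp: case_prod_unfold)
  from grad(3)[OF s this] show "Linf_norm (%(q, p). \<langle>p\<rangle> *R ?g s (q, p)) <= ereal (?C * \<epsilon>\<^sub>0 * \<langle>ln s\<rangle> ^ 6)"
   by (rule order_trans) (unfold ereal_less_eq(3), rule pw, auto)
 next
  show "\<exists>\<gamma>\<^sub>0 E\<^sub>0. Linf_norm \<gamma>\<^sub>0 < \<infinity> & E_field_converges \<gamma>\<^sub>0 & E\<^sub>0 = E_field \<gamma>\<^sub>0 & Linf_norm E\<^sub>0 < \<infinity> &
   uniform_limit UNIV (%s (q, p). pull l f B (- ln s) (q + s *R p + (l * s * ln s) *R E\<^sub>0 q, p + (l * ln s) *R E\<^sub>0 q)) \<gamma>\<^sub>0 (at_right 0)"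
   by (rule scattering[OF l f(1) B BT small])
 qed
qed (use KF_nonneg in \<open>auto intro: add_pos_pos\<close>)

end
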